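(* Let $T,\delta,\lambda\in(0,\infty)$. For every $d\in\mathbb N$ let $f_d\in C(\mathbb R\times\mathbb R^d,\mathbb R)$, $g_d\in C(\mathbb R^d,\mathbb R)$, $\xi_d=(\xi_{d,1},\ldots,\xi_{d,d})\in\mathbb R^d$, $L_{d,i}\in\mathbb R$ ($i\in\mathbb N$), and let $u_d\in C^{1,2}([0,T]\times\mathbb R^d,\mathbb R)$ be an at most polynomially growing function. Assume for all $d\in\mathbb N$, $t\in[0,T)$, $x,\mathfrak x,z,\mathfrak z\in\mathbb R^d$, $y,\mathfrak y\in\mathbb R$ that $$\max\{|f_d(y,z)-f_d(\mathfrak y,\mathfrak z)|,|g_d(x)-g_d(\mathfrak x)|\}\le\sum_{j=1}^dL_{d,j}\big(d^\lambda|x_j-\mathfrak x_j|+|y-\mathfrak y|+|z_j-\mathfrak z_j|\big),$$ $$\big(\tfrac{\partial}{\partial t}u_d\big)(t,x)=(\Delta_xu_d)(t,x)+f_d\big(u_d(t,x),(\nabla_xu_d)(t,x)\big),\qquad u_d(0,x)=g_d(x),$$ and $d^{-\lambda}(|g_d(0)|+|f_d(0,0)|+\max_{i\in\{1,\ldots,d\}}|\xi_{d,i}|)+\sum_{i=1}^dL_{d,i}\le\lambda$. Let $(\Omega,\mathcal F,\mathbb P)$ be a probability space, let $\Theta=\bigcup_{n\in\mathbb N}\mathbb Z^n$, let $Z^{d,\theta}\colon\Omega\to\mathbb R^d$, $d\in\mathbb N$, $\theta\in\Theta$, be independent standard normal random variables, let $\mathfrak r^\theta\colon\Omega\to(0,1)$,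 $\theta\in\Theta$, be i.i.d. random variables with $\mathbb P(\mathfrak r^0\le b)=\sqrt b$ for all $b\in(0,1)$, and assume that $(Z^{d,\theta})_{(d,\theta)\in\mathbb N\times\Theta}$ and $(\mathfrak r^\theta)_{\theta\in\Theta}$ are independent. Let $\mathbf U^{d,\theta}_{n,M}=(\mathbf U^{d,\theta,0}_{n,M},\ldots,\mathbf U^{d,\theta,d}_{n,M})\colon(0,T]\times\mathbb R^d\times\Omega\to\mathbb R^{1+d}$, $n\in\{-1,0,1,\ldots\}$, $M,d\in\mathbb N$, $\theta\in\Theta$, satisfy for all $n,M,d\in\mathbb N$, $\theta\in\Theta$, $t\in(0,T]$, $x\in\mathbb R^d$ that $\mathbf U^{d,\theta}_{-1,M}(t,x)=\mathbf U^{d,\theta}_{0,M}(t,x)=0$ and $$\begin{aligned}\mathbf U^{d,\theta}_{n,M}(t,x)&=(g_d(x),0)+\sum_{i=1}^{M^n}\tfrac1{M^n}\big(g_d(x+[2t]^{1/2}Z^{d,(\theta,0,-i)})-g_d(x)\big)\big(1,[2t]^{-1/2}Z^{d,(\theta,0,-i)}\big)\\&\quad+\sum_{l=0}^{n-1}\sum_{i=1}^{M^{n-l}}\tfrac{2t[\mathfrak r^{(\theta,l,i)}]^{1/2}}{M^{n-l}}\Big[f_d\big(\mathbf U^{d,(\theta,l,i)}_{l,M}(t(1-\mathfrak r^{(\theta,l,i)}),x+[2t\mathfrak r^{(\theta,l,i)}]^{1/2}Z^{d,(\theta,l,i)})\big)\\&\qquad-\mathbf 1_{\mathbb N}(l)f_d\big(\mathbf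 U^{d,(\theta,-l,i)}_{l-1,M}(t(1-\mathfrak r^{(\theta,l,i)}),x+[2t\mathfrak r^{(\theta,l,i)}]^{1/2}Z^{d,(\theta,l,i)})\big)\Big]\big(1,[2t\mathfrak r^{(\theta,l,i)}]^{-1/2}Z^{d,(\theta,l,i)}\big).\end{aligned}$$ Let $\mathrm{RV}_{d,n,M}\in\mathbb Z$, $d,n,M\in\mathbb Z$, satisfy for all $d,n,M\in\mathbb N$ that $\mathrm{RV}_{d,0,M}=0$ and $$\mathrm{RV}_{d,n,M}\le dM^n+\sum_{l=0}^{n-1}\Big[M^{n-l}\big(d+1+\mathrm{RV}_{d,l,M}+\mathbf 1_{\mathbb N}(l)\,\mathrm{RV}_{d,l-1,M}\big)\Big].$$ Then there exist $c\in\mathbb R$ and $N=(N_{d,\varepsilon})_{(d,\varepsilon)\in\mathbb N\times(0,1]}\colon\mathbb N\times(0,1]\to\mathbb N$ such that for all $d\in\mathbb N$, $\varepsilon\in(0,1]$ it holds that $\sum_{n=1}^{N_{d,\varepsilon}}\mathrm{RV}_{d,n,\lfloor n^{1/4}\rfloor}\le c\,d^c\,\varepsilon^{-(2+\delta)}$ and $$\sup_{n\in\mathbb N\cap[N_{d,\varepsilon},\infty)}\Big[\mathbb E\big[|\mathbf U^{d,0,0}_{n,\lfloor n^{1/4}\rfloor}(T,\xi_d)-u_d(T,\xi_d)|^2\big]+\max_{i\in\{1,\ldots,d\}}\mathbb E\big[|\mathbf U^{d,0,i}_{n,\lfloor n^{1/4}\rfloor}(T,\xi_d)-(\tfrac{\partial}{\partial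 x_i}u_d)(T,\xi_d)|^2\big]\Big]^{1/2}\le\varepsilon.$$
   Context: $\mathbb N=\{1,2,3,\ldots\}$. For $\theta=(\theta_1,\ldots,\theta_k)\in\Theta$ and $l,i\in\mathbb Z$, $(\theta,l,i)=(\theta_1,\ldots,\theta_k,l,i)\in\Theta$; the index $0$ means $0\in\mathbb Z^1\subseteq\Theta$. In $\mathbf U^{d,0,i}_{n,M}$ the last superscript is the component index. $\mathbf 1_{\mathbb N}(l)$ is $1$ if $l\in\mathbb N$ and $0$ otherwise. $\mathbb R^{1+d}$ is identified with $\mathbb R\times\mathbb R^d$. $\lfloor\cdot\rfloor$ is the floor function. A function $u$ on $[0,T]\times\mathbb R^d$ is at most polynomially growing if $|u(t,x)|\le\eta(1+\sum_i|x_i|)^\eta$ for some $\eta\in(0,\infty)$ and all $(t,x)$. *)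

theory Defs
  imports "HOL-Probability.Probability"
begin

text \<open>
  Since the dimension d is quantified inside the statement, R^d is the set of functions in
  PiE {1..d} UNIV (value undefined outside {1..d}). This is the underlying set both of the product
  topology \<^term>\<open>powertop_real {1..d}\<close> and of the product sigma-algebra below. Elements of R^{1+d} are
  given by their components 0, ..., d.
\<close>

abbreviation Rd :: "nat \<Rightarrow> (nat \<Rightarrow> real) set" where
  "Rd d \<equiv> {1..d} \<rightarrow>\<^sub>E UNIV"

abbreviation borel_Rd :: "nat \<Rightarrow> (nat \<Rightarrow> real) measure" where
  "borel_Rd d \<equiv> (\<Pi>\<^sub>M j\<in>{1..d}. borel)"

definition zero_Rd :: "nat \<Rightarrow> nat \<Rightarrow> real" where
  "zero_Rd d = (\<lambda>j\<in>{1..d}. 0)"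

definition add_scaled :: "nat \<Rightarrow> (nat \<Rightarrow> real) \<Rightarrow> real \<Rightarrow> (nat \<Rightarrow> real) \<Rightarrow> nat \<Rightarrow> real" where
  "add_scaled d x s z = (\<lambda>j\<in>{1..d}. x j + s * z j)"

text \<open>h(v) for h on R \<times> R^d and v in R^{1+d}.\<close>
definition app_R1d :: "nat \<Rightarrow> (real \<Rightarrow> (nat \<Rightarrow> real) \<Rightarrow> real) \<Rightarrow> (nat \<Rightarrow> real) \<Rightarrow> real" where
  "app_R1d d h v = h (v 0) (\<lambda>j\<in>{1..d}. v j)"

text \<open>Component k of the vector (1, z / s) in R^{1+d}.\<close>
definition one_scaled :: "real \<Rightarrow> (nat \<Rightarrow> real) \<Rightarrow> nat \<Rightarrow> real" where
  "one_scaled s z k = (if k = 0 then 1 else z k / s)"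

definition partial :: "nat \<Rightarrow> ((nat \<Rightarrow> real) \<Rightarrow> real) \<Rightarrow> (nat \<Rightarrow> real) \<Rightarrow> real" where
  "partial j v x = deriv (\<lambda>s. v (x(j := s))) (x j)"

definition gradient :: "nat \<Rightarrow> ((nat \<Rightarrow> real) \<Rightarrow> real) \<Rightarrow> (nat \<Rightarrow> real) \<Rightarrow> nat \<Rightarrow> real" where
  "gradient d v x = (\<lambda>j\<in>{1..d}. partial j v x)"

definition laplacian :: "nat \<Rightarrow> ((nat \<Rightarrow> real) \<Rightarrow> real) \<Rightarrow> (nat \<Rightarrow> real) \<Rightarrow> real" where
  "laplacian d v x = (\<Sum>j\<in>{1..d}. partial j (partial j v) x)"

text \<open>One-sided at the end points of [0, T].\<close>
definition time_deriv :: "real \<Rightarrow> (real \<Rightarrow> (nat \<Rightarrow> real) \<Rightarrow> real) \<Rightarrow> real \<Rightarrow> (nat \<Rightarrow> real) \<Rightarrow> real" where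
  "time_deriv T u t x = vector_derivative (\<lambda>s. u s x) (at t within {0..T})"

definition continuous_time_space ::
  "real \<Rightarrow> nat \<Rightarrow> (real \<Rightarrow> (nat \<Rightarrow> real) \<Rightarrow> real) \<Rightarrow> bool" where
  "continuous_time_space T d v \<longleftrightarrow>
     continuous_map (prod_topology (top_of_set {0..T}) (powertop_real {1..d})) euclideanreal
       (\<lambda>(t, x). v t x)"

text \<open>
  C^{1,2}([0,T] \<times> R^d): the time derivative and the spatial derivatives up to order 2 (mixed ones
  included) exist on all of [0,T] \<times> R^d and are jointly continuous, as is u itself.
\<close>
definition C12 :: "real \<Rightarrow> nat \<Rightarrow> (real \<Rightarrow> (nat \<Rightarrow> real) \<Rightarrow> real) \<Rightarrow> bool" where
  "C12 T d u \<longleftrightarrow>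
     (\<forall>t\<in>{0..T}. \<forall>x\<in>Rd d.
        (\<lambda>s. u s x) differentiable (at t within {0..T}) \<and>
        (\<forall>j\<in>{1..d}. (\<lambda>s. u t (x(j := s))) differentiable (at (x j)) \<and>
           (\<forall>i\<in>{1..d}. (\<lambda>s. partial j (u t) (x(i := s))) differentiable (at (x i))))) \<and>
     continuous_time_space T d u \<and>
     continuous_time_space T d (time_deriv T u) \<and>
     (\<forall>j\<in>{1..d}. continuous_time_space T d (\<lambda>t. partial j (u t)) \<and>
        (\<forall>i\<in>{1..d}. continuous_time_space T d (\<lambda>t. partial i (partial j (u t)))))"

definition poly_growing :: "real \<Rightarrow> nat \<Rightarrow> (real \<Rightarrow> (nat \<Rightarrow> real) \<Rightarrow> real) \<Rightarrow> bool" where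
  "poly_growing T d u \<longleftrightarrow>
     (\<exists>\<eta>>0. \<forall>t\<in>{0..T}. \<forall>x\<in>Rd d. \<bar>u t x\<bar> \<le> \<eta> * (1 + (\<Sum>i\<in>{1..d}. \<bar>x i\<bar>)) powr \<eta>)"

text \<open>
  The union of the Z^n over n \<ge> 1. The index (\<theta>, l, i) is \<^term>\<open>\<theta> @ [l, i]\<close>, the index 0 is
  \<^term>\<open>[0::int]\<close>.
\<close>
definition Theta :: "int list set" where
  "Theta = {\<theta>. \<theta> \<noteq> []}"

definition std_normal_Rd :: "nat \<Rightarrow> (nat \<Rightarrow> real) measure" where
  "std_normal_Rd d = (\<Pi>\<^sub>M j\<in>{1..d}. density lborel std_normal_density)"

definition sigma_family ::
  "'a measure \<Rightarrow> ('i \<Rightarrow> 'b measure) \<Rightarrow> ('i \<Rightarrow> 'a \<Rightarrow> 'b) \<Rightarrow> 'i set \<Rightarrow> 'a set set" where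
  "sigma_family P N X I =
     sigma_sets (space P) (\<Union>i\<in>I. {X i -` A \<inter> space P | A. A \<in> sets (N i)})"

text \<open>The library's \<^term>\<open>prob_space.indep_var\<close> needs both variables to have the same value type.\<close>
definition indep_families ::
  "'a measure \<Rightarrow> ('i \<Rightarrow> 'b measure) \<Rightarrow> ('i \<Rightarrow> 'a \<Rightarrow> 'b) \<Rightarrow> 'i set \<Rightarrow>
    ('j \<Rightarrow> 'c measure) \<Rightarrow> ('j \<Rightarrow> 'a \<Rightarrow> 'c) \<Rightarrow> 'j set \<Rightarrow> bool" where
  "indep_families P N X I N' Y J \<longleftrightarrow>
     prob_space.indep_set P (sigma_family P N X I) (sigma_family P N' Y J)"

definition root4 :: "nat \<Rightarrow> nat" where
  "root4 n = nat \<lfloor>real n powr (1/4)\<rfloor>"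

end

theory Submission
  imports Defs "HOL-Real_Asymp.Real_Asymp"
begin

text \<open>
  Comparing a spatial difference of u with a barrier built from hyperbolic cosines, the maximum
  principle bounds the gradient of u by the Lipschitz constants of g, so u grows at most linearly.
  Cutting u off and passing to the limit in a heat semigroup identity, which follows from Gaussian
  integration by parts, represents u and its gradient as expectations of exactly the terms that the
  scheme samples.

  Hence the mean of the scheme at level n telescopes to this representation with u replaced by level
  n - 1, and as its summands are independent, the mean squared error at level n is at most the sum of
  the second moments of the summands plus the square of the bias. In the weight
  exp(2 beta t) (d + |x|^2) the integral against the source term gains a factor of order
  beta^(-1/2). With beta of order M^2 the recursion closes and gives an error squared of order
  exp(2 beta T) (2/M)^n. For M = floor(n^(1/4)), M^2 is at most n, so the exponential is only
  geometric in n and the error is of order A^n n^(-n/8), while the cost is of order 8^n n^(n/4).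
  The product of the cost at n + 1 and the error at n to the power 2 + delta therefore tends to 0,
  which bounds the cost at the first n whose error is below epsilon. Constants depend on d only
  polynomially, since all Lipschitz constants sum to at most lambda.
\<close>

section \<open>Continuity and measurability on time and space\<close>

text \<open>The law P(r \<le> b) = sqrt b has density 1 / (2 sqrt r); dividing by it turns the time
  integral of length t into the factor \<open>2 * t * sqrt r\<close> of the scheme. The square of
  this factor times that of the gradient weight z_k / sqrt (2 t r) is 2 t z_k^2, so variances stay
  finite although the weight is singular. The growth hypothesis concerns u only and not its
  derivatives, so neither integration by parts nor dominated convergence applies to u directly; this
  is what the barrier and the cutoffs are for. The constant of the linear growth comes from
  compactness and is uncontrolled in d. It serves only to show that a weighted supremum of u and its
  gradient is finite. The representation then bounds this supremum by an explicit constant plus half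
  of itself. All estimates are made on the canonical product space over \<open>Theta\<close>. There
  the scheme is a function of the input, and moving the input along an index preserves its law, so
  recursive calls are distributed like the scheme itself; a single reindexing carries the result
  over to the given variables.\<close>

lemma continuous_map_restrict_Rd:
  "continuous_map euclidean (powertop_real {1..d}) (\<lambda>x::nat \<Rightarrow> real. restrict x {1..d})"
  by (auto simp: continuous_map_componentwise intro!: continuous_on_product_coordinates)

text \<open>Outside {1..d} every point of \<open>Rd d\<close> has the constant value
  \<open>undefined\<close>, so all coordinates are measurable. This moves measurability from the
  product over {1..d} to the full function space, where continuous functions are Borel.\<close>

lemma measurable_Rd_borel: "(\<lambda>x. x) \<in> borel_Rd d \<rightarrow>\<^sub>M (borel :: (nat \<Rightarrow> real) measure)"
proof -
  have "(\<lambda>x. \<lambda>i. x i) \<in> borel_Rd d \<rightarrow>\<^sub>M (\<Pi>\<^sub>M i\<in>UNIV. (borel :: real measure))"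
  proof (rule measurable_abs_UNIV)
    fix i :: nat
    show "(\<lambda>x. x i) \<in> borel_measurable (borel_Rd d)"
    proof (cases "i \<in> {1..d}")
      case False
      then show ?thesis
        by (subst measurable_cong[where g="\<lambda>_. undefined"]) (auto simp: space_PiM PiE_def extensional_def)
    qed auto
  qed
  then show ?thesis
    by (simp add: sets_PiM_equal_borel cong: measurable_cong_sets)
qed

lemma restrict_Rd: "x \<in> Rd d \<Longrightarrow> restrict x {1..d} = x"
  by (auto simp: PiE_def extensional_restrict)

lemma fun_upd_Rd: "x \<in> Rd d \<Longrightarrow> j \<in> {1..d} \<Longrightarrow> x(j := s) \<in> Rd d"
  by (auto simp: PiE_def extensional_def)

lemma add_scaled_Rd: "add_scaled d x s z \<in> Rd d"
  by (auto simp: add_scaled_def)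

text \<open>The product topology on \<open>Rd d\<close> is an abstract topology, whereas X is
  continuous in the type class sense. Restriction to {1..d} maps the function space continuously
  into the abstract topology and fixes the values of X, so composing with it bridges the
  two.\<close>

lemma continuous_on_Rd_compose:
  assumes v: "continuous_map (powertop_real {1..d}) euclideanreal v"
    and X: "continuous_on S X" "X ` S \<subseteq> Rd d"
  shows "continuous_on S (\<lambda>s. v (X s))"
proof -
  have "continuous_map (top_of_set S) euclideanreal (v \<circ> ((\<lambda>x. restrict x {1..d}) \<circ> X))"
    by (intro continuous_map_compose[OF _ v] continuous_map_compose[OF _ continuous_map_restrict_Rd])
      (use X in auto)
  then have "continuous_on S (\<lambda>s. v (restrict (X s) {1..d}))"
    by (simp add: o_def)
  moreover have "restrict (X s) {1..d} = X s" if "s \<in> S" for s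
    using X that by (intro restrict_Rd) auto
  ultimately show ?thesis
    by (simp cong: continuous_on_cong)
qed

lemma continuous_on_restrictI:
  assumes "continuous_on S X"
  shows "continuous_on S (\<lambda>s. restrict (X s) A :: nat \<Rightarrow> real)"
proof (rule continuous_on_coordinatewise_then_product)
  fix i show "continuous_on S (\<lambda>s. restrict (X s) A i)"
    using continuous_on_product_then_coordinatewise[OF assms, of i] by (cases "i \<in> A") auto
qed

lemma measurable_Rd_continuous:
  assumes v: "continuous_map (powertop_real {1..d}) euclideanreal v"
  shows "v \<in> borel_measurable (borel_Rd d)"
proof -
  have "continuous_on UNIV (\<lambda>x::nat\<Rightarrow>real. v (restrict x {1..d}))"
    by (rule continuous_on_Rd_compose[OF v])
      (auto intro!: continuous_on_restrictI)
  then have "(\<lambda>x. v (restrict x {1..d})) \<in> borel_measurable (borel_Rd d)"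
    by (rule measurable_compose[OF measurable_Rd_borel borel_measurable_continuous_onI])
  then show ?thesis
    by (rule measurable_cong[THEN iffD1, rotated]) (auto simp: space_PiM restrict_Rd)
qed

lemma continuous_on_pair_compose:
  assumes v: "continuous_map (prod_topology (top_of_set A) (powertop_real {1..d})) euclideanreal (\<lambda>(t, x). v t x)"
    and \<tau>: "continuous_on S \<tau>" "\<tau> ` S \<subseteq> A"
    and X: "continuous_on S X" "X ` S \<subseteq> Rd d"
  shows "continuous_on S (\<lambda>s. v (\<tau> s) (X s))"
proof -
  have "continuous_map (top_of_set S) (powertop_real {1..d}) (\<lambda>s. restrict (X s) {1..d})"
    using continuous_map_compose[OF _ continuous_map_restrict_Rd, of "top_of_set S" X] X
    by (simp add: o_def)
  moreover have "continuous_map (top_of_set S) (top_of_set A) \<tau>"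
    using \<tau> by (auto simp: image_subset_iff)
  ultimately have "continuous_map (top_of_set S) (prod_topology (top_of_set A) (powertop_real {1..d}))
      (\<lambda>s. (\<tau> s, restrict (X s) {1..d}))"
    by (rule continuous_map_pairedI[rotated])
  from continuous_map_compose[OF this v]
  have "continuous_on S (\<lambda>s. v (\<tau> s) (restrict (X s) {1..d}))"
    by (simp add: o_def)
  moreover have "restrict (X s) {1..d} = X s" if "s \<in> S" for s
    using X that by (intro restrict_Rd) auto
  ultimately show ?thesis
    by (simp cong: continuous_on_cong)
qed

lemma measurable_time_space:
  assumes v: "continuous_time_space T d v"
    and \<tau>: "\<tau> \<in> borel_measurable M" "\<And>\<omega>. \<omega> \<in> space M \<Longrightarrow> \<tau> \<omega> \<in> {0..T}"
    and X: "X \<in> M \<rightarrow>\<^sub>M borel_Rd d"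
  shows "(\<lambda>\<omega>. v (\<tau> \<omega>) (X \<omega>)) \<in> borel_measurable M"
proof (cases "T \<ge> 0")
  case True
  \<comment> \<open>Clamping the time to [0, T] and restricting the point to {1..d} extends v
    continuously to the whole type and changes nothing at the values taken by \<tau> and X.\<close>
  have "continuous_on UNIV (\<lambda>p::real \<times> (nat \<Rightarrow> real). v (max 0 (min T (fst p))) (restrict (snd p) {1..d}))"
  proof (rule continuous_on_pair_compose[OF v[unfolded continuous_time_space_def]])
    show "continuous_on UNIV (\<lambda>p::real \<times> (nat \<Rightarrow> real). max 0 (min T (fst p)))"
      by (intro continuous_intros)
    show "continuous_on UNIV (\<lambda>p::real \<times> (nat \<Rightarrow> real). restrict (snd p) {1..d})"
      by (intro continuous_on_restrictI continuous_on_snd continuous_on_id)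
  qed (use True in auto)
  then have "(\<lambda>p::real \<times> (nat \<Rightarrow> real). v (max 0 (min T (fst p))) (restrict (snd p) {1..d}))
      \<in> borel_measurable borel"
    by (rule borel_measurable_continuous_onI)
  from measurable_compose[OF _ this, of "\<lambda>\<omega>. (\<tau> \<omega>, X \<omega>)" M]
  have "(\<lambda>\<omega>. v (max 0 (min T (\<tau> \<omega>))) (restrict (X \<omega>) {1..d})) \<in> borel_measurable M"
    if "(\<lambda>\<omega>. (\<tau> \<omega>, X \<omega>)) \<in> M \<rightarrow>\<^sub>M borel"
    using that by simp
  moreover have "(\<lambda>\<omega>. (\<tau> \<omega>, X \<omega>)) \<in> M \<rightarrow>\<^sub>M borel"
    unfolding borel_prod[symmetric] using \<tau> measurable_compose[OF X measurable_Rd_borel] by simp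
  ultimately have "(\<lambda>\<omega>. v (max 0 (min T (\<tau> \<omega>))) (restrict (X \<omega>) {1..d})) \<in> borel_measurable M"
    by blast
  then show ?thesis
  proof (rule measurable_cong[THEN iffD1, rotated])
    fix \<omega> assume \<omega>: "\<omega> \<in> space M"
    have "X \<omega> \<in> Rd d" using measurable_space[OF X \<omega>] by (simp add: space_PiM)
    then show "v (max 0 (min T (\<tau> \<omega>))) (restrict (X \<omega>) {1..d}) = v (\<tau> \<omega>) (X \<omega>)"
      using \<tau>(2)[OF \<omega>] by (simp add: restrict_Rd)
  qed
next
  case False
  then have "space M = {}" using \<tau>(2) by fastforce
  then show ?thesis by (simp add: measurable_def)
qed

lemma compact_time_box:
  "compactin (prod_topology (top_of_set {0..T::real}) (powertop_real {1..d}))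
     ({0..T} \<times> ({1..d} \<rightarrow>\<^sub>E {-R..R::real}))"
  by (simp add: compactin_Times compactin_PiE compactin_subtopology)

text \<open>A box in the coordinates {1..d} times [0, T] is compact. No rate in R or d is obtained,
  so the constant serves qualitative purposes only.\<close>

lemma continuous_time_space_bounded:
  assumes v: "continuous_time_space T d v"
  obtains C where "C \<ge> 0" "\<And>t x. t \<in> {0..T} \<Longrightarrow> x \<in> Rd d \<Longrightarrow> (\<And>j. j \<in> {1..d} \<Longrightarrow> \<bar>x j\<bar> \<le> R) \<Longrightarrow> \<bar>v t x\<bar> \<le> C"
proof -
  let ?K = "{0..T} \<times> ({1..d} \<rightarrow>\<^sub>E {-R..R})"
  have "compact ((\<lambda>(t, x). v t x) ` ?K)"
    using image_compactin[OF compact_time_box] v unfolding continuous_time_space_def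
    by (metis compactin_euclidean_iff)
  then obtain C where C: "\<And>y. y \<in> (\<lambda>(t, x). v t x) ` ?K \<Longrightarrow> \<bar>y\<bar> \<le> C"
    by (meson bounded_real compact_imp_bounded)
  show ?thesis
  proof (rule that[of "max C 0"])
    fix t x assume *: "t \<in> {0..T}" "x \<in> Rd d" "\<And>j. j \<in> {1..d} \<Longrightarrow> \<bar>x j\<bar> \<le> R"
    have "x j \<in> {-R..R}" if "j \<in> {1..d}" for j
      using *(3)[OF that] by (simp add: abs_le_iff)
    then have "x \<in> {1..d} \<rightarrow>\<^sub>E {-R..R}"
      using *(2) unfolding PiE_iff by blast
    then have "v t x \<in> (\<lambda>(t, x). v t x) ` ?K"
      using *(1) by (intro image_eqI[of _ _ "(t, x)"]) auto
    from C[OF this] show "\<bar>v t x\<bar> \<le> max C 0"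
      by simp
  qed simp
qed

text \<open>Translates the abstract topology into type class continuity on a set. The converse
  direction rests on the continuity of the inclusion of the product over {1..d} into the function
  space, where the remaining coordinates are constant.\<close>

lemma continuous_time_space_iff:
  "continuous_time_space T d v \<longleftrightarrow> continuous_on ({0..T} \<times> Rd d) (\<lambda>p. v (fst p) (snd p))"
proof
  assume "continuous_time_space T d v"
  then show "continuous_on ({0..T} \<times> Rd d) (\<lambda>p. v (fst p) (snd p))"
    unfolding continuous_time_space_def
    by (rule continuous_on_pair_compose)
      (auto intro: continuous_on_fst[OF continuous_on_id] continuous_on_snd[OF continuous_on_id])
next
  assume v: "continuous_on ({0..T} \<times> Rd d) (\<lambda>p. v (fst p) (snd p))"
  let ?X = "prod_topology (top_of_set {0..T}) (powertop_real {1..d})"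
  have "continuous_map (powertop_real {1..d}) euclidean (\<lambda>x. x)"
    unfolding continuous_map_componentwise_UNIV euclidean_product_topology[symmetric]
  proof
    fix i :: nat
    show "continuous_map (powertop_real {1..d}) euclideanreal (\<lambda>x. x i)"
    proof (cases "i \<in> {1..d}")
      case True then show ?thesis by (rule continuous_map_product_projection)
    next
      case False
      have "continuous_map (powertop_real {1..d}) euclideanreal (\<lambda>x. undefined)"
        by simp
      then show ?thesis
        by (rule continuous_map_eq) (use False in \<open>auto simp: PiE_def extensional_def\<close>)
    qed
  qed
  then have 1: "continuous_map ?X euclidean snd"
    using continuous_map_compose[OF continuous_map_snd] by (fastforce simp: o_def)
  have "continuous_map ?X (top_of_set {0..T}) fst" by (rule continuous_map_fst)
  then have 2: "continuous_map ?X euclidean fst"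
    by (simp add: continuous_map_in_subtopology)
  have "continuous_map ?X (prod_topology euclidean euclidean) (\<lambda>p. (fst p, snd p))"
    by (rule continuous_map_pairedI[OF 2 1])
  then have "continuous_map ?X (top_of_set ({0..T} \<times> Rd d)) (\<lambda>p. p)"
    by (auto simp: continuous_map_in_subtopology)
  moreover have "continuous_map (top_of_set ({0..T} \<times> Rd d)) euclideanreal (\<lambda>p. v (fst p) (snd p))"
    using v by simp
  ultimately have "continuous_map ?X euclideanreal ((\<lambda>p. v (fst p) (snd p)) \<circ> (\<lambda>p. p))"
    by (rule continuous_map_compose)
  then show "continuous_time_space T d v"
    unfolding continuous_time_space_def by (simp add: o_def case_prod_unfold)
qed

lemma continuous_time_space_space:
  assumes "continuous_on UNIV c"
  shows "continuous_time_space T d (\<lambda>t x. c x)"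
  unfolding continuous_time_space_iff
  by (rule continuous_on_compose2[OF assms]) (auto intro: continuous_on_snd[OF continuous_on_id])

lemma continuous_time_space_intros:
  assumes "continuous_time_space T d v" "continuous_time_space T d w"
  shows "continuous_time_space T d (\<lambda>t x. v t x + w t x)"
    and "continuous_time_space T d (\<lambda>t x. v t x * w t x)"
  using assms unfolding continuous_time_space_def case_prod_beta
  by (auto intro: continuous_map_add continuous_map_real_mult)

section \<open>Maximum principle and gradient bound\<close>

text \<open>A positive second derivative would make the first derivative, which is 0 at the maximum,
  positive just to the right; by the mean value theorem the function would then exceed its
  maximum.\<close>

lemma second_derivative_at_max:
  fixes h h' :: "real \<Rightarrow> real"
  assumes h: "\<And>y. (h has_real_derivative h' y) (at y)"
    and h': "(h' has_real_derivative D) (at y0)"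
    and max: "\<And>y. h y \<le> h y0"
  shows "h' y0 = 0" "D \<le> 0"
proof -
  show 0: "h' y0 = 0"
    using DERIV_local_max[OF h, of 1 y0] max by auto
  show "D \<le> 0"
  proof (rule ccontr)
    assume "\<not> D \<le> 0"
    then obtain \<delta> where \<delta>: "\<delta> > 0" "\<And>e. 0 < e \<Longrightarrow> e < \<delta> \<Longrightarrow> h' y0 < h' (y0 + e)"
      using DERIV_pos_inc_right[OF h'] by auto
    obtain z where z: "y0 < z" "z < y0 + \<delta>/2" "h (y0 + \<delta>/2) - h y0 = (y0 + \<delta>/2 - y0) * h' z"
      using MVT2[of y0 "y0 + \<delta>/2" h h'] h \<delta>(1) by auto
    have "h' z > 0" using \<delta>(2)[of "z - y0"] z 0 \<delta>(1) by auto
    then have "h (y0 + \<delta>/2) > h y0" using z(3) \<delta>(1)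
      by (metis add_diff_cancel_left' diff_gt_0_iff_gt half_gt_zero mult_pos_pos)
    then show False using max[of "y0 + \<delta>/2"] by simp
  qed
qed

text \<open>Only times before t are compared, so t may be the end point T, where the derivative is
  one-sided: a negative derivative would give larger values slightly earlier.\<close>

lemma left_derivative_at_max:
  fixes h :: "real \<Rightarrow> real"
  assumes h: "(h has_real_derivative D) (at t within {0..T})"
    and t: "0 < t" "t \<le> T" and max: "\<And>s. s \<in> {0..T} \<Longrightarrow> h s \<le> h t"
  shows "D \<ge> 0"
proof (rule ccontr)
  assume "\<not> D \<ge> 0"
  then obtain \<delta> where \<delta>: "\<delta> > 0" "\<And>e. 0 < e \<Longrightarrow> t - e \<in> {0..T} \<Longrightarrow> e < \<delta> \<Longrightarrow> h t < h (t - e)"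
    using has_real_derivative_neg_dec_left[OF h] by auto
  have "h t < h (t - min (\<delta>/2) t)"
    by (rule \<delta>(2)) (use t \<delta>(1) in auto)
  moreover have "t - min (\<delta>/2) t \<in> {0..T}" using t \<delta>(1) by auto
  ultimately show False using max by fastforce
qed

text \<open>\<open>partial\<close> is the derivative at the coordinate of the point itself. Applying
  the hypothesis at the updated point gives the derivative at every parameter of the line through
  x.\<close>

lemma has_derivative_partial:
  assumes diff: "\<And>x. x \<in> Rd d \<Longrightarrow> (\<lambda>s. v (x(j := s))) differentiable (at (x j))"
    and x: "x \<in> Rd d" "j \<in> {1..d}"
  shows "((\<lambda>s. v (x(j := s))) has_real_derivative partial j v (x(j := y))) (at y)"
proof -
  have "(\<lambda>s. v ((x(j := y))(j := s))) differentiable (at ((x(j := y)) j))"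
    by (rule diff) (rule fun_upd_Rd[OF x])
  then have "(\<lambda>s. v (x(j := s))) field_differentiable (at y)"
    by (simp add: field_differentiable_def real_differentiable_def)
  then show ?thesis
    by (simp add: partial_def DERIV_deriv_iff_field_differentiable)
qed

lemma C12D:
  assumes u: "C12 T d u" and t: "t \<in> {0..T}" and x: "x \<in> Rd d" and j: "j \<in> {1..d}"
  shows "((\<lambda>s. u s x) has_real_derivative time_deriv T u t x) (at t within {0..T})"
    and "((\<lambda>s. u t (x(j := s))) has_real_derivative partial j (u t) (x(j := y))) (at y)"
    and "((\<lambda>s. partial j (u t) (x(j := s))) has_real_derivative
           partial j (partial j (u t)) (x(j := y))) (at y)"
    and "i \<in> {1..d} \<Longrightarrow> ((\<lambda>s. partial j (u t) (x(i := s))) has_real_derivative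
           partial i (partial j (u t)) (x(i := y))) (at y)"
proof -
  show "((\<lambda>s. u s x) has_real_derivative time_deriv T u t x) (at t within {0..T})"
    using u t x unfolding C12_def time_deriv_def has_real_derivative_iff_has_vector_derivative
    by (intro vector_derivative_works[THEN iffD1]) auto
  show "((\<lambda>s. u t (x(j := s))) has_real_derivative partial j (u t) (x(j := y))) (at y)"
    using u t x j by (intro has_derivative_partial) (auto simp: C12_def)
  show *: "((\<lambda>s. partial j (u t) (x(i := s))) has_real_derivative
           partial i (partial j (u t)) (x(i := y))) (at y)" if "i \<in> {1..d}" for i
    using u t x j that by (intro has_derivative_partial) (auto simp: C12_def)
  show "((\<lambda>s. partial j (u t) (x(j := s))) has_real_derivative
           partial j (partial j (u t)) (x(j := y))) (at y)"
    using *[OF j] .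
qed

section \<open>Differences of the solution along one coordinate\<close>

definition shift_coord :: "nat \<Rightarrow> real \<Rightarrow> (nat \<Rightarrow> real) \<Rightarrow> nat \<Rightarrow> real" where
  "shift_coord j h x = x(j := x j + h)"

lemma shift_coord_Rd: "x \<in> Rd d \<Longrightarrow> j \<in> {1..d} \<Longrightarrow> shift_coord j h x \<in> Rd d"
  unfolding shift_coord_def by (rule fun_upd_Rd)

text \<open>Shifting coordinate j is a translation of the parameter if i = j, and it commutes with
  the update of coordinate i otherwise; in neither case does an inner derivative appear.\<close>

lemma has_derivative_shift_coord:
  assumes v: "\<And>x y. x \<in> Rd d \<Longrightarrow> ((\<lambda>s. v (x(i := s))) has_real_derivative w (x(i := y))) (at y)"
    and x: "x \<in> Rd d" "j \<in> {1..d}"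
  shows "((\<lambda>s. v (shift_coord j h (x(i := s)))) has_real_derivative w (shift_coord j h (x(i := y)))) (at y)"
proof (cases "i = j")
  case True
  have "((\<lambda>s. v (x(i := s + h))) has_real_derivative w (x(i := y + h))) (at y)"
    using v[OF x(1), of "y + h"] by (simp add: DERIV_shift)
  then show ?thesis using True by (simp add: shift_coord_def)
next
  case False
  then have "shift_coord j h (x(i := s)) = (shift_coord j h x)(i := s)" for s
    by (auto simp: shift_coord_def)
  then show ?thesis using v[OF shift_coord_Rd[OF x, of h], of y] by simp
qed

lemma gradient_Rd: "gradient d v x \<in> Rd d"
  by (simp add: gradient_def)

text \<open>One dimension d at a time. D stands for d^lambda and is kept abstract, so that the
  powers of it in the constants can be counted at the end. The joint Lipschitz bound enters in two
  separate forms, in (y, z) for f and in x for g.\<close>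

locale semilinear_heat =
  fixes T lam D :: real and d :: nat and f :: "real \<Rightarrow> (nat \<Rightarrow> real) \<Rightarrow> real"
    and g :: "(nat \<Rightarrow> real) \<Rightarrow> real" and L :: "nat \<Rightarrow> real"
    and u :: "real \<Rightarrow> (nat \<Rightarrow> real) \<Rightarrow> real"
  assumes T_pos: "T > 0" and lam_pos: "lam > 0" and d_pos: "d \<ge> 1" and D_nonneg: "D \<ge> 0"
    and f_cont: "continuous_map (prod_topology euclideanreal (powertop_real {1..d})) euclideanreal
        (\<lambda>(y, z). f y z)"
    and g_cont: "continuous_map (powertop_real {1..d}) euclideanreal g"
    and u_C12: "C12 T d u"
    and u_growth: "poly_growing T d u"
    and L_nonneg: "\<And>j. j \<in> {1..d} \<Longrightarrow> L j \<ge> 0"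
    and L_sum: "(\<Sum>j\<in>{1..d}. L j) \<le> lam"
    and f_lipschitz: "\<And>y y' z z'. z \<in> Rd d \<Longrightarrow> z' \<in> Rd d \<Longrightarrow>
        \<bar>f y z - f y' z'\<bar> \<le> (\<Sum>j\<in>{1..d}. L j * (\<bar>y - y'\<bar> + \<bar>z j - z' j\<bar>))"
    and g_lipschitz: "\<And>x x'. x \<in> Rd d \<Longrightarrow> x' \<in> Rd d \<Longrightarrow>
        \<bar>g x - g x'\<bar> \<le> (\<Sum>j\<in>{1..d}. L j * (D * \<bar>x j - x' j\<bar>))"
    and pde: "\<And>t x. 0 \<le> t \<Longrightarrow> t < T \<Longrightarrow> x \<in> Rd d \<Longrightarrow>
        time_deriv T u t x = laplacian d (u t) x + f (u t x) (gradient d (u t) x)"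
    and initial: "\<And>x. x \<in> Rd d \<Longrightarrow> u 0 x = g x"
begin

definition Fu :: "real \<Rightarrow> (nat \<Rightarrow> real) \<Rightarrow> real" where
  "Fu t x = f (u t x) (gradient d (u t) x)"

lemma L_le: "j \<in> {1..d} \<Longrightarrow> L j \<le> lam"
  using member_le_sum[of j "{1..d}" L] L_nonneg L_sum by fastforce

lemma u_cont: "continuous_time_space T d u"
  and time_deriv_cont: "continuous_time_space T d (time_deriv T u)"
  and partial_cont: "j \<in> {1..d} \<Longrightarrow> continuous_time_space T d (\<lambda>t. partial j (u t))"
  and partial2_cont: "j \<in> {1..d} \<Longrightarrow> continuous_time_space T d (\<lambda>t. partial j (partial j (u t)))"
  using u_C12 by (auto simp: C12_def)

lemma Fu_cont: "continuous_time_space T d Fu"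
proof -
  let ?X = "prod_topology (top_of_set {0..T}) (powertop_real {1..d})"
  have "continuous_map ?X (prod_topology euclideanreal (powertop_real {1..d}))
      (\<lambda>p. (u (fst p) (snd p), gradient d (u (fst p)) (snd p)))"
  proof (rule continuous_map_pairedI)
    show "continuous_map ?X euclideanreal (\<lambda>p. u (fst p) (snd p))"
      using u_cont by (simp add: continuous_time_space_def case_prod_unfold)
    show "continuous_map ?X (powertop_real {1..d}) (\<lambda>p. gradient d (u (fst p)) (snd p))"
      using partial_cont
      by (auto simp: continuous_map_componentwise gradient_def continuous_time_space_def case_prod_unfold)
  qed
  from continuous_map_compose[OF this f_cont] show ?thesis
    by (simp add: continuous_time_space_def o_def case_prod_unfold Fu_def)
qed

lemma continuous_in_time:
  assumes "continuous_time_space T d v" "x \<in> Rd d"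
  shows "continuous_on {0..T} (\<lambda>t. v t x)"
  using assms by (intro continuous_on_pair_compose[OF assms(1)[unfolded continuous_time_space_def]]) auto

text \<open>The equation is assumed before time T only, but all its terms are continuous in time on
  [0, T], so it persists at T. The maximum principle uses it there, since a maximum may be attained
  at the final time.\<close>

lemma pde_closed:
  assumes t: "t \<in> {0..T}" and x: "x \<in> Rd d"
  shows "time_deriv T u t x = laplacian d (u t) x + Fu t x"
proof -
  have "time_deriv T u t x - (laplacian d (u t) x + Fu t x) = 0"
  proof (rule continuous_constant_on_closure[of "{0..<T}" "\<lambda>t. time_deriv T u t x - (laplacian d (u t) x + Fu t x)"])
    show "continuous_on (closure {0..<T}) (\<lambda>t. time_deriv T u t x - (laplacian d (u t) x + Fu t x))"
      using T_pos x unfolding laplacian_def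
      by (auto intro!: continuous_on_diff continuous_on_add continuous_on_sum
        continuous_in_time[OF time_deriv_cont] continuous_in_time[OF partial2_cont] continuous_in_time[OF Fu_cont])
  qed (use t x T_pos pde in \<open>auto simp: Fu_def\<close>)
  then show ?thesis by simp
qed

text \<open>The barrier dominates the polynomial growth of u, so that a violation would be attained at some
  point; there the equation is contradicted because cosh'' = cosh and the factor exp (- mu t)
  outweighs the Lipschitz terms.\<close>
lemma shift_difference_below_barrier:
  fixes h \<eta> :: real
  assumes j: "j \<in> {1..d}" and \<eta>: "\<eta> > 0" and t: "t \<in> {0..T}" and x: "x \<in> Rd d"
  shows "exp (- (2 * lam + 2) * t) * (u t (shift_coord j h x) - u t x)
    \<le> D * L j * \<bar>h\<bar> + \<eta> * (\<Sum>i\<in>{1..d}. cosh (x i))"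
proof (rule ccontr)
  \<comment> \<open>At a violating maximum the nonlinearity contributes at most lam times the scaled
    difference plus lam times the barrier, and the Laplacian at most one barrier. As the barrier is
    smaller than the scaled difference there, any rate above 2 * lam + 1 gives a
    contradiction.\<close>
  define \<mu> where "\<mu> = 2 * lam + 2"
  define K where "K = D * L j * \<bar>h\<bar>"
  define \<Psi> where "\<Psi> x = (\<Sum>i\<in>{1..d}. cosh (x i))" for x :: "nat \<Rightarrow> real"
  define q where "q t x = exp (- \<mu> * t) * (u t (shift_coord j h x) - u t x) - K - \<eta> * \<Psi> x" for t x
  assume "\<not> ?thesis"
  then have pos: "q t x > 0" unfolding q_def \<mu>_def K_def \<Psi>_def by simp
  have K: "K \<ge> 0" unfolding K_def using D_nonneg L_nonneg[OF j] by simp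
  have \<Psi>_ge: "cosh (y i) \<le> \<Psi> y" if "i \<in> {1..d}" for i y
    unfolding \<Psi>_def using that by (intro member_le_sum) auto
  obtain \<eta>0 where \<eta>0: "\<eta>0 > 0" "\<And>t x. t \<in> {0..T} \<Longrightarrow> x \<in> Rd d \<Longrightarrow>
      \<bar>u t x\<bar> \<le> \<eta>0 * (1 + (\<Sum>i\<in>{1..d}. \<bar>x i\<bar>)) powr \<eta>0"
    using u_growth unfolding poly_growing_def by auto
  \<comment> \<open>With m the largest |y i|, the polynomial growth of u at distance m + |h| is
    beaten by the single summand cosh m of the barrier.\<close>
  have "eventually (\<lambda>m::real. 2 * \<eta>0 * (1 + real d * (m + \<bar>h\<bar>)) powr \<eta>0 < \<eta> * (exp m / 2)) at_top"
    using \<eta>0(1) \<eta> d_pos by real_asymp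
  then obtain R where R: "\<And>m. m \<ge> R \<Longrightarrow> 2 * \<eta>0 * (1 + real d * (m + \<bar>h\<bar>)) powr \<eta>0 < \<eta> * (exp m / 2)"
    unfolding eventually_at_top_linorder by auto
  have outside: "q s y < 0" if s: "s \<in> {0..T}" and y: "y \<in> Rd d" and big: "\<exists>i\<in>{1..d}. \<bar>y i\<bar> > R" for s y
  proof -
    have "Max ((\<lambda>i. \<bar>y i\<bar>) ` {1..d}) \<in> (\<lambda>i. \<bar>y i\<bar>) ` {1..d}"
      using d_pos by (intro Max_in) auto
    then obtain i where i0: "i \<in> {1..d}" "Max ((\<lambda>i. \<bar>y i\<bar>) ` {1..d}) = \<bar>y i\<bar>"
      by blast
    have i: "i \<in> {1..d}" "\<And>k. k \<in> {1..d} \<Longrightarrow> \<bar>y k\<bar> \<le> \<bar>y i\<bar>"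
      unfolding i0(2)[symmetric] by (use i0(1) in auto)
    define m where "m = \<bar>y i\<bar>"
    have m: "m \<ge> R" "m \<ge> 0" using big i unfolding m_def by force+
    have u1: "\<bar>u s w\<bar> \<le> \<eta>0 * (1 + real d * (m + \<bar>h\<bar>)) powr \<eta>0"
      if w: "w \<in> Rd d" "\<And>k. k \<in> {1..d} \<Longrightarrow> \<bar>w k\<bar> \<le> m + \<bar>h\<bar>" for w
    proof -
      have "(\<Sum>k\<in>{1..d}. \<bar>w k\<bar>) \<le> real d * (m + \<bar>h\<bar>)"
        using sum_bounded_above[of "{1..d}" "\<lambda>k. \<bar>w k\<bar>" "m + \<bar>h\<bar>"] w(2) by simp
      then have "(1 + (\<Sum>k\<in>{1..d}. \<bar>w k\<bar>)) powr \<eta>0 \<le> (1 + real d * (m + \<bar>h\<bar>)) powr \<eta>0"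
        using \<eta>0(1) by (intro powr_mono2) (auto intro!: add_nonneg_nonneg sum_nonneg)
      then show ?thesis using \<eta>0(2)[OF s w(1)] \<eta>0(1) by (meson mult_left_mono order_trans less_imp_le)
    qed
    have y': "\<bar>y k\<bar> \<le> m + \<bar>h\<bar>" "\<bar>shift_coord j h y k\<bar> \<le> m + \<bar>h\<bar>" if "k \<in> {1..d}" for k
      using i(2)[OF that] unfolding m_def shift_coord_def by auto
    have "\<bar>u s (shift_coord j h y) - u s y\<bar> \<le> 2 * \<eta>0 * (1 + real d * (m + \<bar>h\<bar>)) powr \<eta>0"
      using u1[OF y y'(1)] u1[OF shift_coord_Rd[OF y j] y'(2)] by linarith
    also have "\<dots> < \<eta> * (exp m / 2)" by (rule R) fact
    also have "\<dots> \<le> \<eta> * \<Psi> y"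
    proof (rule mult_left_mono)
      have "exp m / 2 \<le> cosh m" by (simp add: cosh_def)
      also have "cosh m = cosh (y i)" by (simp add: m_def abs_if)
      also have "\<dots> \<le> \<Psi> y" by (rule \<Psi>_ge[OF i(1)])
      finally show "exp m / 2 \<le> \<Psi> y" .
    qed (use \<eta> in simp)
    finally have *: "\<bar>u s (shift_coord j h y) - u s y\<bar> < \<eta> * \<Psi> y" .
    have "\<mu> * s \<ge> 0" using s lam_pos by (simp add: \<mu>_def)
    then have "exp (- \<mu> * s) * \<bar>u s (shift_coord j h y) - u s y\<bar> \<le> 1 * \<bar>u s (shift_coord j h y) - u s y\<bar>"
      by (intro mult_right_mono) auto
    then have "exp (- \<mu> * s) * (u s (shift_coord j h y) - u s y) \<le> \<bar>u s (shift_coord j h y) - u s y\<bar>"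
      by (smt (verit) mult_left_mono exp_ge_zero)
    then show ?thesis using * K unfolding q_def by linarith
  qed
  have inside: "y \<in> {1..d} \<rightarrow>\<^sub>E {-R..R}" if "y \<in> Rd d" "\<not> (\<exists>i\<in>{1..d}. \<bar>y i\<bar> > R)" for y
    using that unfolding PiE_iff by (auto simp: not_less abs_le_iff minus_le_iff)
  have x_inside: "x \<in> {1..d} \<rightarrow>\<^sub>E {-R..R}"
  proof (rule inside[OF x])
    show "\<not> (\<exists>i\<in>{1..d}. \<bar>x i\<bar> > R)"
      using outside[OF t x] pos by linarith
  qed
  have ps: "continuous_on S (\<lambda>p. snd p k)" for S :: "(real \<times> (nat \<Rightarrow> real)) set" and k
    by (intro continuous_on_product_then_coordinatewise[of _ snd] continuous_intros)
  have "continuous_on ({0..T} \<times> Rd d) (\<lambda>p. u (fst p) (shift_coord j h (snd p)))"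
  proof (rule continuous_on_pair_compose[OF u_cont[unfolded continuous_time_space_def]])
    show "continuous_on ({0..T} \<times> Rd d) (\<lambda>p. shift_coord j h (snd p))"
      unfolding shift_coord_def
    proof (rule continuous_on_coordinatewise_then_product)
      fix k show "continuous_on ({0..T} \<times> Rd d) (\<lambda>p. ((snd p)(j := snd p j + h)) k)"
        by (cases "k = j") (simp_all add: ps continuous_on_add)
    qed
    show "continuous_on ({0..T} \<times> Rd d) fst" by (rule continuous_on_fst[OF continuous_on_id])
    show "fst ` ({0..T} \<times> Rd d) \<subseteq> {0..T}" by auto
    show "(\<lambda>p. shift_coord j h (snd p)) ` ({0..T} \<times> Rd d) \<subseteq> Rd d"
    proof (rule image_subsetI)
      fix p assume "p \<in> {0..T} \<times> Rd d"
      then show "shift_coord j h (snd p) \<in> Rd d"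
        using shift_coord_Rd[OF _ j] by (simp only: mem_Times_iff)
    qed
  qed
  then have "continuous_on ({0..T} \<times> Rd d) (\<lambda>p. exp (- \<mu> * fst p) *
      (u (fst p) (shift_coord j h (snd p)) - u (fst p) (snd p)))"
    using u_cont[unfolded continuous_time_space_iff]
    by (rule continuous_on_mult[OF continuous_on_exp[OF continuous_on_mult[OF continuous_on_const
          continuous_on_fst[OF continuous_on_id]]] continuous_on_diff])
  moreover have "continuous_on ({0..T} \<times> Rd d) (\<lambda>p. \<eta> * \<Psi> (snd p))"
    unfolding \<Psi>_def
    by (rule continuous_on_mult[OF continuous_on_const continuous_on_sum])
      (rule continuous_on_cosh[OF ps])
  ultimately have qc: "continuous_time_space T d q"
    unfolding continuous_time_space_iff q_def
    by (rule continuous_on_diff[OF continuous_on_diff[OF _ continuous_on_const]])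
  have "\<exists>p\<in>{0..T} \<times> ({1..d} \<rightarrow>\<^sub>E {-R..R}). \<forall>p'\<in>{0..T} \<times> ({1..d} \<rightarrow>\<^sub>E {-R..R}).
      (\<lambda>(t, x). q t x) p' \<le> (\<lambda>(t, x). q t x) p" (is "\<exists>p\<in>?K. _")
  proof -
    have "compact ((\<lambda>(t, x). q t x) ` ?K)"
      using image_compactin[OF compact_time_box] qc unfolding continuous_time_space_def
      by (metis compactin_euclidean_iff)
    then show ?thesis
      using compact_attains_sup[of "(\<lambda>(t, x). q t x) ` ?K"] t x_inside by blast
  qed
  then obtain p where p: "p \<in> {0..T} \<times> ({1..d} \<rightarrow>\<^sub>E {-R..R})"
      "\<forall>p'\<in>{0..T} \<times> ({1..d} \<rightarrow>\<^sub>E {-R..R}). (\<lambda>(t, x). q t x) p' \<le> (\<lambda>(t, x). q t x) p"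
    by (rule bexE)
  define t0 x0 where "t0 = fst p" and "x0 = snd p"
  have t0: "t0 \<in> {0..T}" "x0 \<in> {1..d} \<rightarrow>\<^sub>E {-R..R}"
    using p(1) unfolding t0_def x0_def mem_Times_iff by simp_all
  have max0: "q s y \<le> q t0 x0" if "s \<in> {0..T}" "y \<in> {1..d} \<rightarrow>\<^sub>E {-R..R}" for s y
    using bspec[OF p(2), of "(s, y)"] that unfolding t0_def x0_def case_prod_unfold mem_Times_iff
    by simp
  have x0: "x0 \<in> Rd d" using t0(2) by auto
  have q0: "q t0 x0 > 0"
    using max0[OF t x_inside] pos by linarith
  have max: "q s y \<le> q t0 x0" if "s \<in> {0..T}" "y \<in> Rd d" for s y
    using outside[OF that] max0[OF that(1) inside[OF that(2)]] q0 by (metis less_le_trans linear not_less)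
  let ?x1 = "shift_coord j h x0"
  have x1: "?x1 \<in> Rd d" by (rule shift_coord_Rd[OF x0 j])
  define e where "e = exp (- \<mu> * t0)"
  have e: "e > 0" by (simp add: e_def)
  have \<Psi>pos: "\<Psi> y > 0" for y
    unfolding \<Psi>_def using d_pos by (intro sum_pos) auto
  define v where "v = u t0 ?x1 - u t0 x0"
  have ev: "e * v > \<eta> * \<Psi> x0" using q0 K unfolding q_def v_def e_def by linarith
  \<comment> \<open>At time 0 the Lipschitz bound of g for a shift of size h in coordinate j is
    exactly K, which leaves only the negative barrier term.\<close>
  have "t0 \<noteq> 0"
  proof
    assume "t0 = 0"
    then have "q t0 x0 = g ?x1 - g x0 - K - \<eta> * \<Psi> x0"
      unfolding q_def using initial x0 x1 by simp
    also have "g ?x1 - g x0 \<le> (\<Sum>i\<in>{1..d}. L i * (D * \<bar>?x1 i - x0 i\<bar>))"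
      using g_lipschitz[OF x1 x0] by simp
    also have "\<dots> = (\<Sum>i\<in>{1..d}. if i = j then K else 0)"
      by (intro sum.cong) (auto simp: shift_coord_def K_def)
    also have "\<dots> = K" using j by simp
    finally show False using q0 \<eta> \<Psi>pos[of x0] by (smt (verit) mult_pos_pos)
  qed
  then have t0': "0 < t0" "t0 \<le> T" using t0(1) by auto
  have time: "e * (time_deriv T u t0 ?x1 - time_deriv T u t0 x0) - \<mu> * (e * v) \<ge> 0"
  proof (rule left_derivative_at_max[OF _ t0', of "\<lambda>s. q s x0"])
    show "((\<lambda>s. q s x0) has_real_derivative
      e * (time_deriv T u t0 ?x1 - time_deriv T u t0 x0) - \<mu> * (e * v)) (at t0 within {0..T})"
      unfolding q_def
      by (rule derivative_eq_intros C12D(1)[OF u_C12 t0(1) x1 j] C12D(1)[OF u_C12 t0(1) x0 j] refl)+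
        (simp add: e_def v_def algebra_simps)
  qed (use max x0 in auto)
  \<comment> \<open>A maximum in coordinate i determines the gradient difference exactly and bounds
    the difference of the second derivatives. The dependence of f on the gradient thus reduces to
    |sinh|, which the barrier dominates since |sinh| \<le> cosh.\<close>
  have space: "e * (partial i (u t0) ?x1 - partial i (u t0) x0) = \<eta> * sinh (x0 i)"
    "e * (partial i (partial i (u t0)) ?x1 - partial i (partial i (u t0)) x0) \<le> \<eta> * cosh (x0 i)"
    if i: "i \<in> {1..d}" for i
  proof -
    have \<Psi>_eq: "\<Psi> (x0(i := s)) = cosh s + (\<Sum>k\<in>{1..d} - {i}. cosh (x0 k))" for s
      unfolding \<Psi>_def using i by (subst sum.remove[of _ i]) (auto intro!: sum.cong)
    have d1: "((\<lambda>s. q t0 (x0(i := s))) has_real_derivative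
       e * (partial i (u t0) (shift_coord j h (x0(i := y))) - partial i (u t0) (x0(i := y))) - \<eta> * sinh y) (at y)" for y
      unfolding q_def \<Psi>_eq
      by (rule derivative_eq_intros has_derivative_shift_coord[OF C12D(2)[OF u_C12 t0(1) _ i] x0 j]
          C12D(2)[OF u_C12 t0(1) x0 i] refl | assumption)+ (simp add: e_def)
    have d2: "((\<lambda>y. e * (partial i (u t0) (shift_coord j h (x0(i := y))) - partial i (u t0) (x0(i := y))) - \<eta> * sinh y)
      has_real_derivative e * (partial i (partial i (u t0)) (shift_coord j h (x0(i := x0 i)))
       - partial i (partial i (u t0)) (x0(i := x0 i))) - \<eta> * cosh (x0 i)) (at (x0 i))"
      by (rule derivative_eq_intros has_derivative_shift_coord[OF C12D(3)[OF u_C12 t0(1) _ i] x0 j]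
          C12D(3)[OF u_C12 t0(1) x0 i] refl | assumption)+ simp
    have mx: "q t0 (x0(i := y)) \<le> q t0 (x0(i := x0 i))" for y
      using max[OF t0(1) fun_upd_Rd[OF x0 i]] by simp
    from second_derivative_at_max[OF d1 d2 mx] show
      "e * (partial i (u t0) ?x1 - partial i (u t0) x0) = \<eta> * sinh (x0 i)"
      "e * (partial i (partial i (u t0)) ?x1 - partial i (partial i (u t0)) x0) \<le> \<eta> * cosh (x0 i)"
      by simp_all
  qed
  have lap: "e * (laplacian d (u t0) ?x1 - laplacian d (u t0) x0) \<le> \<eta> * \<Psi> x0"
    unfolding laplacian_def \<Psi>_def sum_subtractf[symmetric] sum_distrib_left
    by (intro sum_mono space(2))
  have ev0: "e * v \<ge> 0" using ev \<eta> \<Psi>pos[of x0] by (smt (verit) mult_pos_pos)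
  have "\<bar>Fu t0 ?x1 - Fu t0 x0\<bar> \<le> (\<Sum>i\<in>{1..d}. L i * (\<bar>v\<bar> + \<bar>partial i (u t0) ?x1 - partial i (u t0) x0\<bar>))"
    unfolding Fu_def v_def
  proof (rule order_trans[OF f_lipschitz[OF gradient_Rd gradient_Rd]], intro eq_refl sum.cong refl)
    fix i assume "i \<in> {1..d}"
    then show "L i * (\<bar>u t0 ?x1 - u t0 x0\<bar> + \<bar>gradient d (u t0) ?x1 i - gradient d (u t0) x0 i\<bar>)
      = L i * (\<bar>u t0 ?x1 - u t0 x0\<bar> + \<bar>partial i (u t0) ?x1 - partial i (u t0) x0\<bar>)"
      by (simp add: gradient_def)
  qed
  then have "e * (Fu t0 ?x1 - Fu t0 x0) \<le>
      e * (\<Sum>i\<in>{1..d}. L i * (\<bar>v\<bar> + \<bar>partial i (u t0) ?x1 - partial i (u t0) x0\<bar>))"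
    using e by (intro mult_left_mono) auto
  also have "\<dots> = (\<Sum>i\<in>{1..d}. L i * (\<bar>e * v\<bar> + \<bar>e * (partial i (u t0) ?x1 - partial i (u t0) x0)\<bar>))"
    unfolding sum_distrib_left abs_mult using e by (intro sum.cong) (auto simp: algebra_simps)
  also have "\<dots> = (\<Sum>i\<in>{1..d}. L i * (e * v + \<eta> * \<bar>sinh (x0 i)\<bar>))"
    unfolding abs_of_nonneg[OF ev0] using \<eta> by (intro sum.cong) (auto simp: space(1) abs_mult)
  also have "\<dots> \<le> (\<Sum>i\<in>{1..d}. L i * (e * v)) + (\<Sum>i\<in>{1..d}. lam * (\<eta> * cosh (x0 i)))"
    unfolding sum.distrib[symmetric] distrib_left
  proof (intro sum_mono add_mono order_refl mult_mono)
    fix i show "\<bar>sinh (x0 i)\<bar> \<le> cosh (x0 i)"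
      using exp_gt_zero[of "x0 i"] exp_gt_zero[of "- x0 i"]
      unfolding sinh_def cosh_def abs_le_iff real_scaleR_def by (intro conjI; simp add: field_simps)
  qed (use L_le lam_pos \<eta> L_nonneg in auto)
  also have "\<dots> \<le> lam * (e * v) + lam * (\<eta> * \<Psi> x0)"
    using mult_right_mono[OF L_sum ev0]
    by (simp add: sum_distrib_right[symmetric] sum_distrib_left[symmetric] \<Psi>_def)
  finally have "e * (Fu t0 ?x1 - Fu t0 x0) \<le> lam * (e * v) + lam * (\<eta> * \<Psi> x0)" .
  then have "\<mu> * (e * v) \<le> (1 + lam) * (\<eta> * \<Psi> x0) + lam * (e * v)"
    using time lap unfolding pde_closed[OF t0(1) x1] pde_closed[OF t0(1) x0]
    by (simp add: algebra_simps)
  then have "(lam + 2) * (e * v) \<le> (1 + lam) * (\<eta> * \<Psi> x0)"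
    unfolding \<mu>_def by (simp add: algebra_simps)
  also have "\<dots> < (1 + lam) * (e * v)"
    using ev lam_pos by (intro mult_strict_left_mono) auto
  finally have "e * v < 0" by (simp add: algebra_simps)
  then show False using ev \<eta> \<Psi>pos[of x0] by (smt (verit) mult_pos_pos)
qed

text \<open>At a fixed point the barrier is removed by letting its factor tend to 0, namely
  \<epsilon> divided by the sum of the cosh values. The opposite sign follows by shifting the
  shifted point back.\<close>

lemma shift_difference_le:
  fixes h :: real
  assumes j: "j \<in> {1..d}" and t: "t \<in> {0..T}" and x: "x \<in> Rd d"
  shows "\<bar>u t (shift_coord j h x) - u t x\<bar> \<le> exp ((2 * lam + 2) * T) * (D * L j) * \<bar>h\<bar>"
proof -
  have upper: "u t (shift_coord j k y) - u t y \<le> exp ((2 * lam + 2) * T) * (D * L j) * \<bar>k\<bar>"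
    if y: "y \<in> Rd d" for k y
  proof -
    define \<Psi> where "\<Psi> = (\<Sum>i\<in>{1..d}. cosh (y i))"
    have \<Psi>: "\<Psi> > 0" unfolding \<Psi>_def using d_pos by (intro sum_pos) auto
    define E where "E = exp (- (2 * lam + 2) * t) * (u t (shift_coord j k y) - u t y)"
    have "E \<le> D * L j * \<bar>k\<bar>"
    proof (rule field_le_epsilon)
      fix \<epsilon> :: real assume "\<epsilon> > 0"
      then show "E \<le> D * L j * \<bar>k\<bar> + \<epsilon>"
        using shift_difference_below_barrier[OF j _ t y, of "\<epsilon> / \<Psi>" k] \<Psi>
        unfolding \<Psi>_def[symmetric] E_def by simp
    qed
    then have "exp ((2 * lam + 2) * t) * E \<le> exp ((2 * lam + 2) * t) * (D * L j * \<bar>k\<bar>)"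
      by (intro mult_left_mono) auto
    moreover have "exp ((2 * lam + 2) * t) * E = u t (shift_coord j k y) - u t y"
      unfolding E_def mult.assoc[symmetric] exp_add[symmetric] by (simp add: algebra_simps)
    moreover have "exp ((2 * lam + 2) * t) * (D * L j * \<bar>k\<bar>) \<le> exp ((2 * lam + 2) * T) * (D * L j * \<bar>k\<bar>)"
      using t lam_pos D_nonneg L_nonneg[OF j] by (intro mult_right_mono) auto
    ultimately show ?thesis by (simp add: mult.assoc)
  qed
  have "shift_coord j (- h) (shift_coord j h x) = x"
    by (auto simp: shift_coord_def)
  then show ?thesis
    using upper[OF x, of h] upper[OF shift_coord_Rd[OF x j, of h], of "- h"] by simp
qed

lemma partial_bound:
  assumes j: "j \<in> {1..d}" and t: "t \<in> {0..T}" and x: "x \<in> Rd d"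
  shows "\<bar>partial j (u t) x\<bar> \<le> exp ((2 * lam + 2) * T) * (D * L j)"
proof -
  have "((\<lambda>s. u t (x(j := s))) has_real_derivative partial j (u t) x) (at (x j))"
    using C12D(2)[OF u_C12 t x j, of "x j"] by simp
  then have "((\<lambda>h. (u t (x(j := x j + h)) - u t (x(j := x j))) / h) \<longlongrightarrow> partial j (u t) x) (at 0)"
    unfolding DERIV_def .
  then have "((\<lambda>h. \<bar>(u t (shift_coord j h x) - u t x) / h\<bar>) \<longlongrightarrow> \<bar>partial j (u t) x\<bar>) (at 0)"
    by (intro tendsto_rabs) (simp add: shift_coord_def)
  moreover have "eventually (\<lambda>h. \<bar>(u t (shift_coord j h x) - u t x) / h\<bar> \<le> exp ((2 * lam + 2) * T) * (D * L j)) (at 0)"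
    using shift_difference_le[OF j t x]
    by (auto simp: eventually_at_filter divide_le_eq abs_divide intro!: always_eventually)
  ultimately show ?thesis
    by (rule tendsto_upperbound) simp
qed

text \<open>Moving x to the origin one coordinate at a time costs at most B |x_i| each, and u at the
  origin is bounded by compactness of [0, T]. The constant is therefore uncontrolled in d; it is
  used for integrability and finiteness only.\<close>

lemma linear_growth:
  obtains C where "C \<ge> 0" "\<And>t x. t \<in> {0..T} \<Longrightarrow> x \<in> Rd d \<Longrightarrow> \<bar>u t x\<bar> \<le> C * (1 + (\<Sum>i\<in>{1..d}. \<bar>x i\<bar>))"
    "\<And>t x j. t \<in> {0..T} \<Longrightarrow> x \<in> Rd d \<Longrightarrow> j \<in> {1..d} \<Longrightarrow> \<bar>partial j (u t) x\<bar> \<le> C"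
proof -
  define B where "B = exp ((2 * lam + 2) * T) * (D * lam)"
  have B: "exp ((2 * lam + 2) * T) * (D * L j) \<le> B" if "j \<in> {1..d}" for j
    unfolding B_def using L_le[OF that] D_nonneg by (intro mult_left_mono) auto
  have B0: "B \<ge> 0" unfolding B_def using D_nonneg lam_pos by simp
  obtain C0 where C0: "C0 \<ge> 0" "\<And>t x. t \<in> {0..T} \<Longrightarrow> x \<in> Rd d \<Longrightarrow> (\<And>j. j \<in> {1..d} \<Longrightarrow> \<bar>x j\<bar> \<le> 0) \<Longrightarrow> \<bar>u t x\<bar> \<le> C0"
    using continuous_time_space_bounded[OF u_cont] by metis
  have step: "\<bar>u t x - u t (\<lambda>i. if i \<in> A then 0 else x i)\<bar> \<le> (\<Sum>i\<in>A. B * \<bar>x i\<bar>)"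
    if "finite A" "A \<subseteq> {1..d}" and t: "t \<in> {0..T}" and x: "x \<in> Rd d" for A t x
    using that(1,2)
  proof (induction A)
    case (insert j A)
    let ?y = "\<lambda>i. if i \<in> A then 0 else x i"
    have y: "?y \<in> Rd d" using x insert.prems by (auto simp: PiE_def extensional_def)
    have j: "j \<in> {1..d}" using insert.prems by simp
    have "shift_coord j (- x j) ?y = (\<lambda>i. if i \<in> insert j A then 0 else x i)"
      using insert.hyps by (auto simp: shift_coord_def)
    then have "\<bar>u t (\<lambda>i. if i \<in> insert j A then 0 else x i) - u t ?y\<bar> \<le> B * \<bar>x j\<bar>"
      using shift_difference_le[OF j t y, of "- x j"] mult_right_mono[OF B[OF j], of "\<bar>x j\<bar>"] by simp
    then show ?case using insert by simp
  qed simp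
  show ?thesis
  proof (rule that[of "max B C0"])
    fix t x assume t: "t \<in> {0..T}" and x: "x \<in> Rd d"
    let ?z = "\<lambda>i. if i \<in> {1..d} then 0 else x i"
    have z: "?z \<in> Rd d" using x by (auto simp: PiE_def extensional_def)
    have "\<bar>u t x\<bar> \<le> \<bar>u t ?z\<bar> + \<bar>u t x - u t ?z\<bar>" by simp
    also have "\<dots> \<le> C0 + (\<Sum>i\<in>{1..d}. B * \<bar>x i\<bar>)"
      using C0(2)[OF t z] step[OF _ _ t x, of "{1..d}"] by simp
    also have "\<dots> \<le> max B C0 + (\<Sum>i\<in>{1..d}. max B C0 * \<bar>x i\<bar>)"
      by (intro add_mono sum_mono mult_right_mono) auto
    finally show "\<bar>u t x\<bar> \<le> max B C0 * (1 + (\<Sum>i\<in>{1..d}. \<bar>x i\<bar>))"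
      by (simp add: distrib_left sum_distrib_left)
    fix j assume "j \<in> {1..d}"
    then show "\<bar>partial j (u t) x\<bar> \<le> max B C0"
      using partial_bound[OF _ t x, of j] B[of j] by simp
  qed (use C0 in simp)
qed

end

section \<open>Gaussian integration by parts\<close>

abbreviation std_normal :: "real measure" where
  "std_normal \<equiv> density lborel std_normal_density"

lemma prob_space_std_normal: "prob_space std_normal"
  by (rule prob_space_normal_density) simp

lemma sets_std_normal_Rd [measurable_cong]: "sets (std_normal_Rd d) = sets (borel_Rd d)"
  unfolding std_normal_Rd_def by (intro sets_PiM_cong) auto

lemma prob_space_std_normal_Rd: "prob_space (std_normal_Rd d)"
  unfolding std_normal_Rd_def by (intro prob_space_PiM prob_space_std_normal)

text \<open>The standard normal density satisfies \<phi>' = - y \<phi>, hence (\<phi> h)' = \<phi>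
  h' - \<phi> h y. Integrating over an interval outside which h vanishes leaves no boundary
  terms.\<close>

lemma stein_1d:
  fixes h h' :: "real \<Rightarrow> real"
  assumes h: "\<And>y. (h has_real_derivative h' y) (at y)"
    and cont: "continuous_on UNIV h'" and vanish: "\<And>y. B \<le> \<bar>y\<bar> \<Longrightarrow> h y = 0"
  shows "(\<integral>y. h y * y \<partial>std_normal) = (\<integral>y. h' y \<partial>std_normal)"
proof -
  define \<phi> where "\<phi> = std_normal_density"
  have \<phi>': "(\<phi> has_real_derivative - y * \<phi> y) (at y)" for y
  proof -
    have "((\<lambda>y. c * exp (- y\<^sup>2 / 2)) has_real_derivative - y * (c * exp (- y\<^sup>2 / 2))) (at y)" for c :: real
      by (auto intro!: derivative_eq_intros)
    then show ?thesis
      unfolding \<phi>_def std_normal_density_def .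
  qed
  have \<phi>_cont: "continuous_on UNIV \<phi>"
    by (rule DERIV_continuous_on[OF has_field_derivative_at_within[OF \<phi>']])
  have h_cont: "continuous_on UNIV h"
    by (rule DERIV_continuous_on[OF has_field_derivative_at_within[OF h]])
  \<comment> \<open>The extra 1 gives every point with |y| \<ge> B' a neighbourhood on which h
    vanishes, so that h' vanishes there too.\<close>
  define B' where "B' = \<bar>B\<bar> + 1"
  have h'0: "h' y = 0" if "B' \<le> \<bar>y\<bar>" for y
  proof -
    have "eventually (\<lambda>s. \<bar>s\<bar> > \<bar>B\<bar>) (nhds y)"
      by (rule order_tendstoD[of _ "\<bar>y\<bar>"])
        (use that B'_def in \<open>auto intro!: tendsto_rabs simp: filterlim_ident\<close>)
    then have "eventually (\<lambda>s. h s = 0) (nhds y)"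
      by eventually_elim (use vanish in force)
    then have "((\<lambda>_. 0) has_real_derivative h' y) (at y)"
      using h[of y] by (subst (asm) DERIV_cong_ev[OF refl _ refl]) auto
    then show ?thesis using DERIV_unique DERIV_const by blast
  qed
  have h0: "h y = 0" if "B' \<le> \<bar>y\<bar>" for y using vanish that unfolding B'_def by auto
  have int: "integrable lborel (\<lambda>y. \<phi> y * k y)" if k: "continuous_on UNIV k" "\<And>y. B' \<le> \<bar>y\<bar> \<Longrightarrow> k y = 0" for k :: "real \<Rightarrow> real"
  proof -
    have "integrable lborel (\<lambda>y. indicator {-B'..B'} y *\<^sub>R (\<phi> y * k y))"
      by (rule borel_integrable_compact)
        (auto intro!: continuous_on_mult continuous_on_subset[OF \<phi>_cont] continuous_on_subset[OF k(1)])
    moreover have eq: "indicator {-B'..B'} y *\<^sub>R (\<phi> y * k y) = \<phi> y * k y" for y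
    proof (cases "y \<in> {-B'..B'}")
      case False
      then have "B' \<le> \<bar>y\<bar>" by auto
      then show ?thesis using k(2) by simp
    qed simp
    ultimately show ?thesis by (simp only: eq)
  qed
  have int1: "integrable lborel (\<lambda>y. \<phi> y * (h y * y))"
    using h0 by (intro int continuous_intros h_cont) auto
  have int2: "integrable lborel (\<lambda>y. \<phi> y * h' y)"
    using h'0 by (intro int cont) auto
  have "(\<integral>y. indicator {-B'..B'} y *\<^sub>R (\<phi> y * h' y - \<phi> y * (h y * y)) \<partial>lborel) = \<phi> B' * h B' - \<phi> (-B') * h (-B')"
  proof (rule integral_FTC_Icc)
    show "- B' \<le> B'" by (simp add: B'_def)
    fix y show "((\<lambda>y. \<phi> y * h y) has_vector_derivative \<phi> y * h' y - \<phi> y * (h y * y)) (at y within {- B'..B'})"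
      unfolding has_real_derivative_iff_has_vector_derivative[symmetric]
      by (rule has_field_derivative_at_within) (auto intro!: derivative_eq_intros \<phi>' h simp: algebra_simps)
  qed (auto intro!: continuous_on_diff continuous_on_mult continuous_on_id continuous_on_subset[OF \<phi>_cont]
        continuous_on_subset[OF h_cont] continuous_on_subset[OF cont])
  also have "\<dots> = 0" using h0[of B'] h0[of "-B'"] by (simp add: B'_def)
  also have "(\<lambda>y. indicator {-B'..B'} y *\<^sub>R (\<phi> y * h' y - \<phi> y * (h y * y))) = (\<lambda>y. \<phi> y * h' y - \<phi> y * (h y * y))"
  proof
    fix y show "indicator {-B'..B'} y *\<^sub>R (\<phi> y * h' y - \<phi> y * (h y * y)) = \<phi> y * h' y - \<phi> y * (h y * y)"
    proof (cases "y \<in> {-B'..B'}")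
      case False
      then have "B' \<le> \<bar>y\<bar>" by auto
      then show ?thesis using h0 h'0 by simp
    qed simp
  qed
  finally have "(\<integral>y. \<phi> y * (h y * y) \<partial>lborel) = (\<integral>y. \<phi> y * h' y \<partial>lborel)"
    using int1 int2 by simp
  moreover have "h \<in> borel_measurable borel" "h' \<in> borel_measurable borel"
    using h_cont cont by (auto intro: borel_measurable_continuous_onI)
  ultimately show ?thesis
    by (simp add: integral_density \<phi>_def)
qed

text \<open>Fubini isolates coordinate j, and the one-dimensional identity is applied with the other
  coordinates frozen. Vanishing is asked for large |z j| only, which is why integrability over all
  coordinates is a separate hypothesis.\<close>

lemma stein:
  assumes j: "j \<in> {1..d}"
    and H: "\<And>z y. z \<in> Rd d \<Longrightarrow> ((\<lambda>s. H (z(j := s))) has_real_derivative H' (z(j := y))) (at y)"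
    and cont: "\<And>z. z \<in> Rd d \<Longrightarrow> continuous_on UNIV (\<lambda>y. H' (z(j := y)))"
    and vanish: "\<And>z. z \<in> Rd d \<Longrightarrow> B \<le> \<bar>z j\<bar> \<Longrightarrow> H z = 0"
    and int: "integrable (std_normal_Rd d) (\<lambda>z. H z * z j)" "integrable (std_normal_Rd d) H'"
  shows "(\<integral>z. H z * z j \<partial>std_normal_Rd d) = (\<integral>z. H' z \<partial>std_normal_Rd d)"
proof -
  interpret product_sigma_finite "\<lambda>_::nat. std_normal"
    unfolding product_sigma_finite_def
    using prob_space_std_normal by (simp add: prob_space_imp_sigma_finite)
  define I where "I = {1..d} - {j}"
  have I: "finite I" "j \<notin> I" "insert j I = {1..d}" using j by (auto simp: I_def)
  have upd: "x(j := s) \<in> Rd d" if "x \<in> space (PiM I (\<lambda>_. std_normal))" for x s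
    using that I by (auto simp: space_PiM PiE_def extensional_def)
  have "(\<integral>z. H z * z j \<partial>std_normal_Rd d) = (\<integral>x. (\<integral>y. H (x(j := y)) * y \<partial>std_normal) \<partial>PiM I (\<lambda>_. std_normal))"
    using product_integral_insert[OF I(1,2), of "\<lambda>z. H z * z j"] int(1)
    unfolding std_normal_Rd_def I(3) by simp
  also have "\<dots> = (\<integral>x. (\<integral>y. H' (x(j := y)) \<partial>std_normal) \<partial>PiM I (\<lambda>_. std_normal))"
  proof (rule Bochner_Integration.integral_cong[OF refl], rule stein_1d)
    fix x assume x: "x \<in> space (PiM I (\<lambda>_. std_normal))"
    show "((\<lambda>y. H (x(j := y))) has_real_derivative H' (x(j := y))) (at y)" for y
      using H[OF upd[OF x, of 0]] by simp
    show "continuous_on UNIV (\<lambda>y. H' (x(j := y)))"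
      using cont[OF upd[OF x, of 0]] by simp
    show "H (x(j := y)) = 0" if "B \<le> \<bar>y\<bar>" for y
      using vanish[OF upd[OF x, of y]] that by simp
  qed
  also have "\<dots> = (\<integral>z. H' z \<partial>std_normal_Rd d)"
    using product_integral_insert[OF I(1,2), of H'] int(2)
    unfolding std_normal_Rd_def I(3) by simp
  finally show ?thesis .
qed

text \<open>The coordinate space is a function space without a norm, so the chain rule along a curve
  is built from partial derivatives. Coordinates are set in motion one at a time, and each step
  needs the differentiability of a function of two real variables, one of whose partial derivatives
  is continuous.\<close>

lemma chain_rule_coordinates:
  fixes h :: "real \<Rightarrow> (nat \<Rightarrow> real) \<Rightarrow> real" and X :: "real set"
  assumes ht: "\<And>\<tau> x. \<tau> \<in> {0..T} \<Longrightarrow> x \<in> Rd d \<Longrightarrow> ((\<lambda>s. h s x) has_real_derivative ht \<tau> x) (at \<tau> within {0..T})"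
    and h1: "\<And>\<tau> x j y. \<tau> \<in> {0..T} \<Longrightarrow> x \<in> Rd d \<Longrightarrow> j \<in> {1..d} \<Longrightarrow>
        ((\<lambda>s. h \<tau> (x(j := s))) has_real_derivative h1 j \<tau> (x(j := y))) (at y)"
    and cont: "\<And>j. j \<in> {1..d} \<Longrightarrow> continuous_time_space T d (h1 j)"
    and v0: "v0 \<in> X"
    and \<tau>: "(\<tau> has_real_derivative \<tau>') (at v0 within X)" "\<tau> ` X \<subseteq> {0..T}" "continuous_on X \<tau>"
    and c: "\<And>j. j \<in> {1..d} \<Longrightarrow> ((\<lambda>v. c v j) has_real_derivative c' j) (at v0 within X)"
      "continuous_on X c" "\<And>v. v \<in> X \<Longrightarrow> c v \<in> Rd d"
  shows "((\<lambda>v. h (\<tau> v) (c v)) has_real_derivative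
      ht (\<tau> v0) (c v0) * \<tau>' + (\<Sum>j\<in>{1..d}. h1 j (\<tau> v0) (c v0) * c' j)) (at v0 within X)"
proof -
  \<comment> \<open>Coordinates in A follow the curve, the others stay at b. The induction starts
    with only the time moving and ends with all of {1..d} moving.\<close>
  define m where "m A b v = (\<lambda>i. if i \<in> A then c v i else b i)" for A and b :: "nat \<Rightarrow> real" and v
  have m_Rd: "m A b v \<in> Rd d" if "A \<subseteq> {1..d}" "b \<in> Rd d" "v \<in> X" for A b v
    using that c(3)[OF that(3)] by (auto simp: m_def PiE_def extensional_def)
  have step: "((\<lambda>v. h (\<tau> v) (m A b v)) has_real_derivative
      ht (\<tau> v0) (m A b v0) * \<tau>' + (\<Sum>j\<in>A. h1 j (\<tau> v0) (m A b v0) * c' j)) (at v0 within X)"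
    if "finite A" "A \<subseteq> {1..d}" "b \<in> Rd d" for A b
    using that
  proof (induction A arbitrary: b)
    case empty
    have "((\<lambda>s. h s b) has_real_derivative ht (\<tau> v0) b) (at (\<tau> v0) within \<tau> ` X)"
      using ht[of "\<tau> v0" b] \<tau>(2) v0 empty by (intro has_field_derivative_subset[OF _ \<tau>(2)]) auto
    from DERIV_image_chain[OF this \<tau>(1)] show ?case by (simp add: m_def o_def)
  next
    case (insert j A b)
    have j: "j \<in> {1..d}" and A: "A \<subseteq> {1..d}" using insert.prems by auto
    \<comment> \<open>The two real variables are the parameter v of the part already in motion and
      the free value y of coordinate j; in the end y is replaced by \<open>c v j\<close>.\<close>
    define H where "H v y = h (\<tau> v) ((m A b v)(j := y))" for v y
    define H1 where "H1 v y = h1 j (\<tau> v) ((m A b v)(j := y))" for v y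
    define y0 where "y0 = c v0 j"
    have m_upd: "(m A b v)(j := y) = m A (b(j := y)) v" for v y
      using insert.hyps by (auto simp: m_def)
    have m_ins: "m (insert j A) b v = (m A b v)(j := c v j)" for v
      using insert.hyps by (auto simp: m_def)
    let ?D = "ht (\<tau> v0) (m (insert j A) b v0) * \<tau>' + (\<Sum>i\<in>A. h1 i (\<tau> v0) (m (insert j A) b v0) * c' i)"
    have "((\<lambda>v. H v y0) has_real_derivative ?D) (at v0 within X)"
      using insert.IH[OF A fun_upd_Rd[OF insert.prems(2) j, of y0]]
      unfolding H_def m_ins m_upd y0_def .
    then have fx: "((\<lambda>v. H v y0) has_derivative (\<lambda>t. ?D * t)) (at v0 within X)"
      by (simp add: has_field_derivative_def)
    have fy: "((\<lambda>y. H v y) has_derivative blinfun_apply (blinfun_scaleR_left (H1 v y))) (at y within UNIV)"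
      if "v \<in> X" for v y
      using h1[OF _ m_Rd[OF A insert.prems(2) that] j, of "\<tau> v" y] \<tau>(2) that
      unfolding H_def H1_def has_field_derivative_def
      by (auto simp: blinfun_scaleR_left.rep_eq mult.commute[of _ "h1 _ _ _"])
    have "continuous_on (X \<times> UNIV) (\<lambda>p. H1 (fst p) (snd p))"
      unfolding H1_def
    proof (rule continuous_on_pair_compose[OF cont[OF j, unfolded continuous_time_space_def]])
      show "continuous_on (X \<times> UNIV) (\<lambda>p. \<tau> (fst p))"
        by (rule continuous_on_compose2[OF \<tau>(3) continuous_on_fst[OF continuous_on_id]]) auto
      show "continuous_on (X \<times> UNIV) (\<lambda>p. (m A b (fst p))(j := snd p))"
      proof (rule continuous_on_coordinatewise_then_product)
        fix k
        have "continuous_on (X \<times> UNIV) (\<lambda>p::real \<times> real. c (fst p) k)"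
          using continuous_on_product_then_coordinatewise[OF c(2), of k]
          by (rule continuous_on_compose2[OF _ continuous_on_fst[OF continuous_on_id]]) auto
        then show "continuous_on (X \<times> UNIV) (\<lambda>p. ((m A b (fst p))(j := snd p)) k)"
          by (cases "k = j"; cases "k \<in> A") (auto simp: m_def continuous_on_snd continuous_on_id)
      qed
      show "(\<lambda>p. \<tau> (fst p)) ` (X \<times> UNIV) \<subseteq> {0..T}" using \<tau>(2) by auto
      show "(\<lambda>p. (m A b (fst p))(j := snd p)) ` (X \<times> UNIV) \<subseteq> Rd d"
      proof (rule image_subsetI)
        fix p :: "real \<times> real" assume "p \<in> X \<times> UNIV"
        then have "fst p \<in> X" by auto
        then show "(m A b (fst p))(j := snd p) \<in> Rd d"
          by (intro fun_upd_Rd[OF m_Rd[OF A insert.prems(2)] j])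
      qed
    qed
    then have "continuous (at (v0, y0) within X \<times> UNIV) (\<lambda>p. H1 (fst p) (snd p))"
      using v0 by (simp add: continuous_on_eq_continuous_within)
    then have "continuous (at (v0, y0) within X \<times> UNIV) (\<lambda>(v, y). blinfun_scaleR_left (H1 v y))"
      unfolding case_prod_unfold
      by (intro bounded_linear.continuous[OF bounded_linear_blinfun_scaleR_left])
    from has_derivative_partialsI[OF fx fy this]
    have part: "((\<lambda>(v, y). H v y) has_derivative (\<lambda>(tx, ty). ?D * tx + blinfun_apply (blinfun_scaleR_left (H1 v0 y0)) ty))
        (at (v0, y0) within X \<times> UNIV)" by simp
    have curve: "((\<lambda>v. (v, c v j)) has_derivative (\<lambda>t. (t, c' j * t))) (at v0 within X)"
      using c(1)[OF j] unfolding has_field_derivative_def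
      by (intro has_derivative_Pair has_derivative_ident)
    have "((\<lambda>(v, y). H v y) has_derivative (\<lambda>(tx, ty). ?D * tx + blinfun_apply (blinfun_scaleR_left (H1 v0 y0)) ty))
        (at (v0, c v0 j) within (\<lambda>v. (v, c v j)) ` X)"
      unfolding y0_def[symmetric] by (rule has_derivative_subset[OF part]) auto
    from has_derivative_in_compose[OF curve this]
    have "((\<lambda>v. H v (c v j)) has_derivative (\<lambda>t. ?D * t + blinfun_apply (blinfun_scaleR_left (H1 v0 y0)) (c' j * t))) (at v0 within X)"
      by simp
    then have "((\<lambda>v. H v (c v j)) has_real_derivative ?D + H1 v0 y0 * c' j) (at v0 within X)"
      unfolding has_field_derivative_def
      by (rule has_derivative_eq_rhs) (auto simp: blinfun_scaleR_left.rep_eq algebra_simps)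
    then show ?case
      unfolding H_def H1_def m_ins y0_def sum.insert[OF insert.hyps(1,2)]
      by (simp only: add.assoc add.commute add.left_commute)
  qed
  have "m {1..d} (c v0) v = c v" if "v \<in> X" for v
    using c(3)[OF that] c(3)[OF v0] by (auto simp: m_def PiE_def extensional_def)
  then have "h (\<tau> v) (c v) = h (\<tau> v) (m {1..d} (c v0) v)" "m {1..d} (c v0) v0 = c v0" if "v \<in> X" for v
    using that v0 by simp_all
  from has_derivative_transform[OF v0 this(1) step[of "{1..d}" "c v0", unfolded has_field_derivative_def]] this(2)[OF v0]
  show ?thesis
    unfolding has_field_derivative_def using c(3)[OF v0] by simp
qed

section \<open>The heat identity\<close>

lemma measurable_add_scaled [measurable]:
  assumes [measurable]: "x \<in> M \<rightarrow>\<^sub>M borel_Rd d" "s \<in> borel_measurable M" "z \<in> M \<rightarrow>\<^sub>M borel_Rd d"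
  shows "(\<lambda>\<omega>. add_scaled d (x \<omega>) (s \<omega>) (z \<omega>)) \<in> M \<rightarrow>\<^sub>M borel_Rd d"
  unfolding add_scaled_def
proof (rule measurable_restrict)
  fix j assume "j \<in> {1..d}"
  then have [measurable]: "(\<lambda>z. z j) \<in> borel_measurable (borel_Rd d)" by simp
  show "(\<lambda>\<omega>. x \<omega> j + s \<omega> * z \<omega> j) \<in> borel_measurable M"
    by measurable
qed

lemma measurable_one_scaled:
  assumes [measurable]: "s \<in> borel_measurable M" "z \<in> M \<rightarrow>\<^sub>M borel_Rd d" and k: "k \<le> d"
  shows "(\<lambda>\<omega>. one_scaled (s \<omega>) (z \<omega>) k) \<in> borel_measurable M"
proof (cases "k = 0")
  case False
  then have [measurable]: "(\<lambda>z. z k) \<in> borel_measurable (borel_Rd d)" using k by simp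
  show ?thesis using False unfolding one_scaled_def by simp
qed (simp add: one_scaled_def)

lemma measurable_std_normal_Rd_ident: "(\<lambda>z. z) \<in> std_normal_Rd d \<rightarrow>\<^sub>M borel_Rd d"
  by (rule measurable_ident_sets[OF sets_std_normal_Rd])

text \<open>Outside the box of size R the function is 0, inside it is bounded by
  compactness.\<close>

lemma bounded_if_vanishing:
  assumes "continuous_time_space T d w"
    and "\<And>\<tau> x j. \<tau> \<in> {0..T} \<Longrightarrow> x \<in> Rd d \<Longrightarrow> j \<in> {1..d} \<Longrightarrow> \<bar>x j\<bar> > R \<Longrightarrow> w \<tau> x = 0"
  shows "\<exists>C\<ge>0. \<forall>\<tau>\<in>{0..T}. \<forall>x\<in>Rd d. \<bar>w \<tau> x\<bar> \<le> C"
proof -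
  obtain C where C: "C \<ge> 0" "\<And>t x. t \<in> {0..T} \<Longrightarrow> x \<in> Rd d \<Longrightarrow> (\<And>j. j \<in> {1..d} \<Longrightarrow> \<bar>x j\<bar> \<le> R) \<Longrightarrow> \<bar>w t x\<bar> \<le> C"
    using continuous_time_space_bounded[OF assms(1)] by metis
  have "\<bar>w \<tau> x\<bar> \<le> C" if "\<tau> \<in> {0..T}" "x \<in> Rd d" for \<tau> x
    using C that assms(2)[OF that] by (metis abs_zero not_le)
  then show ?thesis using C(1) by auto
qed

text \<open>Along v \<mapsto> (t (1 - v^2), x + sqrt (2 t) v z) the derivative of w contains the factor z through the
  spatial gradient; integration by parts in z turns this part into 2 t v times the Laplacian.\<close>
lemma heat_identity:
  fixes w wt :: "real \<Rightarrow> (nat \<Rightarrow> real) \<Rightarrow> real" and w1 w2 :: "nat \<Rightarrow> real \<Rightarrow> (nat \<Rightarrow> real) \<Rightarrow> real"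
  assumes dt: "\<And>\<tau> y. \<tau> \<in> {0..T} \<Longrightarrow> y \<in> Rd d \<Longrightarrow> ((\<lambda>s. w s y) has_real_derivative wt \<tau> y) (at \<tau> within {0..T})"
    and d1: "\<And>\<tau> y j a. \<tau> \<in> {0..T} \<Longrightarrow> y \<in> Rd d \<Longrightarrow> j \<in> {1..d} \<Longrightarrow>
        ((\<lambda>s. w \<tau> (y(j := s))) has_real_derivative w1 j \<tau> (y(j := a))) (at a)"
    and d2: "\<And>\<tau> y j a. \<tau> \<in> {0..T} \<Longrightarrow> y \<in> Rd d \<Longrightarrow> j \<in> {1..d} \<Longrightarrow>
        ((\<lambda>s. w1 j \<tau> (y(j := s))) has_real_derivative w2 j \<tau> (y(j := a))) (at a)"
    and cont: "continuous_time_space T d w" "continuous_time_space T d wt"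
      "\<And>j. j \<in> {1..d} \<Longrightarrow> continuous_time_space T d (w1 j)"
      "\<And>j. j \<in> {1..d} \<Longrightarrow> continuous_time_space T d (w2 j)"
    and vanish: "\<And>\<tau> y i. \<tau> \<in> {0..T} \<Longrightarrow> y \<in> Rd d \<Longrightarrow> i \<in> {1..d} \<Longrightarrow> \<bar>y i\<bar> > R \<Longrightarrow> w \<tau> y = 0"
      "\<And>\<tau> y i. \<tau> \<in> {0..T} \<Longrightarrow> y \<in> Rd d \<Longrightarrow> i \<in> {1..d} \<Longrightarrow> \<bar>y i\<bar> > R \<Longrightarrow> wt \<tau> y = 0"
      "\<And>\<tau> y i j. \<tau> \<in> {0..T} \<Longrightarrow> y \<in> Rd d \<Longrightarrow> i \<in> {1..d} \<Longrightarrow> \<bar>y i\<bar> > R \<Longrightarrow> j \<in> {1..d} \<Longrightarrow> w1 j \<tau> y = 0"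
      "\<And>\<tau> y i j. \<tau> \<in> {0..T} \<Longrightarrow> y \<in> Rd d \<Longrightarrow> i \<in> {1..d} \<Longrightarrow> \<bar>y i\<bar> > R \<Longrightarrow> j \<in> {1..d} \<Longrightarrow> w2 j \<tau> y = 0"
    and t: "0 < t" "t \<le> T" and x: "x \<in> Rd d" and v0: "0 < v0" "v0 \<le> 1" and k: "k \<le> d"
  shows "(\<integral>z. w 0 (add_scaled d x (sqrt (2 * t)) z) * one_scaled (sqrt (2 * t)) z k \<partial>std_normal_Rd d)
       - (\<integral>z. (if k = 0 then w else w1 k) (t * (1 - v0\<^sup>2)) (add_scaled d x (sqrt (2 * t) * v0) z) \<partial>std_normal_Rd d)
     = (\<integral>v. indicator {v0..1} v * (\<integral>z. 2 * t * v * ((\<Sum>j\<in>{1..d}. w2 j (t * (1 - v\<^sup>2)) (add_scaled d x (sqrt (2 * t) * v) z))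
           - wt (t * (1 - v\<^sup>2)) (add_scaled d x (sqrt (2 * t) * v) z))
         * one_scaled (sqrt (2 * t) * v) z k \<partial>std_normal_Rd d) \<partial>lborel)"
proof -
  interpret \<gamma>: prob_space "std_normal_Rd d" by (rule prob_space_std_normal_Rd)
  interpret pair: pair_sigma_finite lborel "std_normal_Rd d" ..
  let ?\<gamma> = "std_normal_Rd d"
  define \<sigma> where "\<sigma> = sqrt (2 * t)"
  have \<sigma>: "\<sigma> > 0" "\<sigma> * \<sigma> = 2 * t" using t by (simp_all add: \<sigma>_def)
  define X where "X v z = add_scaled d x (\<sigma> * v) z" for v z
  define \<tau> where "\<tau> v = t * (1 - v\<^sup>2)" for v
  define q where "q v z = one_scaled (\<sigma> * v) z k" for v z
  define dq where "dq v z = (if k = 0 then 0 else - z k / (\<sigma> * v\<^sup>2))" for v and z :: "nat \<Rightarrow> real"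
  \<comment> \<open>The derivative in v of w along the path times the weight q: - 2 t v is the
    derivative of the time argument, \<sigma> z_j that of coordinate j, and dq that of q.\<close>
  define D where "D v z = (- 2 * t * v * wt (\<tau> v) (X v z) + (\<Sum>j\<in>{1..d}. w1 j (\<tau> v) (X v z) * (\<sigma> * z j))) * q v z
      + w (\<tau> v) (X v z) * dq v z" for v z
  have \<tau>: "\<tau> v \<in> {0..T}" if "v \<in> {v0..1}" for v
  proof -
    have "v\<^sup>2 \<le> 1" using that v0 by (simp add: abs_square_le_1)
    then have "0 \<le> t * (1 - v\<^sup>2)" "t * (1 - v\<^sup>2) \<le> t * 1" using t by (auto intro!: mult_left_mono mult_nonneg_nonneg)
    then show ?thesis unfolding \<tau>_def atLeastAtMost_iff using t by linarith
  qed
  have X: "X v z \<in> Rd d" for v z unfolding X_def by (rule add_scaled_Rd)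
  \<comment> \<open>Since v \<ge> v0 > 0, a coordinate of z beyond R' pushes the point out of the
    support. All integrands therefore vanish for large z, uniformly in v; this is the reason for
    starting at a positive v0.\<close>
  define R' where "R' = (\<bar>R\<bar> + (\<Sum>i\<in>{1..d}. \<bar>x i\<bar>)) / (\<sigma> * v0)"
  have R'0: "R' \<ge> 0" unfolding R'_def using \<sigma> v0 by (auto intro!: divide_nonneg_pos add_nonneg_nonneg sum_nonneg)
  have out: "\<bar>X v z i\<bar> > R" if v: "v \<in> {v0..1}" and i: "i \<in> {1..d}" "\<bar>z i\<bar> > R'" for v z i
  proof -
    have "\<bar>R\<bar> + (\<Sum>i\<in>{1..d}. \<bar>x i\<bar>) < \<sigma> * v0 * \<bar>z i\<bar>"
      using i(2) \<sigma> v0 by (simp add: R'_def divide_less_eq mult.commute)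
    also have "\<dots> \<le> \<sigma> * v * \<bar>z i\<bar>" using v \<sigma> by (intro mult_right_mono mult_left_mono) auto
    also have "\<dots> = \<bar>\<sigma> * v * z i\<bar>" using v v0 \<sigma> by (simp add: abs_mult)
    finally have "\<bar>R\<bar> + (\<Sum>i\<in>{1..d}. \<bar>x i\<bar>) < \<bar>\<sigma> * v * z i\<bar>" .
    moreover have "\<bar>x i\<bar> \<le> (\<Sum>i\<in>{1..d}. \<bar>x i\<bar>)" using i by (intro member_le_sum) auto
    moreover have "X v z i = x i + \<sigma> * v * z i" using i(1) by (simp add: X_def add_scaled_def)
    ultimately show ?thesis by linarith
  qed
  have "\<exists>C\<ge>0. \<forall>\<tau>\<in>{0..T}. \<forall>y\<in>Rd d. \<bar>w \<tau> y\<bar> \<le> C"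
    by (rule bounded_if_vanishing[OF cont(1), of R]) (rule vanish(1))
  then obtain Cw where Cw: "Cw \<ge> 0" "\<And>\<tau> y. \<tau>\<in>{0..T} \<Longrightarrow> y \<in> Rd d \<Longrightarrow> \<bar>w \<tau> y\<bar> \<le> Cw" by blast
  have "\<exists>C\<ge>0. \<forall>\<tau>\<in>{0..T}. \<forall>y\<in>Rd d. \<bar>wt \<tau> y\<bar> \<le> C"
    by (rule bounded_if_vanishing[OF cont(2), of R]) (rule vanish(2))
  then obtain Ct where Ct: "Ct \<ge> 0" "\<And>\<tau> y. \<tau>\<in>{0..T} \<Longrightarrow> y \<in> Rd d \<Longrightarrow> \<bar>wt \<tau> y\<bar> \<le> Ct" by blast
  have "\<forall>j\<in>{1..d}. \<exists>C\<ge>0. \<forall>\<tau>\<in>{0..T}. \<forall>y\<in>Rd d. \<bar>w1 j \<tau> y\<bar> \<le> C"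
    by (intro ballI bounded_if_vanishing[OF cont(3), of _ R]) (assumption | rule vanish(3))+
  from bchoice[OF this] obtain C1 where C1: "\<And>j. j \<in> {1..d} \<Longrightarrow> C1 j \<ge> 0"
      "\<And>j \<tau> y. j \<in> {1..d} \<Longrightarrow> \<tau>\<in>{0..T} \<Longrightarrow> y \<in> Rd d \<Longrightarrow> \<bar>w1 j \<tau> y\<bar> \<le> C1 j" by blast
  have "\<forall>j\<in>{1..d}. \<exists>C\<ge>0. \<forall>\<tau>\<in>{0..T}. \<forall>y\<in>Rd d. \<bar>w2 j \<tau> y\<bar> \<le> C"
    by (intro ballI bounded_if_vanishing[OF cont(4), of _ R]) (assumption | rule vanish(4))+
  from bchoice[OF this] obtain C2 where C2: "\<And>j. j \<in> {1..d} \<Longrightarrow> C2 j \<ge> 0"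
      "\<And>j \<tau> y. j \<in> {1..d} \<Longrightarrow> \<tau>\<in>{0..T} \<Longrightarrow> y \<in> Rd d \<Longrightarrow> \<bar>w2 j \<tau> y\<bar> \<le> C2 j" by blast
  define Q where "Q = 1 + R' / (\<sigma> * v0)"
  have Q: "Q \<ge> 0" unfolding Q_def using R'0 \<sigma> v0 by simp
  have q_le: "\<bar>q v z\<bar> \<le> Q" if v: "v \<in> {v0..1}" and z: "\<And>i. i \<in> {1..d} \<Longrightarrow> \<bar>z i\<bar> \<le> R'" for v z
  proof (cases "k = 0")
    case True then show ?thesis using R'0 \<sigma> v0 by (simp add: q_def one_scaled_def Q_def)
  next
    case False
    have "\<bar>q v z\<bar> = \<bar>z k\<bar> / (\<sigma> * v)" using False v v0 \<sigma> by (simp add: q_def one_scaled_def)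
    also have "\<dots> \<le> R' / (\<sigma> * v0)"
      using False k z[of k] v v0 \<sigma> R'0 by (intro frac_le mult_left_mono) auto
    finally show ?thesis by (simp add: Q_def)
  qed
  have dq_le: "\<bar>dq v z\<bar> \<le> R' / (\<sigma> * v0\<^sup>2)" if v: "v \<in> {v0..1}" and z: "\<And>i. i \<in> {1..d} \<Longrightarrow> \<bar>z i\<bar> \<le> R'" for v z
  proof (cases "k = 0")
    case True then show ?thesis using R'0 \<sigma> v0 by (simp add: dq_def)
  next
    case False
    have "\<bar>dq v z\<bar> = \<bar>z k\<bar> / (\<sigma> * v\<^sup>2)" using False \<sigma> by (simp add: dq_def abs_mult)
    also have "\<dots> \<le> R' / (\<sigma> * v0\<^sup>2)"
      using False k z[of k] v v0 \<sigma> R'0 by (intro frac_le mult_left_mono power_mono) auto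
    finally show ?thesis .
  qed
  define outside where "outside z \<longleftrightarrow> (\<exists>i\<in>{1..d}. \<bar>z i\<bar> > R')" for z :: "nat \<Rightarrow> real"
  have zero: "w (\<tau> v) (X v z) = 0" "wt (\<tau> v) (X v z) = 0"
      "\<And>j. j \<in> {1..d} \<Longrightarrow> w1 j (\<tau> v) (X v z) = 0" "\<And>j. j \<in> {1..d} \<Longrightarrow> w2 j (\<tau> v) (X v z) = 0"
    if v: "v \<in> {v0..1}" and z: "outside z" for v z
  proof -
    obtain i where i: "i \<in> {1..d}" "\<bar>z i\<bar> > R'" using z unfolding outside_def by blast
    note o = \<tau>[OF v] X[of v z] i(1) out[of v i z, OF v i]
    show "w (\<tau> v) (X v z) = 0" "wt (\<tau> v) (X v z) = 0"
      "\<And>j. j \<in> {1..d} \<Longrightarrow> w1 j (\<tau> v) (X v z) = 0" "\<And>j. j \<in> {1..d} \<Longrightarrow> w2 j (\<tau> v) (X v z) = 0"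
      by (rule vanish(1)[OF o] vanish(2)[OF o] vanish(3)[OF o] vanish(4)[OF o]; assumption?)+
  qed
  define CD where "CD = (2 * t * Ct + (\<Sum>j\<in>{1..d}. C1 j * (\<sigma> * R'))) * Q + Cw * (R' / (\<sigma> * v0\<^sup>2))"
  have CD0: "CD \<ge> 0" unfolding CD_def using Ct(1) C1(1) Cw(1) Q R'0 \<sigma> t v0
    by (auto intro!: add_nonneg_nonneg mult_nonneg_nonneg sum_nonneg)
  have D_le: "\<bar>D v z\<bar> \<le> CD" if v: "v \<in> {v0..1}" for v z
  proof (cases "outside z")
    case True
    have "D v z = 0" unfolding D_def using zero[OF v True] by simp
    then show ?thesis using CD0 by simp
  next
    case False
    then have z: "\<bar>z i\<bar> \<le> R'" if "i \<in> {1..d}" for i using that unfolding outside_def by (meson not_le)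
    have "\<bar>D v z\<bar> \<le> (\<bar>- 2 * t * v * wt (\<tau> v) (X v z)\<bar> + (\<Sum>j\<in>{1..d}. \<bar>w1 j (\<tau> v) (X v z) * (\<sigma> * z j)\<bar>)) * \<bar>q v z\<bar>
      + \<bar>w (\<tau> v) (X v z)\<bar> * \<bar>dq v z\<bar>"
      unfolding D_def
      by (rule order_trans[OF abs_triangle_ineq], unfold abs_mult[of _ "q v z"] abs_mult[of _ "dq v z"],
          intro add_mono mult_right_mono order_refl order_trans[OF abs_triangle_ineq] sum_abs) auto
    also have "\<dots> \<le> CD"
      unfolding CD_def
    proof (intro add_mono mult_mono sum_mono)
      have "2 * t * v * \<bar>wt (\<tau> v) (X v z)\<bar> \<le> (2 * t * 1) * Ct"
        using Ct(2)[OF \<tau>[OF v] X] t v v0 by (intro mult_mono) auto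
      then show "\<bar>- 2 * t * v * wt (\<tau> v) (X v z)\<bar> \<le> 2 * t * Ct"
        using t v v0 by (simp add: abs_mult)
      fix j assume j: "j \<in> {1..d}"
      show "\<bar>w1 j (\<tau> v) (X v z) * (\<sigma> * z j)\<bar> \<le> C1 j * (\<sigma> * R')"
        unfolding abs_mult using C1(2)[OF j \<tau>[OF v] X, of v z] C1(1)[OF j] z[OF j] \<sigma>
        by (intro mult_mono) auto
    qed (use q_le[OF v z] dq_le[OF v z] Cw(2)[OF \<tau>[OF v] X] Cw(1) Ct(1) C1(1) t \<sigma> R'0 in
        \<open>auto intro!: add_nonneg_nonneg sum_nonneg mult_nonneg_nonneg\<close>)
    finally show ?thesis .
  qed
  have meas: "(\<lambda>z. f (\<tau> v) (X v z)) \<in> borel_measurable ?\<gamma>"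
    if "continuous_time_space T d f" "v \<in> {v0..1}" for f v
  proof (rule measurable_time_space[OF that(1)])
    show "X v \<in> ?\<gamma> \<rightarrow>\<^sub>M borel_Rd d"
      unfolding X_def using x measurable_std_normal_Rd_ident
      by (intro measurable_add_scaled) (auto simp: space_PiM)
  qed (use \<tau>[OF that(2)] in auto)
  have meas_z: "(\<lambda>z. z j) \<in> borel_measurable ?\<gamma>" if "j \<in> {1..d}" for j
    using that by (intro measurable_compose[OF measurable_std_normal_Rd_ident]) simp
  have meas_q: "q v \<in> borel_measurable ?\<gamma>" for v
    unfolding q_def by (intro measurable_one_scaled[OF _ measurable_std_normal_Rd_ident k]) auto
  have int: "integrable ?\<gamma> (\<lambda>z. f (\<tau> v) (X v z) * b z)"
    if f: "continuous_time_space T d f" "\<And>\<tau> y. \<tau>\<in>{0..T} \<Longrightarrow> y \<in> Rd d \<Longrightarrow> \<bar>f \<tau> y\<bar> \<le> C"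
        "\<And>z. outside z \<Longrightarrow> f (\<tau> v) (X v z) = 0" and v: "v \<in> {v0..1}"
      and b: "b \<in> borel_measurable ?\<gamma>" "\<And>z. (\<And>i. i \<in> {1..d} \<Longrightarrow> \<bar>z i\<bar> \<le> R') \<Longrightarrow> \<bar>b z\<bar> \<le> B" for f b B C v
  proof (rule \<gamma>.integrable_const_bound[of _ "\<bar>C\<bar> * \<bar>B\<bar>"])
    show "AE z in ?\<gamma>. norm (f (\<tau> v) (X v z) * b z) \<le> \<bar>C\<bar> * \<bar>B\<bar>"
    proof (rule AE_I2)
      fix z
      show "norm (f (\<tau> v) (X v z) * b z) \<le> \<bar>C\<bar> * \<bar>B\<bar>"
      proof (cases "outside z")
        case False
        then have "\<bar>b z\<bar> \<le> B" unfolding outside_def by (intro b(2)) (meson not_le)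
        then show ?thesis using f(2)[OF \<tau>[OF v] X, of v z]
          unfolding real_norm_def abs_mult by (intro mult_mono) auto
      qed (simp add: f(3))
    qed
  qed (use meas[OF f(1) v] b(1) in measurable)
  let ?S = "{v0..1}"
  have \<tau>_cont: "continuous_on ?S \<tau>" unfolding \<tau>_def by (intro continuous_intros)
  have X_cont: "continuous_on ?S (\<lambda>v. X v z)" for z
  proof (rule continuous_on_coordinatewise_then_product)
    fix i show "continuous_on ?S (\<lambda>v. X v z i)"
      by (cases "i \<in> {1..d}") (auto simp: X_def add_scaled_def intro!: continuous_intros)
  qed
  have f_cont: "continuous_on ?S (\<lambda>v. f (\<tau> v) (X v z))" if "continuous_time_space T d f" for f z
    by (rule continuous_on_pair_compose[OF that[unfolded continuous_time_space_def] \<tau>_cont _ X_cont])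
      (intro image_subsetI \<tau> X; assumption)+
  have dq: "((\<lambda>v. q v z) has_real_derivative dq v z) (at v within ?S)" if "v \<in> ?S" for v z
  proof (cases "k = 0")
    case False
    have "((\<lambda>v. z k / (\<sigma> * v)) has_real_derivative - z k / (\<sigma> * v\<^sup>2)) (at v within ?S)"
      using that v0 \<sigma>(1) by (auto intro!: derivative_eq_intros simp: field_simps power2_eq_square)
    then show ?thesis using False by (simp add: q_def one_scaled_def dq_def)
  qed (simp add: q_def one_scaled_def dq_def)
  have deriv: "((\<lambda>v. w (\<tau> v) (X v z) * q v z) has_real_derivative D v z) (at v within ?S)"
    if v: "v \<in> ?S" for v z
  proof -
    have "((\<lambda>v. w (\<tau> v) (X v z)) has_real_derivative
        wt (\<tau> v) (X v z) * (- 2 * t * v) + (\<Sum>j\<in>{1..d}. w1 j (\<tau> v) (X v z) * (\<sigma> * z j))) (at v within ?S)"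
    proof (rule chain_rule_coordinates[OF dt d1 cont(3) v])
      show "(\<tau> has_real_derivative - 2 * t * v) (at v within ?S)"
        unfolding \<tau>_def by (auto intro!: derivative_eq_intros)
      show "\<tau> ` ?S \<subseteq> {0..T}" using \<tau> by blast
      show "continuous_on ?S \<tau>" by fact
      show "continuous_on ?S (\<lambda>v. X v z)" by (rule X_cont)
      show "X v z \<in> Rd d" for v by (rule X)
      fix j assume "j \<in> {1..d}"
      then show "((\<lambda>v. X v z j) has_real_derivative \<sigma> * z j) (at v within ?S)"
        unfolding X_def add_scaled_def by (auto intro!: derivative_eq_intros)
    qed
    from DERIV_mult[OF this dq[OF v, of z]] show ?thesis
      unfolding D_def by (rule DERIV_cong) (simp add: algebra_simps)
  qed
  have D_cont: "continuous_on ?S (\<lambda>v. D v z)" for z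
  proof -
    have "continuous_on ?S (\<lambda>v. q v z)"
      by (rule DERIV_continuous_on[OF dq])
    moreover have "continuous_on ?S (\<lambda>v. dq v z)"
      using v0 \<sigma>(1) unfolding dq_def by (cases "k = 0") (auto intro!: continuous_intros)
    ultimately show ?thesis
      unfolding D_def
      by (intro continuous_on_add continuous_on_mult continuous_on_sum continuous_on_const continuous_on_id
          f_cont[OF cont(1)] f_cont[OF cont(2)] f_cont[OF cont(3)])
  qed
  have ftc: "(\<integral>v. indicator ?S v * D v z \<partial>lborel) = w (\<tau> 1) (X 1 z) * q 1 z - w (\<tau> v0) (X v0 z) * q v0 z" for z
  proof -
    have "(\<integral>v. indicator ?S v *\<^sub>R D v z \<partial>lborel) = w (\<tau> 1) (X 1 z) * q 1 z - w (\<tau> v0) (X v0 z) * q v0 z"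
      by (rule integral_FTC_Icc[where F="\<lambda>v. w (\<tau> v) (X v z) * q v z"])
        (use v0 deriv D_cont in \<open>auto simp: has_real_derivative_iff_has_vector_derivative\<close>)
    then show ?thesis by simp
  qed
  \<comment> \<open>Clamping v to [v0, 1] keeps the time argument in [0, T] and makes the integrand
    jointly measurable on the whole line; the indicator hides the change.\<close>
  define c where "c v = max v0 (min 1 v)" for v
  have c: "c v \<in> ?S" for v using v0 by (auto simp: c_def)
  have [measurable]: "c \<in> borel_measurable borel" unfolding c_def by measurable
  have fm: "(\<lambda>p. f (\<tau> (c (fst p))) (X (c (fst p)) (snd p))) \<in> borel_measurable (lborel \<Otimes>\<^sub>M ?\<gamma>)"
    if "continuous_time_space T d f" for f
  proof (rule measurable_time_space[OF that])
    show "(\<lambda>p. \<tau> (c (fst p))) \<in> borel_measurable (lborel \<Otimes>\<^sub>M ?\<gamma>)" unfolding \<tau>_def by measurable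
    show "(\<lambda>p. X (c (fst p)) (snd p)) \<in> lborel \<Otimes>\<^sub>M ?\<gamma> \<rightarrow>\<^sub>M borel_Rd d"
      unfolding X_def using x measurable_compose[OF measurable_snd measurable_std_normal_Rd_ident]
      by (intro measurable_add_scaled) (auto simp: space_PiM)
  qed (use \<tau> c in auto)
  have zm: "(\<lambda>p. snd p j) \<in> borel_measurable (lborel \<Otimes>\<^sub>M ?\<gamma>)" if "j \<in> {1..d}" for j
    by (rule measurable_compose[OF measurable_snd meas_z[OF that]])
  have qm: "(\<lambda>p. q (c (fst p)) (snd p)) \<in> borel_measurable (lborel \<Otimes>\<^sub>M ?\<gamma>)"
    unfolding q_def
    by (intro measurable_one_scaled[OF _ measurable_compose[OF measurable_snd measurable_std_normal_Rd_ident] k]) auto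
  have dqm: "(\<lambda>p. dq (c (fst p)) (snd p)) \<in> borel_measurable (lborel \<Otimes>\<^sub>M ?\<gamma>)"
  proof (cases "k = 0")
    case False
    then have [measurable]: "(\<lambda>p. snd p k) \<in> borel_measurable (lborel \<Otimes>\<^sub>M ?\<gamma>)" using k by (intro zm) auto
    show ?thesis using False unfolding dq_def by simp
  qed (simp add: dq_def)
  have cm: "(\<lambda>p. c (fst p)) \<in> borel_measurable (lborel \<Otimes>\<^sub>M ?\<gamma>)" by measurable
  have Dm: "(\<lambda>p. indicator ?S (fst p) * D (c (fst p)) (snd p)) \<in> borel_measurable (lborel \<Otimes>\<^sub>M ?\<gamma>)"
    unfolding D_def
    by (intro borel_measurable_times borel_measurable_add borel_measurable_sum borel_measurable_const
        fm[OF cont(1)] fm[OF cont(2)] fm[OF cont(3)] qm dqm zm cm) auto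
  have ind_eq: "indicator ?S v * D (c v) z = indicator ?S v * D v z" for v z
    by (auto simp: indicator_def c_def)
  have "integrable (lborel \<Otimes>\<^sub>M ?\<gamma>) (\<lambda>p. indicator ?S (fst p) * D (c (fst p)) (snd p))"
  proof (rule integrableI_bounded_set[where A="?S \<times> space ?\<gamma>" and B="CD"])
    show "emeasure (lborel \<Otimes>\<^sub>M ?\<gamma>) (?S \<times> space ?\<gamma>) < \<infinity>"
      using v0 by (subst \<gamma>.emeasure_pair_measure_Times) (auto simp: \<gamma>.emeasure_space_1)
    show "AE p\<in>?S \<times> space ?\<gamma> in lborel \<Otimes>\<^sub>M ?\<gamma>. norm (indicator ?S (fst p) * D (c (fst p)) (snd p)) \<le> CD"
      using D_le[OF c] CD0 by (intro AE_I2) (auto simp: indicator_def)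
    show "AE p in lborel \<Otimes>\<^sub>M ?\<gamma>. p \<notin> ?S \<times> space ?\<gamma> \<longrightarrow> indicator ?S (fst p) * D (c (fst p)) (snd p) = 0"
      by (intro AE_I2) (auto simp: space_pair_measure indicator_def)
  qed (use Dm in auto)
  then have "integrable (lborel \<Otimes>\<^sub>M ?\<gamma>) (\<lambda>(v, z). indicator ?S v * D v z)"
    by (simp add: case_prod_unfold ind_eq)
  from pair.Fubini_integral[OF this]
  have fub: "(\<integral>z. (\<integral>v. indicator ?S v * D v z \<partial>lborel) \<partial>?\<gamma>) = (\<integral>v. indicator ?S v * (\<integral>z. D v z \<partial>?\<gamma>) \<partial>lborel)"
    by simp
  have coord: "\<bar>z i\<bar> \<le> R'" if "\<And>i. i \<in> {1..d} \<Longrightarrow> \<bar>z i\<bar> \<le> R'" "i \<in> {1..d}" for z :: "nat \<Rightarrow> real" and i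
    using that by blast
  have intF: "integrable ?\<gamma> (\<lambda>z. w (\<tau> v) (X v z) * q v z)" if v: "v \<in> ?S" for v
    by (rule int[OF cont(1) Cw(2) zero(1)[OF v] v meas_q q_le[OF v]])
  have X_upd: "X v (z(j := s)) = (X v z)(j := x j + \<sigma> * v * s)" if "j \<in> {1..d}" for v z j s
    using that by (auto simp: X_def add_scaled_def)
  have q_upd: "((\<lambda>s. q v (z(j := s))) has_real_derivative (if j = k then 1 / (\<sigma> * v) else 0)) (at y)"
    if "j \<in> {1..d}" "v \<in> ?S" for v z j y
    using that v0 \<sigma>(1) by (cases "k = 0"; cases "j = k") (auto simp: q_def one_scaled_def intro!: derivative_eq_intros)
  have X_upd_cont: "continuous_on UNIV (\<lambda>y. f (\<tau> v) (X v (z(j := y))))"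
    if "continuous_time_space T d f" "v \<in> ?S" for f v z j
  proof (rule continuous_on_pair_compose[OF that(1)[unfolded continuous_time_space_def]])
    show "continuous_on UNIV (\<lambda>y. X v (z(j := y)))"
    proof (rule continuous_on_coordinatewise_then_product)
      fix i show "continuous_on UNIV (\<lambda>y. X v (z(j := y)) i)"
        by (cases "i \<in> {1..d}"; cases "i = j") (auto simp: X_def add_scaled_def intro!: continuous_intros)
    qed
    show "(\<lambda>y. X v (z(j := y))) ` UNIV \<subseteq> Rd d" by (intro image_subsetI X)
  qed (use \<tau>[OF that(2)] in auto)
  have inner_wk: "(\<integral>z. w (\<tau> v) (X v z) * q v z \<partial>?\<gamma>) = (\<integral>z. (if k = 0 then w else w1 k) (\<tau> v) (X v z) \<partial>?\<gamma>)"
    and inner: "(\<integral>z. D v z \<partial>?\<gamma>) = (\<integral>z. 2 * t * v * ((\<Sum>j\<in>{1..d}. w2 j (\<tau> v) (X v z)) - wt (\<tau> v) (X v z)) * q v z \<partial>?\<gamma>)"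
    if v: "v \<in> ?S" for v
  proof -
    have vpos: "v > 0" using v v0 by simp
    have zq: "\<bar>q v z * z j\<bar> \<le> Q * R'" if "\<And>i. i \<in> {1..d} \<Longrightarrow> \<bar>z i\<bar> \<le> R'" "j \<in> {1..d}" for z j
      unfolding abs_mult using q_le[OF v that(1)] coord[OF that] Q R'0 by (intro mult_mono) auto
    have i1: "integrable ?\<gamma> (\<lambda>z. w1 j (\<tau> v) (X v z) * (q v z * z j))" if j: "j \<in> {1..d}" for j
      by (rule int[OF cont(3)[OF j] C1(2)[OF j] zero(3)[OF v _ j] v _ zq])
        (use meas_q meas_z j in auto)
    have i1': "integrable ?\<gamma> (\<lambda>z. w1 j (\<tau> v) (X v z) * b)" if j: "j \<in> {1..d}" for j b
      by (rule int[OF cont(3)[OF j] C1(2)[OF j] zero(3)[OF v _ j] v _ order_refl]) auto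
    have i2: "integrable ?\<gamma> (\<lambda>z. w2 j (\<tau> v) (X v z) * q v z)" if j: "j \<in> {1..d}" for j
      by (rule int[OF cont(4)[OF j] C2(2)[OF j] zero(4)[OF v _ j] v meas_q q_le[OF v]])
    have it: "integrable ?\<gamma> (\<lambda>z. wt (\<tau> v) (X v z) * q v z)"
      by (rule int[OF cont(2) Ct(2) zero(2)[OF v] v meas_q q_le[OF v]])
    have iz: "integrable ?\<gamma> (\<lambda>z. w (\<tau> v) (X v z) * z j)" if j: "j \<in> {1..d}" for j
      using j by (intro int[OF cont(1) Cw(2) zero(1)[OF v] v meas_z[OF j], of R']) blast
    have dqmv: "dq v \<in> borel_measurable ?\<gamma>"
      using meas_z[of k] k unfolding dq_def by (cases "k = 0") auto
    have id: "integrable ?\<gamma> (\<lambda>z. w (\<tau> v) (X v z) * dq v z)"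
      by (rule int[OF cont(1) Cw(2) zero(1)[OF v] v dqmv dq_le[OF v]])
    \<comment> \<open>The factor z j multiplies w1 times q, and integrating by parts differentiates
      both: the first factor gives the second derivative of w, the second an extra term with w1 k if
      j = k.\<close>
    have S1: "(\<integral>z. (w1 j (\<tau> v) (X v z) * q v z) * z j \<partial>?\<gamma>)
        = (\<integral>z. \<sigma> * v * (w2 j (\<tau> v) (X v z) * q v z) + w1 j (\<tau> v) (X v z) * (if j = k then 1 / (\<sigma> * v) else 0) \<partial>?\<gamma>)"
      if j: "j \<in> {1..d}" for j
    proof (rule stein[OF j, where B="R' + 1"])
      fix z y assume z: "z \<in> Rd d"
      have *: "((\<lambda>s. w1 j (\<tau> v) ((X v z)(j := x j + \<sigma> * v * s))) has_real_derivative
          w2 j (\<tau> v) ((X v z)(j := x j + \<sigma> * v * y)) * (\<sigma> * v)) (at y)"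
        by (rule DERIV_chain2[OF d2[OF \<tau>[OF v] X j]]) (auto intro!: derivative_eq_intros)
      show "((\<lambda>s. w1 j (\<tau> v) (X v (z(j := s))) * q v (z(j := s))) has_real_derivative
          \<sigma> * v * (w2 j (\<tau> v) (X v (z(j := y))) * q v (z(j := y)))
          + w1 j (\<tau> v) (X v (z(j := y))) * (if j = k then 1 / (\<sigma> * v) else 0)) (at y)"
        using DERIV_mult[OF * q_upd[OF j v]] unfolding X_upd[OF j]
        by (rule DERIV_cong) (simp add: algebra_simps)
    next
      fix z assume z: "z \<in> Rd d"
      show "continuous_on UNIV (\<lambda>y. \<sigma> * v * (w2 j (\<tau> v) (X v (z(j := y))) * q v (z(j := y)))
          + w1 j (\<tau> v) (X v (z(j := y))) * (if j = k then 1 / (\<sigma> * v) else 0))"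
        by (intro continuous_on_add continuous_on_mult continuous_on_const X_upd_cont[OF _ v] cont j
            DERIV_continuous_on[OF has_field_derivative_at_within[OF q_upd[OF j v]]])
      show "w1 j (\<tau> v) (X v z) * q v z = 0" if "R' + 1 \<le> \<bar>z j\<bar>"
        using zero(3)[OF v _ j, of z] that j unfolding outside_def by force
    next
      show "integrable ?\<gamma> (\<lambda>z. w1 j (\<tau> v) (X v z) * q v z * z j)"
        using i1[OF j] by (simp add: mult.assoc)
      show "integrable ?\<gamma> (\<lambda>z. \<sigma> * v * (w2 j (\<tau> v) (X v z) * q v z)
          + w1 j (\<tau> v) (X v z) * (if j = k then 1 / (\<sigma> * v) else 0))"
        by (rule Bochner_Integration.integrable_add[OF integrable_mult_right[OF i2[OF j]] i1'[OF j]])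
    qed
    have S1': "\<sigma> * (\<integral>z. w1 j (\<tau> v) (X v z) * (q v z * z j) \<partial>?\<gamma>) = 2 * t * v * (\<integral>z. w2 j (\<tau> v) (X v z) * q v z \<partial>?\<gamma>)
        + (if j = k then (\<integral>z. w1 k (\<tau> v) (X v z) \<partial>?\<gamma>) / v else 0)" if j: "j \<in> {1..d}" for j
    proof -
      have "(\<integral>z. w1 j (\<tau> v) (X v z) * (q v z * z j) \<partial>?\<gamma>) =
          \<sigma> * v * (\<integral>z. w2 j (\<tau> v) (X v z) * q v z \<partial>?\<gamma>)
          + (\<integral>z. w1 j (\<tau> v) (X v z) * (if j = k then 1 / (\<sigma> * v) else 0) \<partial>?\<gamma>)"
        using S1[OF j] Bochner_Integration.integral_add[OF integrable_mult_right[OF i2[OF j], of "\<sigma> * v"] i1'[OF j]]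
        by (simp add: mult.assoc)
      then show ?thesis
        using \<sigma> vpos by (auto simp: distrib_left mult.assoc[symmetric])
    qed
    \<comment> \<open>Integration by parts against the weight itself. The first equation turns the
      weight into a derivative in coordinate k. The second is the negative of the extra term for j =
      k, so the two cancel in the integral of D and only the heat operator remains.\<close>
    have S2': "(\<integral>z. w (\<tau> v) (X v z) * q v z \<partial>?\<gamma>) = (\<integral>z. (if k = 0 then w else w1 k) (\<tau> v) (X v z) \<partial>?\<gamma>)"
      and S2: "(\<integral>z. w (\<tau> v) (X v z) * dq v z \<partial>?\<gamma>) = - (if k = 0 then 0 else (\<integral>z. w1 k (\<tau> v) (X v z) \<partial>?\<gamma>) / v)"
    proof -
      have *: "(\<integral>z. w (\<tau> v) (X v z) * z k \<partial>?\<gamma>) = (\<integral>z. w1 k (\<tau> v) (X v z) \<partial>?\<gamma>) * (\<sigma> * v)" if "k \<noteq> 0"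
      proof -
      have k': "k \<in> {1..d}" using k that by simp
      have "(\<integral>z. w (\<tau> v) (X v z) * z k \<partial>?\<gamma>) = (\<integral>z. w1 k (\<tau> v) (X v z) * (\<sigma> * v) \<partial>?\<gamma>)"
      proof (rule stein[OF k', where B="R' + 1"])
        fix z y assume z: "z \<in> Rd d"
        show "((\<lambda>s. w (\<tau> v) (X v (z(k := s)))) has_real_derivative w1 k (\<tau> v) (X v (z(k := y))) * (\<sigma> * v)) (at y)"
          unfolding X_upd[OF k'] by (rule DERIV_chain2[OF d1[OF \<tau>[OF v] X k']]) (auto intro!: derivative_eq_intros)
      next
        fix z assume z: "z \<in> Rd d"
        show "continuous_on UNIV (\<lambda>y. w1 k (\<tau> v) (X v (z(k := y))) * (\<sigma> * v))"
          by (intro continuous_on_mult continuous_on_const X_upd_cont[OF _ v] cont k')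
        show "w (\<tau> v) (X v z) = 0" if "R' + 1 \<le> \<bar>z k\<bar>"
          using zero(1)[OF v, of z] that k' unfolding outside_def by force
      qed (rule iz[OF k'] i1'[OF k'])+
      then show ?thesis by simp
      qed
      have "(\<integral>z. w (\<tau> v) (X v z) * q v z \<partial>?\<gamma>) = (\<integral>z. (w (\<tau> v) (X v z) * z k) * (1 / (\<sigma> * v)) \<partial>?\<gamma>)" if "k \<noteq> 0"
        using that by (simp add: q_def one_scaled_def)
      then show "(\<integral>z. w (\<tau> v) (X v z) * q v z \<partial>?\<gamma>) = (\<integral>z. (if k = 0 then w else w1 k) (\<tau> v) (X v z) \<partial>?\<gamma>)"
        using * \<sigma>(1) vpos by (cases "k = 0") (simp_all add: q_def one_scaled_def)
      have "(\<integral>z. w (\<tau> v) (X v z) * dq v z \<partial>?\<gamma>) = (\<integral>z. (w (\<tau> v) (X v z) * z k) * (- 1 / (\<sigma> * v\<^sup>2)) \<partial>?\<gamma>)" if "k \<noteq> 0"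
        using that by (simp add: dq_def)
      then show "(\<integral>z. w (\<tau> v) (X v z) * dq v z \<partial>?\<gamma>) = - (if k = 0 then 0 else (\<integral>z. w1 k (\<tau> v) (X v z) \<partial>?\<gamma>) / v)"
        using * \<sigma>(1) vpos by (cases "k = 0") (simp_all add: dq_def power2_eq_square)
    qed
    have lin: "(\<integral>z. a * A z + (\<Sum>j\<in>{1..d}. b * F j z) + h z \<partial>?\<gamma>)
        = a * (\<integral>z. A z \<partial>?\<gamma>) + (\<Sum>j\<in>{1..d}. b * (\<integral>z. F j z \<partial>?\<gamma>)) + (\<integral>z. h z \<partial>?\<gamma>)"
      if "integrable ?\<gamma> A" "\<And>j. j \<in> {1..d} \<Longrightarrow> integrable ?\<gamma> (F j)" "integrable ?\<gamma> h"
      for a b :: real and A F h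
    proof -
      have "integrable ?\<gamma> (\<lambda>z. \<Sum>j\<in>{1..d}. b * F j z)"
        by (intro Bochner_Integration.integrable_sum integrable_mult_right that)
      moreover have "integrable ?\<gamma> (\<lambda>z. a * A z)" using that by simp
      moreover have "(\<integral>z. (\<Sum>j\<in>{1..d}. b * F j z) \<partial>?\<gamma>) = (\<Sum>j\<in>{1..d}. b * (\<integral>z. F j z \<partial>?\<gamma>))"
        by (subst Bochner_Integration.integral_sum) (use that in auto)
      ultimately show ?thesis
        using that(3) by (simp only: Bochner_Integration.integral_add Bochner_Integration.integrable_add integral_mult_right_zero)
    qed
    have "(\<integral>z. D v z \<partial>?\<gamma>) = (\<integral>z. - 2 * t * v * (wt (\<tau> v) (X v z) * q v z)
        + (\<Sum>j\<in>{1..d}. \<sigma> * (w1 j (\<tau> v) (X v z) * (q v z * z j))) + w (\<tau> v) (X v z) * dq v z \<partial>?\<gamma>)"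
      unfolding D_def by (intro Bochner_Integration.integral_cong) (auto simp: algebra_simps sum_distrib_left sum_distrib_right)
    also have "\<dots> = - 2 * t * v * (\<integral>z. wt (\<tau> v) (X v z) * q v z \<partial>?\<gamma>)
        + (\<Sum>j\<in>{1..d}. \<sigma> * (\<integral>z. w1 j (\<tau> v) (X v z) * (q v z * z j) \<partial>?\<gamma>)) + (\<integral>z. w (\<tau> v) (X v z) * dq v z \<partial>?\<gamma>)"
      by (rule lin[OF it i1 id])
    also have "(\<Sum>j\<in>{1..d}. \<sigma> * (\<integral>z. w1 j (\<tau> v) (X v z) * (q v z * z j) \<partial>?\<gamma>))
        = (\<Sum>j\<in>{1..d}. 2 * t * v * (\<integral>z. w2 j (\<tau> v) (X v z) * q v z \<partial>?\<gamma>))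
          + (\<Sum>j\<in>{1..d}. if j = k then (\<integral>z. w1 k (\<tau> v) (X v z) \<partial>?\<gamma>) / v else 0)"
      unfolding sum.distrib[symmetric] by (intro sum.cong refl S1')
    also have "(\<Sum>j\<in>{1..d}. if j = k then (\<integral>z. w1 k (\<tau> v) (X v z) \<partial>?\<gamma>) / v else 0)
        = (if k = 0 then 0 else (\<integral>z. w1 k (\<tau> v) (X v z) \<partial>?\<gamma>) / v)"
      using k by (cases "k = 0") simp_all
    finally have "(\<integral>z. D v z \<partial>?\<gamma>) = - 2 * t * v * (\<integral>z. wt (\<tau> v) (X v z) * q v z \<partial>?\<gamma>)
        + (\<Sum>j\<in>{1..d}. 2 * t * v * (\<integral>z. w2 j (\<tau> v) (X v z) * q v z \<partial>?\<gamma>))"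
      unfolding S2 by simp
    also have "\<dots> = (\<integral>z. - 2 * t * v * (wt (\<tau> v) (X v z) * q v z)
        + (\<Sum>j\<in>{1..d}. 2 * t * v * (w2 j (\<tau> v) (X v z) * q v z)) \<partial>?\<gamma>)"
    proof -
      have "(\<integral>z. - 2 * t * v * (wt (\<tau> v) (X v z) * q v z)
        + (\<Sum>j\<in>{1..d}. 2 * t * v * (w2 j (\<tau> v) (X v z) * q v z)) + 0 \<partial>?\<gamma>)
        = - 2 * t * v * (\<integral>z. wt (\<tau> v) (X v z) * q v z \<partial>?\<gamma>)
        + (\<Sum>j\<in>{1..d}. 2 * t * v * (\<integral>z. w2 j (\<tau> v) (X v z) * q v z \<partial>?\<gamma>)) + (\<integral>z. 0 \<partial>?\<gamma>)"
        by (rule lin[OF it i2]) auto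
      then show ?thesis by simp
    qed
    also have "\<dots> = (\<integral>z. 2 * t * v * ((\<Sum>j\<in>{1..d}. w2 j (\<tau> v) (X v z)) - wt (\<tau> v) (X v z)) * q v z \<partial>?\<gamma>)"
      by (intro Bochner_Integration.integral_cong) (auto simp: algebra_simps sum_distrib_left sum_distrib_right)
    finally show "(\<integral>z. D v z \<partial>?\<gamma>) = (\<integral>z. 2 * t * v * ((\<Sum>j\<in>{1..d}. w2 j (\<tau> v) (X v z)) - wt (\<tau> v) (X v z)) * q v z \<partial>?\<gamma>)" .
    show "(\<integral>z. w (\<tau> v) (X v z) * q v z \<partial>?\<gamma>) = (\<integral>z. (if k = 0 then w else w1 k) (\<tau> v) (X v z) \<partial>?\<gamma>)"
      by (rule S2')
  qed
  have v0S: "v0 \<in> ?S" using v0 by simp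
  \<comment> \<open>At v = 1 the path has reached time 0 with the full Gaussian displacement. At v0
    the weighted integral is rewritten by \<open>inner_wk\<close> as one of w or of its k-th
    derivative.\<close>
  have "(\<integral>z. w (\<tau> 1) (X 1 z) * q 1 z \<partial>?\<gamma>) - (\<integral>z. w (\<tau> v0) (X v0 z) * q v0 z \<partial>?\<gamma>)
      = (\<integral>z. (\<integral>v. indicator ?S v * D v z \<partial>lborel) \<partial>?\<gamma>)"
    unfolding ftc using v0 by (intro Bochner_Integration.integral_diff[symmetric] intF) auto
  also have "\<dots> = (\<integral>v. indicator ?S v * (\<integral>z. 2 * t * v * ((\<Sum>j\<in>{1..d}. w2 j (\<tau> v) (X v z)) - wt (\<tau> v) (X v z)) * q v z \<partial>?\<gamma>) \<partial>lborel)"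
    unfolding fub by (intro Bochner_Integration.integral_cong refl) (auto simp: indicator_def inner)
  finally show ?thesis
    unfolding inner_wk[OF v0S] unfolding \<tau>_def X_def q_def \<sigma>_def by simp
qed

section \<open>Gaussian moments and cutoff functions\<close>

lemma distr_std_normal_coordinate:
  assumes "j \<in> {1..d}"
  shows "distr (std_normal_Rd d) borel (\<lambda>z. z j) = std_normal"
proof -
  have "distr (std_normal_Rd d) std_normal (\<lambda>z. z j) = std_normal"
    unfolding std_normal_Rd_def using assms prob_space_std_normal
    by (intro distr_PiM_component) auto
  then show ?thesis by (simp cong: distr_cong)
qed

lemma measurable_std_normal_coordinate:
  "j \<in> {1..d} \<Longrightarrow> (\<lambda>z. z j) \<in> borel_measurable (std_normal_Rd d)"
  by (intro measurable_compose[OF measurable_std_normal_Rd_ident]) simp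

lemma
  assumes j: "j \<in> {1..d}" and h[measurable]: "h \<in> borel_measurable borel"
  shows integral_std_normal_coordinate: "(\<integral>z. h (z j) \<partial>std_normal_Rd d) = (\<integral>y. std_normal_density y * h y \<partial>lborel)"
    and integrable_std_normal_coordinate: "integrable (std_normal_Rd d) (\<lambda>z. h (z j)) \<longleftrightarrow> integrable lborel (\<lambda>y. std_normal_density y * h y)"
proof -
  have "(\<integral>z. h (z j) \<partial>std_normal_Rd d) = (\<integral>y. h y \<partial>std_normal)"
    using integral_distr[OF measurable_std_normal_coordinate[OF j], of h] by (simp add: distr_std_normal_coordinate[OF j])
  then show "(\<integral>z. h (z j) \<partial>std_normal_Rd d) = (\<integral>y. std_normal_density y * h y \<partial>lborel)"
    by (simp add: integral_density)
  have "integrable (std_normal_Rd d) (\<lambda>z. h (z j)) \<longleftrightarrow> integrable std_normal h"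
    using integrable_distr_eq[OF measurable_std_normal_coordinate[OF j], of h] by (simp add: distr_std_normal_coordinate[OF j])
  then show "integrable (std_normal_Rd d) (\<lambda>z. h (z j)) \<longleftrightarrow> integrable lborel (\<lambda>y. std_normal_density y * h y)"
    by (simp add: integrable_density)
qed

text \<open>Fourth moments enter because second moments of gradient components contain z_k^2 times
  quantities that grow quadratically in z.\<close>

lemma std_normal_coordinate_moments:
  assumes j: "j \<in> {1..d}"
  shows "(\<integral>z. z j \<partial>std_normal_Rd d) = 0" "integrable (std_normal_Rd d) (\<lambda>z. z j)"
    and "(\<integral>z. (z j)\<^sup>2 \<partial>std_normal_Rd d) = 1" "integrable (std_normal_Rd d) (\<lambda>z. (z j)\<^sup>2)"
    and "(\<integral>z. (z j)^4 \<partial>std_normal_Rd d) = 3" "integrable (std_normal_Rd d) (\<lambda>z. (z j)^4)"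
proof -
  have f4: "fact 4 = (24::real)" by (simp add: fact_numeral)
  show "(\<integral>z. z j \<partial>std_normal_Rd d) = 0" "integrable (std_normal_Rd d) (\<lambda>z. z j)"
    using std_normal_moment_odd[of 0] integral_std_normal_coordinate[OF j, of "\<lambda>y. y"]
      integrable_std_normal_coordinate[OF j, of "\<lambda>y. y"] by (auto simp: has_bochner_integral_iff)
  show "(\<integral>z. (z j)\<^sup>2 \<partial>std_normal_Rd d) = 1" "integrable (std_normal_Rd d) (\<lambda>z. (z j)\<^sup>2)"
    using std_normal_moment_even[of 1] integral_std_normal_coordinate[OF j, of "\<lambda>y. y\<^sup>2"]
      integrable_std_normal_coordinate[OF j, of "\<lambda>y. y\<^sup>2"] by (auto simp: has_bochner_integral_iff)
  show "(\<integral>z. (z j)^4 \<partial>std_normal_Rd d) = 3" "integrable (std_normal_Rd d) (\<lambda>z. (z j)^4)"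
    using std_normal_moment_even[of 2] integral_std_normal_coordinate[OF j, of "\<lambda>y. y^4"]
      integrable_std_normal_coordinate[OF j, of "\<lambda>y. y^4"] f4 by (auto simp: has_bochner_integral_iff)
qed

lemma sum_square_le:
  fixes a :: "'i \<Rightarrow> real"
  assumes "finite I"
  shows "(\<Sum>i\<in>I. a i)\<^sup>2 \<le> real (card I) * (\<Sum>i\<in>I. (a i)\<^sup>2)"
  using L2_set_mult_ineq_lemma[of 0] Cauchy_Schwarz_ineq_sum[of "\<lambda>_. 1" a I] assms by simp

text \<open>The majorant for the limit passage in the representation: one linear factor comes from
  the growth of u and of the nonlinearity, the other from the weight of a gradient
  component.\<close>

lemma integrable_std_normal_linear_square:
  "integrable (std_normal_Rd d) (\<lambda>z. (1 + (\<Sum>i\<in>{1..d}. \<bar>z i\<bar>))\<^sup>2)"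
proof -
  interpret prob_space "std_normal_Rd d" by (rule prob_space_std_normal_Rd)
  show ?thesis
  proof (rule Bochner_Integration.integrable_bound)
    show "integrable (std_normal_Rd d) (\<lambda>z. 2 + 2 * (real d * (\<Sum>i\<in>{1..d}. (z i)\<^sup>2)))"
      by (intro Bochner_Integration.integrable_add Bochner_Integration.integrable_sum integrable_mult_right
          std_normal_coordinate_moments) auto
    show "(\<lambda>z. (1 + (\<Sum>i\<in>{1..d}. \<bar>z i\<bar>))\<^sup>2) \<in> borel_measurable (std_normal_Rd d)"
      by (intro borel_measurable_power borel_measurable_add borel_measurable_sum borel_measurable_abs
          measurable_std_normal_coordinate) auto
    show "AE z in std_normal_Rd d. norm ((1 + (\<Sum>i\<in>{1..d}. \<bar>z i\<bar>))\<^sup>2) \<le> norm (2 + 2 * (real d * (\<Sum>i\<in>{1..d}. (z i)\<^sup>2)))"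
    proof (rule AE_I2)
      fix z :: "nat \<Rightarrow> real"
      have "(1 + (\<Sum>i\<in>{1..d}. \<bar>z i\<bar>))\<^sup>2 \<le> 2 + 2 * (\<Sum>i\<in>{1..d}. \<bar>z i\<bar>)\<^sup>2"
        using zero_le_power2[of "1 - (\<Sum>i\<in>{1..d}. \<bar>z i\<bar>)"] by (simp add: power2_eq_square algebra_simps)
      also have "(\<Sum>i\<in>{1..d}. \<bar>z i\<bar>)\<^sup>2 \<le> real d * (\<Sum>i\<in>{1..d}. (z i)\<^sup>2)"
        using sum_square_le[of "{1..d}" "\<lambda>i. \<bar>z i\<bar>"] by simp
      finally show "norm ((1 + (\<Sum>i\<in>{1..d}. \<bar>z i\<bar>))\<^sup>2) \<le> norm (2 + 2 * (real d * (\<Sum>i\<in>{1..d}. (z i)\<^sup>2)))"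
        by simp
    qed
  qed
qed

section \<open>A twice differentiable cutoff and the size of its derivatives\<close>

lemma DERIV_positive_part_power:
  "((\<lambda>y::real. (max 0 y) ^ (n + 2)) has_real_derivative real (n + 2) * (max 0 y) ^ (n + 1)) (at y)"
proof -
  consider "y > 0" | "y < 0" | "y = 0" by linarith
  then show ?thesis
  proof cases
    case 1
    have "((\<lambda>y::real. y ^ (n + 2)) has_real_derivative real (n + 2) * y ^ (n + 1)) (at y)"
      using DERIV_pow[of "n + 2" y] by simp
    then have "((\<lambda>y::real. (max 0 y) ^ (n + 2)) has_real_derivative real (n + 2) * y ^ (n + 1)) (at y)"
      by (rule has_field_derivative_transform_within_open[where S="{0<..}"]) (use 1 in auto)
    then show ?thesis using 1 by simp
  next
    case 2
    have "((\<lambda>y::real. 0) has_real_derivative 0) (at y)" by simp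
    then have "((\<lambda>y::real. (max 0 y) ^ (n + 2)) has_real_derivative 0) (at y)"
      by (rule has_field_derivative_transform_within_open[where S="{..<0}"]) (use 2 in auto)
    then show ?thesis using 2 by simp
  next
    case 3
    \<comment> \<open>At 0 the function vanishes to order at least 2, so the difference quotient is
      at most |h|^(n + 1).\<close>
    have "((\<lambda>h::real. (max 0 h) ^ (n + 2) / h) \<longlongrightarrow> 0) (at 0)"
    proof (rule Lim_null_comparison)
      show "((\<lambda>h::real. \<bar>h\<bar> ^ (n + 1)) \<longlongrightarrow> 0) (at 0)"
        by (rule tendsto_eq_intros refl)+ simp
      have "norm ((max 0 h) ^ (n + 2) / h) \<le> \<bar>h\<bar> ^ (n + 1)" for h :: real
      proof (cases "h > 0")
        case False
        then have "norm ((max 0 h) ^ (n + 2) / h) = 0" by simp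
        also have "0 \<le> \<bar>h\<bar> ^ (n + 1)" by (rule zero_le_power) simp
        finally show ?thesis .
      qed simp
      then show "\<forall>\<^sub>F h in at 0. norm ((max 0 h) ^ (n + 2) / h) \<le> \<bar>h\<bar> ^ (n + 1)"
        by simp
    qed
    then show ?thesis using 3 by (simp add: DERIV_def)
  qed
qed

definition norm2 :: "nat \<Rightarrow> (nat \<Rightarrow> real) \<Rightarrow> real" where
  "norm2 d y = (\<Sum>i\<in>{1..d}. (y i)\<^sup>2)"

text \<open>The third power is the smallest integer power of the positive part that is twice
  continuously differentiable, as the heat identity requires. For R > 0 the support is the Euclidean
  ball of radius R.\<close>

definition cutoff :: "nat \<Rightarrow> real \<Rightarrow> (nat \<Rightarrow> real) \<Rightarrow> real" where
  "cutoff d R y = (max 0 (1 - norm2 d y / R\<^sup>2)) ^ 3"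

definition cutoff_partial :: "nat \<Rightarrow> real \<Rightarrow> nat \<Rightarrow> (nat \<Rightarrow> real) \<Rightarrow> real" where
  "cutoff_partial d R j y = - 3 * (max 0 (1 - norm2 d y / R\<^sup>2))\<^sup>2 * (2 * y j / R\<^sup>2)"

definition cutoff_partial2 :: "nat \<Rightarrow> real \<Rightarrow> nat \<Rightarrow> (nat \<Rightarrow> real) \<Rightarrow> real" where
  "cutoff_partial2 d R j y = 6 * max 0 (1 - norm2 d y / R\<^sup>2) * (2 * y j / R\<^sup>2)\<^sup>2
     - 3 * (max 0 (1 - norm2 d y / R\<^sup>2))\<^sup>2 * (2 / R\<^sup>2)"

lemma norm2_nonneg: "norm2 d y \<ge> 0"
  unfolding norm2_def by (intro sum_nonneg) auto

lemma DERIV_norm2: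
  assumes j: "j \<in> {1..d}"
  shows "((\<lambda>s. norm2 d (y(j := s))) has_real_derivative 2 * s) (at s)"
proof -
  have "norm2 d (y(j := s)) = s\<^sup>2 + (\<Sum>i\<in>{1..d} - {j}. (y i)\<^sup>2)" for s
    unfolding norm2_def using j by (subst sum.remove[of _ j]) (auto intro!: sum.cong)
  then show ?thesis by (auto intro!: derivative_eq_intros)
qed

lemma DERIV_cutoff:
  assumes j: "j \<in> {1..d}" and R: "R > 0"
  shows "((\<lambda>s. cutoff d R (y(j := s))) has_real_derivative cutoff_partial d R j (y(j := s))) (at s)"
    and "((\<lambda>s. cutoff_partial d R j (y(j := s))) has_real_derivative cutoff_partial2 d R j (y(j := s))) (at s)"
proof -
  have n: "((\<lambda>s. 1 - norm2 d (y(j := s)) / R\<^sup>2) has_real_derivative - (2 * s / R\<^sup>2)) (at s)" for s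
    using DERIV_diff[OF DERIV_const DERIV_cdivide[OF DERIV_norm2[OF j]], of 1 y "R\<^sup>2" s] by simp
  have p3: "((\<lambda>s. (max 0 (1 - norm2 d (y(j := s)) / R\<^sup>2)) ^ 3) has_real_derivative
      3 * (max 0 (1 - norm2 d (y(j := s)) / R\<^sup>2))\<^sup>2 * - (2 * s / R\<^sup>2)) (at s)" for s
    using DERIV_chain2[OF DERIV_positive_part_power[of 1] n] by (simp add: numeral_3_eq_3 numeral_2_eq_2)
  have p2: "((\<lambda>s. (max 0 (1 - norm2 d (y(j := s)) / R\<^sup>2))\<^sup>2) has_real_derivative
      2 * max 0 (1 - norm2 d (y(j := s)) / R\<^sup>2) * - (2 * s / R\<^sup>2)) (at s)" for s
    using DERIV_chain2[OF DERIV_positive_part_power[of 0] n] by (simp add: power2_eq_square)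
  show "((\<lambda>s. cutoff d R (y(j := s))) has_real_derivative cutoff_partial d R j (y(j := s))) (at s)"
    unfolding cutoff_def cutoff_partial_def using p3[of s] by simp
  have l: "((\<lambda>s. 2 * s / R\<^sup>2) has_real_derivative 2 / R\<^sup>2) (at s)"
    by (rule DERIV_cdivide) (auto intro!: derivative_eq_intros)
  show "((\<lambda>s. cutoff_partial d R j (y(j := s))) has_real_derivative cutoff_partial2 d R j (y(j := s))) (at s)"
    unfolding cutoff_partial_def cutoff_partial2_def fun_upd_same
    by (rule DERIV_cong[OF DERIV_mult[OF DERIV_cmult[OF p2, of "-3"] l]]) (simp add: algebra_simps power2_eq_square)
qed

lemma norm2_ge: "i \<in> {1..d} \<Longrightarrow> (y i)\<^sup>2 \<le> norm2 d y"
  unfolding norm2_def by (intro member_le_sum) auto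

lemma positive_part_cutoff:
  assumes R: "R > 0"
  shows "0 \<le> max 0 (1 - norm2 d y / R\<^sup>2)" "max 0 (1 - norm2 d y / R\<^sup>2) \<le> 1"
    and "i \<in> {1..d} \<Longrightarrow> \<bar>y i\<bar> > R \<Longrightarrow> max 0 (1 - norm2 d y / R\<^sup>2) = 0"
proof -
  show "max 0 (1 - norm2 d y / R\<^sup>2) \<le> 1" using norm2_nonneg[of d y] by simp
  assume i: "i \<in> {1..d}" "\<bar>y i\<bar> > R"
  then have "R\<^sup>2 < (y i)\<^sup>2" using R by (metis abs_ge_zero less_imp_le power2_abs power_strict_mono zero_less_numeral)
  then have "norm2 d y / R\<^sup>2 > 1" using norm2_ge[OF i(1), of y] R by (simp add: less_divide_eq)
  then show "max 0 (1 - norm2 d y / R\<^sup>2) = 0" by simp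
qed simp

lemma cutoff_vanish:
  assumes R: "R > 0" and "i \<in> {1..d}" "\<bar>y i\<bar> > R"
  shows "cutoff d R y = 0" "cutoff_partial d R j y = 0" "cutoff_partial2 d R j y = 0"
  unfolding cutoff_def cutoff_partial_def cutoff_partial2_def positive_part_cutoff(3)[of R i d y, OF assms] by simp_all

text \<open>Where the cutoff is nonzero, |y j| \<le> R, so each derivative gains a factor 1 / R.
  Against the linear growth of u and its bounded gradient, the error terms in the equation for the
  cut-off function are then of order 1 / R.\<close>

lemma cutoff_bounds:
  assumes R: "R \<ge> 1" and j: "j \<in> {1..d}"
  shows "\<bar>cutoff d R y\<bar> \<le> 1" "\<bar>cutoff_partial d R j y\<bar> \<le> 6 / R" "\<bar>cutoff_partial2 d R j y\<bar> \<le> 30 / R\<^sup>2"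
proof -
  have R0: "R > 0" using R by simp
  let ?m = "max 0 (1 - norm2 d y / R\<^sup>2)"
  note m = positive_part_cutoff(1,2)[OF R0, of d y]
  have m': "?m^3 \<le> 1" "?m\<^sup>2 \<le> 1" using m by (auto intro: power_le_one)
  show "\<bar>cutoff d R y\<bar> \<le> 1" unfolding cutoff_def using m m' by simp
  show "\<bar>cutoff_partial d R j y\<bar> \<le> 6 / R"
  proof (cases "\<bar>y j\<bar> > R")
    case True then show ?thesis using cutoff_vanish(2)[of R j d y, OF R0 j True] R0 by simp
  next
    case False
    have "\<bar>cutoff_partial d R j y\<bar> = 3 * ?m\<^sup>2 * (2 * \<bar>y j\<bar> / R\<^sup>2)"
      unfolding cutoff_partial_def by (simp add: abs_mult)
    also have "\<dots> \<le> 3 * 1 * (2 * R / R\<^sup>2)"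
      using False m' R0 by (intro mult_mono divide_right_mono) auto
    also have "\<dots> = 6 / R" using R0 by (simp add: power2_eq_square)
    finally show ?thesis .
  qed
  show "\<bar>cutoff_partial2 d R j y\<bar> \<le> 30 / R\<^sup>2"
  proof (cases "\<bar>y j\<bar> > R")
    case True then show ?thesis using cutoff_vanish(3)[of R j d y, OF R0 j True] R0 by simp
  next
    case False
    have "(2 * y j / R\<^sup>2)\<^sup>2 = (2 * \<bar>y j\<bar> / R\<^sup>2)\<^sup>2" by (simp add: power_divide power_mult_distrib)
    also have "\<dots> \<le> (2 * R / R\<^sup>2)\<^sup>2" using False R0 by (intro power_mono divide_right_mono mult_left_mono) auto
    also have "\<dots> = 4 / R\<^sup>2" using R0 by (simp add: power2_eq_square field_simps)
    finally have *: "(2 * y j / R\<^sup>2)\<^sup>2 \<le> 4 / R\<^sup>2" .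
    have "\<bar>cutoff_partial2 d R j y\<bar> \<le> 6 * ?m * (2 * y j / R\<^sup>2)\<^sup>2 + 3 * ?m\<^sup>2 * (2 / R\<^sup>2)"
      unfolding cutoff_partial2_def using m by (intro order_trans[OF abs_triangle_ineq4]) simp
    also have "\<dots> \<le> 6 * 1 * (4 / R\<^sup>2) + 3 * 1 * (2 / R\<^sup>2)"
      using m m' * by (intro add_mono mult_mono) auto
    also have "\<dots> = 30 / R\<^sup>2" by simp
    finally show ?thesis .
  qed
qed

lemma cutoff_continuous:
  "continuous_on UNIV (cutoff d R)" "continuous_on UNIV (cutoff_partial d R j)" "continuous_on UNIV (cutoff_partial2 d R j)"
proof -
  have y: "continuous_on UNIV (\<lambda>y::nat \<Rightarrow> real. y i)" for i by (rule continuous_on_product_coordinates)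
  have "continuous_on UNIV (norm2 d)"
    unfolding norm2_def by (intro continuous_on_sum continuous_on_power y)
  then have m: "continuous_on UNIV (\<lambda>y. max 0 (1 - norm2 d y / R\<^sup>2))"
    by (cases "R = 0") (auto intro!: continuous_on_max continuous_on_diff continuous_on_divide continuous_on_const)
  have l: "continuous_on UNIV (\<lambda>x::nat \<Rightarrow> real. 2 * x j / R\<^sup>2)"
    by (cases "R = 0") (auto intro!: continuous_on_divide continuous_on_mult continuous_on_const y)
  show "continuous_on UNIV (cutoff d R)" unfolding cutoff_def by (intro continuous_on_power m)
  show "continuous_on UNIV (cutoff_partial d R j)"
    unfolding cutoff_partial_def by (intro continuous_on_mult continuous_on_power m l continuous_on_const)
  show "continuous_on UNIV (cutoff_partial2 d R j)"
    unfolding cutoff_partial2_def by (intro continuous_on_diff continuous_on_mult continuous_on_power m l continuous_on_const)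
qed

text \<open>The point may vary with n: besides fixed points, the limit is taken along points
  converging to the start of the path.\<close>

lemma cutoff_tendsto:
  assumes "(\<lambda>n. norm2 d (y n)) \<longlonglongrightarrow> l"
  shows "(\<lambda>n. cutoff d (real (Suc n)) (y n)) \<longlonglongrightarrow> 1"
proof -
  have "(\<lambda>n. inverse (real (Suc n)) * inverse (real (Suc n)) * norm2 d (y n)) \<longlonglongrightarrow> 0 * 0 * l"
    by (intro tendsto_mult assms LIMSEQ_inverse_real_of_nat)
  then have "(\<lambda>n. (max 0 (1 - inverse (real (Suc n)) * inverse (real (Suc n)) * norm2 d (y n))) ^ 3) \<longlonglongrightarrow> (max 0 (1 - 0)) ^ 3"
    by (intro tendsto_power tendsto_max tendsto_diff tendsto_const) simp
  then show ?thesis by (simp add: cutoff_def power2_eq_square divide_inverse mult.commute)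
qed

section \<open>Representation of the solution and its gradient\<close>

definition unif01 :: "real measure" where
  "unif01 = density lborel (\<lambda>v. ennreal (indicator {0<..<1} v))"

lemma sets_unif01 [measurable_cong]: "sets unif01 = sets borel"
  by (simp add: unif01_def)

lemma prob_space_unif01: "prob_space unif01"
proof
  have "emeasure lborel {0<..<1::real} = 1" by simp
  then show "emeasure unif01 (space unif01) = 1"
    by (simp add: unif01_def emeasure_density ennreal_indicator)
qed

lemma integral_unif01:
  fixes h :: "real \<Rightarrow> real"
  assumes [measurable]: "h \<in> borel_measurable borel"
  shows "(\<integral>v. h v \<partial>unif01) = (\<integral>v. indicator {0<..<1} v * h v \<partial>lborel)"
  unfolding unif01_def by (subst integral_density) (auto simp: indicator_def)

lemma (in prob_space) distr_pair_snd:
  assumes "sigma_finite_measure N"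
  shows "distr (M \<Otimes>\<^sub>M N) N snd = N"
proof (rule measure_eqI)
  interpret N: sigma_finite_measure N by fact
  fix A assume "A \<in> sets (distr (M \<Otimes>\<^sub>M N) N snd)"
  then have A: "A \<in> sets N" by simp
  have "snd -` A \<inter> space (M \<Otimes>\<^sub>M N) = space M \<times> A"
    using sets.sets_into_space[OF A] by (auto simp: space_pair_measure)
  then show "emeasure (distr (M \<Otimes>\<^sub>M N) N snd) A = emeasure N A"
    using A by (simp add: emeasure_distr N.emeasure_pair_measure_Times emeasure_space_1)
qed simp

lemma measurable_unif01_snd: "snd \<in> unif01 \<Otimes>\<^sub>M std_normal_Rd d \<rightarrow>\<^sub>M borel_Rd d"
  by (rule measurable_compose[OF measurable_snd measurable_std_normal_Rd_ident])

context semilinear_heat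
begin

text \<open>Indexed like the components of the scheme, so that the solution and its gradient are
  treated by one argument.\<close>

definition ucomp :: "nat \<Rightarrow> real \<Rightarrow> (nat \<Rightarrow> real) \<Rightarrow> real" where
  "ucomp k = (if k = 0 then u else (\<lambda>t. partial k (u t)))"

text \<open>The Lipschitz bound of f carries the linear growth of u and the bound on its gradient
  over to the nonlinearity.\<close>

lemma linear_growth_Fu:
  obtains C where "C \<ge> 0"
    "\<And>t x k. t \<in> {0..T} \<Longrightarrow> x \<in> Rd d \<Longrightarrow> k \<le> d \<Longrightarrow> \<bar>ucomp k t x\<bar> \<le> C * (1 + (\<Sum>i\<in>{1..d}. \<bar>x i\<bar>))"
    "\<And>t x j. t \<in> {0..T} \<Longrightarrow> x \<in> Rd d \<Longrightarrow> j \<in> {1..d} \<Longrightarrow> \<bar>partial j (u t) x\<bar> \<le> C"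
    "\<And>t x. t \<in> {0..T} \<Longrightarrow> x \<in> Rd d \<Longrightarrow> \<bar>Fu t x\<bar> \<le> C * (1 + (\<Sum>i\<in>{1..d}. \<bar>x i\<bar>))"
proof -
  obtain C where C: "C \<ge> 0" "\<And>t x. t \<in> {0..T} \<Longrightarrow> x \<in> Rd d \<Longrightarrow> \<bar>u t x\<bar> \<le> C * (1 + (\<Sum>i\<in>{1..d}. \<bar>x i\<bar>))"
    "\<And>t x j. t \<in> {0..T} \<Longrightarrow> x \<in> Rd d \<Longrightarrow> j \<in> {1..d} \<Longrightarrow> \<bar>partial j (u t) x\<bar> \<le> C"
    using linear_growth by metis
  define C' where "C' = \<bar>f 0 (zero_Rd d)\<bar> + 2 * lam * C + C"
  have C': "C \<le> C'" using C(1) lam_pos by (simp add: C'_def)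
  have CC: "C * g \<le> C' * g" if "g \<ge> 0" for g using C' that by (rule mult_right_mono)
  show ?thesis
  proof (rule that[of C'])
    show "C' \<ge> 0" using C' C(1) by simp
    fix t x assume t: "t \<in> {0..T}" and x: "x \<in> Rd d"
    define gr where "gr = 1 + (\<Sum>i\<in>{1..d}. \<bar>x i\<bar>)"
    have gr: "gr \<ge> 1" unfolding gr_def by (auto intro!: sum_nonneg)
    have ub: "\<bar>u t x\<bar> \<le> C * gr" using C(2)[OF t x] by (simp add: gr_def)
    have "C \<le> C * gr" using C(1) gr by (metis mult.right_neutral mult_left_mono)
    then have pb: "\<bar>partial j (u t) x\<bar> \<le> C * gr" if "j \<in> {1..d}" for j
      using C(3)[OF t x that] by simp
    have "\<bar>ucomp k t x\<bar> \<le> C * gr" if "k \<le> d" for k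
      using ub pb[of k] that by (cases "k = 0") (auto simp: ucomp_def)
    then show "\<bar>ucomp k t x\<bar> \<le> C' * (1 + (\<Sum>i\<in>{1..d}. \<bar>x i\<bar>))" if "k \<le> d" for k
      using that CC[of gr] gr unfolding gr_def by force
    show "\<bar>partial j (u t) x\<bar> \<le> C'" if "j \<in> {1..d}" for j
      using C(3)[OF t x that] C' by simp
    have "\<bar>Fu t x - f 0 (zero_Rd d)\<bar> \<le> (\<Sum>j\<in>{1..d}. L j * (\<bar>u t x - 0\<bar> + \<bar>gradient d (u t) x j - zero_Rd d j\<bar>))"
      unfolding Fu_def by (rule f_lipschitz) (auto simp: gradient_def zero_Rd_def)
    also have "\<dots> \<le> (\<Sum>j\<in>{1..d}. L j * (2 * (C * gr)))"
    proof (intro sum_mono mult_left_mono)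
      fix j assume j: "j \<in> {1..d}"
      show "\<bar>u t x - 0\<bar> + \<bar>gradient d (u t) x j - zero_Rd d j\<bar> \<le> 2 * (C * gr)"
        using ub pb[OF j] j by (simp add: gradient_def zero_Rd_def)
    qed (rule L_nonneg)
    also have "\<dots> \<le> lam * (2 * (C * gr))"
      unfolding sum_distrib_right[symmetric] using L_sum C(1) gr by (intro mult_right_mono) auto
    finally have "\<bar>Fu t x\<bar> \<le> \<bar>f 0 (zero_Rd d)\<bar> + 2 * lam * C * gr" by (simp add: algebra_simps)
    also have "\<dots> \<le> \<bar>f 0 (zero_Rd d)\<bar> * gr + 2 * lam * C * gr + C * gr"
    proof -
      have "0 \<le> C * gr" using gr C(1) by simp
      moreover have "\<bar>f 0 (zero_Rd d)\<bar> * 1 \<le> \<bar>f 0 (zero_Rd d)\<bar> * gr" using gr by (intro mult_left_mono) auto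
      ultimately show ?thesis by linarith
    qed
    also have "\<dots> = C' * gr" by (simp add: C'_def algebra_simps)
    finally show "\<bar>Fu t x\<bar> \<le> C' * (1 + (\<Sum>i\<in>{1..d}. \<bar>x i\<bar>))" by (simp add: gr_def)
  qed
qed

text \<open>The heat identity is applied to u times the cutoff of radius n + 1, with lower end 1 /
  (n + 1), and n tends to infinity. The term at the lower end converges to u or its k-th derivative
  at (t, x), where the path starts; Laplacian minus time derivative of the cut-off function
  converges to minus the nonlinearity. In the variable v, the square root of the relative time, the
  integrand stays integrable at 0.\<close>

theorem feynman_kac_unif:
  assumes t: "0 < t" "t \<le> T" and x: "x \<in> Rd d" and k: "k \<le> d"
  shows "ucomp k t x =
     (\<integral>z. g (add_scaled d x (sqrt (2 * t)) z) * one_scaled (sqrt (2 * t)) z k \<partial>std_normal_Rd d)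
     + (\<integral>p. indicator {0<..<1} (fst p) * (2 * t * fst p * Fu (t * (1 - (fst p)\<^sup>2)) (add_scaled d x (sqrt (2 * t) * fst p) (snd p))
          * one_scaled (sqrt (2 * t) * fst p) (snd p) k) \<partial>(unif01 \<Otimes>\<^sub>M std_normal_Rd d))"
proof -
  interpret \<gamma>: prob_space "std_normal_Rd d" by (rule prob_space_std_normal_Rd)
  interpret U: prob_space unif01 by (rule prob_space_unif01)
  let ?\<gamma> = "std_normal_Rd d"
  interpret pair: pair_prob_space unif01 ?\<gamma> ..
  let ?\<nu> = "unif01 \<Otimes>\<^sub>M ?\<gamma>"
  obtain C where C: "C \<ge> 0"
    "\<And>t x k. t \<in> {0..T} \<Longrightarrow> x \<in> Rd d \<Longrightarrow> k \<le> d \<Longrightarrow> \<bar>ucomp k t x\<bar> \<le> C * (1 + (\<Sum>i\<in>{1..d}. \<bar>x i\<bar>))"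
    "\<And>t x j. t \<in> {0..T} \<Longrightarrow> x \<in> Rd d \<Longrightarrow> j \<in> {1..d} \<Longrightarrow> \<bar>partial j (u t) x\<bar> \<le> C"
    "\<And>t x. t \<in> {0..T} \<Longrightarrow> x \<in> Rd d \<Longrightarrow> \<bar>Fu t x\<bar> \<le> C * (1 + (\<Sum>i\<in>{1..d}. \<bar>x i\<bar>))"
    using linear_growth_Fu by metis
  define gr where "gr y = 1 + (\<Sum>i\<in>{1..d}. \<bar>y i\<bar>)" for y :: "nat \<Rightarrow> real"
  have gr1: "gr y \<ge> 1" for y unfolding gr_def by (auto intro!: sum_nonneg)
  have ub: "\<bar>u s y\<bar> \<le> C * gr y" if "s \<in> {0..T}" "y \<in> Rd d" for s y
    using C(2)[OF that, of 0] by (simp add: ucomp_def gr_def)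
  define \<sigma> where "\<sigma> = sqrt (2 * t)"
  have \<sigma>: "\<sigma> > 0" "\<sigma> * \<sigma> = 2 * t" using t by (simp_all add: \<sigma>_def)
  define X where "X v z = add_scaled d x (\<sigma> * v) z" for v z
  define \<tau> where "\<tau> v = t * (1 - v\<^sup>2)" for v
  define q where "q v z = one_scaled (\<sigma> * v) z k" for v z
  have \<tau>: "\<tau> v \<in> {0..T}" if "v \<in> {0..1}" for v
  proof -
    have "v\<^sup>2 \<le> 1" using that by (simp add: abs_square_le_1)
    then have "0 \<le> t * (1 - v\<^sup>2)" "t * (1 - v\<^sup>2) \<le> t * 1" using t by (auto intro!: mult_left_mono mult_nonneg_nonneg)
    then show ?thesis unfolding \<tau>_def atLeastAtMost_iff using t by linarith
  qed
  have X: "X v z \<in> Rd d" for v z unfolding X_def by (rule add_scaled_Rd)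
  \<comment> \<open>A majorant for the growth along the path that is uniform in v and depends on z
    only through \<open>gr z\<close>.\<close>
  define Gz where "Gz z = gr x * (1 + \<sigma>) * gr z" for z
  have gr_X: "gr (X v z) \<le> Gz z" if v: "v \<in> {0..1}" for v z
  proof -
    have "gr (X v z) \<le> 1 + (\<Sum>i\<in>{1..d}. \<bar>x i\<bar> + \<sigma> * \<bar>z i\<bar>)"
      unfolding gr_def
    proof (intro add_mono order_refl sum_mono)
      fix i assume i: "i \<in> {1..d}"
      have "\<bar>\<sigma> * v * z i\<bar> \<le> \<sigma> * 1 * \<bar>z i\<bar>"
        unfolding abs_mult using v \<sigma> by (intro mult_mono) auto
      then show "\<bar>X v z i\<bar> \<le> \<bar>x i\<bar> + \<sigma> * \<bar>z i\<bar>"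
        using i by (auto simp: X_def add_scaled_def)
    qed
    also have "\<dots> = gr x + \<sigma> * (gr z - 1)"
      by (simp add: gr_def sum.distrib sum_distrib_left)
    also have "\<dots> \<le> gr x * gr z + gr x * \<sigma> * gr z"
    proof (intro add_mono)
      show "gr x \<le> gr x * gr z" using gr1[of x] gr1[of z] by (metis mult.right_neutral mult_left_mono order_trans zero_le_one)
      have "1 * \<sigma> * (gr z - 1) \<le> gr x * \<sigma> * gr z"
        using gr1[of x] gr1[of z] \<sigma> by (intro mult_mono) auto
      then show "\<sigma> * (gr z - 1) \<le> gr x * \<sigma> * gr z" by simp
    qed
    also have "\<dots> = Gz z" by (simp add: Gz_def algebra_simps)
    finally show ?thesis .
  qed
  have Gz0: "Gz z \<ge> 0" for z unfolding Gz_def using gr1[of x] gr1[of z] \<sigma> by (intro mult_nonneg_nonneg) auto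
  \<comment> \<open>The weight z_k / (\<sigma> v) is singular at v = 0, but the factor v of the
    integrand cancels the singularity.\<close>
  have vq: "\<bar>v * q v z\<bar> \<le> (1 + 1 / \<sigma>) * gr z" if v: "v \<in> {0<..1}" for v z
  proof (cases "k = 0")
    case True
    have "\<bar>v * q v z\<bar> \<le> 1" using True v by (simp add: q_def one_scaled_def)
    also have "1 \<le> gr z" by (rule gr1)
    also have "\<dots> \<le> (1 + 1 / \<sigma>) * gr z" using \<sigma> gr1[of z] by (simp add: distrib_right)
    finally show ?thesis .
  next
    case False
    then have "\<bar>z k\<bar> \<le> (\<Sum>i\<in>{1..d}. \<bar>z i\<bar>)" using k by (intro member_le_sum) auto
    then have zk: "\<bar>z k\<bar> \<le> gr z" by (simp add: gr_def)
    have "\<bar>v * q v z\<bar> = \<bar>z k\<bar> / \<sigma>" using False v \<sigma> by (simp add: q_def one_scaled_def abs_mult)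
    also have "\<dots> \<le> gr z / \<sigma>" using zk \<sigma> by (intro divide_right_mono) auto
    also have "\<dots> \<le> (1 + 1 / \<sigma>) * gr z" using gr1[of z] by (simp add: distrib_right)
    finally show ?thesis .
  qed
  have int_gr2: "integrable ?\<gamma> (\<lambda>z. (gr z)\<^sup>2)"
    unfolding gr_def by (rule integrable_std_normal_linear_square)
  have gr_le: "gr z \<le> (gr z)\<^sup>2" for z using gr1[of z] by (simp add: power2_eq_square)
  have gr_meas: "gr \<in> borel_measurable ?\<gamma>"
    unfolding gr_def by (intro borel_measurable_add borel_measurable_sum borel_measurable_abs
          measurable_std_normal_coordinate) auto
  have meas: "(\<lambda>z. f (\<tau> v) (X v z)) \<in> borel_measurable ?\<gamma>"
    if "continuous_time_space T d f" "v \<in> {0..1}" for f v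
  proof (rule measurable_time_space[OF that(1)])
    show "X v \<in> ?\<gamma> \<rightarrow>\<^sub>M borel_Rd d"
      unfolding X_def using x measurable_std_normal_Rd_ident
      by (intro measurable_add_scaled) (auto simp: space_PiM)
  qed (use \<tau>[OF that(2)] in auto)
  have meas_q: "q v \<in> borel_measurable ?\<gamma>" for v
    unfolding q_def by (intro measurable_one_scaled[OF _ measurable_std_normal_Rd_ident k]) auto
  define V where "V n = 1 / real (Suc n)" for n
  define R where "R n = real (Suc n)" for n
  have V: "0 < V n" "V n \<le> 1" and R: "R n \<ge> 1" "R n > 0" for n unfolding V_def R_def by (simp_all add: field_simps)
  have V': "V n \<in> {0..1}" "V n \<in> {0<..1}" for n using V[of n] by auto
  have V_lim: "V \<longlonglongrightarrow> 0" unfolding V_def using LIMSEQ_inverse_real_of_nat by (simp add: inverse_eq_divide)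
  have R_lim: "(\<lambda>n. a / R n) \<longlonglongrightarrow> 0" for a
    unfolding R_def using tendsto_mult[OF tendsto_const[of a] LIMSEQ_inverse_real_of_nat] by (simp add: inverse_eq_divide)
  define w where "w n s y = cutoff d (R n) y * u s y" for n s y
  define wt where "wt n s y = cutoff d (R n) y * time_deriv T u s y" for n s y
  define w1 where "w1 n j s y = cutoff d (R n) y * partial j (u s) y + cutoff_partial d (R n) j y * u s y" for n j s y
  define w2 where "w2 n j s y = cutoff d (R n) y * partial j (partial j (u s)) y
      + (2 * cutoff_partial d (R n) j y * partial j (u s) y + cutoff_partial2 d (R n) j y * u s y)" for n j s y
  \<comment> \<open>The commutator of the Laplacian with the cutoff, applied to u. It is the only
    error in the equation for the cut-off function.\<close>
  define G where "G n s y = (\<Sum>j\<in>{1..d}. 2 * cutoff_partial d (R n) j y * partial j (u s) y + cutoff_partial2 d (R n) j y * u s y)" for n s y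
  define wk where "wk n = (if k = 0 then w n else w1 n k)" for n
  define H where "H n p = indicator {0<..<1} (fst p) * (indicator {V n..1} (fst p) * (2 * t * fst p * ((\<Sum>j\<in>{1..d}. w2 n j (\<tau> (fst p)) (X (fst p) (snd p)))
        - wt n (\<tau> (fst p)) (X (fst p) (snd p))) * q (fst p) (snd p)))" for n p
  note cs = continuous_time_space_intros continuous_time_space_space[OF cutoff_continuous(1)]
    continuous_time_space_space[OF cutoff_continuous(2)] continuous_time_space_space[OF cutoff_continuous(3)]
    u_cont time_deriv_cont partial_cont partial2_cont
  have cw: "continuous_time_space T d (w n)" "continuous_time_space T d (wt n)"
    "j \<in> {1..d} \<Longrightarrow> continuous_time_space T d (w1 n j)" "j \<in> {1..d} \<Longrightarrow> continuous_time_space T d (w2 n j)" for n j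
    unfolding w_def wt_def w1_def w2_def mult.assoc
    by (intro cs continuous_time_space_space[OF continuous_on_const]; assumption)+
  have identity: "(\<integral>z. w n 0 (X 1 z) * q 1 z \<partial>?\<gamma>) - (\<integral>z. wk n (\<tau> (V n)) (X (V n) z) \<partial>?\<gamma>)
      = (\<integral>v. indicator {V n..1} v * (\<integral>z. 2 * t * v * ((\<Sum>j\<in>{1..d}. w2 n j (\<tau> v) (X v z)) - wt n (\<tau> v) (X v z)) * q v z \<partial>?\<gamma>) \<partial>lborel)" for n
  proof -
    have f1: "((\<lambda>s. w n s y) has_real_derivative wt n s y) (at s within {0..T})"
      if s: "s \<in> {0..T}" and y: "y \<in> Rd d" for s y
      unfolding w_def wt_def
      using DERIV_cmult[OF C12D(1)[OF u_C12 s y, of 1]] d_pos by simp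
    have f2: "((\<lambda>s. w n r (y(j := s))) has_real_derivative w1 n j r (y(j := a))) (at a)"
      if r: "r \<in> {0..T}" and y: "y \<in> Rd d" and j: "j \<in> {1..d}" for r y j a
      unfolding w_def w1_def
      by (rule DERIV_cong[OF DERIV_mult[OF DERIV_cutoff(1)[OF j R(2)] C12D(2)[OF u_C12 r y j]]]) simp
    have f3: "((\<lambda>s. w1 n j r (y(j := s))) has_real_derivative w2 n j r (y(j := a))) (at a)"
      if r: "r \<in> {0..T}" and y: "y \<in> Rd d" and j: "j \<in> {1..d}" for r y j a
      unfolding w1_def w2_def
      by (rule DERIV_cong[OF DERIV_add[OF DERIV_mult[OF DERIV_cutoff(1)[OF j R(2)] C12D(3)[OF u_C12 r y j]]
            DERIV_mult[OF DERIV_cutoff(2)[OF j R(2)] C12D(2)[OF u_C12 r y j]]]]) (simp add: algebra_simps)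
    have f4: "w n s y = 0" "wt n s y = 0" "w1 n j s y = 0" "w2 n j s y = 0"
      if "i \<in> {1..d}" "\<bar>y i\<bar> > R n" for s y i j
      unfolding w_def wt_def w1_def w2_def
      using cutoff_vanish[of "R n" i d y, OF R(2) that] by simp_all
    have "(\<integral>z. w n 0 (add_scaled d x (sqrt (2 * t)) z) * one_scaled (sqrt (2 * t)) z k \<partial>std_normal_Rd d)
       - (\<integral>z. (if k = 0 then w n else w1 n k) (t * (1 - (V n)\<^sup>2)) (add_scaled d x (sqrt (2 * t) * V n) z) \<partial>std_normal_Rd d)
     = (\<integral>v. indicator {V n..1} v * (\<integral>z. 2 * t * v * ((\<Sum>j\<in>{1..d}. w2 n j (t * (1 - v\<^sup>2)) (add_scaled d x (sqrt (2 * t) * v) z))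
           - wt n (t * (1 - v\<^sup>2)) (add_scaled d x (sqrt (2 * t) * v) z))
         * one_scaled (sqrt (2 * t) * v) z k \<partial>std_normal_Rd d) \<partial>lborel)"
      by (rule heat_identity[of T d "w n" "wt n" "w1 n" "w2 n" "R n" t x "V n" k, OF f1 f2 f3 cw(1,2) cw(3,4)])
        (use f4 V t x k in \<open>auto intro: f4\<close>)
    then show ?thesis
      unfolding wk_def X_def \<tau>_def q_def \<sigma>_def by simp
  qed
  define KG where "KG = real d * (12 * C + 30 * (C * (1 + real d)))"
  \<comment> \<open>On the box containing the support of the cutoff, u is of order R, which uses up
    one factor 1 / R of the derivatives of the cutoff.\<close>
  have u_box: "\<bar>u s y\<bar> \<le> C * (1 + real d) * R n"
    if "s \<in> {0..T}" "y \<in> Rd d" "\<not> (\<exists>i\<in>{1..d}. \<bar>y i\<bar> > R n)" for s y n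
  proof -
    have "gr y \<le> 1 + real d * R n"
      unfolding gr_def using sum_bounded_above[of "{1..d}" "\<lambda>k. \<bar>y k\<bar>" "R n"] that(3) by (auto simp: not_less)
    also have "\<dots> \<le> (1 + real d) * R n" using R(1)[of n] by (simp add: distrib_right)
    finally have "C * gr y \<le> C * ((1 + real d) * R n)" using C(1) by (rule mult_left_mono)
    then show ?thesis using ub[OF that(1,2)] by simp
  qed
  have cu1: "\<bar>cutoff_partial d (R n) j y * u s y\<bar> \<le> 6 * (C * (1 + real d))"
    and cu2: "\<bar>cutoff_partial2 d (R n) j y * u s y\<bar> \<le> 30 * (C * (1 + real d)) / R n"
    if "s \<in> {0..T}" "y \<in> Rd d" "j \<in> {1..d}" for s y n j
  proof -
    have "\<bar>cutoff_partial d (R n) j y * u s y\<bar> \<le> 6 * (C * (1 + real d)) \<and>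
      \<bar>cutoff_partial2 d (R n) j y * u s y\<bar> \<le> 30 * (C * (1 + real d)) / R n"
    proof (cases "\<exists>i\<in>{1..d}. \<bar>y i\<bar> > R n")
      case True
      then obtain i where "i \<in> {1..d}" "\<bar>y i\<bar> > R n" by blast
      then show ?thesis using cutoff_vanish[of "R n" i d y, OF R(2)] C(1) R(2)[of n] by simp
    next
      case False
      note b = u_box[OF that(1,2) False]
      have "\<bar>cutoff_partial d (R n) j y * u s y\<bar> \<le> 6 / R n * (C * (1 + real d) * R n)"
        unfolding abs_mult using cutoff_bounds(2)[OF R(1) that(3), of n y] b R(2)[of n] by (intro mult_mono) auto
      also have "\<dots> = 6 * (C * (1 + real d))" using R(2)[of n] by simp
      finally have 1: "\<bar>cutoff_partial d (R n) j y * u s y\<bar> \<le> 6 * (C * (1 + real d))" .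
      have "\<bar>cutoff_partial2 d (R n) j y * u s y\<bar> \<le> 30 / (R n)\<^sup>2 * (C * (1 + real d) * R n)"
        unfolding abs_mult using cutoff_bounds(3)[OF R(1) that(3), of n y] b R(2)[of n] by (intro mult_mono) auto
      also have "\<dots> = 30 * (C * (1 + real d)) / R n" using R(2)[of n] by (simp add: power2_eq_square)
      finally show ?thesis using 1 by simp
    qed
    then show "\<bar>cutoff_partial d (R n) j y * u s y\<bar> \<le> 6 * (C * (1 + real d))"
      "\<bar>cutoff_partial2 d (R n) j y * u s y\<bar> \<le> 30 * (C * (1 + real d)) / R n" by auto
  qed
  have G_le: "\<bar>G n s y\<bar> \<le> KG / R n" if "s \<in> {0..T}" "y \<in> Rd d" for n s y
  proof -
    have "\<bar>G n s y\<bar> \<le> (\<Sum>j\<in>{1..d}. \<bar>2 * cutoff_partial d (R n) j y * partial j (u s) y + cutoff_partial2 d (R n) j y * u s y\<bar>)"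
      unfolding G_def by (rule sum_abs)
    also have "\<dots> \<le> (\<Sum>j\<in>{1..d}. 12 * C / R n + 30 * (C * (1 + real d)) / R n)"
    proof (intro sum_mono order_trans[OF abs_triangle_ineq] add_mono cu2 that)
      fix j assume j: "j \<in> {1..d}"
      have "\<bar>cutoff_partial d (R n) j y\<bar> * \<bar>partial j (u s) y\<bar> \<le> 6 / R n * C"
        using cutoff_bounds(2)[OF R(1) j, of n y] C(3)[OF that j] R(2)[of n] by (intro mult_mono) auto
      then show "\<bar>2 * cutoff_partial d (R n) j y * partial j (u s) y\<bar> \<le> 12 * C / R n"
        by (simp add: abs_mult)
    qed
    also have "\<dots> = KG / R n" by (simp add: KG_def add_divide_distrib distrib_left)
    finally show ?thesis .
  qed
  have KG0: "KG \<ge> 0" unfolding KG_def using C(1) by simp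
  have source: "(\<Sum>j\<in>{1..d}. w2 n j s y) - wt n s y = - (cutoff d (R n) y * Fu s y) + G n s y"
    if "s \<in> {0..T}" "y \<in> Rd d" for n s y
    unfolding w2_def wt_def G_def pde_closed[OF that] laplacian_def
    by (simp add: sum.distrib sum_distrib_left algebra_simps)
  define Kf where "Kf = 2 * t * ((C * (gr x * (1 + \<sigma>)) + KG) * (1 + 1 / \<sigma>))"
  have bound: "\<bar>a * (2 * t * v * b * q v z)\<bar> \<le> Kf * (gr z)\<^sup>2"
    if v: "v \<in> {0<..<1}" and b: "\<bar>b\<bar> \<le> C * Gz z + KG" and a: "\<bar>a\<bar> \<le> 1" for a b v z
  proof -
    have "\<bar>a * (2 * t * v * b * q v z)\<bar> = \<bar>a\<bar> * (2 * t * (\<bar>b\<bar> * \<bar>v * q v z\<bar>))"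
      using t by (simp add: abs_mult)
    also have "\<dots> \<le> 1 * (2 * t * ((C * Gz z + KG) * ((1 + 1 / \<sigma>) * gr z)))"
      using vq[of v z] v a b t C(1) Gz0[of z] KG0 \<sigma> gr1[of z] by (intro mult_mono mult_left_mono) auto
    also have "\<dots> \<le> 1 * (2 * t * ((C * Gz z + KG * gr z) * ((1 + 1 / \<sigma>) * gr z)))"
      using t KG0 gr1[of z] \<sigma> mult_left_mono[of 1 "gr z" KG]
      by (intro mult_left_mono mult_right_mono add_left_mono) auto
    also have "\<dots> = Kf * (gr z)\<^sup>2"
      unfolding Kf_def Gz_def by (simp add: power2_eq_square algebra_simps)
    finally show ?thesis .
  qed
  have Fu_X: "\<bar>Fu (\<tau> v) (X v z)\<bar> \<le> C * Gz z" if "v \<in> {0..1}" for v z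
    using C(4)[OF \<tau>[OF that] X[of v z]] mult_left_mono[OF gr_X[OF that, of z] C(1)] unfolding gr_def by linarith
  have source_X: "\<bar>(\<Sum>j\<in>{1..d}. w2 n j (\<tau> v) (X v z)) - wt n (\<tau> v) (X v z)\<bar> \<le> C * Gz z + KG"
    if v: "v \<in> {0..1}" for n v z
  proof -
    have "\<bar>cutoff d (R n) (X v z) * Fu (\<tau> v) (X v z)\<bar> \<le> 1 * (C * Gz z)"
      unfolding abs_mult using cutoff_bounds(1)[OF R(1), of 1 d n "X v z"] d_pos Fu_X[OF v, of z]
      by (intro mult_mono) auto
    moreover have "\<bar>G n (\<tau> v) (X v z)\<bar> \<le> KG"
    proof -
      have "KG / R n \<le> KG / 1" using KG0 R(1)[of n] by (intro divide_left_mono) auto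
      then show ?thesis using G_le[OF \<tau>[OF v] X, of n v z] by simp
    qed
    ultimately show ?thesis unfolding source[OF \<tau>[OF v] X] by linarith
  qed
  have A_lim: "(\<lambda>n. \<integral>z. w n 0 (X 1 z) * q 1 z \<partial>?\<gamma>) \<longlonglongrightarrow> (\<integral>z. g (X 1 z) * q 1 z \<partial>?\<gamma>)"
  proof (rule integral_dominated_convergence[where w="\<lambda>z. (C * (gr x * (1 + \<sigma>)) * (1 + 1 / \<sigma>)) * (gr z)\<^sup>2"])
    have \<tau>1: "\<tau> 1 = 0" by (simp add: \<tau>_def)
    have g: "g (X 1 z) = u (\<tau> 1) (X 1 z)" for z using initial[OF X] \<tau>1 by simp
    show "(\<lambda>z. g (X 1 z) * q 1 z) \<in> borel_measurable ?\<gamma>"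
      unfolding g using meas[OF u_cont, of 1] meas_q by simp
    show "(\<lambda>z. w n 0 (X 1 z) * q 1 z) \<in> borel_measurable ?\<gamma>" for n
      using meas[OF cw(1), of 1 n] meas_q unfolding \<tau>1 by simp
    show "integrable ?\<gamma> (\<lambda>z. (C * (gr x * (1 + \<sigma>)) * (1 + 1 / \<sigma>)) * (gr z)\<^sup>2)"
      using int_gr2 by simp
    show "AE z in ?\<gamma>. (\<lambda>n. w n 0 (X 1 z) * q 1 z) \<longlonglongrightarrow> g (X 1 z) * q 1 z"
    proof (intro AE_I2 tendsto_mult tendsto_const)
      fix z
      have "(\<lambda>n. cutoff d (R n) (X 1 z)) \<longlonglongrightarrow> 1"
        unfolding R_def by (rule cutoff_tendsto) (rule tendsto_const)
      from tendsto_mult[OF this tendsto_const[of "u 0 (X 1 z)"]]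
      show "(\<lambda>n. w n 0 (X 1 z)) \<longlonglongrightarrow> g (X 1 z)" unfolding w_def using initial[OF X, of 1 z] by simp
    qed
    show "AE z in ?\<gamma>. norm (w n 0 (X 1 z) * q 1 z) \<le> (C * (gr x * (1 + \<sigma>)) * (1 + 1 / \<sigma>)) * (gr z)\<^sup>2" for n
    proof (rule AE_I2)
      fix z
      have "\<bar>w n 0 (X 1 z)\<bar> \<le> 1 * (C * Gz z)"
        unfolding w_def abs_mult
        using cutoff_bounds(1)[OF R(1), of 1 d n "X 1 z"] d_pos ub[OF _ X, of 0 1 z] T_pos
          mult_left_mono[OF gr_X[of 1 z] C(1)] by (intro mult_mono) auto
      moreover have "\<bar>q 1 z\<bar> \<le> (1 + 1 / \<sigma>) * gr z" using vq[of 1 z] by simp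
      ultimately have "\<bar>w n 0 (X 1 z) * q 1 z\<bar> \<le> (C * Gz z) * ((1 + 1 / \<sigma>) * gr z)"
        unfolding abs_mult using C(1) Gz0[of z] by (intro mult_mono) auto
      also have "\<dots> = (C * (gr x * (1 + \<sigma>)) * (1 + 1 / \<sigma>)) * (gr z)\<^sup>2"
        unfolding Gz_def by (simp add: power2_eq_square algebra_simps)
      finally show "norm (w n 0 (X 1 z) * q 1 z) \<le> (C * (gr x * (1 + \<sigma>)) * (1 + 1 / \<sigma>)) * (gr z)\<^sup>2" by simp
    qed
  qed
  have \<tau>_cont: "continuous_on {0..1} \<tau>" unfolding \<tau>_def by (intro continuous_intros)
  have X_cont: "continuous_on {0..1} (\<lambda>v. X v z)" for z
  proof (rule continuous_on_coordinatewise_then_product)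
    fix i show "continuous_on {0..1} (\<lambda>v. X v z i)"
      by (cases "i \<in> {1..d}") (auto simp: X_def add_scaled_def intro!: continuous_intros)
  qed
  have \<tau>0: "\<tau> 0 = t" and X0: "X 0 z = x" for z
    using x by (auto simp: \<tau>_def X_def add_scaled_def PiE_def extensional_def fun_eq_iff)
  have f_lim: "(\<lambda>n. f (\<tau> (V n)) (X (V n) z)) \<longlonglongrightarrow> f t x" if "continuous_time_space T d f" for f z
  proof -
    have "continuous_on {0..1} (\<lambda>v. f (\<tau> v) (X v z))"
      by (rule continuous_on_pair_compose[OF that[unfolded continuous_time_space_def] \<tau>_cont _ X_cont])
        (intro image_subsetI \<tau> X; assumption)+
    from continuous_on_tendsto_compose[OF this V_lim] show ?thesis
      using V' \<tau>0 X0 by simp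
  qed
  have norm2_lim: "(\<lambda>n. norm2 d (X (V n) z)) \<longlonglongrightarrow> norm2 d x" for z
  proof -
    have "continuous_on UNIV (norm2 d)"
      unfolding norm2_def by (intro continuous_on_sum continuous_on_power continuous_on_product_coordinates)
    from f_lim[OF continuous_time_space_space[OF this]] show ?thesis .
  qed
  have int_gr: "integrable ?\<gamma> gr"
    by (rule Bochner_Integration.integrable_bound[OF int_gr2 gr_meas])
      (use gr_le gr1 in \<open>auto intro!: AE_I2 simp: abs_of_nonneg order_trans[OF zero_le_one]\<close>)
  \<comment> \<open>For k \<ge> 1 the product rule leaves an extra term, the derivative of the
    cutoff times u. It tends to 0 pointwise, because u is evaluated at points converging to x, and
    \<open>cu1\<close> bounds it uniformly in n.\<close>
  have B_lim: "(\<lambda>n. \<integral>z. wk n (\<tau> (V n)) (X (V n) z) \<partial>?\<gamma>) \<longlonglongrightarrow> ucomp k t x"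
  proof -
    have "(\<lambda>n. \<integral>z. wk n (\<tau> (V n)) (X (V n) z) \<partial>?\<gamma>) \<longlonglongrightarrow> (\<integral>z. ucomp k t x \<partial>?\<gamma>)"
    proof (rule integral_dominated_convergence[where w="\<lambda>z. (C * (gr x * (1 + \<sigma>))) * gr z + 6 * (C * (1 + real d))"])
      have wkc: "continuous_time_space T d (wk n)" for n
        using cw(1)[of n] cw(3)[of k n] k by (auto simp: wk_def)
      show "(\<lambda>z. wk n (\<tau> (V n)) (X (V n) z)) \<in> borel_measurable ?\<gamma>" for n
        by (rule meas[OF wkc V'(1)])
      show "integrable ?\<gamma> (\<lambda>z. (C * (gr x * (1 + \<sigma>))) * gr z + 6 * (C * (1 + real d)))"
        using int_gr by simp
      have c1: "(\<lambda>n. cutoff d (R n) (X (V n) z)) \<longlonglongrightarrow> 1" for z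
        unfolding R_def by (rule cutoff_tendsto[OF norm2_lim])
      show "AE z in ?\<gamma>. (\<lambda>n. wk n (\<tau> (V n)) (X (V n) z)) \<longlonglongrightarrow> ucomp k t x"
      proof (rule AE_I2)
        fix z
        show "(\<lambda>n. wk n (\<tau> (V n)) (X (V n) z)) \<longlonglongrightarrow> ucomp k t x"
        proof (cases "k = 0")
          case True
          then show ?thesis
            using tendsto_mult[OF c1 f_lim[OF u_cont, of z]] by (simp add: wk_def ucomp_def w_def)
        next
          case False
          then have k': "k \<in> {1..d}" using k by simp
          have "(\<lambda>n. cutoff_partial d (R n) k (X (V n) z)) \<longlonglongrightarrow> 0"
            by (rule Lim_null_comparison[OF _ R_lim[of 6]])
              (use cutoff_bounds(2)[OF R(1) k'] in \<open>auto intro!: always_eventually\<close>)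
          from tendsto_add[OF tendsto_mult[OF c1 f_lim[OF partial_cont[OF k'], of z]] tendsto_mult[OF this f_lim[OF u_cont, of z]]]
          show ?thesis using False by (simp add: wk_def ucomp_def w1_def)
        qed
      qed
      show "AE z in ?\<gamma>. norm (wk n (\<tau> (V n)) (X (V n) z)) \<le> (C * (gr x * (1 + \<sigma>))) * gr z + 6 * (C * (1 + real d))" for n
      proof (rule AE_I2)
        fix z
        have Gz: "(C * (gr x * (1 + \<sigma>))) * gr z = C * Gz z" by (simp add: Gz_def)
        have "\<bar>cutoff d (R n) (X (V n) z) * ucomp k (\<tau> (V n)) (X (V n) z)\<bar> \<le> 1 * (C * Gz z)"
          unfolding abs_mult
          using cutoff_bounds(1)[OF R(1), of 1 d n "X (V n) z"] d_pos C(2)[OF \<tau>[OF V'(1)[of n]] X[of "V n" z] k]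
            mult_left_mono[OF gr_X[OF V'(1)[of n], of z] C(1)] by (intro mult_mono) (auto simp: gr_def)
        moreover have "0 \<le> 6 * (C * (1 + real d))" using C(1) by simp
        ultimately show "norm (wk n (\<tau> (V n)) (X (V n) z)) \<le> (C * (gr x * (1 + \<sigma>))) * gr z + 6 * (C * (1 + real d))"
          using cu1[OF \<tau>[OF V'(1)[of n]] X[of "V n" z], of k n] k unfolding Gz
          by (cases "k = 0") (auto simp: wk_def w_def w1_def ucomp_def)
      qed
    qed simp
    then show ?thesis by (simp add: \<gamma>.prob_space)
  qed
  define c where "c v = max 0 (min 1 v)" for v :: real
  have c: "c v \<in> {0..1}" for v by (auto simp: c_def)
  have [measurable]: "c \<in> borel_measurable borel" unfolding c_def by measurable
  have fst_b[measurable]: "fst \<in> borel_measurable ?\<nu>"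
    using measurable_fst[of unif01 ?\<gamma>] by (simp cong: measurable_cong_sets add: sets_unif01)
  have fm: "(\<lambda>p. f (\<tau> (c (fst p))) (X (c (fst p)) (snd p))) \<in> borel_measurable ?\<nu>"
    if "continuous_time_space T d f" for f
  proof (rule measurable_time_space[OF that])
    show "(\<lambda>p. \<tau> (c (fst p))) \<in> borel_measurable ?\<nu>" unfolding \<tau>_def by measurable
    show "(\<lambda>p. X (c (fst p)) (snd p)) \<in> ?\<nu> \<rightarrow>\<^sub>M borel_Rd d"
      unfolding X_def using x measurable_unif01_snd
      by (intro measurable_add_scaled) (auto simp: space_PiM)
  qed (use \<tau> c in auto)
  have qm: "(\<lambda>p. q (fst p) (snd p)) \<in> borel_measurable ?\<nu>"
    unfolding q_def by (intro measurable_one_scaled[OF _ measurable_unif01_snd k]) auto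
  define Hl where "Hl p = indicator {0<..<1} (fst p) * (2 * t * fst p * (- Fu (\<tau> (fst p)) (X (fst p) (snd p))) * q (fst p) (snd p))" for p
  have cid: "c v = v" if "v \<in> {0<..<1}" for v using that by (simp add: c_def)
  have Hm: "H n \<in> borel_measurable ?\<nu>" for n
  proof -
    have "H n = (\<lambda>p. indicator {0<..<1} (fst p) * (indicator {V n..1} (fst p) * (2 * t * fst p * ((\<Sum>j\<in>{1..d}. w2 n j (\<tau> (c (fst p))) (X (c (fst p)) (snd p)))
        - wt n (\<tau> (c (fst p))) (X (c (fst p)) (snd p))) * q (fst p) (snd p))))"
      by (auto simp: H_def fun_eq_iff indicator_def cid)
    also have "\<dots> \<in> borel_measurable ?\<nu>"
      by (intro borel_measurable_times borel_measurable_diff borel_measurable_sum borel_measurable_const fm cw qm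
          measurable_compose[OF fst_b borel_measurable_indicator] fst_b) auto
    finally show ?thesis .
  qed
  have Hlm: "Hl \<in> borel_measurable ?\<nu>"
  proof -
    have "Hl = (\<lambda>p. indicator {0<..<1} (fst p) * (2 * t * fst p * (- Fu (\<tau> (c (fst p))) (X (c (fst p)) (snd p))) * q (fst p) (snd p)))"
      by (auto simp: Hl_def fun_eq_iff indicator_def cid)
    also have "\<dots> \<in> borel_measurable ?\<nu>"
      by (intro borel_measurable_times borel_measurable_uminus borel_measurable_const fm Fu_cont qm
          measurable_compose[OF fst_b borel_measurable_indicator] fst_b) auto
    finally show ?thesis .
  qed
  have int_bound: "integrable ?\<nu> (\<lambda>p. Kf * (gr (snd p))\<^sup>2)"
  proof (rule integrable_mult_right)
    have "distr ?\<nu> ?\<gamma> snd = ?\<gamma>"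
      by (rule U.distr_pair_snd) unfold_locales
    then show "integrable ?\<nu> (\<lambda>p. (gr (snd p))\<^sup>2)"
      using integrable_distr[of snd ?\<nu> ?\<gamma> "\<lambda>z. (gr z)\<^sup>2"] int_gr2 by simp
  qed
  have H_bound: "\<bar>H n p\<bar> \<le> Kf * (gr (snd p))\<^sup>2" for n p
  proof (cases "fst p \<in> {0<..<1}")
    case True
    then have "fst p \<in> {0..1}" by simp
    from bound[OF True source_X[OF this, of n "snd p"], of "indicator {V n..1} (fst p)"]
    show ?thesis using True by (simp add: H_def indicator_def)
  next
    case False
    have "Kf \<ge> 0" unfolding Kf_def using t C(1) gr1[of x] KG0 \<sigma> by simp
    then show ?thesis using False by (simp add: H_def)
  qed
  have H_int: "integrable ?\<nu> (H n)" for n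
    by (rule Bochner_Integration.integrable_bound[OF int_bound Hm])
      (use H_bound in \<open>auto intro!: AE_I2 intro: order_trans[OF _ abs_ge_self]\<close>)
  \<comment> \<open>The interval [V n, 1] of the heat identity reaches beyond the open interval (0,
    1) of the uniform law only in the null set {1}.\<close>
  have E_eq: "(\<integral>v. indicator {V n..1} v * (\<integral>z. 2 * t * v * ((\<Sum>j\<in>{1..d}. w2 n j (\<tau> v) (X v z)) - wt n (\<tau> v) (X v z)) * q v z \<partial>?\<gamma>) \<partial>lborel)
      = (\<integral>p. H n p \<partial>?\<nu>)" (is "(\<integral>v. indicator _ v * ?I v \<partial>lborel) = _") for n
  proof -
    have inner: "(\<integral>z. H n (v, z) \<partial>?\<gamma>) = indicator {0<..<1} v * (indicator {V n..1} v * ?I v)" for v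
      by (simp add: H_def)
    have Jm: "(\<lambda>v. \<integral>z. H n (v, z) \<partial>?\<gamma>) \<in> borel_measurable unif01"
      using Hm[of n] by (intro \<gamma>.borel_measurable_lebesgue_integral) (simp add: case_prod_unfold)
    then have Jm': "(\<lambda>v. \<integral>z. H n (v, z) \<partial>?\<gamma>) \<in> borel_measurable borel"
      by (simp cong: measurable_cong_sets add: sets_unif01)
    have "(\<integral>p. H n p \<partial>?\<nu>) = (\<integral>v. (\<integral>z. H n (v, z) \<partial>?\<gamma>) \<partial>unif01)"
      by (rule pair.integral_fst'[OF H_int, symmetric])
    also have "\<dots> = (\<integral>v. indicator {0<..<1} v * (\<integral>z. H n (v, z) \<partial>?\<gamma>) \<partial>lborel)"
      by (rule integral_unif01[OF Jm'])
    also have "\<dots> = (\<integral>v. (\<integral>z. H n (v, z) \<partial>?\<gamma>) \<partial>lborel)"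
      unfolding inner by (intro Bochner_Integration.integral_cong) (auto simp: indicator_def)
    also have "\<dots> = (\<integral>v. indicator {V n..1} v * ?I v \<partial>lborel)"
    proof (rule integral_cong_AE)
      have "AE v in lborel. v \<noteq> (1::real)" by (rule AE_lborel_singleton)
      then show "AE v in lborel. (\<integral>z. H n (v, z) \<partial>?\<gamma>) = indicator {V n..1} v * ?I v"
        unfolding inner
        by (rule AE_mp) (intro AE_I2 impI, use V(1)[of n] in \<open>auto simp: indicator_def\<close>)
      show "(\<lambda>v. \<integral>z. H n (v, z) \<partial>?\<gamma>) \<in> borel_measurable lborel" using Jm' by simp
      have "(\<lambda>v. indicator {V n..1} v * ?I v) = (\<lambda>v. if v = 1 then ?I 1 else \<integral>z. H n (v, z) \<partial>?\<gamma>)"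
        unfolding inner using V[of n] by (auto simp: fun_eq_iff indicator_def)
      also have "\<dots> \<in> borel_measurable lborel" using Jm' by simp
      finally show "(\<lambda>v. indicator {V n..1} v * ?I v) \<in> borel_measurable lborel" .
    qed
    finally show ?thesis by simp
  qed
  have E_lim: "(\<lambda>n. \<integral>p. H n p \<partial>?\<nu>) \<longlonglongrightarrow> (\<integral>p. Hl p \<partial>?\<nu>)"
  proof (rule integral_dominated_convergence[OF Hlm Hm int_bound])
    show "AE p in ?\<nu>. norm (H n p) \<le> Kf * (gr (snd p))\<^sup>2" for n
      using H_bound by (intro AE_I2) simp
    show "AE p in ?\<nu>. (\<lambda>n. H n p) \<longlonglongrightarrow> Hl p"
    proof (rule AE_I2)
      fix p :: "real \<times> (nat \<Rightarrow> real)"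
      obtain v z where p: "p = (v, z)" by (cases p)
      show "(\<lambda>n. H n p) \<longlonglongrightarrow> Hl p"
      proof (cases "v \<in> {0<..<1}")
        case True
        then have v: "v \<in> {0..1}" by simp
        have "eventually (\<lambda>n. V n < v) sequentially"
          using order_tendstoD(2)[OF V_lim] True by simp
        then have "eventually (\<lambda>n. indicator {V n..1} v = (1::real)) sequentially"
          by eventually_elim (use True in auto)
        then have i: "(\<lambda>n. indicator {V n..1} v :: real) \<longlonglongrightarrow> 1" by (rule tendsto_eventually)
        have cl: "(\<lambda>n. cutoff d (R n) (X v z)) \<longlonglongrightarrow> 1"
          unfolding R_def by (rule cutoff_tendsto) (rule tendsto_const)
        have "(\<lambda>n. G n (\<tau> v) (X v z)) \<longlonglongrightarrow> 0"
          by (rule Lim_null_comparison[OF _ R_lim[of KG]]) (use G_le[OF \<tau>[OF v] X] in auto)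
        from tendsto_add[OF tendsto_minus[OF tendsto_mult[OF cl tendsto_const[of "Fu (\<tau> v) (X v z)"]]] this]
        have "(\<lambda>n. (\<Sum>j\<in>{1..d}. w2 n j (\<tau> v) (X v z)) - wt n (\<tau> v) (X v z)) \<longlonglongrightarrow> - Fu (\<tau> v) (X v z)"
          unfolding source[OF \<tau>[OF v] X] by simp
        from tendsto_mult[OF tendsto_const[of "indicator {0<..<1} v"] tendsto_mult[OF i tendsto_mult[OF tendsto_mult[OF tendsto_const[of "2 * t * v"] this] tendsto_const[of "q v z"]]]]
        show ?thesis by (simp add: H_def Hl_def p)
      qed (simp add: H_def Hl_def p)
    qed
  qed
  have "(\<lambda>n. (\<integral>z. w n 0 (X 1 z) * q 1 z \<partial>?\<gamma>) - (\<integral>z. wk n (\<tau> (V n)) (X (V n) z) \<partial>?\<gamma>))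
      \<longlonglongrightarrow> (\<integral>z. g (X 1 z) * q 1 z \<partial>?\<gamma>) - ucomp k t x"
    by (rule tendsto_diff[OF A_lim B_lim])
  moreover have "(\<lambda>n. (\<integral>z. w n 0 (X 1 z) * q 1 z \<partial>?\<gamma>) - (\<integral>z. wk n (\<tau> (V n)) (X (V n) z) \<partial>?\<gamma>))
      \<longlonglongrightarrow> (\<integral>p. Hl p \<partial>?\<nu>)"
    unfolding identity E_eq by (rule E_lim)
  ultimately have "(\<integral>z. g (X 1 z) * q 1 z \<partial>?\<gamma>) - ucomp k t x = (\<integral>p. Hl p \<partial>?\<nu>)"
    by (rule LIMSEQ_unique)
  moreover have "(\<integral>p. Hl p \<partial>?\<nu>) = - (\<integral>p. indicator {0<..<1} (fst p) * (2 * t * fst p * Fu (\<tau> (fst p)) (X (fst p) (snd p)) * q (fst p) (snd p)) \<partial>?\<nu>)"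
    unfolding integral_minus[symmetric] by (simp add: Hl_def)
  ultimately show ?thesis
    unfolding X_def \<tau>_def q_def \<sigma>_def by simp
qed

end

section \<open>The law of the random input\<close>

text \<open>The square root of the random time has the uniform distribution.\<close>
definition rlaw :: "real measure" where
  "rlaw = distr unif01 borel (\<lambda>v. v\<^sup>2)"

lemma sets_rlaw [measurable_cong]: "sets rlaw = sets borel"
  by (simp add: rlaw_def)

lemma prob_space_rlaw: "prob_space rlaw"
  unfolding rlaw_def by (intro prob_space.prob_space_distr prob_space_unif01) measurable

definition step_law :: "nat \<Rightarrow> ((nat \<Rightarrow> real) \<times> real) measure" where
  "step_law d = std_normal_Rd d \<Otimes>\<^sub>M rlaw"

lemma sets_step_law [measurable_cong]: "sets (step_law d) = sets (borel_Rd d \<Otimes>\<^sub>M borel)"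
  unfolding step_law_def by (intro sets_pair_measure_cong sets_std_normal_Rd sets_rlaw)

lemma prob_space_step_law: "prob_space (step_law d)"
  unfolding step_law_def by (intro prob_space_pair prob_space_std_normal_Rd prob_space_rlaw)

text \<open>Connects the representation, an integral over the uniform variable v, with the random
  time v^2 that the scheme samples.\<close>

lemma step_law_eq_distr:
  "step_law d = distr (unif01 \<Otimes>\<^sub>M std_normal_Rd d) (std_normal_Rd d \<Otimes>\<^sub>M borel) (\<lambda>(v, z). (z, v\<^sup>2))"
proof -
  interpret U: prob_space unif01 by (rule prob_space_unif01)
  interpret \<gamma>: prob_space "std_normal_Rd d" by (rule prob_space_std_normal_Rd)
  interpret R: prob_space rlaw by (rule prob_space_rlaw)
  interpret pair: pair_sigma_finite "std_normal_Rd d" unif01 ..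
  have "step_law d = distr (std_normal_Rd d) (std_normal_Rd d) (\<lambda>x. x) \<Otimes>\<^sub>M distr unif01 borel (\<lambda>v. v\<^sup>2)"
    unfolding step_law_def rlaw_def by simp
  also have "\<dots> = distr (std_normal_Rd d \<Otimes>\<^sub>M unif01) (std_normal_Rd d \<Otimes>\<^sub>M borel) (\<lambda>(x, v). (x, v\<^sup>2))"
    by (rule pair_measure_distr) (use R.sigma_finite_measure_axioms in \<open>simp_all add: rlaw_def\<close>)
  also have "std_normal_Rd d \<Otimes>\<^sub>M unif01 = distr (unif01 \<Otimes>\<^sub>M std_normal_Rd d) (std_normal_Rd d \<Otimes>\<^sub>M unif01) (\<lambda>(x, y). (y, x))"
    by (rule pair.distr_pair_swap)
  also have "distr \<dots> (std_normal_Rd d \<Otimes>\<^sub>M borel) (\<lambda>(x, v). (x, v\<^sup>2)) =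
      distr (unif01 \<Otimes>\<^sub>M std_normal_Rd d) (std_normal_Rd d \<Otimes>\<^sub>M borel) (\<lambda>(v, z). (z, v\<^sup>2))"
    by (subst distr_distr) (auto simp: o_def case_prod_unfold)
  finally show ?thesis .
qed

text \<open>The joint law of the pairs (Z^{d,theta}, r^theta), theta in Theta, for one dimension d.\<close>
definition tree_law :: "nat \<Rightarrow> (int list \<Rightarrow> (nat \<Rightarrow> real) \<times> real) measure" where
  "tree_law d = (\<Pi>\<^sub>M \<eta>\<in>Theta. step_law d)"

lemma prob_space_tree_law: "prob_space (tree_law d)"
  unfolding tree_law_def by (intro prob_space_PiM prob_space_step_law)

text \<open>The input seen by the recursive call at index \<theta>, readdressed relative to
  \<theta>. With it the scheme on the canonical space needs no index argument.\<close>

definition subtree :: "int list \<Rightarrow> (int list \<Rightarrow> 'b) \<Rightarrow> int list \<Rightarrow> 'b" where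
  "subtree \<theta> \<omega> = (\<lambda>\<eta>\<in>Theta. \<omega> (\<theta> @ \<eta>))"

lemma append_Theta: "\<eta> \<in> Theta \<Longrightarrow> \<theta> @ \<eta> \<in> Theta"
  by (simp add: Theta_def)

lemma measurable_tree_component: "\<eta> \<in> Theta \<Longrightarrow> (\<lambda>\<omega>. \<omega> \<eta>) \<in> tree_law d \<rightarrow>\<^sub>M step_law d"
  unfolding tree_law_def by (rule measurable_component_singleton)

lemma measurable_subtree: "subtree \<theta> \<in> tree_law d \<rightarrow>\<^sub>M tree_law d"
  unfolding subtree_def tree_law_def
  by (intro measurable_restrict measurable_component_singleton append_Theta)

text \<open>Reindexing an i.i.d. family by an injective map preserves its law. The map used sends
  the extra index [] to \<eta>0 and every other \<eta> to \<open>\<eta>1 @ \<eta>\<close>; it is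
  injective by \<open>notin\<close>. The result expresses that the single pair is independent of the
  whole subtree and that the subtree is distributed like the full input.\<close>

lemma distr_subtree_pair:
  assumes \<eta>0: "\<eta>0 \<in> Theta" and notin: "\<And>\<eta>. \<eta> \<in> Theta \<Longrightarrow> \<eta>1 @ \<eta> \<noteq> \<eta>0"
  shows "distr (tree_law d) (step_law d \<Otimes>\<^sub>M tree_law d) (\<lambda>\<omega>. (\<omega> \<eta>0, subtree \<eta>1 \<omega>)) = step_law d \<Otimes>\<^sub>M tree_law d"
proof -
  let ?S = "\<lambda>_::int list. step_law d"
  let ?B = "PiM UNIV ?S"
  define f where "f \<eta> = (if \<eta> = [] then \<eta>0 else \<eta>1 @ \<eta>)" for \<eta> :: "int list"
  have ins: "insert [] Theta = UNIV" by (auto simp: Theta_def)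
  have inj: "inj_on f UNIV"
    using notin unfolding inj_on_def f_def Theta_def by auto
  have f: "f \<in> UNIV \<rightarrow> Theta" using \<eta>0 by (auto simp: f_def Theta_def)
  have d1: "distr (tree_law d) ?B (\<lambda>\<omega>. \<lambda>n\<in>UNIV. \<omega> (f n)) = ?B"
    unfolding tree_law_def by (rule distr_PiM_reindex[OF prob_space_step_law inj f])
  have d2: "distr (step_law d \<Otimes>\<^sub>M tree_law d) ?B (\<lambda>(x, X). X([] := x)) = ?B"
    using distr_pair_PiM_eq_PiM[of Theta ?S "[]", OF prob_space_step_law prob_space_step_law]
    unfolding tree_law_def ins .
  define \<psi> where "\<psi> Y = (Y [], restrict Y Theta)" for Y :: "int list \<Rightarrow> (nat \<Rightarrow> real) \<times> real"
  have \<psi>m: "\<psi> \<in> ?B \<rightarrow>\<^sub>M step_law d \<Otimes>\<^sub>M tree_law d"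
    unfolding \<psi>_def tree_law_def
    by (intro measurable_Pair measurable_component_singleton measurable_restrict) auto
  have fm: "(\<lambda>\<omega>. \<lambda>n\<in>UNIV. \<omega> (f n)) \<in> tree_law d \<rightarrow>\<^sub>M ?B"
    using f by (intro measurable_restrict measurable_tree_component) auto
  have um: "(\<lambda>(x, X). X([] := x)) \<in> step_law d \<Otimes>\<^sub>M tree_law d \<rightarrow>\<^sub>M ?B"
    unfolding tree_law_def ins[symmetric]
    using measurable_fun_upd[of UNIV Theta "[]" snd "step_law d \<Otimes>\<^sub>M PiM Theta ?S" ?S fst] ins
    by (simp add: case_prod_unfold)
  have "distr (tree_law d) (step_law d \<Otimes>\<^sub>M tree_law d) (\<lambda>\<omega>. (\<omega> \<eta>0, subtree \<eta>1 \<omega>))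
      = distr (distr (tree_law d) ?B (\<lambda>\<omega>. \<lambda>n\<in>UNIV. \<omega> (f n))) (step_law d \<Otimes>\<^sub>M tree_law d) \<psi>"
    by (subst distr_distr[OF \<psi>m fm], intro distr_cong refl)
      (auto simp: \<psi>_def f_def subtree_def Theta_def o_def fun_eq_iff)
  also have "\<dots> = distr (distr (step_law d \<Otimes>\<^sub>M tree_law d) ?B (\<lambda>(x, X). X([] := x))) (step_law d \<Otimes>\<^sub>M tree_law d) \<psi>"
    unfolding d1 d2 ..
  also have "\<dots> = distr (step_law d \<Otimes>\<^sub>M tree_law d) (step_law d \<Otimes>\<^sub>M tree_law d) (\<lambda>p. p)"
  proof (subst distr_distr[OF \<psi>m um], intro distr_cong refl)
    fix p assume "p \<in> space (step_law d \<Otimes>\<^sub>M tree_law d)"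
    then have "snd p \<in> extensional Theta"
      by (auto simp: space_pair_measure tree_law_def space_PiM PiE_def)
    then show "(\<psi> \<circ> (\<lambda>(x, X). X([] := x))) p = p"
      by (cases p) (auto simp: \<psi>_def Theta_def fun_eq_iff extensional_def)
  qed
  finally show ?thesis by simp
qed

section \<open>Independence of functions of disjoint parts of the input\<close>

lemma distr_tree_component: "\<eta> \<in> Theta \<Longrightarrow> distr (tree_law d) (step_law d) (\<lambda>\<omega>. \<omega> \<eta>) = step_law d"
  unfolding tree_law_def by (intro distr_PiM_component prob_space_step_law)

lemma indep_vars_tree_coordinates:
  "prob_space.indep_vars (tree_law d) (\<lambda>_. step_law d) (\<lambda>\<eta> \<omega>. \<omega> \<eta>) Theta"
proof -
  interpret prob_space "tree_law d" by (rule prob_space_tree_law)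
  have ne: "Theta \<noteq> {}" by (auto simp: Theta_def)
  have "distr (tree_law d) (PiM Theta (\<lambda>_. step_law d)) (\<lambda>\<omega>. \<lambda>\<eta>\<in>Theta. \<omega> \<eta>) = distr (tree_law d) (tree_law d) (\<lambda>\<omega>. \<omega>)"
    unfolding tree_law_def[symmetric]
    by (intro distr_cong refl) (auto simp: tree_law_def space_PiM PiE_def extensional_restrict)
  also have "\<dots> = tree_law d" by simp
  also have "\<dots> = (\<Pi>\<^sub>M \<eta>\<in>Theta. distr (tree_law d) (step_law d) (\<lambda>\<omega>. \<omega> \<eta>))"
    unfolding tree_law_def by (intro PiM_cong refl) (simp add: distr_tree_component[unfolded tree_law_def])
  finally show ?thesis
    by (subst indep_vars_iff_distr_eq_PiM'[OF ne measurable_tree_component]) auto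
qed

text \<open>Restrictions of the input to disjoint index sets are independent. To write Y j as a
  function of the restriction to K j, the missing coordinates are filled in from a fixed sample
  point \<omega>0; by \<open>dep\<close> this does not affect Y j.\<close>

lemma indep_vars_tree_functions:
  fixes Y :: "'j \<Rightarrow> (int list \<Rightarrow> (nat \<Rightarrow> real) \<times> real) \<Rightarrow> real"
  assumes Y: "\<And>j. j \<in> J \<Longrightarrow> Y j \<in> borel_measurable (tree_law d)"
    and K: "\<And>j. j \<in> J \<Longrightarrow> K j \<subseteq> Theta" "disjoint_family_on K J"
    and dep: "\<And>j \<omega> \<omega>'. j \<in> J \<Longrightarrow>
       (\<And>\<eta>. \<eta> \<in> K j \<Longrightarrow> \<omega> \<eta> = \<omega>' \<eta>) \<Longrightarrow> Y j \<omega> = Y j \<omega>'"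
  shows "prob_space.indep_vars (tree_law d) (\<lambda>_. borel) Y J"
proof -
  interpret prob_space "tree_law d" by (rule prob_space_tree_law)
  obtain \<omega>0 where \<omega>0: "\<omega>0 \<in> space (tree_law d)" using not_empty by blast
  define ext where "ext j \<zeta> = (\<lambda>\<eta>\<in>Theta. if \<eta> \<in> K j then \<zeta> \<eta> else \<omega>0 \<eta>)" for j and \<zeta> :: "int list \<Rightarrow> (nat \<Rightarrow> real) \<times> real"
  have ext_m: "ext j \<in> PiM (K j) (\<lambda>_. step_law d) \<rightarrow>\<^sub>M tree_law d" if "j \<in> J" for j
    unfolding ext_def tree_law_def
  proof (rule measurable_restrict)
    fix \<eta> assume \<eta>: "\<eta> \<in> Theta"
    show "(\<lambda>\<zeta>. if \<eta> \<in> K j then \<zeta> \<eta> else \<omega>0 \<eta>) \<in> PiM (K j) (\<lambda>_. step_law d) \<rightarrow>\<^sub>M step_law d"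
      using \<omega>0 \<eta> by (cases "\<eta> \<in> K j") (auto simp: tree_law_def space_PiM PiE_iff intro!: measurable_const)
  qed
  have "indep_vars (\<lambda>j. PiM (K j) (\<lambda>_. step_law d)) (\<lambda>j \<omega>. restrict (\<lambda>\<eta>. \<omega> \<eta>) (K j)) J"
    by (rule indep_vars_restrict[OF indep_vars_tree_coordinates K])
  then have "indep_vars (\<lambda>_. borel) (\<lambda>j \<omega>. (Y j \<circ> ext j) (restrict (\<lambda>\<eta>. \<omega> \<eta>) (K j))) J"
    by (rule indep_vars_compose2) (rule measurable_comp[OF ext_m Y])
  moreover have "(Y j \<circ> ext j) (restrict (\<lambda>\<eta>. \<omega> \<eta>) (K j)) = Y j \<omega>" if j: "j \<in> J" for j \<omega>
    unfolding o_def by (intro dep[OF j]) (use K(1)[OF j] in \<open>auto simp: ext_def\<close>)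
  ultimately show ?thesis
    by (subst indep_vars_cong[OF refl _ refl]) auto
qed

text \<open>The decomposition into variance and squared bias: variances of independent summands add
  up, and each is at most the second moment of its summand.\<close>

lemma (in prob_space) second_moment_indep_sum:
  fixes X :: "'i \<Rightarrow> 'a \<Rightarrow> real"
  assumes "finite J" and "indep_vars (\<lambda>_. borel) X J"
    and sq: "\<And>j. j \<in> J \<Longrightarrow> integrable M (\<lambda>\<omega>. (X j \<omega>)\<^sup>2)"
  shows "integrable M (\<lambda>\<omega>. ((\<Sum>j\<in>J. X j \<omega>) - c)\<^sup>2)"
    and "expectation (\<lambda>\<omega>. ((\<Sum>j\<in>J. X j \<omega>) - c)\<^sup>2)
      \<le> (\<Sum>j\<in>J. expectation (\<lambda>\<omega>. (X j \<omega>)\<^sup>2)) + ((\<Sum>j\<in>J. expectation (X j)) - c)\<^sup>2"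
proof -
  have Xm: "X j \<in> borel_measurable M" if "j \<in> J" for j
    using assms(2) that by (auto simp: indep_vars_def)
  have Xi: "integrable M (X j)" if "j \<in> J" for j
    by (rule square_integrable_imp_integrable[OF Xm[OF that] sq[OF that]])
  define Y where "Y j \<omega> = X j \<omega> - expectation (X j)" for j \<omega>
  have Yi: "integrable M (Y j)" "expectation (Y j) = 0" "integrable M (\<lambda>\<omega>. (Y j \<omega>)\<^sup>2)"
    "expectation (\<lambda>\<omega>. (Y j \<omega>)\<^sup>2) \<le> expectation (\<lambda>\<omega>. (X j \<omega>)\<^sup>2)" if "j \<in> J" for j
  proof -
    show "integrable M (Y j)" "expectation (Y j) = 0"
      unfolding Y_def using Xi[OF that] by (simp_all add: prob_space)
    have "(\<lambda>\<omega>. (Y j \<omega>)\<^sup>2) = (\<lambda>\<omega>. (X j \<omega>)\<^sup>2 - 2 * expectation (X j) * X j \<omega> + (expectation (X j))\<^sup>2)"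
      unfolding Y_def by (auto simp: power2_eq_square algebra_simps)
    then show "integrable M (\<lambda>\<omega>. (Y j \<omega>)\<^sup>2)"
      using Xi[OF that] sq[OF that] by simp
    show "expectation (\<lambda>\<omega>. (Y j \<omega>)\<^sup>2) \<le> expectation (\<lambda>\<omega>. (X j \<omega>)\<^sup>2)"
      unfolding Y_def using variance_eq[OF Xi[OF that] sq[OF that]] by simp
  qed
  have indY: "indep_vars (\<lambda>_. borel) Y J"
    unfolding Y_def by (rule indep_vars_compose2[OF assms(2)]) auto
  have main: "integrable M (\<lambda>\<omega>. \<Sum>j\<in>A. Y j \<omega>) \<and> expectation (\<lambda>\<omega>. \<Sum>j\<in>A. Y j \<omega>) = 0
      \<and> integrable M (\<lambda>\<omega>. (\<Sum>j\<in>A. Y j \<omega>)\<^sup>2) \<and> expectation (\<lambda>\<omega>. (\<Sum>j\<in>A. Y j \<omega>)\<^sup>2) = (\<Sum>j\<in>A. expectation (\<lambda>\<omega>. (Y j \<omega>)\<^sup>2))"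
    if "finite A" "A \<subseteq> J" for A
    using that
  proof (induction A)
    case (insert i A)
    let ?S = "\<lambda>\<omega>. \<Sum>j\<in>A. Y j \<omega>"
    have IH: "integrable M ?S" "expectation ?S = 0" "integrable M (\<lambda>\<omega>. (?S \<omega>)\<^sup>2)"
        "expectation (\<lambda>\<omega>. (?S \<omega>)\<^sup>2) = (\<Sum>j\<in>A. expectation (\<lambda>\<omega>. (Y j \<omega>)\<^sup>2))"
      using insert by auto
    have i: "i \<in> J" using insert.prems by simp
    have "indep_var borel (Y i) borel ?S"
      by (rule indep_vars_sum[OF insert.hyps indep_vars_subset[OF indY insert.prems]])
    from indep_var_integrable[OF this Yi(1)[OF i] IH(1)] indep_var_lebesgue_integral[OF this Yi(1)[OF i] IH(1)]
    have YS: "integrable M (\<lambda>\<omega>. Y i \<omega> * ?S \<omega>)" "expectation (\<lambda>\<omega>. Y i \<omega> * ?S \<omega>) = 0"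
      using IH(2) by simp_all
    have eq: "(\<lambda>\<omega>. (\<Sum>j\<in>insert i A. Y j \<omega>)\<^sup>2) = (\<lambda>\<omega>. (Y i \<omega>)\<^sup>2 + 2 * (Y i \<omega> * ?S \<omega>) + (?S \<omega>)\<^sup>2)"
      using insert.hyps by (auto simp: power2_eq_square algebra_simps)
    show ?case
      unfolding eq using insert.hyps Yi[OF i] IH YS by simp
  qed simp
  have m: "integrable M (\<lambda>\<omega>. \<Sum>j\<in>J. Y j \<omega>)" "expectation (\<lambda>\<omega>. \<Sum>j\<in>J. Y j \<omega>) = 0"
      "integrable M (\<lambda>\<omega>. (\<Sum>j\<in>J. Y j \<omega>)\<^sup>2)"
      "expectation (\<lambda>\<omega>. (\<Sum>j\<in>J. Y j \<omega>)\<^sup>2) = (\<Sum>j\<in>J. expectation (\<lambda>\<omega>. (Y j \<omega>)\<^sup>2))"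
    using main[OF assms(1)] by auto
  define b where "b = (\<Sum>j\<in>J. expectation (X j)) - c"
  have eq: "(\<lambda>\<omega>. ((\<Sum>j\<in>J. X j \<omega>) - c)\<^sup>2) = (\<lambda>\<omega>. (\<Sum>j\<in>J. Y j \<omega>)\<^sup>2 + 2 * b * (\<Sum>j\<in>J. Y j \<omega>) + b\<^sup>2)"
    unfolding Y_def b_def sum_subtractf by (auto simp: power2_eq_square algebra_simps)
  show "integrable M (\<lambda>\<omega>. ((\<Sum>j\<in>J. X j \<omega>) - c)\<^sup>2)"
    unfolding eq using m(1,3) by simp
  have "expectation (\<lambda>\<omega>. ((\<Sum>j\<in>J. X j \<omega>) - c)\<^sup>2) = (\<Sum>j\<in>J. expectation (\<lambda>\<omega>. (Y j \<omega>)\<^sup>2)) + b\<^sup>2"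
    unfolding eq using m by (simp add: prob_space)
  also have "\<dots> \<le> (\<Sum>j\<in>J. expectation (\<lambda>\<omega>. (X j \<omega>)\<^sup>2)) + b\<^sup>2"
    by (intro add_right_mono sum_mono Yi(4))
  finally show "expectation (\<lambda>\<omega>. ((\<Sum>j\<in>J. X j \<omega>) - c)\<^sup>2)
      \<le> (\<Sum>j\<in>J. expectation (\<lambda>\<omega>. (X j \<omega>)\<^sup>2)) + ((\<Sum>j\<in>J. expectation (X j)) - c)\<^sup>2"
    by (simp add: b_def)
qed

section \<open>The scheme on the canonical space\<close>

definition init_term :: "nat \<Rightarrow> ((nat \<Rightarrow> real) \<Rightarrow> real) \<Rightarrow> real \<Rightarrow> (nat \<Rightarrow> real) \<Rightarrow> (nat \<Rightarrow> real) \<Rightarrow> nat \<Rightarrow> real" where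
  "init_term d g t x z k = (g (add_scaled d x (sqrt (2 * t)) z) - g x) * one_scaled (sqrt (2 * t)) z k"

text \<open>The indicator is 1 along the given random variables; it keeps the time argument of h in
  (0, t) on the whole canonical space.\<close>
definition source_term ::
  "nat \<Rightarrow> real \<Rightarrow> (nat \<Rightarrow> real) \<Rightarrow> (nat \<Rightarrow> real) \<times> real \<Rightarrow> nat \<Rightarrow> (real \<Rightarrow> (nat \<Rightarrow> real) \<Rightarrow> real) \<Rightarrow> real" where
  "source_term d t x p k h = indicator {0<..<1} (snd p) * (2 * t * sqrt (snd p)
     * h (t * (1 - snd p)) (add_scaled d x (sqrt (2 * t * snd p)) (fst p))
     * one_scaled (sqrt (2 * t * snd p)) (fst p) k)"

text \<open>The scheme at the root index as a function of the whole input \<omega>. There is no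
  level -1: for l = 0 the factor \<open>of_bool (l \<ge> 1)\<close> is 0, and the truncated
  difference l - 1 stays below n.\<close>

function mlp :: "nat \<Rightarrow> (real \<Rightarrow> (nat \<Rightarrow> real) \<Rightarrow> real) \<Rightarrow> ((nat \<Rightarrow> real) \<Rightarrow> real) \<Rightarrow> nat \<Rightarrow> nat \<Rightarrow>
    real \<Rightarrow> (nat \<Rightarrow> real) \<Rightarrow> (int list \<Rightarrow> (nat \<Rightarrow> real) \<times> real) \<Rightarrow> nat \<Rightarrow> real" where
  "mlp d f g M n t x \<omega> k = (if n = 0 then 0 else
     (if k = 0 then g x else 0)
     + (\<Sum>i=1..M^n. 1 / real (M^n) * init_term d g t x (fst (\<omega> [0, - int i])) k)
     + (\<Sum>l=0..<n. \<Sum>i=1..M^(n - l). 1 / real (M^(n - l)) *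
          source_term d t x (\<omega> [int l, int i]) k (\<lambda>s y.
            app_R1d d f (mlp d f g M l s y (subtree [int l, int i] \<omega>))
            - of_bool (l \<ge> 1) * app_R1d d f (mlp d f g M (l - 1) s y (subtree [- int l, int i] \<omega>)))))"
  by pat_completeness auto
termination
  by (relation "Wellfounded.measure (\<lambda>(d, f, g, M, n, _). n)") auto

declare mlp.simps [simp del]

lemma mlp_0: "mlp d f g M 0 = (\<lambda>t x \<omega> k. 0)"
  by (auto simp: mlp.simps fun_eq_iff)

lemma measurable_pair_continuous:
  assumes v: "continuous_map (prod_topology euclideanreal (powertop_real {1..d})) euclideanreal (\<lambda>(y, z). f y z)"
    and \<tau>: "\<tau> \<in> borel_measurable M" and X: "X \<in> M \<rightarrow>\<^sub>M borel_Rd d"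
  shows "(\<lambda>\<omega>. f (\<tau> \<omega>) (X \<omega>)) \<in> borel_measurable M"
proof -
  have "continuous_on UNIV (\<lambda>p::real \<times> (nat \<Rightarrow> real). f (fst p) (restrict (snd p) {1..d}))"
  proof (rule continuous_on_pair_compose[where A=UNIV and v=f and \<tau>=fst and X="\<lambda>p. restrict (snd p) {1..d}"])
    show "continuous_map (prod_topology (top_of_set UNIV) (powertop_real {1..d})) euclideanreal (\<lambda>(y, z). f y z)"
      using v by simp
    show "continuous_on UNIV (\<lambda>p::real \<times> (nat \<Rightarrow> real). restrict (snd p) {1..d})"
      by (intro continuous_on_restrictI continuous_on_snd continuous_on_id)
  qed (auto intro: continuous_on_fst[OF continuous_on_id])
  from borel_measurable_continuous_onI[OF this]
  have m: "(\<lambda>p::real \<times> (nat \<Rightarrow> real). f (fst p) (restrict (snd p) {1..d})) \<in> borel_measurable borel" .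
  have "(\<lambda>\<omega>. (\<tau> \<omega>, X \<omega>)) \<in> M \<rightarrow>\<^sub>M borel"
    unfolding borel_prod[symmetric] using \<tau> measurable_compose[OF X measurable_Rd_borel] by simp
  from measurable_compose[OF this m]
  have "(\<lambda>\<omega>. f (\<tau> \<omega>) (restrict (X \<omega>) {1..d})) \<in> borel_measurable M" by simp
  then show ?thesis
  proof (rule measurable_cong[THEN iffD1, rotated])
    fix \<omega> assume \<omega>: "\<omega> \<in> space M"
    have "X \<omega> \<in> Rd d" using measurable_space[OF X \<omega>] by (simp add: space_PiM)
    then show "f (\<tau> \<omega>) (restrict (X \<omega>) {1..d}) = f (\<tau> \<omega>) (X \<omega>)"
      by (simp add: restrict_Rd)
  qed
qed

lemma measurable_step_fst: "fst \<in> step_law d \<rightarrow>\<^sub>M borel_Rd d"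
  and measurable_step_snd: "snd \<in> borel_measurable (step_law d)"
  using measurable_fst[of "borel_Rd d" borel] measurable_snd[of "borel_Rd d" borel]
  by (simp_all cong: measurable_cong_sets add: sets_step_law)

text \<open>The function h may itself depend on the sample. It has to be measurable only after
  insertion of the random time and point, which is the form in which the recursion supplies
  it.\<close>

lemma measurable_source_term:
  assumes t: "\<tau> \<in> borel_measurable M" and x: "X \<in> M \<rightarrow>\<^sub>M borel_Rd d" and p: "p \<in> M \<rightarrow>\<^sub>M step_law d" and k: "k \<le> d"
    and h: "(\<lambda>\<omega>. h \<omega> (\<tau> \<omega> * (1 - snd (p \<omega>))) (add_scaled d (X \<omega>) (sqrt (2 * \<tau> \<omega> * snd (p \<omega>))) (fst (p \<omega>)))) \<in> borel_measurable M"
  shows "(\<lambda>\<omega>. source_term d (\<tau> \<omega>) (X \<omega>) (p \<omega>) k (h \<omega>)) \<in> borel_measurable M"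
proof -
  have aux: "(\<lambda>\<omega>. sqrt (2 * a \<omega> * b \<omega>)) \<in> borel_measurable M" "(\<lambda>\<omega>. 2 * a \<omega> * sqrt (b \<omega>)) \<in> borel_measurable M"
      "(\<lambda>\<omega>. indicator {0<..<1} (b \<omega>) :: real) \<in> borel_measurable M"
    if [measurable]: "a \<in> borel_measurable M" "b \<in> borel_measurable M" for a b :: "'a \<Rightarrow> real"
    by measurable
  have s: "(\<lambda>\<omega>. snd (p \<omega>)) \<in> borel_measurable M"
    by (rule measurable_compose[OF p measurable_step_snd])
  have z: "(\<lambda>\<omega>. fst (p \<omega>)) \<in> M \<rightarrow>\<^sub>M borel_Rd d"
    by (rule measurable_compose[OF p measurable_step_fst])
  show ?thesis
    unfolding source_term_def
    by (intro borel_measurable_times measurable_one_scaled[OF aux(1)[OF t s] z k] aux(2,3)[OF t s] aux(3)[OF s s] h)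
qed

lemma measurable_init_term:
  assumes g: "continuous_map (powertop_real {1..d}) euclideanreal g"
    and t: "\<tau> \<in> borel_measurable M" and x: "X \<in> M \<rightarrow>\<^sub>M borel_Rd d" and z: "z \<in> M \<rightarrow>\<^sub>M borel_Rd d" and k: "k \<le> d"
  shows "(\<lambda>\<omega>. init_term d g (\<tau> \<omega>) (X \<omega>) (z \<omega>) k) \<in> borel_measurable M"
proof -
  have s: "(\<lambda>\<omega>. sqrt (2 * \<tau> \<omega>)) \<in> borel_measurable M" using t by measurable
  show ?thesis
    unfolding init_term_def
    by (intro borel_measurable_times borel_measurable_diff measurable_one_scaled[OF s z k]
        measurable_compose[OF measurable_add_scaled[OF x s z] measurable_Rd_continuous[OF g]]
        measurable_compose[OF x measurable_Rd_continuous[OF g]])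
qed

lemma measurable_app_R1d:
  assumes f: "continuous_map (prod_topology euclideanreal (powertop_real {1..d})) euclideanreal (\<lambda>(y, z). f y z)"
    and V: "\<And>k. k \<le> d \<Longrightarrow> (\<lambda>\<omega>. V \<omega> k) \<in> borel_measurable M"
  shows "(\<lambda>\<omega>. app_R1d d f (V \<omega>)) \<in> borel_measurable M"
  unfolding app_R1d_def
  by (intro measurable_pair_continuous[OF f] measurable_restrict V) auto

text \<open>Time, point and input are arbitrary measurable functions because a recursive call is
  evaluated at a random time and point and on a subtree.\<close>

lemma measurable_mlp:
  assumes f: "continuous_map (prod_topology euclideanreal (powertop_real {1..d})) euclideanreal (\<lambda>(y, z). f y z)"
    and g: "continuous_map (powertop_real {1..d}) euclideanreal g"
    and "\<tau> \<in> borel_measurable N" "X \<in> N \<rightarrow>\<^sub>M borel_Rd d" "W \<in> N \<rightarrow>\<^sub>M tree_law d" "k \<le> d"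
  shows "(\<lambda>a. mlp d f g M n (\<tau> a) (X a) (W a) k) \<in> borel_measurable N"
  using assms(3-6)
proof (induction n arbitrary: \<tau> X W k rule: less_induct)
  case (less n)
  note t = less.prems(1) and X = less.prems(2) and W = less.prems(3) and k = less.prems(4)
  have comp: "(\<lambda>a. W a [p, q]) \<in> N \<rightarrow>\<^sub>M step_law d" for p q
    by (rule measurable_compose[OF W measurable_tree_component]) (simp add: Theta_def)
  have sub: "(\<lambda>a. subtree \<theta> (W a)) \<in> N \<rightarrow>\<^sub>M tree_law d" for \<theta>
    by (rule measurable_compose[OF W measurable_subtree])
  have snd: "(\<lambda>a. snd (W a [p, q])) \<in> borel_measurable N" for p q
    by (rule measurable_compose[OF comp measurable_step_snd])
  have fst: "(\<lambda>a. fst (W a [p, q])) \<in> N \<rightarrow>\<^sub>M borel_Rd d" for p q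
    by (rule measurable_compose[OF comp measurable_step_fst])
  have s: "(\<lambda>a. \<tau> a * (1 - snd (W a [p, q]))) \<in> borel_measurable N" for p q
    by (rule borel_measurable_times[OF t borel_measurable_diff[OF borel_measurable_const snd]])
  have sqrt2: "(\<lambda>\<omega>. sqrt (2 * a \<omega> * b \<omega>)) \<in> borel_measurable N"
    if [measurable]: "a \<in> borel_measurable N" "b \<in> borel_measurable N" for a b :: "'a \<Rightarrow> real"
    by measurable
  have y: "(\<lambda>a. add_scaled d (X a) (sqrt (2 * \<tau> a * snd (W a [p, q]))) (fst (W a [p, q]))) \<in> N \<rightarrow>\<^sub>M borel_Rd d" for p q
    using t snd[of p q] by (intro measurable_add_scaled X fst sqrt2)
  have inner: "(\<lambda>a. app_R1d d f (mlp d f g M l (\<tau> a * (1 - snd (W a [p, q])))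
      (add_scaled d (X a) (sqrt (2 * \<tau> a * snd (W a [p, q]))) (fst (W a [p, q]))) (subtree \<theta> (W a)))) \<in> borel_measurable N"
    if "l < n" for l p q \<theta>
    by (rule measurable_app_R1d[OF f]) (rule less.IH[OF that s y sub])
  show ?case
  proof (cases "n = 0")
    case False
    have "(\<lambda>a. (if k = 0 then g (X a) else 0)
     + (\<Sum>i=1..M^n. 1 / real (M^n) * init_term d g (\<tau> a) (X a) (fst (W a [0, - int i])) k)
     + (\<Sum>l=0..<n. \<Sum>i=1..M^(n - l). 1 / real (M^(n - l)) *
          source_term d (\<tau> a) (X a) (W a [int l, int i]) k (\<lambda>s y.
            app_R1d d f (mlp d f g M l s y (subtree [int l, int i] (W a)))
            - of_bool (l \<ge> 1) * app_R1d d f (mlp d f g M (l - 1) s y (subtree [- int l, int i] (W a)))))) \<in> borel_measurable N"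
    proof (intro borel_measurable_add borel_measurable_sum borel_measurable_times borel_measurable_const
        measurable_init_term[OF g t X fst k] measurable_source_term[OF t X comp k] borel_measurable_diff inner)
      show "(\<lambda>a. if k = 0 then g (X a) else 0) \<in> borel_measurable N"
        using measurable_compose[OF X measurable_Rd_continuous[OF g]] by simp
    qed auto
    then show ?thesis using False by (subst mlp.simps) simp
  qed (simp add: mlp_0)
qed

section \<open>Second moments\<close>

text \<open>The nonnegative integral makes integrability a consequence of the bound, so that
  finiteness and size of a second moment are proved together.\<close>

definition second_moment_le :: "'a measure \<Rightarrow> ('a \<Rightarrow> real) \<Rightarrow> real \<Rightarrow> bool" where
  "second_moment_le Q X c \<longleftrightarrow> X \<in> borel_measurable Q \<and> (\<integral>\<^sup>+\<omega>. ennreal ((X \<omega>)\<^sup>2) \<partial>Q) \<le> ennreal c"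

lemma second_moment_leD:
  assumes X: "second_moment_le Q X c" and c: "c \<ge> 0"
  shows "X \<in> borel_measurable Q" "integrable Q (\<lambda>\<omega>. (X \<omega>)\<^sup>2)" "(\<integral>\<omega>. (X \<omega>)\<^sup>2 \<partial>Q) \<le> c"
proof -
  show m: "X \<in> borel_measurable Q" using X by (simp add: second_moment_le_def)
  have le: "(\<integral>\<^sup>+\<omega>. ennreal ((X \<omega>)\<^sup>2) \<partial>Q) \<le> ennreal c" using X by (simp add: second_moment_le_def)
  show i: "integrable Q (\<lambda>\<omega>. (X \<omega>)\<^sup>2)"
    by (rule integrableI_nonneg) (use m le in \<open>auto intro: le_less_trans\<close>)
  have "ennreal (\<integral>\<omega>. (X \<omega>)\<^sup>2 \<partial>Q) \<le> ennreal c"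
    using le nn_integral_eq_integral[OF i] by simp
  then show "(\<integral>\<omega>. (X \<omega>)\<^sup>2 \<partial>Q) \<le> c" using c by (simp add: ennreal_le_iff)
qed

lemma second_moment_leI:
  assumes "X \<in> borel_measurable Q" "integrable Q Y" "\<And>\<omega>. \<omega> \<in> space Q \<Longrightarrow> (X \<omega>)\<^sup>2 \<le> Y \<omega>" "(\<integral>\<omega>. Y \<omega> \<partial>Q) \<le> c"
  shows "second_moment_le Q X c"
proof -
  have "(\<integral>\<^sup>+\<omega>. ennreal ((X \<omega>)\<^sup>2) \<partial>Q) \<le> (\<integral>\<^sup>+\<omega>. ennreal (Y \<omega>) \<partial>Q)"
    by (intro nn_integral_mono ennreal_leI assms)
  also have "\<dots> = ennreal (\<integral>\<omega>. Y \<omega> \<partial>Q)"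
    by (rule nn_integral_eq_integral[OF assms(2)]) (use assms(3) in \<open>auto intro!: AE_I2 intro: order_trans[OF zero_le_power2]\<close>)
  also have "\<dots> \<le> ennreal c" by (rule ennreal_leI) fact
  finally show ?thesis using assms(1) by (simp add: second_moment_le_def)
qed

lemma second_moment_le_diff:
  assumes X: "second_moment_le Q X a" "a \<ge> 0" and Y: "second_moment_le Q Y b" "b \<ge> 0"
  shows "second_moment_le Q (\<lambda>\<omega>. X \<omega> - Y \<omega>) (2 * a + 2 * b)"
proof (rule second_moment_leI[where Y="\<lambda>\<omega>. 2 * (X \<omega>)\<^sup>2 + 2 * (Y \<omega>)\<^sup>2"])
  note x = second_moment_leD[OF X] and y = second_moment_leD[OF Y]
  show "(\<lambda>\<omega>. X \<omega> - Y \<omega>) \<in> borel_measurable Q" using x y by simp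
  show "integrable Q (\<lambda>\<omega>. 2 * (X \<omega>)\<^sup>2 + 2 * (Y \<omega>)\<^sup>2)" using x y by simp
  show "(\<integral>\<omega>. 2 * (X \<omega>)\<^sup>2 + 2 * (Y \<omega>)\<^sup>2 \<partial>Q) \<le> 2 * a + 2 * b" using x y by simp
  fix \<omega> show "(X \<omega> - Y \<omega>)\<^sup>2 \<le> 2 * (X \<omega>)\<^sup>2 + 2 * (Y \<omega>)\<^sup>2"
    using zero_le_power2[of "X \<omega> + Y \<omega>"] by (simp add: power2_eq_square algebra_simps)
qed

lemma second_moment_le_cmult:
  assumes X: "second_moment_le Q X a" "a \<ge> 0"
  shows "second_moment_le Q (\<lambda>\<omega>. b * X \<omega>) (b\<^sup>2 * a)"
  by (rule second_moment_leI[where Y="\<lambda>\<omega>. b\<^sup>2 * (X \<omega>)\<^sup>2"])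
    (use second_moment_leD[OF X] in \<open>auto simp: power_mult_distrib intro: mult_left_mono\<close>)

lemma second_moment_le_distr:
  assumes X: "second_moment_le Q X a" and f: "f \<in> P \<rightarrow>\<^sub>M Q" and d: "distr P Q f = Q"
  shows "second_moment_le P (\<lambda>\<omega>. X (f \<omega>)) a"
proof -
  have Xm: "X \<in> borel_measurable Q" using X by (simp add: second_moment_le_def)
  have "(\<integral>\<^sup>+\<omega>. ennreal ((X (f \<omega>))\<^sup>2) \<partial>P) = (\<integral>\<^sup>+\<omega>. ennreal ((X \<omega>)\<^sup>2) \<partial>distr P Q f)"
    using Xm by (subst nn_integral_distr[OF f]) auto
  then show ?thesis
    using X Xm unfolding d by (auto simp: second_moment_le_def intro: measurable_compose[OF f])
qed

lemma (in prob_space) second_moment_le_mean: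
  assumes X: "second_moment_le M X a" "a \<ge> 0"
  shows "integrable M X" "(expectation X)\<^sup>2 \<le> a"
proof -
  note x = second_moment_leD[OF X]
  show i: "integrable M X" by (rule square_integrable_imp_integrable[OF x(1,2)])
  have "0 \<le> variance X" by (rule variance_positive)
  then show "(expectation X)\<^sup>2 \<le> a" using variance_eq[OF i x(2)] x(3) by simp
qed

text \<open>A Gaussian step of variance s^2 per coordinate adds d s^2 to the mean of
  \<open>norm2\<close>. The summand d absorbs this, so the weight is reproduced up to a factor
  independent of d.\<close>

definition weight :: "nat \<Rightarrow> (nat \<Rightarrow> real) \<Rightarrow> real" where
  "weight d x = real d + norm2 d x"

lemma weight_ge_1: "d \<ge> 1 \<Longrightarrow> weight d x \<ge> 1"
  using norm2_nonneg[of d x] by (simp add: weight_def)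

text \<open>Mixed moments are reduced to single coordinates by 2 a^2 b^2 \<le> a^4 + b^4; the
  coefficient 6 is twice the fourth moment 3.\<close>

lemma nn_integral_weight:
  assumes k: "k \<le> d"
  shows "(\<integral>\<^sup>+z. ennreal ((if k = 0 then 1 else (z k)\<^sup>2) * weight d (add_scaled d x s z)) \<partial>std_normal_Rd d)
    \<le> ennreal ((2 + 6 * s\<^sup>2) * weight d x)"
proof -
  interpret \<gamma>: prob_space "std_normal_Rd d" by (rule prob_space_std_normal_Rd)
  let ?\<gamma> = "std_normal_Rd d"
  have w: "weight d (add_scaled d x s z) \<le> real d + (\<Sum>j\<in>{1..d}. 2 * (x j)\<^sup>2 + 2 * s\<^sup>2 * (z j)\<^sup>2)" for z
    unfolding weight_def norm2_def
  proof (intro add_left_mono sum_mono)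
    fix j assume "j \<in> {1..d}"
    then show "(add_scaled d x s z j)\<^sup>2 \<le> 2 * (x j)\<^sup>2 + 2 * s\<^sup>2 * (z j)\<^sup>2"
      using zero_le_power2[of "x j - s * z j"] by (simp add: add_scaled_def power2_eq_square algebra_simps)
  qed
  define Y where "Y z = (if k = 0 then real d + (\<Sum>j\<in>{1..d}. 2 * (x j)\<^sup>2 + 2 * s\<^sup>2 * (z j)\<^sup>2)
    else real d * (z k)\<^sup>2 + (\<Sum>j\<in>{1..d}. 2 * (x j)\<^sup>2 * (z k)\<^sup>2 + s\<^sup>2 * ((z j)^4 + (z k)^4)))" for z
  have le: "(if k = 0 then 1 else (z k)\<^sup>2) * weight d (add_scaled d x s z) \<le> Y z" for z
  proof (cases "k = 0")
    case False
    have "(z k)\<^sup>2 * weight d (add_scaled d x s z) \<le> (z k)\<^sup>2 * (real d + (\<Sum>j\<in>{1..d}. 2 * (x j)\<^sup>2 + 2 * s\<^sup>2 * (z j)\<^sup>2))"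
      by (rule mult_left_mono[OF w]) simp
    also have "\<dots> = real d * (z k)\<^sup>2 + (\<Sum>j\<in>{1..d}. 2 * (x j)\<^sup>2 * (z k)\<^sup>2 + s\<^sup>2 * (2 * (z j)\<^sup>2 * (z k)\<^sup>2))"
      by (simp add: distrib_left sum_distrib_left algebra_simps)
    also have "\<dots> \<le> Y z"
      using False unfolding Y_def
    proof (simp, intro sum_mono add_left_mono mult_left_mono)
      fix j
      show "2 * (z j)\<^sup>2 * (z k)\<^sup>2 \<le> z j ^ 4 + z k ^ 4"
        using zero_le_power2[of "(z j)\<^sup>2 - (z k)\<^sup>2"] by (simp add: power2_eq_square power4_eq_xxxx algebra_simps)
    qed simp
    finally show ?thesis using False by simp
  qed (use w Y_def in simp)
  have mom: "integrable ?\<gamma> (\<lambda>z. (z j)\<^sup>2)" "(\<integral>z. (z j)\<^sup>2 \<partial>?\<gamma>) = 1"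
    "integrable ?\<gamma> (\<lambda>z. (z j)^4)" "(\<integral>z. (z j)^4 \<partial>?\<gamma>) = 3" if "j \<in> {1..d}" for j
    using std_normal_coordinate_moments[OF that] by auto
  have Yi: "integrable ?\<gamma> Y \<and> (\<integral>z. Y z \<partial>?\<gamma>) \<le> (2 + 6 * s\<^sup>2) * weight d x"
  proof (cases "k = 0")
    case True
    have "integrable ?\<gamma> (\<lambda>z. (\<Sum>j\<in>{1..d}. 2 * (x j)\<^sup>2 + 2 * s\<^sup>2 * (z j)\<^sup>2))"
      using mom by (intro Bochner_Integration.integrable_sum) auto
    moreover have "(\<integral>z. (\<Sum>j\<in>{1..d}. 2 * (x j)\<^sup>2 + 2 * s\<^sup>2 * (z j)\<^sup>2) \<partial>?\<gamma>) = (\<Sum>j\<in>{1..d}. 2 * (x j)\<^sup>2 + 2 * s\<^sup>2)"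
      using mom by (subst Bochner_Integration.integral_sum) (auto simp: \<gamma>.prob_space)
    ultimately have "integrable ?\<gamma> Y" "(\<integral>z. Y z \<partial>?\<gamma>) = real d + (2 * norm2 d x + 2 * s\<^sup>2 * real d)"
      using True unfolding Y_def by (simp_all add: \<gamma>.prob_space sum.distrib sum_distrib_left norm2_def)
    moreover have "real d + (2 * norm2 d x + 2 * s\<^sup>2 * real d) \<le> (2 + 6 * s\<^sup>2) * weight d x"
      using norm2_nonneg[of d x] by (simp add: weight_def algebra_simps)
    ultimately show ?thesis by simp
  next
    case False
    then have k': "k \<in> {1..d}" using k by simp
    have "integrable ?\<gamma> (\<lambda>z. (\<Sum>j\<in>{1..d}. 2 * (x j)\<^sup>2 * (z k)\<^sup>2 + s\<^sup>2 * ((z j)^4 + (z k)^4)))"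
      using mom mom[OF k'] by (intro Bochner_Integration.integrable_sum) auto
    moreover have "(\<integral>z. (\<Sum>j\<in>{1..d}. 2 * (x j)\<^sup>2 * (z k)\<^sup>2 + s\<^sup>2 * ((z j)^4 + (z k)^4)) \<partial>?\<gamma>) = (\<Sum>j\<in>{1..d}. 2 * (x j)\<^sup>2 + s\<^sup>2 * 6)"
      using mom mom[OF k'] by (subst Bochner_Integration.integral_sum) auto
    ultimately have "integrable ?\<gamma> Y" "(\<integral>z. Y z \<partial>?\<gamma>) = real d + (2 * norm2 d x + 6 * s\<^sup>2 * real d)"
      using False mom[OF k'] unfolding Y_def by (simp_all add: sum.distrib sum_distrib_left norm2_def)
    moreover have "real d + (2 * norm2 d x + 6 * s\<^sup>2 * real d) \<le> (2 + 6 * s\<^sup>2) * weight d x"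
      using norm2_nonneg[of d x] by (simp add: weight_def algebra_simps)
    ultimately show ?thesis by simp
  qed
  have "(\<integral>\<^sup>+z. ennreal ((if k = 0 then 1 else (z k)\<^sup>2) * weight d (add_scaled d x s z)) \<partial>?\<gamma>) \<le> (\<integral>\<^sup>+z. ennreal (Y z) \<partial>?\<gamma>)"
    by (intro nn_integral_mono ennreal_leI le)
  also have "\<dots> = ennreal (\<integral>z. Y z \<partial>?\<gamma>)"
  proof (rule nn_integral_eq_integral)
    show "AE z in ?\<gamma>. 0 \<le> Y z"
      unfolding Y_def by (intro AE_I2) (auto intro!: add_nonneg_nonneg sum_nonneg mult_nonneg_nonneg)
  qed (use Yi in simp)
  also have "\<dots> \<le> ennreal ((2 + 6 * s\<^sup>2) * weight d x)"
    using Yi by (intro ennreal_leI) simp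
  finally show ?thesis .
qed

section \<open>Gaussian integrals that produce the factor of order \<beta>^(-1/2)\<close>

lemma nn_integral_exp_square:
  fixes c :: real
  assumes c: "c > 0"
  shows "(\<integral>\<^sup>+v. ennreal (exp (- c * v\<^sup>2)) \<partial>lborel) = ennreal (sqrt (pi / c))"
proof -
  define \<sigma> where "\<sigma> = 1 / sqrt (2 * c)"
  have \<sigma>: "\<sigma> > 0" "2 * \<sigma>\<^sup>2 = 1 / c" using c by (simp_all add: \<sigma>_def power_divide)
  have "exp (- c * v\<^sup>2) = sqrt (pi / c) * normal_density 0 \<sigma> v" for v
  proof -
    have "2 * pi * \<sigma>\<^sup>2 = pi / c" using arg_cong[OF \<sigma>(2), of "\<lambda>y. pi * y"] by (simp add: ac_simps)
    moreover have "- (v - 0)\<^sup>2 / (2 * \<sigma>\<^sup>2) = - c * v\<^sup>2" using \<sigma>(2) by simp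
    moreover have "sqrt (pi / c) > 0" using c by simp
    ultimately show ?thesis unfolding normal_density_def using c by simp
  qed
  then have "(\<integral>\<^sup>+v. ennreal (exp (- c * v\<^sup>2)) \<partial>lborel) = (\<integral>\<^sup>+v. ennreal (sqrt (pi / c)) * ennreal (normal_density 0 \<sigma> v) \<partial>lborel)"
    using c by (simp add: ennreal_mult normal_density_nonneg)
  also have "\<dots> = ennreal (sqrt (pi / c)) * (\<integral>\<^sup>+v. ennreal (normal_density 0 \<sigma> v) \<partial>lborel)"
    by (rule nn_integral_cmult) simp
  also have "(\<integral>\<^sup>+v. ennreal (normal_density 0 \<sigma> v) \<partial>lborel) = 1"
    using integral_normal_density[OF \<sigma>(1), of 0] integrable_normal_density[OF \<sigma>(1), of 0]
    by (subst nn_integral_eq_integral) (auto simp: normal_density_nonneg)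
  finally show ?thesis by simp
qed

text \<open>With \<rho> = v^2 for a uniform v the integrand becomes Gaussian, and (0, 1) may be
  enlarged to the whole line.\<close>

lemma nn_integral_rlaw_exp:
  assumes c: "c > 0"
  shows "(\<integral>\<^sup>+\<rho>. ennreal (exp (- c * \<rho>)) \<partial>rlaw) \<le> ennreal (sqrt (pi / c))"
proof -
  have "(\<integral>\<^sup>+\<rho>. ennreal (exp (- c * \<rho>)) \<partial>rlaw) = (\<integral>\<^sup>+v. ennreal (exp (- c * v\<^sup>2)) \<partial>unif01)"
    unfolding rlaw_def by (subst nn_integral_distr) auto
  also have "\<dots> = (\<integral>\<^sup>+v. ennreal (indicator {0<..<1} v) * ennreal (exp (- c * v\<^sup>2)) \<partial>lborel)"
    unfolding unif01_def by (subst nn_integral_density) auto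
  also have "\<dots> \<le> (\<integral>\<^sup>+v. ennreal (exp (- c * v\<^sup>2)) \<partial>lborel)"
    by (intro nn_integral_mono) (auto simp: indicator_def)
  also have "\<dots> = ennreal (sqrt (pi / c))" by (rule nn_integral_exp_square[OF c])
  finally show ?thesis .
qed

text \<open>Three factors are collected: 4 T + 2 from the squared weight of the source term after
  splitting off one t, 2 + 12 T from the Gaussian mean of \<open>weight\<close>, and sqrt (2 T) from
  that t times the exponential integral.\<close>

definition source_const :: "real \<Rightarrow> real" where
  "source_const T = (4 * T + 2) * (2 + 12 * T) * sqrt (2 * T)"

text \<open>For a gradient component, (2 t sqrt \<rho>)^2 / (2 t \<rho>) is the constant 2 t: the
  prefactor cancels the singularity of the weight. For k = 0 the factor is 4 t^2 \<rho>. The sum of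
  the two bounds covers both cases.\<close>

lemma source_term_square_le:
  assumes t: "0 < t"
  shows "(source_term d t x (z, \<rho>) k h)\<^sup>2 \<le> (4 * t\<^sup>2 + 2 * t) * (indicator {0<..<1} \<rho>
     * ((if k = 0 then 1 else (z k)\<^sup>2) * (h (t * (1 - \<rho>)) (add_scaled d x (sqrt (2 * t * \<rho>)) z))\<^sup>2))"
proof (cases "\<rho> \<in> {0<..<1}")
  case True
  define H where "H = h (t * (1 - \<rho>)) (add_scaled d x (sqrt (2 * t * \<rho>)) z)"
  have s: "(source_term d t x (z, \<rho>) k h)\<^sup>2 = (if k = 0 then 4 * t\<^sup>2 * \<rho> else 2 * t * (z k)\<^sup>2) * H\<^sup>2"
  proof (cases "k = 0")
    case True then show ?thesis using \<open>\<rho> \<in> {0<..<1}\<close>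
      by (simp add: source_term_def one_scaled_def H_def power_mult_distrib)
  next
    case False
    have "(2 * t * sqrt \<rho> * H * (z k / sqrt (2 * t * \<rho>)))\<^sup>2 = 4 * t\<^sup>2 * \<rho> * H\<^sup>2 * ((z k)\<^sup>2 / (2 * t * \<rho>))"
      using True t by (simp add: power_mult_distrib power_divide)
    also have "\<dots> = 2 * t * (z k)\<^sup>2 * H\<^sup>2" using True t by (simp add: power2_eq_square field_simps)
    finally show ?thesis using True False by (simp add: source_term_def one_scaled_def H_def)
  qed
  have "(if k = 0 then 4 * t\<^sup>2 * \<rho> else 2 * t * (z k)\<^sup>2) \<le> (4 * t\<^sup>2 + 2 * t) * (if k = 0 then 1 else (z k)\<^sup>2)"
  proof (cases "k = 0")
    case k: True
    have "4 * t\<^sup>2 * \<rho> \<le> 4 * t\<^sup>2 * 1" using True by (intro mult_left_mono) auto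
    then show ?thesis unfolding if_P[OF k] mult_1_right using t by linarith
  qed (auto simp: distrib_right)
  then have "(if k = 0 then 4 * t\<^sup>2 * \<rho> else 2 * t * (z k)\<^sup>2) * H\<^sup>2 \<le> (4 * t\<^sup>2 + 2 * t) * (if k = 0 then 1 else (z k)\<^sup>2) * H\<^sup>2"
    by (rule mult_right_mono) simp
  then show ?thesis unfolding s using True by (simp add: H_def mult.assoc)
qed (simp add: source_term_def)

text \<open>At the time s = t (1 - \<rho>) reached by the step, exp (2 \<beta> s) = exp (2 \<beta>
  t) exp (- 2 \<beta> t \<rho>). Integrating over \<omega>, then z, then \<rho> reproduces the
  weight at (t, x), and the last integral contributes the factor of order \<beta>^(-1/2), which is
  small for large \<beta>.\<close>

lemma source_second_moment:
  assumes t: "0 < t" "t \<le> T" and k: "k \<le> d" and \<beta>: "\<beta> > 0" and c: "c \<ge> 0" and Q: "prob_space Q"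
    and meas: "(\<lambda>(p, \<omega>). source_term d t x p k (\<Phi> \<omega>)) \<in> borel_measurable (step_law d \<Otimes>\<^sub>M Q)"
    and \<Phi>: "\<And>s y. 0 < s \<Longrightarrow> s < t \<Longrightarrow> y \<in> Rd d \<Longrightarrow> second_moment_le Q (\<lambda>\<omega>. \<Phi> \<omega> s y) (c * exp (2 * \<beta> * s) * weight d y)"
  shows "second_moment_le (step_law d \<Otimes>\<^sub>M Q) (\<lambda>(p, \<omega>). source_term d t x p k (\<Phi> \<omega>))
    (source_const T / sqrt \<beta> * c * exp (2 * \<beta> * t) * weight d x)"
proof -
  interpret Q: prob_space Q by (rule Q)
  interpret \<gamma>: prob_space "std_normal_Rd d" by (rule prob_space_std_normal_Rd)
  interpret R: prob_space rlaw by (rule prob_space_rlaw)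
  interpret pair: pair_sigma_finite "std_normal_Rd d" rlaw ..
  define B where "B = (4 * t\<^sup>2 + 2 * t) * c * exp (2 * \<beta> * t)"
  have B: "B \<ge> 0" using t c by (simp add: B_def)
  define W where "W z \<rho> = (if k = 0 then 1 else (z k)\<^sup>2) * weight d (add_scaled d x (sqrt (2 * t * \<rho>)) z)" for z \<rho>
  have W0: "W z \<rho> \<ge> 0" for z \<rho> using norm2_nonneg[of d] by (auto simp: W_def weight_def)
  \<comment> \<open>For fixed p the function \<Phi> is evaluated at a single time and point, so the
    second moment bound there can be inserted before p is integrated.\<close>
  have inner: "(\<integral>\<^sup>+\<omega>. ennreal ((source_term d t x p k (\<Phi> \<omega>))\<^sup>2) \<partial>Q)
      \<le> ennreal (indicator {0<..<1} (snd p) * (B * exp (- (2 * \<beta> * t) * snd p) * W (fst p) (snd p)))" for p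
  proof (cases "snd p \<in> {0<..<1}")
    case True
    obtain z \<rho> where p: "p = (z, \<rho>)" by (cases p)
    have \<rho>: "0 < \<rho>" "\<rho> < 1" using True p by auto
    define s where "s = t * (1 - \<rho>)"
    define y where "y = add_scaled d x (sqrt (2 * t * \<rho>)) z"
    have s: "0 < s" "s < t" using \<rho> t by (auto simp: s_def)
    have y: "y \<in> Rd d" unfolding y_def by (rule add_scaled_Rd)
    define b where "b = (4 * t\<^sup>2 + 2 * t) * (if k = 0 then 1 else (z k)\<^sup>2)"
    have b: "b \<ge> 0" using t by (simp add: b_def)
    note sm = \<Phi>[OF s y]
    have "(\<integral>\<^sup>+\<omega>. ennreal ((source_term d t x p k (\<Phi> \<omega>))\<^sup>2) \<partial>Q) \<le> (\<integral>\<^sup>+\<omega>. ennreal b * ennreal ((\<Phi> \<omega> s y)\<^sup>2) \<partial>Q)"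
    proof (intro nn_integral_mono)
      fix \<omega>
      have "(source_term d t x p k (\<Phi> \<omega>))\<^sup>2 \<le> b * (\<Phi> \<omega> s y)\<^sup>2"
        using source_term_square_le[OF t(1), of d x z \<rho> k "\<Phi> \<omega>"] True
        unfolding p by (simp add: b_def s_def y_def mult.assoc)
      then show "ennreal ((source_term d t x p k (\<Phi> \<omega>))\<^sup>2) \<le> ennreal b * ennreal ((\<Phi> \<omega> s y)\<^sup>2)"
        using b by (simp add: ennreal_mult[symmetric] ennreal_leI)
    qed
    also have "\<dots> = ennreal b * (\<integral>\<^sup>+\<omega>. ennreal ((\<Phi> \<omega> s y)\<^sup>2) \<partial>Q)"
      using sm by (intro nn_integral_cmult) (auto simp: second_moment_le_def)
    also have "\<dots> \<le> ennreal b * ennreal (c * exp (2 * \<beta> * s) * weight d y)"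
      using sm by (intro mult_left_mono) (auto simp: second_moment_le_def)
    also have "\<dots> = ennreal (b * (c * exp (2 * \<beta> * s) * weight d y))"
      by (rule ennreal_mult[symmetric]) (use b c norm2_nonneg[of d y] in \<open>auto simp: weight_def\<close>)
    also have "b * (c * exp (2 * \<beta> * s) * weight d y) = B * exp (- (2 * \<beta> * t) * \<rho>) * W z \<rho>"
    proof -
      have "exp (2 * \<beta> * s) = exp (2 * \<beta> * t) * exp (- (2 * \<beta> * t) * \<rho>)"
        unfolding exp_add[symmetric] by (simp add: s_def algebra_simps)
      then show ?thesis by (simp add: b_def B_def W_def y_def)
    qed
    finally show ?thesis using True p by simp
  qed (simp add: source_term_def)
  have Wm: "(\<lambda>p. W (fst p) (snd p)) \<in> borel_measurable (std_normal_Rd d \<Otimes>\<^sub>M rlaw)"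
  proof -
    have fm: "fst \<in> std_normal_Rd d \<Otimes>\<^sub>M rlaw \<rightarrow>\<^sub>M borel_Rd d" and sm: "snd \<in> borel_measurable (std_normal_Rd d \<Otimes>\<^sub>M rlaw)"
      using measurable_step_fst[of d] measurable_step_snd[of d] by (simp_all add: step_law_def)
    have q: "(\<lambda>p. sqrt (2 * t * snd p)) \<in> borel_measurable (std_normal_Rd d \<Otimes>\<^sub>M rlaw)"
      using sm by simp
    have nm: "norm2 d \<in> borel_measurable (borel_Rd d)"
      unfolding norm2_def by (intro borel_measurable_sum borel_measurable_power measurable_component_singleton) auto
    have xm: "(\<lambda>p. add_scaled d x (sqrt (2 * t * snd p)) (fst p)) \<in> std_normal_Rd d \<Otimes>\<^sub>M rlaw \<rightarrow>\<^sub>M borel_Rd d"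
    proof -
      have "(\<lambda>p. add_scaled d (restrict x {1..d}) (sqrt (2 * t * snd p)) (fst p)) \<in> std_normal_Rd d \<Otimes>\<^sub>M rlaw \<rightarrow>\<^sub>M borel_Rd d"
        by (rule measurable_add_scaled[OF _ q fm]) (auto simp: space_PiM)
      then show ?thesis by (simp add: add_scaled_def cong: restrict_cong)
    qed
    have zk: "(\<lambda>p. (if k = 0 then 1 else (fst p k)\<^sup>2)) \<in> borel_measurable (std_normal_Rd d \<Otimes>\<^sub>M rlaw)"
    proof (cases "k = 0")
      case False
      have "(\<lambda>p. fst p k) \<in> borel_measurable (std_normal_Rd d \<Otimes>\<^sub>M rlaw)"
        using False k by (intro measurable_compose[OF fm measurable_component_singleton]) auto
      then show ?thesis using False by simp
    qed simp
    show ?thesis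
      unfolding W_def weight_def
      by (intro borel_measurable_times borel_measurable_add borel_measurable_const zk measurable_compose[OF xm nm])
  qed
  have "(\<integral>\<^sup>+p. ennreal (((\<lambda>(p, \<omega>). source_term d t x p k (\<Phi> \<omega>)) p)\<^sup>2) \<partial>(step_law d \<Otimes>\<^sub>M Q))
      = (\<integral>\<^sup>+p. (\<integral>\<^sup>+\<omega>. ennreal ((source_term d t x p k (\<Phi> \<omega>))\<^sup>2) \<partial>Q) \<partial>step_law d)"
    using meas by (subst Q.nn_integral_fst[symmetric]) auto
  also have "\<dots> \<le> (\<integral>\<^sup>+p. ennreal (B * exp (- (2 * \<beta> * t) * snd p) * W (fst p) (snd p)) \<partial>step_law d)"
    by (intro nn_integral_mono order_trans[OF inner] ennreal_leI) (use B W0 in \<open>auto simp: indicator_def\<close>)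
  also have "\<dots> = (\<integral>\<^sup>+\<rho>. (\<integral>\<^sup>+z. ennreal (B * exp (- (2 * \<beta> * t) * \<rho>)) * ennreal (W z \<rho>) \<partial>std_normal_Rd d) \<partial>rlaw)"
  proof -
    have sm: "snd \<in> borel_measurable (std_normal_Rd d \<Otimes>\<^sub>M rlaw)"
      using measurable_step_snd[of d] by (simp add: step_law_def)
    have "(\<lambda>p. ennreal (B * exp (- (2 * \<beta> * t) * snd p) * W (fst p) (snd p))) \<in> borel_measurable (std_normal_Rd d \<Otimes>\<^sub>M rlaw)"
      using sm by (intro measurable_compose[OF _ measurable_ennreal] borel_measurable_times Wm borel_measurable_const
          measurable_compose[OF _ borel_measurable_exp])
    from pair.nn_integral_snd[OF this] show ?thesis
      unfolding step_law_def using B W0 by (simp add: ennreal_mult)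
  qed
  also have "\<dots> \<le> (\<integral>\<^sup>+\<rho>. ennreal (B * ((2 + 12 * T) * weight d x)) * ennreal (exp (- (2 * \<beta> * t) * \<rho>)) \<partial>rlaw)"
  proof (rule nn_integral_mono_AE)
    \<comment> \<open>The factor 2 + 12 T for the Gaussian mean relies on 0 \<le> \<rho> \<le> 1,
      which holds almost surely.\<close>
    have "AE \<rho> in rlaw. 0 < \<rho> \<and> \<rho> < 1"
      unfolding rlaw_def unif01_def
      by (subst AE_distr_iff, simp, simp, subst AE_density) (auto simp: indicator_def power_less_one_iff intro!: AE_I2)
    then show "AE \<rho> in rlaw. (\<integral>\<^sup>+z. ennreal (B * exp (- (2 * \<beta> * t) * \<rho>)) * ennreal (W z \<rho>) \<partial>std_normal_Rd d)
        \<le> ennreal (B * ((2 + 12 * T) * weight d x)) * ennreal (exp (- (2 * \<beta> * t) * \<rho>))"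
    proof (rule AE_mp, intro AE_I2 impI)
      fix \<rho> :: real assume \<rho>: "0 < \<rho> \<and> \<rho> < 1"
      have Wz: "(\<lambda>z. ennreal (W z \<rho>)) \<in> borel_measurable (std_normal_Rd d)"
        using measurable_compose[OF measurable_Pair2'[of \<rho> rlaw "std_normal_Rd d"] measurable_compose[OF Wm measurable_ennreal]]
        by (simp add: rlaw_def)
      have "(\<integral>\<^sup>+z. ennreal (B * exp (- (2 * \<beta> * t) * \<rho>)) * ennreal (W z \<rho>) \<partial>std_normal_Rd d)
          = ennreal (B * exp (- (2 * \<beta> * t) * \<rho>)) * (\<integral>\<^sup>+z. ennreal (W z \<rho>) \<partial>std_normal_Rd d)"
        by (rule nn_integral_cmult[OF Wz])
      also have "\<dots> \<le> ennreal (B * exp (- (2 * \<beta> * t) * \<rho>)) * ennreal ((2 + 6 * (sqrt (2 * t * \<rho>))\<^sup>2) * weight d x)"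
        unfolding W_def by (intro mult_left_mono nn_integral_weight[OF k]) simp
      also have "\<dots> \<le> ennreal (B * exp (- (2 * \<beta> * t) * \<rho>)) * ennreal ((2 + 12 * T) * weight d x)"
      proof (intro mult_left_mono ennreal_leI mult_right_mono)
        have "t * \<rho> \<le> T * 1" using t \<rho> by (intro mult_mono) auto
        then show "2 + 6 * (sqrt (2 * t * \<rho>))\<^sup>2 \<le> 2 + 12 * T" using t \<rho> by simp
      qed (use norm2_nonneg[of d x] in \<open>auto simp: weight_def\<close>)
      also have "\<dots> = ennreal (B * ((2 + 12 * T) * weight d x)) * ennreal (exp (- (2 * \<beta> * t) * \<rho>))"
        using B t norm2_nonneg[of d x] by (simp add: ennreal_mult[symmetric] weight_def mult.commute mult.left_commute)
      finally show "(\<integral>\<^sup>+z. ennreal (B * exp (- (2 * \<beta> * t) * \<rho>)) * ennreal (W z \<rho>) \<partial>std_normal_Rd d)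
        \<le> ennreal (B * ((2 + 12 * T) * weight d x)) * ennreal (exp (- (2 * \<beta> * t) * \<rho>))" .
    qed
  qed
  also have "\<dots> = ennreal (B * ((2 + 12 * T) * weight d x)) * (\<integral>\<^sup>+\<rho>. ennreal (exp (- (2 * \<beta> * t) * \<rho>)) \<partial>rlaw)"
    by (rule nn_integral_cmult) (simp cong: measurable_cong_sets add: sets_rlaw)
  also have "\<dots> \<le> ennreal (B * ((2 + 12 * T) * weight d x)) * ennreal (sqrt (pi / (2 * \<beta> * t)))"
    using \<beta> t by (intro mult_left_mono nn_integral_rlaw_exp) auto
  also have "\<dots> = ennreal (B * ((2 + 12 * T) * weight d x) * sqrt (pi / (2 * \<beta> * t)))"
    using B t \<beta> norm2_nonneg[of d x] by (intro ennreal_mult[symmetric]) (auto simp: weight_def)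
  also have "\<dots> \<le> ennreal (source_const T / sqrt \<beta> * c * exp (2 * \<beta> * t) * weight d x)"
  proof (rule ennreal_leI)
    \<comment> \<open>One factor t outweighs the t^(-1/2) of the exponential integral, so the bound
      is uniform as t tends to 0; pi < 4 rounds the constant.\<close>
    have "t * sqrt (pi / (2 * \<beta> * t)) = sqrt (t * t * (pi / (2 * \<beta> * t)))"
      unfolding real_sqrt_mult[of "t * t"] using t by simp
    also have "\<dots> \<le> sqrt (2 * T / \<beta>)"
    proof (rule real_sqrt_le_mono)
      have "t * t * (pi / (2 * \<beta> * t)) = pi / 2 * t / \<beta>" using t \<beta> by (simp add: field_simps)
      also have "\<dots> \<le> 2 * T / \<beta>"
        using t \<beta> pi_less_4 by (intro divide_right_mono mult_mono) auto
      finally show "t * t * (pi / (2 * \<beta> * t)) \<le> 2 * T / \<beta>" .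
    qed
    finally have *: "t * sqrt (pi / (2 * \<beta> * t)) \<le> sqrt (2 * T) / sqrt \<beta>" by (simp add: real_sqrt_divide)
    have "(4 * t\<^sup>2 + 2 * t) * sqrt (pi / (2 * \<beta> * t)) = (4 * t + 2) * (t * sqrt (pi / (2 * \<beta> * t)))"
      by (simp add: power2_eq_square algebra_simps)
    also have "\<dots> \<le> (4 * T + 2) * (sqrt (2 * T) / sqrt \<beta>)"
      using * t \<beta> by (intro mult_mono) auto
    finally have **: "(4 * t\<^sup>2 + 2 * t) * sqrt (pi / (2 * \<beta> * t)) \<le> (4 * T + 2) * (sqrt (2 * T) / sqrt \<beta>)" .
    have "B * ((2 + 12 * T) * weight d x) * sqrt (pi / (2 * \<beta> * t))
        = ((4 * t\<^sup>2 + 2 * t) * sqrt (pi / (2 * \<beta> * t))) * (c * exp (2 * \<beta> * t) * ((2 + 12 * T) * weight d x))"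
      by (simp add: B_def)
    also have "\<dots> \<le> ((4 * T + 2) * (sqrt (2 * T) / sqrt \<beta>)) * (c * exp (2 * \<beta> * t) * ((2 + 12 * T) * weight d x))"
      using ** c t norm2_nonneg[of d x] by (intro mult_right_mono) (auto simp: weight_def)
    also have "\<dots> = source_const T / sqrt \<beta> * c * exp (2 * \<beta> * t) * weight d x"
      by (simp add: source_const_def)
    finally show "B * ((2 + 12 * T) * weight d x) * sqrt (pi / (2 * \<beta> * t)) \<le> source_const T / sqrt \<beta> * c * exp (2 * \<beta> * t) * weight d x" .
  qed
  finally show ?thesis using meas by (simp add: second_moment_le_def)
qed

context semilinear_heat
begin

section \<open>Second moments of the nonlinearity and of the sampled terms\<close>

definition uvec :: "real \<Rightarrow> (nat \<Rightarrow> real) \<Rightarrow> nat \<Rightarrow> real" where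
  "uvec t x = (\<lambda>k. ucomp k t x)"

lemma Fu_eq: "Fu t x = app_R1d d f (uvec t x)"
proof -
  have "(\<lambda>j\<in>{1..d}. uvec t x j) = gradient d (u t) x"
    by (auto simp: uvec_def ucomp_def gradient_def)
  then show ?thesis by (simp add: Fu_def app_R1d_def) (simp add: uvec_def ucomp_def)
qed

text \<open>Cauchy-Schwarz with the weights L j. Their sum is at most lam, so the factor is
  independent of d although d coordinates occur.\<close>

lemma app_R1d_square_lipschitz:
  "(app_R1d d f V - app_R1d d f W)\<^sup>2 \<le> 2 * lam * (\<Sum>j\<in>{1..d}. L j * ((V 0 - W 0)\<^sup>2 + (V j - W j)\<^sup>2))"
proof -
  define a where "a j = \<bar>V 0 - W 0\<bar> + \<bar>V j - W j\<bar>" for j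
  have "\<bar>app_R1d d f V - app_R1d d f W\<bar> \<le> (\<Sum>j\<in>{1..d}. L j * (\<bar>V 0 - W 0\<bar> + \<bar>(\<lambda>j\<in>{1..d}. V j) j - (\<lambda>j\<in>{1..d}. W j) j\<bar>))"
    unfolding app_R1d_def by (rule f_lipschitz) auto
  also have "\<dots> = (\<Sum>j\<in>{1..d}. sqrt (L j) * (sqrt (L j) * a j))"
    using L_nonneg by (intro sum.cong) (auto simp: a_def)
  finally have "\<bar>app_R1d d f V - app_R1d d f W\<bar>\<^sup>2 \<le> (\<Sum>j\<in>{1..d}. sqrt (L j) * (sqrt (L j) * a j))\<^sup>2"
    by (rule power_mono) simp
  also have "\<dots> \<le> (\<Sum>j\<in>{1..d}. (sqrt (L j))\<^sup>2) * (\<Sum>j\<in>{1..d}. (sqrt (L j) * a j)\<^sup>2)"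
    by (rule Cauchy_Schwarz_ineq_sum)
  also have "\<dots> = (\<Sum>j\<in>{1..d}. L j) * (\<Sum>j\<in>{1..d}. L j * (a j)\<^sup>2)"
    using L_nonneg by (simp add: power_mult_distrib)
  also have "\<dots> \<le> lam * (\<Sum>j\<in>{1..d}. L j * (2 * ((V 0 - W 0)\<^sup>2 + (V j - W j)\<^sup>2)))"
  proof (intro mult_mono L_sum sum_mono mult_left_mono L_nonneg)
    fix j
    show "(a j)\<^sup>2 \<le> 2 * ((V 0 - W 0)\<^sup>2 + (V j - W j)\<^sup>2)"
      using zero_le_power2[of "\<bar>V 0 - W 0\<bar> - \<bar>V j - W j\<bar>"] by (simp add: a_def power2_eq_square algebra_simps)
  qed (use lam_pos L_nonneg in \<open>auto intro!: sum_nonneg\<close>)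
  also have "\<dots> = 2 * lam * (\<Sum>j\<in>{1..d}. L j * ((V 0 - W 0)\<^sup>2 + (V j - W j)\<^sup>2))"
    by (simp add: sum_distrib_left algebra_simps)
  finally show ?thesis by simp
qed

text \<open>A common bound for all components suffices, since the sum over j carries the weights L
  j. The factor 4 lam^2 is 2 lam from the squared Lipschitz bound times 2 lam from the two
  components in each summand.\<close>

lemma app_R1d_second_moment:
  assumes V: "\<And>k. k \<le> d \<Longrightarrow> second_moment_le Q (\<lambda>\<omega>. V \<omega> k - W k) c" and c: "c \<ge> 0"
    and m: "(\<lambda>\<omega>. app_R1d d f (V \<omega>)) \<in> borel_measurable Q"
  shows "second_moment_le Q (\<lambda>\<omega>. app_R1d d f (V \<omega>) - app_R1d d f W) (4 * lam\<^sup>2 * c)"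
proof (rule second_moment_leI)
  note D = second_moment_leD[OF V c]
  let ?Y = "\<lambda>\<omega>. 2 * lam * (\<Sum>j\<in>{1..d}. L j * ((V \<omega> 0 - W 0)\<^sup>2 + (V \<omega> j - W j)\<^sup>2))"
  show "(\<lambda>\<omega>. app_R1d d f (V \<omega>) - app_R1d d f W) \<in> borel_measurable Q" using m by simp
  have i: "integrable Q (\<lambda>\<omega>. L j * ((V \<omega> 0 - W 0)\<^sup>2 + (V \<omega> j - W j)\<^sup>2))" if "j \<in> {1..d}" for j
    using D(2)[of 0] D(2)[of j] that by auto
  show "integrable Q ?Y" by (intro integrable_mult_right Bochner_Integration.integrable_sum i)
  show "(app_R1d d f (V \<omega>) - app_R1d d f W)\<^sup>2 \<le> ?Y \<omega>" for \<omega> by (rule app_R1d_square_lipschitz)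
  have "(\<integral>\<omega>. ?Y \<omega> \<partial>Q) = 2 * lam * (\<Sum>j\<in>{1..d}. \<integral>\<omega>. L j * ((V \<omega> 0 - W 0)\<^sup>2 + (V \<omega> j - W j)\<^sup>2) \<partial>Q)"
    using i by (subst integral_mult_right_zero, subst Bochner_Integration.integral_sum) auto
  also have "\<dots> \<le> 2 * lam * (\<Sum>j\<in>{1..d}. L j * (c + c))"
  proof (intro mult_left_mono sum_mono)
    fix j assume j: "j \<in> {1..d}"
    have "(\<integral>\<omega>. L j * ((V \<omega> 0 - W 0)\<^sup>2 + (V \<omega> j - W j)\<^sup>2) \<partial>Q)
        = L j * ((\<integral>\<omega>. (V \<omega> 0 - W 0)\<^sup>2 \<partial>Q) + (\<integral>\<omega>. (V \<omega> j - W j)\<^sup>2 \<partial>Q))"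
      using D(2)[of 0] D(2)[of j] j by simp
    also have "\<dots> \<le> L j * (c + c)"
      using D(3)[of 0] D(3)[of j] j by (intro mult_left_mono add_mono L_nonneg) auto
    finally show "(\<integral>\<omega>. L j * ((V \<omega> 0 - W 0)\<^sup>2 + (V \<omega> j - W j)\<^sup>2) \<partial>Q) \<le> L j * (c + c)" .
  qed (use lam_pos in auto)
  also have "\<dots> = 4 * lam * c * (\<Sum>j\<in>{1..d}. L j)"
    unfolding sum_distrib_right[symmetric] by simp
  also have "\<dots> \<le> 4 * lam * c * lam"
    using L_sum lam_pos c by (intro mult_left_mono) auto
  finally show "(\<integral>\<omega>. ?Y \<omega> \<partial>Q) \<le> 4 * lam\<^sup>2 * c" by (simp add: power2_eq_square ac_simps)
qed

text \<open>The factor 3 + 2 T covers both cases at once: 2 T for the value, and the fourth moment 3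
  for a gradient component.\<close>

definition init_const :: real where
  "init_const = (3 + 2 * T) * (D\<^sup>2 * lam\<^sup>2)"

lemma init_const_nonneg: "init_const \<ge> 0"
  unfolding init_const_def using T_pos by simp

text \<open>The increment of g is of order sqrt (2 t) and compensates the division by sqrt (2 t) in
  the gradient weight. This is the purpose of subtracting g x: without it the second moment could
  blow up as t tends to 0.\<close>

lemma init_second_moment:
  assumes t: "0 < t" "t \<le> T" and x: "x \<in> Rd d" and k: "k \<le> d"
  shows "second_moment_le (std_normal_Rd d) (\<lambda>z. init_term d g t x z k) init_const"
proof -
  interpret \<gamma>: prob_space "std_normal_Rd d" by (rule prob_space_std_normal_Rd)
  let ?\<gamma> = "std_normal_Rd d"
  have xm: "(\<lambda>z. x) \<in> ?\<gamma> \<rightarrow>\<^sub>M borel_Rd d" using x by (auto simp: space_PiM)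
  have m1: "(\<lambda>z. init_term d g t x z k) \<in> borel_measurable ?\<gamma>"
    by (rule measurable_init_term[OF g_cont _ xm measurable_std_normal_Rd_ident k]) simp
  define \<sigma> where "\<sigma> = sqrt (2 * t)"
  have \<sigma>: "\<sigma> > 0" "\<sigma>\<^sup>2 = 2 * t" using t by (simp_all add: \<sigma>_def)
  define Y where "Y z = D\<^sup>2 * lam * (\<Sum>j\<in>{1..d}. L j * (if k = 0 then 2 * T * (z j)\<^sup>2 else ((z j)^4 + (z k)^4) / 2))" for z
  have gl: "(g (add_scaled d x \<sigma> z) - g x)\<^sup>2 \<le> D\<^sup>2 * \<sigma>\<^sup>2 * lam * (\<Sum>j\<in>{1..d}. L j * (z j)\<^sup>2)" for z
  proof -
    have "\<bar>g (add_scaled d x \<sigma> z) - g x\<bar> \<le> (\<Sum>j\<in>{1..d}. L j * (D * \<bar>add_scaled d x \<sigma> z j - x j\<bar>))"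
      by (rule g_lipschitz[OF add_scaled_Rd x])
    also have "\<dots> = D * \<sigma> * (\<Sum>j\<in>{1..d}. sqrt (L j) * (sqrt (L j) * \<bar>z j\<bar>))"
      unfolding sum_distrib_left using L_nonneg \<sigma> by (intro sum.cong) (auto simp: add_scaled_def abs_mult)
    finally have "\<bar>g (add_scaled d x \<sigma> z) - g x\<bar>\<^sup>2 \<le> (D * \<sigma> * (\<Sum>j\<in>{1..d}. sqrt (L j) * (sqrt (L j) * \<bar>z j\<bar>)))\<^sup>2"
      by (rule power_mono) simp
    also have "\<dots> = D\<^sup>2 * \<sigma>\<^sup>2 * (\<Sum>j\<in>{1..d}. sqrt (L j) * (sqrt (L j) * \<bar>z j\<bar>))\<^sup>2" by (simp add: power_mult_distrib)
    also have "\<dots> \<le> D\<^sup>2 * \<sigma>\<^sup>2 * ((\<Sum>j\<in>{1..d}. (sqrt (L j))\<^sup>2) * (\<Sum>j\<in>{1..d}. (sqrt (L j) * \<bar>z j\<bar>)\<^sup>2))"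
      by (intro mult_left_mono Cauchy_Schwarz_ineq_sum) simp
    also have "\<dots> = D\<^sup>2 * \<sigma>\<^sup>2 * ((\<Sum>j\<in>{1..d}. L j) * (\<Sum>j\<in>{1..d}. L j * (z j)\<^sup>2))"
      using L_nonneg by (simp add: power_mult_distrib)
    also have "\<dots> \<le> D\<^sup>2 * \<sigma>\<^sup>2 * (lam * (\<Sum>j\<in>{1..d}. L j * (z j)\<^sup>2))"
      using L_nonneg by (intro mult_left_mono mult_right_mono L_sum sum_nonneg) auto
    finally show ?thesis by (simp add: mult.assoc)
  qed
  have m3: "(init_term d g t x z k)\<^sup>2 \<le> Y z" for z
  proof (cases "k = 0")
    case True
    have "(init_term d g t x z k)\<^sup>2 \<le> D\<^sup>2 * \<sigma>\<^sup>2 * lam * (\<Sum>j\<in>{1..d}. L j * (z j)\<^sup>2)"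
      using gl[of z] True by (simp add: init_term_def one_scaled_def \<sigma>_def)
    also have "\<dots> \<le> D\<^sup>2 * (2 * T) * lam * (\<Sum>j\<in>{1..d}. L j * (z j)\<^sup>2)"
      using t \<sigma>(2) lam_pos L_nonneg by (intro mult_right_mono mult_left_mono sum_nonneg) auto
    also have "\<dots> = Y z" using True by (simp add: Y_def sum_distrib_left algebra_simps)
    finally show ?thesis .
  next
    case False
    have "(init_term d g t x z k)\<^sup>2 = (g (add_scaled d x \<sigma> z) - g x)\<^sup>2 * ((z k)\<^sup>2 / \<sigma>\<^sup>2)"
      using False by (simp add: init_term_def one_scaled_def \<sigma>_def power_mult_distrib power_divide)
    also have "\<dots> \<le> (D\<^sup>2 * \<sigma>\<^sup>2 * lam * (\<Sum>j\<in>{1..d}. L j * (z j)\<^sup>2)) * ((z k)\<^sup>2 / \<sigma>\<^sup>2)"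
      by (intro mult_right_mono gl) simp
    also have "\<dots> = D\<^sup>2 * lam * (\<Sum>j\<in>{1..d}. L j * ((z j)\<^sup>2 * (z k)\<^sup>2))"
      using \<sigma>(1) by (simp add: sum_distrib_left sum_distrib_right algebra_simps)
    also have "\<dots> \<le> Y z"
      unfolding Y_def if_not_P[OF False]
    proof (intro mult_left_mono sum_mono L_nonneg)
      fix j
      show "(z j)\<^sup>2 * (z k)\<^sup>2 \<le> (z j ^ 4 + z k ^ 4) / 2"
        using zero_le_power2[of "(z j)\<^sup>2 - (z k)\<^sup>2"] by (simp add: power2_eq_square power4_eq_xxxx algebra_simps)
    qed (use lam_pos in auto)
    finally show ?thesis .
  qed
  have moment: "integrable ?\<gamma> (\<lambda>z. L j * (if k = 0 then 2 * T * (z j)\<^sup>2 else ((z j)^4 + (z k)^4) / 2))"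
    "(\<integral>z. L j * (if k = 0 then 2 * T * (z j)\<^sup>2 else ((z j)^4 + (z k)^4) / 2) \<partial>?\<gamma>) \<le> L j * (3 + 2 * T)"
    if j: "j \<in> {1..d}" for j
  proof -
    note mj = std_normal_coordinate_moments[OF j]
    show "integrable ?\<gamma> (\<lambda>z. L j * (if k = 0 then 2 * T * (z j)\<^sup>2 else ((z j)^4 + (z k)^4) / 2))"
      using mj std_normal_coordinate_moments[of k d] k by (cases "k = 0") auto
    have "(\<integral>z. L j * (if k = 0 then 2 * T * (z j)\<^sup>2 else ((z j)^4 + (z k)^4) / 2) \<partial>?\<gamma>) = L j * (if k = 0 then 2 * T else 3)"
      using mj std_normal_coordinate_moments[of k d] k by (cases "k = 0") auto
    also have "\<dots> \<le> L j * (3 + 2 * T)" using T_pos L_nonneg[OF j] by (intro mult_left_mono) auto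
    finally show "(\<integral>z. L j * (if k = 0 then 2 * T * (z j)\<^sup>2 else ((z j)^4 + (z k)^4) / 2) \<partial>?\<gamma>) \<le> L j * (3 + 2 * T)" .
  qed
  have m2: "integrable ?\<gamma> Y"
    unfolding Y_def by (intro integrable_mult_right Bochner_Integration.integrable_sum moment)
  have "(\<integral>z. Y z \<partial>?\<gamma>) = D\<^sup>2 * lam * (\<Sum>j\<in>{1..d}. \<integral>z. L j * (if k = 0 then 2 * T * (z j)\<^sup>2 else ((z j)^4 + (z k)^4) / 2) \<partial>?\<gamma>)"
    unfolding Y_def using moment(1) by (subst integral_mult_right_zero, subst Bochner_Integration.integral_sum) auto
  also have "\<dots> \<le> D\<^sup>2 * lam * (\<Sum>j\<in>{1..d}. L j * (3 + 2 * T))"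
    using lam_pos by (intro mult_left_mono sum_mono moment(2)) auto
  also have "\<dots> \<le> D\<^sup>2 * lam * (lam * (3 + 2 * T))"
    unfolding sum_distrib_right[symmetric] using lam_pos T_pos by (intro mult_left_mono mult_right_mono L_sum) auto
  also have "\<dots> = init_const" by (simp add: init_const_def power2_eq_square)
  finally have m4: "(\<integral>z. Y z \<partial>?\<gamma>) \<le> init_const" .
  show ?thesis by (rule second_moment_leI[OF m1 m2 m3 m4])
qed

lemma source_Fu_measurable:
  assumes t: "0 < t" "t \<le> T" and x: "x \<in> Rd d" and k: "k \<le> d"
  shows "(\<lambda>p. source_term d t x p k Fu) \<in> borel_measurable (step_law d)"
proof -
  \<comment> \<open>\<open>Fu\<close> is controlled for times in [0, T] only, so the random time is
    clamped; the indicator in \<open>source_term\<close> makes both versions equal.\<close>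
  define c where "c \<rho> = max 0 (min 1 \<rho>)" for \<rho> :: real
  have c: "c \<rho> \<in> {0..1}" for \<rho> by (auto simp: c_def)
  have cm: "(\<lambda>p. c (snd p)) \<in> borel_measurable (step_law d)"
    unfolding c_def using measurable_step_snd[of d] by simp
  have "(\<lambda>p. source_term d t x p k Fu) = (\<lambda>p. source_term d t x p k (\<lambda>_ y. Fu (t * (1 - c (snd p))) y))"
    by (auto simp: source_term_def fun_eq_iff indicator_def c_def)
  also have "\<dots> \<in> borel_measurable (step_law d)"
  proof (rule measurable_source_term[where \<tau>="\<lambda>_. t" and X="\<lambda>_. x" and p="\<lambda>p. p" and h="\<lambda>p _ y. Fu (t * (1 - c (snd p))) y"])
    show xm: "(\<lambda>_. x) \<in> step_law d \<rightarrow>\<^sub>M borel_Rd d" using x by (auto simp: space_PiM)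
    show "(\<lambda>p. Fu (t * (1 - c (snd p))) (add_scaled d x (sqrt (2 * t * snd p)) (fst p))) \<in> borel_measurable (step_law d)"
    proof (rule measurable_time_space[OF Fu_cont])
      show "(\<lambda>p. t * (1 - c (snd p))) \<in> borel_measurable (step_law d)" using cm by simp
      show "(\<lambda>p. add_scaled d x (sqrt (2 * t * snd p)) (fst p)) \<in> step_law d \<rightarrow>\<^sub>M borel_Rd d"
        using measurable_step_snd[of d] by (intro measurable_add_scaled xm measurable_step_fst) simp
      fix p :: "(nat \<Rightarrow> real) \<times> real"
      have "0 \<le> t * (1 - c (snd p))" "t * (1 - c (snd p)) \<le> t * 1"
        using c[of "snd p"] t by (auto intro!: mult_nonneg_nonneg mult_left_mono)
      then show "t * (1 - c (snd p)) \<in> {0..T}" unfolding atLeastAtMost_iff using t by linarith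
    qed
  qed (use k in auto)
  finally show ?thesis .
qed

text \<open>The representation in the form that the scheme samples: g x may be subtracted because
  the weight has mean 1 for k = 0 and mean 0 otherwise, and the uniform variable v is replaced by
  the random time v^2.\<close>

theorem feynman_kac:
  assumes t: "0 < t" "t \<le> T" and x: "x \<in> Rd d" and k: "k \<le> d"
  shows "ucomp k t x = (if k = 0 then g x else 0) + (\<integral>z. init_term d g t x z k \<partial>std_normal_Rd d)
     + (\<integral>p. source_term d t x p k Fu \<partial>step_law d)"
proof -
  interpret \<gamma>: prob_space "std_normal_Rd d" by (rule prob_space_std_normal_Rd)
  let ?\<gamma> = "std_normal_Rd d"
  let ?q = "\<lambda>z. one_scaled (sqrt (2 * t)) z k"
  have ii: "integrable ?\<gamma> (\<lambda>z. init_term d g t x z k)"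
    using \<gamma>.second_moment_le_mean[OF init_second_moment[OF assms] init_const_nonneg] by simp
  have q: "integrable ?\<gamma> ?q" "(\<integral>z. ?q z \<partial>?\<gamma>) = (if k = 0 then 1 else 0)"
    using std_normal_coordinate_moments[of k d] k
    by (cases "k = 0"; simp add: one_scaled_def \<gamma>.prob_space)+
  have "(\<integral>z. g (add_scaled d x (sqrt (2 * t)) z) * ?q z \<partial>?\<gamma>) = (\<integral>z. init_term d g t x z k + g x * ?q z \<partial>?\<gamma>)"
    by (intro Bochner_Integration.integral_cong) (auto simp: init_term_def algebra_simps)
  also have "\<dots> = (\<integral>z. init_term d g t x z k \<partial>?\<gamma>) + (if k = 0 then g x else 0)"
    using ii q by simp
  finally have 1: "(\<integral>z. g (add_scaled d x (sqrt (2 * t)) z) * ?q z \<partial>?\<gamma>)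
      = (\<integral>z. init_term d g t x z k \<partial>?\<gamma>) + (if k = 0 then g x else 0)" .
  have swap: "(\<lambda>(v, z). (z, v\<^sup>2)) \<in> unif01 \<Otimes>\<^sub>M ?\<gamma> \<rightarrow>\<^sub>M ?\<gamma> \<Otimes>\<^sub>M borel"
    unfolding case_prod_unfold
  proof (intro measurable_Pair measurable_snd)
    have "(\<lambda>v. v\<^sup>2) \<in> borel_measurable unif01"
      by (simp cong: measurable_cong_sets add: sets_unif01)
    then show "(\<lambda>p. (fst p)\<^sup>2) \<in> borel_measurable (unif01 \<Otimes>\<^sub>M ?\<gamma>)"
      by (rule measurable_compose[OF measurable_fst])
  qed
  have sm: "(\<lambda>p. source_term d t x p k Fu) \<in> borel_measurable (?\<gamma> \<Otimes>\<^sub>M borel)"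
    using source_Fu_measurable[OF assms]
    unfolding step_law_def measurable_cong_sets[OF sets_pair_measure_cong[OF refl sets_rlaw] refl] .
  have "(\<integral>p. source_term d t x p k Fu \<partial>step_law d) = (\<integral>p. source_term d t x ((\<lambda>(v, z). (z, v\<^sup>2)) p) k Fu \<partial>(unif01 \<Otimes>\<^sub>M ?\<gamma>))"
    unfolding step_law_eq_distr by (rule integral_distr[OF swap sm])
  also have "\<dots> = (\<integral>p. indicator {0<..<1} (fst p) * source_term d t x ((\<lambda>(v, z). (z, v\<^sup>2)) p) k Fu \<partial>(unif01 \<Otimes>\<^sub>M ?\<gamma>))"
  proof (rule integral_cong_AE)
    have "AE v in unif01. v \<in> {0<..<1}"
      unfolding unif01_def by (subst AE_density) (auto simp: indicator_def)
    then have "AE v in distr (unif01 \<Otimes>\<^sub>M ?\<gamma>) unif01 fst. v \<in> {0<..<1}"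
      unfolding \<gamma>.distr_pair_fst .
    from AE_distrD[OF measurable_fst this]
    show "AE p in unif01 \<Otimes>\<^sub>M ?\<gamma>. source_term d t x ((\<lambda>(v, z). (z, v\<^sup>2)) p) k Fu
        = indicator {0<..<1} (fst p) * source_term d t x ((\<lambda>(v, z). (z, v\<^sup>2)) p) k Fu"
      by (rule AE_mp) (intro AE_I2 impI, simp)
    show m: "(\<lambda>p. source_term d t x ((\<lambda>(v, z). (z, v\<^sup>2)) p) k Fu) \<in> borel_measurable (unif01 \<Otimes>\<^sub>M ?\<gamma>)"
      by (rule measurable_compose[OF swap sm])
    have "(\<lambda>p. indicator {0<..<1} (fst p) :: real) \<in> borel_measurable (unif01 \<Otimes>\<^sub>M ?\<gamma>)"
      by (rule measurable_compose[OF measurable_fst]) (simp cong: measurable_cong_sets add: sets_unif01)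
    from borel_measurable_times[OF this m]
    show "(\<lambda>p. indicator {0<..<1} (fst p) * source_term d t x ((\<lambda>(v, z). (z, v\<^sup>2)) p) k Fu) \<in> borel_measurable (unif01 \<Otimes>\<^sub>M ?\<gamma>)" .
  qed
  also have "\<dots> = (\<integral>p. indicator {0<..<1} (fst p) * (2 * t * fst p * Fu (t * (1 - (fst p)\<^sup>2)) (add_scaled d x (sqrt (2 * t) * fst p) (snd p))
          * one_scaled (sqrt (2 * t) * fst p) (snd p) k) \<partial>(unif01 \<Otimes>\<^sub>M std_normal_Rd d))"
  proof (intro Bochner_Integration.integral_cong refl)
    fix p :: "real \<times> (nat \<Rightarrow> real)"
    obtain v z where p: "p = (v, z)" by (cases p)
    show "indicator {0<..<1} (fst p) * source_term d t x ((\<lambda>(v, z). (z, v\<^sup>2)) p) k Fu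
      = indicator {0<..<1} (fst p) * (2 * t * fst p * Fu (t * (1 - (fst p)\<^sup>2)) (add_scaled d x (sqrt (2 * t) * fst p) (snd p))
          * one_scaled (sqrt (2 * t) * fst p) (snd p) k)"
    proof (cases "v \<in> {0<..<1}")
      case True
      then have "v\<^sup>2 \<in> {0<..<1}" by (simp add: power_less_one_iff)
      moreover have "sqrt (2 * t * v\<^sup>2) = sqrt (2 * t) * v"
        using True unfolding real_sqrt_mult[of "2 * t"] by simp
      moreover have "sqrt (v\<^sup>2) = v" using True by simp
      ultimately show ?thesis unfolding source_term_def p by simp
    qed (simp add: p)
  qed
  finally show ?thesis
    unfolding feynman_kac_unif[OF assms] 1 by linarith
qed

end

section \<open>A priori bound on the solution\<close>

text \<open>Makes the source estimate, which is stated on a product with a further independent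
  input, available for integrands without such an input.\<close>

lemma second_moment_le_fst:
  assumes X: "second_moment_le (A \<Otimes>\<^sub>M Q) (\<lambda>p. X (fst p)) c" and Q: "prob_space Q" and m: "X \<in> borel_measurable A"
  shows "second_moment_le A X c"
proof -
  interpret Q: prob_space Q by (rule Q)
  have "(\<integral>\<^sup>+p. ennreal ((X p)\<^sup>2) \<partial>A) = (\<integral>\<^sup>+p. ennreal ((X p)\<^sup>2) \<partial>distr (A \<Otimes>\<^sub>M Q) A fst)"
    by (simp add: Q.distr_pair_fst)
  also have "\<dots> = (\<integral>\<^sup>+p. ennreal ((X (fst p))\<^sup>2) \<partial>(A \<Otimes>\<^sub>M Q))"
    using m by (intro nn_integral_distr) auto
  finally show ?thesis using X m by (simp add: second_moment_le_def)
qed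

lemma (in prob_space) second_moment_le_const:
  "a\<^sup>2 \<le> c \<Longrightarrow> second_moment_le M (\<lambda>_. a) c"
  by (rule second_moment_leI[where Y="\<lambda>_. a\<^sup>2"]) (auto simp: prob_space)

lemma source_term_diff:
  "source_term d t x p k (\<lambda>s y. h1 s y - h2 s y) = source_term d t x p k h1 - source_term d t x p k h2"
  by (simp add: source_term_def algebra_simps)

lemma square_sum3_le: "(a + b + c)\<^sup>2 \<le> 3 * (a\<^sup>2 + b\<^sup>2 + c\<^sup>2)" for a b c :: real
  using zero_le_power2[of "a - b"] zero_le_power2[of "a - c"] zero_le_power2[of "b - c"]
  by (simp add: power2_eq_square algebra_simps)

context semilinear_heat
begin

definition f0 :: real where "f0 = f 0 (zero_Rd d)"

text \<open>The factor 6 is 3 from squaring a sum of three terms times 2 from absorbing half of a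
  supremum in \<open>ucomp_bound\<close>. The last summand is 2 f0^2 / (48 lam^2), the contribution
  of f at the origin under the smallness condition on \<beta>.\<close>

definition error_const :: real where
  "error_const = 6 * (2 * (g (zero_Rd d))\<^sup>2 + 2 * (D\<^sup>2 * lam\<^sup>2) + init_const + f0\<^sup>2 / (24 * lam\<^sup>2))"

text \<open>The factor gained in the weight exp (2 beta t) when integrating against the source term.\<close>
definition kap :: "real \<Rightarrow> real" where
  "kap \<beta> = source_const T / sqrt \<beta>"

lemma kap_nonneg: "\<beta> > 0 \<Longrightarrow> kap \<beta> \<ge> 0"
  unfolding kap_def source_const_def using T_pos by simp

lemma error_const_nonneg: "error_const \<ge> 0"
  unfolding error_const_def using init_const_nonneg by (auto intro!: add_nonneg_nonneg)

lemma zero_Rd_in: "zero_Rd d \<in> Rd d"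
  by (simp add: zero_Rd_def)

lemma app_R1d_0: "app_R1d d f (\<lambda>k. 0) = f0"
  by (simp add: app_R1d_def f0_def zero_Rd_def)

lemma g_square_le:
  assumes x: "x \<in> Rd d"
  shows "(g x)\<^sup>2 \<le> (2 * (g (zero_Rd d))\<^sup>2 + 2 * (D\<^sup>2 * lam\<^sup>2)) * weight d x"
proof -
  have "\<bar>g x - g (zero_Rd d)\<bar> \<le> (\<Sum>j\<in>{1..d}. L j * (D * \<bar>x j - zero_Rd d j\<bar>))"
    by (rule g_lipschitz[OF x zero_Rd_in])
  also have "\<dots> = D * (\<Sum>j\<in>{1..d}. sqrt (L j) * (sqrt (L j) * \<bar>x j\<bar>))"
    unfolding sum_distrib_left using L_nonneg by (intro sum.cong) (auto simp: zero_Rd_def)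
  finally have "\<bar>g x - g (zero_Rd d)\<bar>\<^sup>2 \<le> (D * (\<Sum>j\<in>{1..d}. sqrt (L j) * (sqrt (L j) * \<bar>x j\<bar>)))\<^sup>2"
    by (rule power_mono) simp
  also have "\<dots> = D\<^sup>2 * (\<Sum>j\<in>{1..d}. sqrt (L j) * (sqrt (L j) * \<bar>x j\<bar>))\<^sup>2" by (simp add: power_mult_distrib)
  also have "\<dots> \<le> D\<^sup>2 * ((\<Sum>j\<in>{1..d}. (sqrt (L j))\<^sup>2) * (\<Sum>j\<in>{1..d}. (sqrt (L j) * \<bar>x j\<bar>)\<^sup>2))"
    by (intro mult_left_mono Cauchy_Schwarz_ineq_sum) simp
  also have "\<dots> = D\<^sup>2 * ((\<Sum>j\<in>{1..d}. L j) * (\<Sum>j\<in>{1..d}. L j * (x j)\<^sup>2))"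
    using L_nonneg by (simp add: power_mult_distrib)
  also have "\<dots> \<le> D\<^sup>2 * (lam * (\<Sum>j\<in>{1..d}. lam * (x j)\<^sup>2))"
    using L_nonneg lam_pos by (intro mult_left_mono mult_mono L_sum sum_mono mult_right_mono L_le sum_nonneg) auto
  also have "\<dots> = D\<^sup>2 * lam\<^sup>2 * norm2 d x"
    by (simp add: norm2_def sum_distrib_left power2_eq_square algebra_simps)
  also have "\<dots> \<le> D\<^sup>2 * lam\<^sup>2 * weight d x" by (intro mult_left_mono) (auto simp: weight_def)
  finally have 1: "(g x - g (zero_Rd d))\<^sup>2 \<le> D\<^sup>2 * lam\<^sup>2 * weight d x" by simp
  have "(g x)\<^sup>2 \<le> 2 * (g (zero_Rd d))\<^sup>2 + 2 * (g x - g (zero_Rd d))\<^sup>2"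
    using zero_le_power2[of "2 * g (zero_Rd d) - g x"] by (simp add: power2_eq_square algebra_simps)
  also have "\<dots> \<le> 2 * (g (zero_Rd d))\<^sup>2 * weight d x + 2 * (D\<^sup>2 * lam\<^sup>2 * weight d x)"
    using 1 weight_ge_1[OF d_pos, of x] mult_left_mono[of 1 "weight d x" "2 * (g (zero_Rd d))\<^sup>2"]
    by (intro add_mono) auto
  finally show ?thesis by (simp add: distrib_right mult.assoc)
qed

lemma ew_ge_1: "\<beta> > 0 \<Longrightarrow> t > 0 \<Longrightarrow> exp (2 * \<beta> * t) * weight d x \<ge> 1"
  using mult_mono[of 1 "exp (2 * \<beta> * t)" 1 "weight d x"] weight_ge_1[OF d_pos, of x] by simp

text \<open>The weighted supremum S of the solution and its gradient is finite by linear growth.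
  Inserting the bound by S into the representation gives S \<le> error_const / 2 + S / 2, where the
  constant of the linear growth no longer appears. This is the case n = 0 of the error
  estimate.\<close>

lemma ucomp_bound:
  assumes \<beta>: "\<beta> > 0" "48 * lam\<^sup>2 * kap \<beta> \<le> 1" and t: "0 < t" "t \<le> T" and x: "x \<in> Rd d" and k: "k \<le> d"
  shows "(ucomp k t x)\<^sup>2 \<le> error_const * (exp (2 * \<beta> * t) * weight d x)"
proof -
  interpret tree: prob_space "tree_law d" by (rule prob_space_tree_law)
  interpret step: prob_space "step_law d" by (rule prob_space_step_law)
  interpret \<gamma>: prob_space "std_normal_Rd d" by (rule prob_space_std_normal_Rd)
  define E where "E t x = exp (2 * \<beta> * t) * weight d x" for t x
  have E1: "E t x \<ge> 1" if "t > 0" for t x unfolding E_def by (rule ew_ge_1[OF \<beta>(1) that])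
  \<comment> \<open>All components share one supremum, because the Lipschitz bound of f couples
    them.\<close>
  define A where "A = (\<lambda>(t, x, k). (ucomp k t x)\<^sup>2 / E t x) ` ({0<..T} \<times> Rd d \<times> {..d})"
  obtain C where C: "C \<ge> 0"
    "\<And>t x k. t \<in> {0..T} \<Longrightarrow> x \<in> Rd d \<Longrightarrow> k \<le> d \<Longrightarrow> \<bar>ucomp k t x\<bar> \<le> C * (1 + (\<Sum>i\<in>{1..d}. \<bar>x i\<bar>))"
    using linear_growth_Fu by metis
  have bdd: "bdd_above A"
  proof (rule bdd_aboveI[of _ "C\<^sup>2 * (2 + 2 * real d)"])
    fix a assume "a \<in> A"
    then obtain t x k where a: "a = (ucomp k t x)\<^sup>2 / E t x" and tx: "0 < t" "t \<le> T" "x \<in> Rd d" "k \<le> d"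
      unfolding A_def by auto
    have "(\<Sum>i\<in>{1..d}. \<bar>x i\<bar>)\<^sup>2 \<le> real d * norm2 d x"
      using sum_square_le[of "{1..d}" "\<lambda>i. \<bar>x i\<bar>"] by (simp add: norm2_def)
    then have "(1 + (\<Sum>i\<in>{1..d}. \<bar>x i\<bar>))\<^sup>2 \<le> 2 + 2 * (real d * norm2 d x)"
      using zero_le_power2[of "1 - (\<Sum>i\<in>{1..d}. \<bar>x i\<bar>)"] by (simp add: power2_eq_square algebra_simps)
    also have "\<dots> \<le> 2 * weight d x + 2 * (real d * weight d x)"
      using weight_ge_1[OF d_pos, of x] by (intro add_mono mult_left_mono) (auto simp: weight_def)
    also have "\<dots> = (2 + 2 * real d) * weight d x" by (simp add: algebra_simps)
    also have "\<dots> \<le> (2 + 2 * real d) * E t x"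
      unfolding E_def using tx(1) \<beta>(1) weight_ge_1[OF d_pos, of x]
        mult_right_mono[of 1 "exp (2 * \<beta> * t)" "weight d x"] by (intro mult_left_mono) auto
    finally have 1: "(1 + (\<Sum>i\<in>{1..d}. \<bar>x i\<bar>))\<^sup>2 \<le> (2 + 2 * real d) * E t x" .
    have "(ucomp k t x)\<^sup>2 = \<bar>ucomp k t x\<bar>\<^sup>2" by simp
    also have "\<dots> \<le> (C * (1 + (\<Sum>i\<in>{1..d}. \<bar>x i\<bar>)))\<^sup>2"
      using C(2)[of t x k] tx by (intro power_mono) auto
    also have "\<dots> \<le> C\<^sup>2 * ((2 + 2 * real d) * E t x)"
      unfolding power_mult_distrib by (rule mult_left_mono[OF 1]) simp
    finally show "a \<le> C\<^sup>2 * (2 + 2 * real d)"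
      using E1[OF tx(1), of x] unfolding a by (simp add: divide_le_eq mult.assoc)
  qed
  have ne: "A \<noteq> {}" unfolding A_def using T_pos zero_Rd_in by auto
  define S where "S = Sup A"
  have le_S: "(ucomp k t x)\<^sup>2 \<le> S * E t x" if "0 < t" "t \<le> T" "x \<in> Rd d" "k \<le> d" for t x k
  proof -
    have "(ucomp k t x)\<^sup>2 / E t x \<in> A"
      unfolding A_def by (rule image_eqI[of _ _ "(t, x, k)"]) (use that in auto)
    from cSup_upper[OF this bdd] show ?thesis
      using E1[OF that(1), of x] by (simp add: S_def divide_le_eq)
  qed
  have S0: "S \<ge> 0"
  proof -
    have "0 \<le> (ucomp 0 T (zero_Rd d))\<^sup>2" by simp
    also have "\<dots> \<le> S * E T (zero_Rd d)" using T_pos zero_Rd_in by (intro le_S) auto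
    finally show ?thesis using E1[OF T_pos, of "zero_Rd d"] by (simp add: zero_le_mult_iff)
  qed
  have Fu_S: "(Fu s y)\<^sup>2 \<le> (2 * f0\<^sup>2 + 8 * lam\<^sup>2 * S) * E s y" if s: "0 < s" "s \<le> T" and y: "y \<in> Rd d" for s y
  proof -
    have "(Fu s y - f0)\<^sup>2 \<le> 2 * lam * (\<Sum>j\<in>{1..d}. L j * ((uvec s y 0 - 0)\<^sup>2 + (uvec s y j - 0)\<^sup>2))"
      unfolding Fu_eq app_R1d_0[symmetric] by (rule app_R1d_square_lipschitz)
    also have "\<dots> \<le> 2 * lam * (\<Sum>j\<in>{1..d}. L j * (S * E s y + S * E s y))"
      using lam_pos le_S[OF s y] by (intro mult_left_mono sum_mono add_mono L_nonneg) (auto simp: uvec_def)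
    also have "\<dots> \<le> 2 * lam * (lam * (S * E s y + S * E s y))"
      unfolding sum_distrib_right[symmetric] using lam_pos S0 E1[OF s(1), of y]
      by (intro mult_left_mono mult_right_mono L_sum) auto
    finally have 1: "(Fu s y - f0)\<^sup>2 \<le> 4 * lam\<^sup>2 * S * E s y" by (simp add: power2_eq_square algebra_simps)
    have "(Fu s y)\<^sup>2 \<le> 2 * f0\<^sup>2 + 2 * (Fu s y - f0)\<^sup>2"
      using zero_le_power2[of "2 * f0 - Fu s y"] by (simp add: power2_eq_square algebra_simps)
    also have "\<dots> \<le> 2 * f0\<^sup>2 * E s y + 2 * (4 * lam\<^sup>2 * S * E s y)"
    proof -
      have "2 * f0\<^sup>2 * 1 \<le> 2 * f0\<^sup>2 * E s y" using E1[OF s(1), of y] by (intro mult_left_mono) auto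
      then show ?thesis using 1 by linarith
    qed
    finally show ?thesis by (simp add: algebra_simps)
  qed
  have "a \<le> error_const / 2 + S / 2" if aA: "a \<in> A" for a
  proof -
    obtain t x k where a: "a = (ucomp k t x)\<^sup>2 / E t x" and tx: "0 < t" "t \<le> T" "x \<in> Rd d" "k \<le> d"
      using aA unfolding A_def by auto
    note E = E1[OF tx(1), of x]
    define c where "c = 2 * f0\<^sup>2 + 8 * lam\<^sup>2 * S"
    have c: "c \<ge> 0" unfolding c_def using S0 by simp
    note sm = source_Fu_measurable[OF tx]
    have "second_moment_le (step_law d \<Otimes>\<^sub>M tree_law d) (\<lambda>(p, \<omega>). source_term d t x p k Fu)
      (source_const T / sqrt \<beta> * c * exp (2 * \<beta> * t) * weight d x)"
    proof (rule source_second_moment[OF tx(1,2,4) \<beta>(1) c prob_space_tree_law])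
      show "(\<lambda>(p, \<omega>). source_term d t x p k Fu) \<in> borel_measurable (step_law d \<Otimes>\<^sub>M tree_law d)"
        unfolding case_prod_unfold by (rule measurable_compose[OF measurable_fst sm])
      fix s y assume s: "0 < s" "s < t" "y \<in> Rd d"
      then show "second_moment_le (tree_law d) (\<lambda>\<omega>. Fu s y) (c * exp (2 * \<beta> * s) * weight d y)"
        using Fu_S[of s y] tx(2) by (intro tree.second_moment_le_const) (simp add: c_def E_def mult.assoc)
    qed
    then have "second_moment_le (step_law d) (\<lambda>p. source_term d t x p k Fu) (kap \<beta> * c * E t x)"
      by (intro second_moment_le_fst[OF _ prob_space_tree_law sm]) (simp add: case_prod_unfold kap_def E_def mult.assoc)
    from step.second_moment_le_mean(2)[OF this]
    have src: "(\<integral>p. source_term d t x p k Fu \<partial>step_law d)\<^sup>2 \<le> kap \<beta> * c * E t x"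
      using kap_nonneg[OF \<beta>(1)] c E by simp
    \<comment> \<open>The number 48 turns 8 lam^2 S into S / 6; the factor 3 from the sum of three
      terms then makes it S / 2.\<close>
    have "48 * lam\<^sup>2 * (kap \<beta> * c) \<le> c"
      using mult_right_mono[OF \<beta>(2) c] by (simp add: mult.assoc)
    then have kc: "kap \<beta> * c \<le> f0\<^sup>2 / (24 * lam\<^sup>2) + S / 6"
      using lam_pos by (simp add: c_def field_simps)
    have init: "(\<integral>z. init_term d g t x z k \<partial>std_normal_Rd d)\<^sup>2 \<le> init_const"
      by (rule \<gamma>.second_moment_le_mean(2)[OF init_second_moment[OF tx] init_const_nonneg])
    define b where "b = 2 * (g (zero_Rd d))\<^sup>2 + 2 * (D\<^sup>2 * lam\<^sup>2)"
    have "(if k = 0 then g x else 0)\<^sup>2 \<le> b * weight d x"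
      using g_square_le[OF tx(3)] weight_ge_1[OF d_pos, of x] unfolding b_def[symmetric] by (simp add: b_def)
    also have "\<dots> \<le> b * E t x"
      unfolding E_def b_def using tx(1) \<beta>(1) weight_ge_1[OF d_pos, of x]
        mult_right_mono[of 1 "exp (2 * \<beta> * t)" "weight d x"] by (intro mult_left_mono) auto
    finally have base: "(if k = 0 then g x else 0)\<^sup>2 \<le> b * E t x" .
    have "(ucomp k t x)\<^sup>2 \<le> 3 * ((if k = 0 then g x else 0)\<^sup>2 + (\<integral>z. init_term d g t x z k \<partial>std_normal_Rd d)\<^sup>2
        + (\<integral>p. source_term d t x p k Fu \<partial>step_law d)\<^sup>2)"
      unfolding feynman_kac[OF tx] by (rule square_sum3_le)
    also have "\<dots> \<le> 3 * (b * E t x + init_const * E t x + (f0\<^sup>2 / (24 * lam\<^sup>2) + S / 6) * E t x)"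
    proof -
      have "kap \<beta> * c * E t x \<le> (f0\<^sup>2 / (24 * lam\<^sup>2) + S / 6) * E t x"
        using E by (intro mult_right_mono[OF kc]) simp
      then have s: "(\<integral>p. source_term d t x p k Fu \<partial>step_law d)\<^sup>2 \<le> (f0\<^sup>2 / (24 * lam\<^sup>2) + S / 6) * E t x"
        by (rule order_trans[OF src])
      have "init_const * 1 \<le> init_const * E t x"
        using E init_const_nonneg by (intro mult_left_mono) auto
      then have i: "(\<integral>z. init_term d g t x z k \<partial>std_normal_Rd d)\<^sup>2 \<le> init_const * E t x"
        using init by simp
      show ?thesis by (intro mult_left_mono add_mono base i s) simp
    qed
    also have "\<dots> = (error_const / 2 + S / 2) * E t x"
      by (simp add: error_const_def b_def algebra_simps)
    finally show ?thesis unfolding a using E by (simp add: divide_le_eq)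
  qed
  then have "S \<le> error_const / 2 + S / 2"
    unfolding S_def[symmetric] using cSup_least[OF ne, of "error_const / 2 + S / 2"] by (simp add: S_def)
  then have "S \<le> error_const" by simp
  then have "S * E t x \<le> error_const * E t x"
    using E1[OF t(1), of x] by (intro mult_right_mono) auto
  with le_S[OF t x k] show ?thesis unfolding E_def by (rule order_trans)
qed

lemma measurable_source_mlp:
  assumes x: "x \<in> Rd d" and k: "k \<le> d"
  shows "(\<lambda>(p, \<omega>). source_term d t x p k (\<lambda>s y. app_R1d d f (mlp d f g M l s y \<omega>))) \<in> borel_measurable (step_law d \<Otimes>\<^sub>M tree_law d)"
proof -
  let ?N = "step_law d \<Otimes>\<^sub>M tree_law d"
  have xm: "(\<lambda>_. x) \<in> ?N \<rightarrow>\<^sub>M borel_Rd d" using x by (auto simp: space_PiM)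
  have s: "(\<lambda>a. snd (fst a)) \<in> borel_measurable ?N"
    by (rule measurable_compose[OF measurable_fst measurable_step_snd])
  have z: "(\<lambda>a. fst (fst a)) \<in> ?N \<rightarrow>\<^sub>M borel_Rd d"
    by (rule measurable_compose[OF measurable_fst measurable_step_fst])
  have "(\<lambda>a. source_term d t x (fst a) k (\<lambda>s y. app_R1d d f (mlp d f g M l s y (snd a)))) \<in> borel_measurable ?N"
  proof (rule measurable_source_term[where \<tau>="\<lambda>_. t" and X="\<lambda>_. x" and p=fst, OF _ xm measurable_fst k])
    show "(\<lambda>a. app_R1d d f (mlp d f g M l (t * (1 - snd (fst a)))
        (add_scaled d x (sqrt (2 * t * snd (fst a))) (fst (fst a))) (snd a))) \<in> borel_measurable ?N"
      using s by (intro measurable_app_R1d[OF f_cont] measurable_mlp[OF f_cont g_cont] measurable_add_scaled xm z measurable_snd) auto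
  qed simp
  then show ?thesis by (simp add: case_prod_unfold)
qed

definition mlp_error :: "nat \<Rightarrow> nat \<Rightarrow> (int list \<Rightarrow> (nat \<Rightarrow> real) \<times> real) \<Rightarrow> real \<Rightarrow> (nat \<Rightarrow> real) \<Rightarrow> real" where
  "mlp_error M l \<omega> s y = app_R1d d f (mlp d f g M l s y \<omega>) - Fu s y"

text \<open>The defect in the mean when the nonlinearity is evaluated at the approximation of level
  l instead of at the solution. The means of the levels telescope to a single such term.\<close>

definition bias :: "nat \<Rightarrow> real \<Rightarrow> (nat \<Rightarrow> real) \<Rightarrow> nat \<Rightarrow> nat \<Rightarrow> real" where
  "bias M t x k l = (\<integral>a. (\<lambda>(p, \<omega>). source_term d t x p k (mlp_error M l \<omega>)) a \<partial>(step_law d \<Otimes>\<^sub>M tree_law d))"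

text \<open>The Lipschitz bound transfers the error of level l to the nonlinearity with the factor 4
  lam^2, and integration against the source term gains \<open>kap \<beta>\<close>. The product
  measure expresses that a step is independent of the subtree used after it.\<close>

lemma source_mlp_error_moment:
  assumes t: "0 < t" "t \<le> T" and x: "x \<in> Rd d" and k: "k \<le> d" and \<beta>: "\<beta> > 0" and e: "e \<ge> 0"
    and IH: "\<And>s y i. 0 < s \<Longrightarrow> s \<le> T \<Longrightarrow> y \<in> Rd d \<Longrightarrow> i \<le> d \<Longrightarrow>
      second_moment_le (tree_law d) (\<lambda>\<omega>. mlp d f g M l s y \<omega> i - ucomp i s y) (e * (exp (2 * \<beta> * s) * weight d y))"
  shows "second_moment_le (step_law d \<Otimes>\<^sub>M tree_law d) (\<lambda>(p, \<omega>). source_term d t x p k (mlp_error M l \<omega>))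
     (4 * lam\<^sup>2 * kap \<beta> * e * (exp (2 * \<beta> * t) * weight d x))"
proof -
  have "second_moment_le (step_law d \<Otimes>\<^sub>M tree_law d) (\<lambda>(p, \<omega>). source_term d t x p k (mlp_error M l \<omega>))
     (source_const T / sqrt \<beta> * (4 * lam\<^sup>2 * e) * exp (2 * \<beta> * t) * weight d x)"
  proof (rule source_second_moment[OF t k \<beta> _ prob_space_tree_law])
    have "(\<lambda>(p, \<omega>). source_term d t x p k (\<lambda>s y. app_R1d d f (mlp d f g M l s y \<omega>)) - source_term d t x p k Fu)
        \<in> borel_measurable (step_law d \<Otimes>\<^sub>M tree_law d)"
      using borel_measurable_diff[OF measurable_source_mlp[OF x k] measurable_compose[OF measurable_fst source_Fu_measurable[OF t x k]]]
      by (simp add: case_prod_unfold)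
    then show "(\<lambda>(p, \<omega>). source_term d t x p k (mlp_error M l \<omega>)) \<in> borel_measurable (step_law d \<Otimes>\<^sub>M tree_law d)"
      unfolding mlp_error_def source_term_diff .
    fix s y assume s: "0 < s" "s < t" and y: "y \<in> Rd d"
    have "second_moment_le (tree_law d) (\<lambda>\<omega>. app_R1d d f (mlp d f g M l s y \<omega>) - app_R1d d f (uvec s y))
        (4 * lam\<^sup>2 * (e * (exp (2 * \<beta> * s) * weight d y)))"
    proof (rule app_R1d_second_moment)
      show "second_moment_le (tree_law d) (\<lambda>\<omega>. mlp d f g M l s y \<omega> i - uvec s y i) (e * (exp (2 * \<beta> * s) * weight d y))"
        if "i \<le> d" for i
        unfolding uvec_def using s t y that by (intro IH) auto
      show "0 \<le> e * (exp (2 * \<beta> * s) * weight d y)"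
        using e weight_ge_1[OF d_pos, of y] by simp
      show "(\<lambda>\<omega>. app_R1d d f (mlp d f g M l s y \<omega>)) \<in> borel_measurable (tree_law d)"
        using y by (intro measurable_app_R1d[OF f_cont] measurable_mlp[OF f_cont g_cont]) (auto simp: space_PiM)
    qed
    then show "second_moment_le (tree_law d) (\<lambda>\<omega>. mlp_error M l \<omega> s y) (4 * lam\<^sup>2 * e * exp (2 * \<beta> * s) * weight d y)"
      unfolding mlp_error_def Fu_eq by (simp add: mult.assoc)
  qed (use e in simp)
  then show ?thesis by (simp add: kap_def ac_simps)
qed

end

section \<open>Error recursion\<close>

lemma measurable_subtree_pair:
  "\<eta>0 \<in> Theta \<Longrightarrow> (\<lambda>\<omega>. (\<omega> \<eta>0, subtree \<eta>1 \<omega>)) \<in> tree_law d \<rightarrow>\<^sub>M step_law d \<Otimes>\<^sub>M tree_law d"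
  by (intro measurable_Pair measurable_tree_component measurable_subtree)

context semilinear_heat
begin

text \<open>A summand is indexed by the pair (l, i) for sample i of level l, and by (0, -i) for sample i of the
  initial value.\<close>
definition summand :: "nat \<Rightarrow> nat \<Rightarrow> real \<Rightarrow> (nat \<Rightarrow> real) \<Rightarrow> nat \<Rightarrow> nat \<times> int \<Rightarrow>
    (int list \<Rightarrow> (nat \<Rightarrow> real) \<times> real) \<Rightarrow> real" where
  "summand M n t x k j \<omega> =
     (if snd j < 0 then 1 / real (M^n) * init_term d g t x (fst (\<omega> [0, snd j])) k
      else 1 / real (M^(n - fst j)) * source_term d t x (\<omega> [int (fst j), snd j]) k (\<lambda>s y.
            app_R1d d f (mlp d f g M (fst j) s y (subtree [int (fst j), snd j] \<omega>))
            - of_bool (fst j \<ge> 1) * app_R1d d f (mlp d f g M (fst j - 1) s y (subtree [- int (fst j), snd j] \<omega>))))"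

definition indices :: "nat \<Rightarrow> nat \<Rightarrow> (nat \<times> int) set" where
  "indices M n = (\<lambda>i. (0, - int i)) ` {1..M^n} \<union> (\<lambda>(l, i). (l, int i)) ` (SIGMA l:{0..<n}. {1..M^(n - l)})"

lemma finite_indices: "finite (indices M n)"
  by (simp add: indices_def)

lemma sum_indices:
  "(\<Sum>j\<in>indices M n. h j) = (\<Sum>i=1..M^n. h (0, - int i)) + (\<Sum>l=0..<n. \<Sum>i=1..M^(n - l). h (l, int i))"
proof -
  have "(\<Sum>j\<in>indices M n. h j) = (\<Sum>j\<in>(\<lambda>i. (0, - int i)) ` {1..M^n}. h j)
      + (\<Sum>j\<in>(\<lambda>(l, i). (l, int i)) ` (SIGMA l:{0..<n}. {1..M^(n - l)}). h j)"
    unfolding indices_def by (rule sum.union_disjoint) auto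
  also have "(\<Sum>j\<in>(\<lambda>i. (0, - int i)) ` {1..M^n}. h j) = (\<Sum>i=1..M^n. h (0, - int i))"
    by (subst sum.reindex) (auto simp: inj_on_def)
  also have "(\<Sum>j\<in>(\<lambda>(l, i). (l, int i)) ` (SIGMA l:{0..<n}. {1..M^(n - l)}). h j)
      = (\<Sum>(l, i)\<in>(SIGMA l:{0..<n}. {1..M^(n - l)}). h (l, int i))"
    by (subst sum.reindex) (auto simp: inj_on_def case_prod_unfold)
  also have "\<dots> = (\<Sum>l=0..<n. \<Sum>i=1..M^(n - l). h (l, int i))"
    by (subst sum.Sigma) auto
  finally show ?thesis .
qed

lemma mlp_eq_sum_summands:
  assumes "n \<ge> 1"
  shows "mlp d f g M n t x \<omega> k = (if k = 0 then g x else 0) + (\<Sum>j\<in>indices M n. summand M n t x k j \<omega>)"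
proof -
  have "(\<Sum>i=1..M^n. summand M n t x k (0, - int i) \<omega>) = (\<Sum>i=1..M^n. 1 / real (M^n) * init_term d g t x (fst (\<omega> [0, - int i])) k)"
    by (intro sum.cong) (auto simp: summand_def)
  moreover have "(\<Sum>l=0..<n. \<Sum>i=1..M^(n - l). summand M n t x k (l, int i) \<omega>) =
     (\<Sum>l=0..<n. \<Sum>i=1..M^(n - l). 1 / real (M^(n - l)) *
          source_term d t x (\<omega> [int l, int i]) k (\<lambda>s y.
            app_R1d d f (mlp d f g M l s y (subtree [int l, int i] \<omega>))
            - of_bool (l \<ge> 1) * app_R1d d f (mlp d f g M (l - 1) s y (subtree [- int l, int i] \<omega>))))"
    by (intro sum.cong) (auto simp: summand_def)
  ultimately show ?thesis
    using assms unfolding sum_indices by (subst mlp.simps) (simp only: if_False add.assoc, simp)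
qed

lemma indep_summands:
  assumes "\<And>j. j \<in> indices M n \<Longrightarrow> summand M n t x k j \<in> borel_measurable (tree_law d)"
  shows "prob_space.indep_vars (tree_law d) (\<lambda>_. borel) (summand M n t x k) (indices M n)"
  \<comment> \<open>The summand (l, i) only uses the input below the indices (l, i) and (-l, i).\<close>
proof (rule indep_vars_tree_functions[where K="\<lambda>j. {\<eta>. \<exists>a r. \<eta> = a # snd j # r \<and> nat \<bar>a\<bar> = fst j}"])
  show "{\<eta>. \<exists>a r. \<eta> = a # snd j # r \<and> nat \<bar>a\<bar> = fst j} \<subseteq> Theta" for j :: "nat \<times> int"
    by (auto simp: Theta_def)
  show "disjoint_family_on (\<lambda>j. {\<eta>. \<exists>a r. \<eta> = a # snd j # r \<and> nat \<bar>a\<bar> = fst j}) (indices M n)"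
    by (auto simp: disjoint_family_on_def prod_eq_iff)
  fix j and \<omega> \<omega>' :: "int list \<Rightarrow> (nat \<Rightarrow> real) \<times> real" assume j: "j \<in> indices M n"
    and eq: "\<And>\<eta>. \<eta> \<in> {\<eta>. \<exists>a r. \<eta> = a # snd j # r \<and> nat \<bar>a\<bar> = fst j} \<Longrightarrow> \<omega> \<eta> = \<omega>' \<eta>"
  \<comment> \<open>A negative second component marks a sample of the initial value, which is filed
    under level 0; hence \<open>[0, snd j]\<close> also belongs to the index set of j.\<close>
  have l0: "fst j = 0" if "snd j < 0" using j that by (auto simp: indices_def)
  have v: "\<omega> [a, snd j] = \<omega>' [a, snd j]" if "nat \<bar>a\<bar> = fst j" for a
    using that by (intro eq) auto
  have sub: "subtree [a, snd j] \<omega> = subtree [a, snd j] \<omega>'" if "nat \<bar>a\<bar> = fst j" for a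
    unfolding subtree_def using that by (intro restrict_ext eq) auto
  show "summand M n t x k j \<omega> = summand M n t x k j \<omega>'"
    unfolding summand_def using l0 v[of 0] v[of "int (fst j)"] sub[of "int (fst j)"] sub[of "- int (fst j)"] by simp
qed (rule assms)

definition source_mean :: "real \<Rightarrow> (nat \<Rightarrow> real) \<Rightarrow> nat \<Rightarrow> real" where
  "source_mean t x k = (\<integral>p. source_term d t x p k Fu \<partial>step_law d)"

text \<open>Both evaluations in a level use the same pair, so the term is a difference of two errors
  relative to the same \<open>Fu\<close>, and the exact source cancels. For m = 0 nothing is
  subtracted and the exact source survives as \<open>source_mean\<close>; as the approximation of
  level 0 is 0, the second moment is then controlled by f0 alone.\<close>

lemma source_level_moments:
  fixes q :: int
  assumes t: "0 < t" "t \<le> T" and x: "x \<in> Rd d" and k: "k \<le> d" and \<beta>: "\<beta> > 0"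
    and e: "\<And>l. e l \<ge> 0"
    and IH: "\<And>l s y i. l \<le> m \<Longrightarrow> 0 < s \<Longrightarrow> s \<le> T \<Longrightarrow> y \<in> Rd d \<Longrightarrow> i \<le> d \<Longrightarrow>
      second_moment_le (tree_law d) (\<lambda>\<omega>. mlp d f g M l s y \<omega> i - ucomp i s y) (e l * (exp (2 * \<beta> * s) * weight d y))"
  assumes Y_def: "Y = (\<lambda>\<omega>. source_term d t x (\<omega> [int m, q]) k (\<lambda>s y.
            app_R1d d f (mlp d f g M m s y (subtree [int m, q] \<omega>))
            - of_bool (m \<ge> 1) * app_R1d d f (mlp d f g M (m - 1) s y (subtree [- int m, q] \<omega>))))"
  shows "second_moment_le (tree_law d) Y ((if m = 0 then kap \<beta> * f0\<^sup>2 else 8 * lam\<^sup>2 * kap \<beta> * (e m + e (m - 1))) * (exp (2 * \<beta> * t) * weight d x))"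
    and "(\<integral>\<omega>. Y \<omega> \<partial>tree_law d) = bias M t x k m - (if m = 0 then - source_mean t x k else bias M t x k (m - 1))"
proof -
  interpret tree: prob_space "tree_law d" by (rule prob_space_tree_law)
  interpret step: prob_space "step_law d" by (rule prob_space_step_law)
  interpret pr: prob_space "step_law d \<Otimes>\<^sub>M tree_law d" by (intro prob_space_pair prob_space_step_law prob_space_tree_law)
  let ?N = "step_law d \<Otimes>\<^sub>M tree_law d"
  define W where "W = exp (2 * \<beta> * t) * weight d x"
  have W: "W \<ge> 1" unfolding W_def by (rule ew_ge_1[OF \<beta> t(1)])
  have kp: "kap \<beta> \<ge> 0" by (rule kap_nonneg[OF \<beta>])
  have sm: "second_moment_le ?N (\<lambda>(p, \<omega>). source_term d t x p k (mlp_error M l \<omega>)) (4 * lam\<^sup>2 * kap \<beta> * e l * W)"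
    if "l \<le> m" for l
    unfolding W_def by (rule source_mlp_error_moment[OF t x k \<beta> e IH[OF that]])
  have \<eta>0: "[int m, q] \<in> Theta" by (simp add: Theta_def)
  \<comment> \<open>Indices below a two-letter index are longer than [int m, q], so the pair is
    independent of both subtrees, even of the one below its own index.\<close>
  have notin: "[a, q] @ \<eta> \<noteq> [int m, q]" if "\<eta> \<in> Theta" for a \<eta>
    using that by (simp add: Theta_def)
  have "second_moment_le (tree_law d) Y ((if m = 0 then kap \<beta> * f0\<^sup>2 else 8 * lam\<^sup>2 * kap \<beta> * (e m + e (m - 1))) * W)
    \<and> (\<integral>\<omega>. Y \<omega> \<partial>tree_law d) = bias M t x k m - (if m = 0 then - source_mean t x k else bias M t x k (m - 1))"
  proof (cases "m = 0")
    case False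
    define X where "X l a \<omega> = (\<lambda>(p, \<omega>). source_term d t x p k (mlp_error M l \<omega>)) (\<omega> [int m, q], subtree [a, q] \<omega>)"
      for l and a :: int and \<omega>
    have Y_eq: "Y = (\<lambda>\<omega>. X m (int m) \<omega> - X (m - 1) (- int m) \<omega>)"
      using False unfolding Y_def X_def by (auto simp: fun_eq_iff source_term_diff[symmetric] mlp_error_def)
    have Xm: "second_moment_le (tree_law d) (X l a) (4 * lam\<^sup>2 * kap \<beta> * e l * W)"
      and Xe: "(\<integral>\<omega>. X l a \<omega> \<partial>tree_law d) = bias M t x k l" if "l \<le> m" for l a
    proof -
      note mp = measurable_subtree_pair[OF \<eta>0]
      have dp: "distr (tree_law d) ?N (\<lambda>\<omega>. (\<omega> [int m, q], subtree [a, q] \<omega>)) = ?N"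
        by (rule distr_subtree_pair[OF \<eta>0 notin])
      show "second_moment_le (tree_law d) (X l a) (4 * lam\<^sup>2 * kap \<beta> * e l * W)"
        unfolding X_def by (rule second_moment_le_distr[OF sm[OF that] mp dp])
      have "(\<integral>\<omega>. X l a \<omega> \<partial>tree_law d) = (\<integral>p. (\<lambda>(p, \<omega>). source_term d t x p k (mlp_error M l \<omega>)) p \<partial>distr (tree_law d) ?N (\<lambda>\<omega>. (\<omega> [int m, q], subtree [a, q] \<omega>)))"
        unfolding X_def using sm[OF that] by (intro integral_distr[symmetric] mp) (simp add: second_moment_le_def)
      then show "(\<integral>\<omega>. X l a \<omega> \<partial>tree_law d) = bias M t x k l" unfolding dp bias_def .
    qed
    have nn: "4 * lam\<^sup>2 * kap \<beta> * e l * W \<ge> 0" for l using kp e W by simp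
    have "second_moment_le (tree_law d) Y (2 * (4 * lam\<^sup>2 * kap \<beta> * e m * W) + 2 * (4 * lam\<^sup>2 * kap \<beta> * e (m - 1) * W))"
      unfolding Y_eq by (intro second_moment_le_diff Xm nn) auto
    moreover have "(\<integral>\<omega>. Y \<omega> \<partial>tree_law d) = bias M t x k m - bias M t x k (m - 1)"
      unfolding Y_eq using tree.second_moment_le_mean(1)[OF Xm nn]
      by (subst Bochner_Integration.integral_diff) (auto simp: Xe)
    ultimately show ?thesis using False by (simp add: algebra_simps)
  next
    case True
    define Z where "Z p = source_term d t x p k (\<lambda>s y. f0)" for p
    have Y_eq: "Y = (\<lambda>\<omega>. Z (\<omega> [int m, q]))"
      using True unfolding Y_def Z_def by (simp add: mlp_0 app_R1d_0)
    have xm: "(\<lambda>_. x) \<in> step_law d \<rightarrow>\<^sub>M borel_Rd d" using x by (auto simp: space_PiM)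
    have Zmeas: "Z \<in> borel_measurable (step_law d)"
      unfolding Z_def by (rule measurable_source_term[where \<tau>="\<lambda>_. t" and X="\<lambda>_. x" and p="\<lambda>p. p" and h="\<lambda>_ _ _. f0"])
        (use k xm in auto)
    have "second_moment_le ?N (\<lambda>(p, \<omega>). source_term d t x p k (\<lambda>s y. f0)) (source_const T / sqrt \<beta> * f0\<^sup>2 * exp (2 * \<beta> * t) * weight d x)"
    proof (rule source_second_moment[OF t k \<beta> _ prob_space_tree_law])
      show "(\<lambda>(p, \<omega>). source_term d t x p k (\<lambda>s y. f0)) \<in> borel_measurable ?N"
        using measurable_compose[OF measurable_fst Zmeas] by (simp add: case_prod_unfold Z_def)
      fix s y assume s: "0 < s" "s < t" "y \<in> Rd d"
      have "f0\<^sup>2 * 1 \<le> f0\<^sup>2 * (exp (2 * \<beta> * s) * weight d y)"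
        by (intro mult_left_mono ew_ge_1 \<beta> s) simp
      then show "second_moment_le (tree_law d) (\<lambda>\<omega>. f0) (f0\<^sup>2 * exp (2 * \<beta> * s) * weight d y)"
        by (intro tree.second_moment_le_const) (simp add: mult.assoc)
    qed simp
    then have Zm: "second_moment_le (step_law d) Z (kap \<beta> * f0\<^sup>2 * W)"
      by (intro second_moment_le_fst[OF _ prob_space_tree_law Zmeas]) (simp add: case_prod_unfold kap_def W_def Z_def mult.assoc)
    have Zi: "integrable (step_law d) Z"
      using step.second_moment_le_mean(1)[OF Zm] kp W by simp
    have mc: "(\<lambda>\<omega>. \<omega> [int m, q]) \<in> tree_law d \<rightarrow>\<^sub>M step_law d" by (rule measurable_tree_component[OF \<eta>0])
    have "second_moment_le (tree_law d) Y (kap \<beta> * f0\<^sup>2 * W)"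
      unfolding Y_eq by (rule second_moment_le_distr[OF Zm mc distr_tree_component[OF \<eta>0]])
    moreover have "(\<integral>\<omega>. Y \<omega> \<partial>tree_law d) = (\<integral>p. Z p \<partial>step_law d)"
      unfolding Y_eq using integral_distr[OF mc Zmeas] by (simp add: distr_tree_component[OF \<eta>0])
    moreover have "bias M t x k m = (\<integral>p. Z p \<partial>step_law d) - source_mean t x k"
    proof -
      let ?D = "\<lambda>p. Z p - source_term d t x p k Fu"
      have Dm: "?D \<in> borel_measurable (step_law d)"
        by (intro borel_measurable_diff Zmeas source_Fu_measurable[OF t x k])
      have "second_moment_le ?N (\<lambda>p. ?D (fst p)) (4 * lam\<^sup>2 * kap \<beta> * e m * W)"
        using sm[of m] unfolding mlp_error_def source_term_diff Z_def True mlp_0 app_R1d_0 by (simp add: case_prod_unfold)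
      from step.second_moment_le_mean(1)[OF second_moment_le_fst[OF this prob_space_tree_law Dm]]
      have Di: "integrable (step_law d) ?D" using kp e W by simp
      have Fi: "integrable (step_law d) (\<lambda>p. source_term d t x p k Fu)"
        using Bochner_Integration.integrable_diff[OF Zi Di] by simp
      have "bias M t x k m = (\<integral>a. ?D (fst a) \<partial>?N)"
        unfolding bias_def mlp_error_def source_term_diff Z_def True mlp_0 app_R1d_0 by (simp add: case_prod_unfold)
      also have "\<dots> = (\<integral>p. ?D p \<partial>distr ?N (step_law d) fst)"
        by (rule integral_distr[symmetric, OF measurable_fst Dm])
      also have "\<dots> = (\<integral>p. ?D p \<partial>step_law d)" by (simp add: tree.distr_pair_fst)
      also have "\<dots> = (\<integral>p. Z p \<partial>step_law d) - source_mean t x k"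
        unfolding source_mean_def using Zi Fi by simp
      finally show ?thesis .
    qed
    ultimately show ?thesis using True by simp
  qed
  then show "second_moment_le (tree_law d) Y ((if m = 0 then kap \<beta> * f0\<^sup>2 else 8 * lam\<^sup>2 * kap \<beta> * (e m + e (m - 1))) * (exp (2 * \<beta> * t) * weight d x))"
    and "(\<integral>\<omega>. Y \<omega> \<partial>tree_law d) = bias M t x k m - (if m = 0 then - source_mean t x k else bias M t x k (m - 1))"
    unfolding W_def by auto
qed

lemma init_level_moments:
  assumes t: "0 < t" "t \<le> T" and x: "x \<in> Rd d" and k: "k \<le> d"
  shows "second_moment_le (tree_law d) (\<lambda>\<omega>. init_term d g t x (fst (\<omega> [0, q])) k) init_const"
    and "(\<integral>\<omega>. init_term d g t x (fst (\<omega> [0, q])) k \<partial>tree_law d) = (\<integral>z. init_term d g t x z k \<partial>std_normal_Rd d)"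
proof -
  interpret R: prob_space rlaw by (rule prob_space_rlaw)
  have \<eta>0: "[0, q] \<in> Theta" by (simp add: Theta_def)
  have fm: "fst \<in> step_law d \<rightarrow>\<^sub>M std_normal_Rd d" unfolding step_law_def by simp
  have m: "(\<lambda>\<omega>. fst (\<omega> [0, q])) \<in> tree_law d \<rightarrow>\<^sub>M std_normal_Rd d"
    by (rule measurable_compose[OF measurable_tree_component[OF \<eta>0] fm])
  have "distr (tree_law d) (std_normal_Rd d) (\<lambda>\<omega>. fst (\<omega> [0, q])) = distr (distr (tree_law d) (step_law d) (\<lambda>\<omega>. \<omega> [0, q])) (std_normal_Rd d) fst"
    by (subst distr_distr[OF fm measurable_tree_component[OF \<eta>0]]) (simp add: o_def)
  also have "\<dots> = std_normal_Rd d"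
    unfolding distr_tree_component[OF \<eta>0] unfolding step_law_def by (rule R.distr_pair_fst)
  finally have dd: "distr (tree_law d) (std_normal_Rd d) (\<lambda>\<omega>. fst (\<omega> [0, q])) = std_normal_Rd d" .
  note im = init_second_moment[OF t x k]
  show "second_moment_le (tree_law d) (\<lambda>\<omega>. init_term d g t x (fst (\<omega> [0, q])) k) init_const"
    by (rule second_moment_le_distr[OF im m dd])
  have "(\<lambda>z. init_term d g t x z k) \<in> borel_measurable (std_normal_Rd d)"
    using im by (simp add: second_moment_le_def)
  from integral_distr[OF m this]
  show "(\<integral>\<omega>. init_term d g t x (fst (\<omega> [0, q])) k \<partial>tree_law d) = (\<integral>z. init_term d g t x z k \<partial>std_normal_Rd d)"
    unfolding dd by simp
qed

text \<open>After multiplication by M^n / 2^n, the levels contribute at most C0 / 4, the bias C0 /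
  24, and the initial samples together with f at the origin C0 / 6, in sum less than C0. The sum of
  2^l over l < n is below 2^n, which is how the ratio 2 / M reproduces itself.\<close>

lemma error_recursion_le:
  fixes q C0 I F L2 M W :: real
  assumes q: "q \<ge> 0" and C0: "C0 \<ge> 0" and I: "I \<ge> 0" and L2: "L2 \<ge> 0" and M: "M \<ge> 1" and W: "W \<ge> 1"
    and small: "48 * L2 * q * M \<le> 1" and IF: "I + q * F \<le> C0 / 6" and n: "n \<ge> 1"
  defines "e \<equiv> \<lambda>l. C0 * (2 / M) ^ l"
  shows "I / M^n + (\<Sum>l=0..<n. (if l = 0 then q * F else 8 * L2 * q * (e l + e (l - 1))) * W / M^(n - l))
     + 4 * L2 * q * e (n - 1) * W \<le> e n * W"
proof -
  have Mp: "M > 0" using M by simp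
  have level: "(if l = 0 then q * F else 8 * L2 * q * (e l + e (l - 1))) / M^(n - l)
      \<le> (if l = 0 then q * F / M^n else 0) + C0 / 4 * 2^l / M^n" if l: "l \<in> {0..<n}" for l
  proof (cases "l = 0")
    case True
    then show ?thesis using C0 Mp by simp
  next
    case False
    then obtain l' where l': "l = Suc l'" by (cases l) auto
    have Mn: "M^n = M^(n - l) * M^l" using l by (simp add: power_add[symmetric])
    have e1: "e l / M^(n - l) = C0 * 2^l / M^n"
      unfolding e_def Mn using Mp by (simp add: power_divide)
    \<comment> \<open>The term with l - 1 lacks one factor 2 / M and is larger by M / 2. This forces
      q M, and not just q, to be small, hence \<beta> of order M^2.\<close>
    have e2: "e (l - 1) / M^(n - l) = C0 * 2^l * (M / 2) / M^n"
      unfolding e_def Mn l' using Mp by (simp add: power_divide)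
    have "8 * L2 * q * (e l + e (l - 1)) / M^(n - l) = 8 * L2 * q * (e l / M^(n - l) + e (l - 1) / M^(n - l))"
      by (simp only: add_divide_distrib[symmetric] times_divide_eq_right)
    also have "\<dots> = 8 * L2 * q * (1 + M / 2) * (C0 * 2^l / M^n)"
      unfolding e1 e2 using Mp by (simp add: field_simps)
    also have "\<dots> \<le> 1 / 4 * (C0 * 2^l / M^n)"
    proof (rule mult_right_mono)
      have "8 * L2 * q * (1 + M / 2) \<le> 8 * L2 * q * (M + M / 2)"
        using M L2 q by (intro mult_left_mono) auto
      also have "\<dots> = 48 * L2 * q * M / 4" by simp
      also have "\<dots> \<le> 1 / 4" by (rule divide_right_mono[OF small]) simp
      finally show "8 * L2 * q * (1 + M / 2) \<le> 1 / 4" .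
    qed (use C0 Mp in simp)
    finally show ?thesis using False by simp
  qed
  have "(\<Sum>l=0..<n. (if l = 0 then q * F else 8 * L2 * q * (e l + e (l - 1))) / M^(n - l))
      \<le> (\<Sum>l=0..<n. (if l = 0 then q * F / M^n else 0) + C0 / 4 * 2^l / M^n)"
    by (rule sum_mono[OF level])
  also have "\<dots> = q * F / M^n + C0 / 4 / M^n * (\<Sum>l=0..<n. 2^l)"
    using n by (simp add: sum.distrib sum.delta sum_distrib_left sum_divide_distrib mult.commute)
  also have "(\<Sum>l=0..<n. 2^l :: real) = 2^n - 1"
    by (induction n) auto
  also have "q * F / M^n + C0 / 4 / M^n * (2^n - 1) \<le> q * F / M^n + C0 / 4 * 2^n / M^n"
    using C0 Mp by (simp add: field_simps)
  finally have s1: "(\<Sum>l=0..<n. (if l = 0 then q * F else 8 * L2 * q * (e l + e (l - 1))) / M^(n - l))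
      \<le> q * F / M^n + C0 / 4 * 2^n / M^n" .
  obtain n' where n': "n = Suc n'" using n by (cases n) auto
  have "4 * L2 * q * e (n - 1) = 48 * L2 * q * M * (C0 / 24 * 2^n / M^n)"
    unfolding e_def n' using Mp by (simp add: power_divide field_simps)
  also have "\<dots> \<le> 1 * (C0 / 24 * 2^n / M^n)"
    using C0 Mp by (intro mult_right_mono small) simp
  finally have s2: "4 * L2 * q * e (n - 1) \<le> C0 / 24 * 2^n / M^n" by simp
  have "I / M^n + q * F / M^n \<le> C0 / 6 / M^n"
    using divide_right_mono[OF IF, of "M^n"] Mp by (simp add: add_divide_distrib)
  also have "\<dots> \<le> C0 / 6 * 2^n / M^n"
    using C0 Mp mult_left_mono[of 1 "2^n" "C0 / 6"] by (intro divide_right_mono) auto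
  finally have s3: "I / M^n + q * F / M^n \<le> C0 / 6 * 2^n / M^n" .
  have en: "e n = C0 * 2^n / M^n" by (simp add: e_def power_divide)
  have "C0 * 2^n / M^n \<ge> 0" using C0 Mp by simp
  then have "I / M^n + (\<Sum>l=0..<n. (if l = 0 then q * F else 8 * L2 * q * (e l + e (l - 1))) / M^(n - l))
      + 4 * L2 * q * e (n - 1) \<le> e n"
    using s1 s2 s3 unfolding en by simp
  then have "(I / M^n + (\<Sum>l=0..<n. (if l = 0 then q * F else 8 * L2 * q * (e l + e (l - 1))) / M^(n - l))
      + 4 * L2 * q * e (n - 1)) * W \<le> e n * W"
    using W by (intro mult_right_mono) auto
  moreover have "I / M^n * 1 \<le> I / M^n * W" using I W Mp by (intro mult_left_mono) auto
  ultimately show ?thesis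
    by (simp add: distrib_right sum_distrib_right)
qed

text \<open>The induction is over all t, x and k at once with one fixed \<beta>, since level n at
  time t uses lower levels at all earlier times. For n = 0 the error is the solution itself.\<close>

theorem mlp_error_bound:
  assumes \<beta>: "\<beta> > 0" and M: "M \<ge> 1" and small: "48 * lam\<^sup>2 * kap \<beta> * real M \<le> 1"
    and t: "0 < t" "t \<le> T" and x: "x \<in> Rd d" and k: "k \<le> d"
  shows "second_moment_le (tree_law d) (\<lambda>\<omega>. mlp d f g M n t x \<omega> k - ucomp k t x)
    (error_const * (2 / real M)^n * (exp (2 * \<beta> * t) * weight d x))"
  using t x k
proof (induction n arbitrary: t x k rule: less_induct)
  case (less n)
  note t = less.prems(1,2) and x = less.prems(3) and k = less.prems(4)
  interpret tree: prob_space "tree_law d" by (rule prob_space_tree_law)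
  interpret pr: prob_space "step_law d \<Otimes>\<^sub>M tree_law d" by (intro prob_space_pair prob_space_step_law prob_space_tree_law)
  define e where "e l = error_const * (2 / real M)^l" for l :: nat
  have e0: "e l \<ge> 0" for l using error_const_nonneg by (simp add: e_def)
  define W where "W = exp (2 * \<beta> * t) * weight d x"
  have W: "W \<ge> 1" unfolding W_def by (rule ew_ge_1[OF \<beta> t(1)])
  have kp: "kap \<beta> \<ge> 0" by (rule kap_nonneg[OF \<beta>])
  have "48 * lam\<^sup>2 * kap \<beta> * 1 \<le> 48 * lam\<^sup>2 * kap \<beta> * real M"
    using M kp by (intro mult_left_mono) auto
  then have small1: "48 * lam\<^sup>2 * kap \<beta> \<le> 1" using small by simp
  show ?case
  proof (cases "n = 0")
    case True
    show ?thesis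
      using ucomp_bound[OF \<beta> small1 t x k] True by (simp add: mlp_0 tree.second_moment_le_const)
  next
    case False
    define m2 where "m2 l = (if l = 0 then kap \<beta> * f0\<^sup>2 else 8 * lam\<^sup>2 * kap \<beta> * (e l + e (l - 1)))" for l
    have m2: "m2 l \<ge> 0" for l unfolding m2_def using kp e0 by simp
    define lm where "lm l = bias M t x k l - (if l = 0 then - source_mean t x k else bias M t x k (l - 1))" for l
    define im where "im = (\<integral>z. init_term d g t x z k \<partial>std_normal_Rd d)"
    have src: "second_moment_le (tree_law d) (summand M n t x k (l, int i)) ((1 / real (M^(n - l)))\<^sup>2 * (m2 l * W))"
      "(\<integral>\<omega>. summand M n t x k (l, int i) \<omega> \<partial>tree_law d) = 1 / real (M^(n - l)) * lm l" if l: "l < n" for l i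
    proof -
      let ?Y = "\<lambda>\<omega>. source_term d t x (\<omega> [int l, int i]) k (\<lambda>s y.
            app_R1d d f (mlp d f g M l s y (subtree [int l, int i] \<omega>))
            - of_bool (l \<ge> 1) * app_R1d d f (mlp d f g M (l - 1) s y (subtree [- int l, int i] \<omega>)))"
      have IH: "second_moment_le (tree_law d) (\<lambda>\<omega>. mlp d f g M l' s y \<omega> i - ucomp i s y) (e l' * (exp (2 * \<beta> * s) * weight d y))"
        if "l' \<le> l" "0 < s" "s \<le> T" "y \<in> Rd d" "i \<le> d" for l' s y i
        unfolding e_def using that l by (intro less.IH) auto
      note lev = source_level_moments[OF t x k \<beta> e0 IH, of l "?Y" "int i", OF _ _ _ _ _ refl]
      have eq: "summand M n t x k (l, int i) = (\<lambda>\<omega>. 1 / real (M^(n - l)) * ?Y \<omega>)"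
        by (auto simp: summand_def fun_eq_iff)
      have lev1: "second_moment_le (tree_law d) ?Y (m2 l * W)"
        unfolding m2_def W_def by (rule lev(1))
      show "second_moment_le (tree_law d) (summand M n t x k (l, int i)) ((1 / real (M^(n - l)))\<^sup>2 * (m2 l * W))"
        unfolding eq using m2 W by (intro second_moment_le_cmult[OF lev1]) simp
      have lev2: "(\<integral>\<omega>. ?Y \<omega> \<partial>tree_law d) = lm l"
        unfolding lm_def by (rule lev(2))
      show "(\<integral>\<omega>. summand M n t x k (l, int i) \<omega> \<partial>tree_law d) = 1 / real (M^(n - l)) * lm l"
        unfolding eq integral_mult_right_zero lev2 ..
    qed
    have ini: "second_moment_le (tree_law d) (summand M n t x k (0, - int i)) ((1 / real (M^n))\<^sup>2 * init_const)"
      "(\<integral>\<omega>. summand M n t x k (0, - int i) \<omega> \<partial>tree_law d) = 1 / real (M^n) * im" if i: "i \<ge> 1" for i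
    proof -
      have eq: "summand M n t x k (0, - int i) = (\<lambda>\<omega>. 1 / real (M^n) * init_term d g t x (fst (\<omega> [0, - int i])) k)"
        using i by (auto simp: summand_def fun_eq_iff)
      show "second_moment_le (tree_law d) (summand M n t x k (0, - int i)) ((1 / real (M^n))\<^sup>2 * init_const)"
        unfolding eq by (intro second_moment_le_cmult init_level_moments t x k init_const_nonneg)
      show "(\<integral>\<omega>. summand M n t x k (0, - int i) \<omega> \<partial>tree_law d) = 1 / real (M^n) * im"
        unfolding eq integral_mult_right_zero init_level_moments(2)[OF t x k] im_def ..
    qed
    define b where "b j = (if snd j < 0 then (1 / real (M^n))\<^sup>2 * init_const else (1 / real (M^(n - fst j)))\<^sup>2 * (m2 (fst j) * W))" for j :: "nat \<times> int"
    have b0: "b j \<ge> 0" for j unfolding b_def using init_const_nonneg m2 W by simp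
    have sm: "second_moment_le (tree_law d) (summand M n t x k j) (b j)" if "j \<in> indices M n" for j
      using that src(1) ini(1) unfolding indices_def b_def by auto
    note D = second_moment_leD[OF sm b0]
    \<comment> \<open>The summands do not contain the deterministic term g x, so it is moved to the
      target value.\<close>
    define c where "c = ucomp k t x - (if k = 0 then g x else 0)"
    have c: "c = im + source_mean t x k"
      unfolding c_def im_def source_mean_def feynman_kac[OF t x k] by simp
    have Mn: "real (M^i) > 0" for i using M by simp
    \<comment> \<open>Level 0 supplies the exact mean \<open>source_mean\<close>, and the
      differences of biases collapse to the bias of the last level.\<close>
    have tele: "(\<Sum>l=0..<m. lm l) = (if m = 0 then 0 else bias M t x k (m - 1) + source_mean t x k)" for m
      by (induction m) (auto simp: lm_def)
    have mean: "(\<Sum>j\<in>indices M n. \<integral>\<omega>. summand M n t x k j \<omega> \<partial>tree_law d) - c = bias M t x k (n - 1)"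
    proof -
      have "(\<Sum>j\<in>indices M n. \<integral>\<omega>. summand M n t x k j \<omega> \<partial>tree_law d)
          = (\<Sum>i=1..M^n. 1 / real (M^n) * im) + (\<Sum>l=0..<n. \<Sum>i=1..M^(n - l). 1 / real (M^(n - l)) * lm l)"
        unfolding sum_indices by (intro arg_cong2[where f="(+)"] sum.cong refl ini(2) src(2)) auto
      also have "\<dots> = im + (\<Sum>l=0..<n. lm l)"
        using Mn M by simp
      finally show ?thesis using False by (simp add: tele c)
    qed
    have var: "(\<Sum>j\<in>indices M n. \<integral>\<omega>. (summand M n t x k j \<omega>)\<^sup>2 \<partial>tree_law d)
        \<le> init_const / real M^n + (\<Sum>l=0..<n. m2 l * W / real M^(n - l))"
    proof -
      have "(\<Sum>j\<in>indices M n. \<integral>\<omega>. (summand M n t x k j \<omega>)\<^sup>2 \<partial>tree_law d) \<le> (\<Sum>j\<in>indices M n. b j)"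
        by (intro sum_mono D(3))
      also have "\<dots> = (\<Sum>i=1..M^n. (1 / real (M^n))\<^sup>2 * init_const)
          + (\<Sum>l=0..<n. \<Sum>i=1..M^(n - l). (1 / real (M^(n - l)))\<^sup>2 * (m2 l * W))"
        unfolding sum_indices by (intro arg_cong2[where f="(+)"] sum.cong refl) (auto simp: b_def)
      also have "\<dots> = init_const / real M^n + (\<Sum>l=0..<n. m2 l * W / real M^(n - l))"
        using M by (intro arg_cong2[where f="(+)"] sum.cong refl) (simp_all add: power2_eq_square)
      finally show ?thesis .
    qed
    have "second_moment_le (step_law d \<Otimes>\<^sub>M tree_law d) (\<lambda>(p, \<omega>). source_term d t x p k (mlp_error M (n - 1) \<omega>))
        (4 * lam\<^sup>2 * kap \<beta> * e (n - 1) * W)"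
      unfolding W_def
    proof (rule source_mlp_error_moment[OF t x k \<beta> e0])
      fix s y i assume "0 < s" "s \<le> T" "y \<in> Rd d" "i \<le> d"
      then show "second_moment_le (tree_law d) (\<lambda>\<omega>. mlp d f g M (n - 1) s y \<omega> i - ucomp i s y)
          (e (n - 1) * (exp (2 * \<beta> * s) * weight d y))"
        unfolding e_def using False by (intro less.IH) auto
    qed
    from pr.second_moment_le_mean(2)[OF this]
    have bias: "(bias M t x k (n - 1))\<^sup>2 \<le> 4 * lam\<^sup>2 * kap \<beta> * e (n - 1) * W"
      unfolding bias_def using kp e0 W by simp
    note indep = tree.second_moment_indep_sum[OF finite_indices indep_summands[OF D(1)] D(2), of c]
    have eq: "mlp d f g M n t x \<omega> k - ucomp k t x = (\<Sum>j\<in>indices M n. summand M n t x k j \<omega>) - c" for \<omega>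
      using mlp_eq_sum_summands[of n M t x \<omega> k] False by (simp add: c_def)
    have "kap \<beta> * f0\<^sup>2 \<le> f0\<^sup>2 / (24 * lam\<^sup>2)"
    proof -
      have "48 * (lam\<^sup>2 * (kap \<beta> * f0\<^sup>2)) \<le> f0\<^sup>2"
        using mult_right_mono[OF small1, of "f0\<^sup>2"] by (simp add: mult.assoc)
      moreover have "0 \<le> lam\<^sup>2 * (kap \<beta> * f0\<^sup>2)" using kp by simp
      ultimately have "24 * lam\<^sup>2 * (kap \<beta> * f0\<^sup>2) \<le> f0\<^sup>2" by simp
      then show ?thesis using lam_pos by (simp add: field_simps)
    qed
    then have IF: "init_const + kap \<beta> * f0\<^sup>2 \<le> error_const / 6"
    proof -
      have "error_const / 6 = 2 * (g (zero_Rd d))\<^sup>2 + 2 * (D\<^sup>2 * lam\<^sup>2) + init_const + f0\<^sup>2 / (24 * lam\<^sup>2)"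
        unfolding error_const_def by simp
      moreover have "0 \<le> (g (zero_Rd d))\<^sup>2" "0 \<le> D\<^sup>2 * lam\<^sup>2" by simp_all
      ultimately show ?thesis using \<open>kap \<beta> * f0\<^sup>2 \<le> f0\<^sup>2 / (24 * lam\<^sup>2)\<close> by linarith
    qed
    have "tree.expectation (\<lambda>\<omega>. ((\<Sum>j\<in>indices M n. summand M n t x k j \<omega>) - c)\<^sup>2)
       \<le> init_const / real M^n + (\<Sum>l=0..<n. m2 l * W / real M^(n - l)) + 4 * lam\<^sup>2 * kap \<beta> * e (n - 1) * W"
      using indep(2) var bias unfolding mean by linarith
    also have "\<dots> \<le> e n * W"
      unfolding m2_def e_def
      by (rule error_recursion_le[OF kp error_const_nonneg init_const_nonneg _ _ W small IF]) (use M False in auto)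
    finally have le: "tree.expectation (\<lambda>\<omega>. ((\<Sum>j\<in>indices M n. summand M n t x k j \<omega>) - c)\<^sup>2) \<le> e n * W" .
    have "second_moment_le (tree_law d) (\<lambda>\<omega>. mlp d f g M n t x \<omega> k - ucomp k t x) (e n * W)"
      unfolding eq
      by (rule second_moment_leI[OF _ indep(1) order_refl le])
        (intro borel_measurable_diff borel_measurable_sum D(1) borel_measurable_const)
    then show ?thesis unfolding e_def W_def .
  qed
qed

end

section \<open>Cost versus error\<close>

lemma error_rate_tendsto_0:
  fixes A :: real
  assumes "A \<ge> 1"
  shows "(\<lambda>n. A ^ n * real n powr (- real n / 8)) \<longlonglongrightarrow> 0"
proof -
  \<comment> \<open>Adding 1 makes the growth coefficient strictly positive even for A = 1, so that
    one asymptotic comparison covers all A.\<close>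
  have "((\<lambda>x::real. exp ((ln A + 1) * x) * x powr (- x / 8)) \<longlongrightarrow> 0) at_top"
  proof -
    have "ln A + 1 > 0" using assms ln_ge_zero[of A] by linarith
    then show ?thesis by real_asymp
  qed
  then have "(\<lambda>n. exp ((ln A + 1) * real n) * real n powr (- real n / 8)) \<longlonglongrightarrow> 0"
    by (rule filterlim_compose[OF _ filterlim_real_sequentially])
  then show ?thesis
  proof (rule tendsto_sandwich[rotated -2, OF tendsto_const])
    have "A ^ n \<le> exp ((ln A + 1) * real n)" for n
      using assms exp_of_nat_mult[of n "ln A"] by (simp add: mult.commute distrib_left exp_add)
    then show "\<forall>\<^sub>F n in sequentially. A ^ n * real n powr (- real n / 8) \<le> exp ((ln A + 1) * real n) * real n powr (- real n / 8)"
      by (intro always_eventually allI mult_right_mono) auto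
  qed (use assms in auto)
qed

text \<open>The powers of n have exponents n / 4 from the cost and - (2 + \<delta>) n / 8 from the
  error, in sum - \<delta> n / 8. For \<delta> > 0 this superexponential decay beats all geometric
  factors and the shift from n to n + 1 in the cost.\<close>

lemma cost_error_product_tendsto_0:
  fixes A \<delta> :: real
  assumes A: "A \<ge> 1" and \<delta>: "\<delta> > 0"
  shows "(\<lambda>n. real (Suc n) * 8 ^ Suc n * real (Suc n) powr (real (Suc n) / 4)
      * (A ^ n * real n powr (- real n / 8)) powr (2 + \<delta>)) \<longlonglongrightarrow> 0"
proof -
  have "((\<lambda>x::real. (x + 1) * exp (ln 8 * (x + 1)) * (x + 1) powr ((x + 1) / 4)
      * (exp (ln A * x) * x powr (- x / 8)) powr (2 + \<delta>)) \<longlongrightarrow> 0) at_top"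
    using \<delta> by real_asymp
  then have "(\<lambda>n. (real n + 1) * exp (ln 8 * (real n + 1)) * (real n + 1) powr ((real n + 1) / 4)
      * (exp (ln A * real n) * real n powr (- real n / 8)) powr (2 + \<delta>)) \<longlonglongrightarrow> 0"
    by (rule filterlim_compose[OF _ filterlim_real_sequentially])
  moreover have "exp (ln A * real n) = A ^ n" for n
    using A exp_of_nat_mult[of n "ln A"] by (simp add: mult.commute)
  moreover have "exp (ln 8 * (real n + 1)) = 8 ^ Suc n" for n
    using exp_of_nat_mult[of "Suc n" "ln (8::real)"] by (simp add: mult.commute add.commute)
  ultimately show ?thesis by (simp add: add.commute)
qed

text \<open>N is the least index from which all errors are at most \<epsilon>. If N = m + 1 with m
  \<ge> 1, the error at m exceeds \<epsilon>, so multiplying the cost at m + 1 by (error /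
  \<epsilon>)^(2 + \<delta>) only increases it, and the product of the cost with that power of the
  error is bounded.\<close>

lemma complexity_choice:
  fixes A K p \<delta> :: real
  assumes A: "A \<ge> 1" and K: "K > 0" and p: "p \<ge> 0" and \<delta>: "\<delta> > 0"
  shows "\<exists>(c::real) (N :: nat \<Rightarrow> real \<Rightarrow> nat). \<forall>d\<ge>1. \<forall>\<epsilon>\<in>{0<..1}. N d \<epsilon> \<ge> 1
     \<and> real d * (real (N d \<epsilon>) * 8 ^ N d \<epsilon> * real (N d \<epsilon>) powr (real (N d \<epsilon>) / 4)) \<le> c * real d powr c * \<epsilon> powr (- (2 + \<delta>))
     \<and> (\<forall>n\<ge>N d \<epsilon>. K * real d powr p * (A ^ n * real n powr (- real n / 8)) \<le> \<epsilon>)"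
proof -
  define b where "b n = A ^ n * real n powr (- real n / 8)" for n
  have b0: "b n \<ge> 0" for n using A by (simp add: b_def)
  define cost where "cost n = real n * 8 ^ n * real n powr (real n / 4)" for n
  have cost0: "cost n \<ge> 0" for n by (simp add: cost_def)
  have "Bseq (\<lambda>n. cost (Suc n) * b n powr (2 + \<delta>))"
    using cost_error_product_tendsto_0[OF A \<delta>] unfolding cost_def b_def
    by (intro convergent_imp_Bseq) (auto simp: convergent_def)
  then obtain C where C: "C > 0" "\<And>n. \<bar>cost (Suc n) * b n powr (2 + \<delta>)\<bar> \<le> C"
    by (auto elim: BseqE)
  define good where "good d \<epsilon> m \<longleftrightarrow> m \<ge> 1 \<and> (\<forall>n\<ge>m. K * real d powr p * b n \<le> \<epsilon>)" for d :: nat and \<epsilon> m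
  define N where "N d \<epsilon> = (LEAST m. good d \<epsilon> m)" for d \<epsilon>
  have good: "good d \<epsilon> (N d \<epsilon>)" if "\<epsilon> > 0" for d \<epsilon>
  proof -
    have "(\<lambda>n. K * real d powr p * b n) \<longlonglongrightarrow> K * real d powr p * 0"
      unfolding b_def by (intro tendsto_mult tendsto_const error_rate_tendsto_0 A)
    then have "eventually (\<lambda>n. K * real d powr p * b n < \<epsilon>) sequentially"
      using that by (intro order_tendstoD) auto
    then obtain m where "\<And>n. n \<ge> m \<Longrightarrow> K * real d powr p * b n < \<epsilon>"
      unfolding eventually_sequentially by blast
    then have "good d \<epsilon> (Suc m)"
      unfolding good_def by (auto intro: less_imp_le)
    then show ?thesis unfolding N_def by (rule LeastI)
  qed
  \<comment> \<open>The same c serves as factor and as exponent. It dominates 8, which is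
    \<open>cost 1\<close>, and both the exponent of d and the factor obtained for larger N.\<close>
  define c where "c = 8 + (1 + p * (2 + \<delta>)) + C * K powr (2 + \<delta>)"
  have CK: "C * K powr (2 + \<delta>) \<ge> 0" using C by simp
  have c1: "c \<ge> 8" "c \<ge> 1" "c \<ge> 1 + p * (2 + \<delta>)" "c \<ge> C * K powr (2 + \<delta>)"
    unfolding c_def using CK p \<delta> by auto
  have cost_le: "real d * cost (N d \<epsilon>) \<le> c * real d powr c * \<epsilon> powr (- (2 + \<delta>))"
    if d: "d \<ge> 1" and \<epsilon>: "0 < \<epsilon>" "\<epsilon> \<le> 1" for d \<epsilon>
  proof -
    have dr: "real d \<ge> 1" using d by simp
    have \<epsilon>1: "\<epsilon> powr (- (2 + \<delta>)) \<ge> 1"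
      using powr_mono2'[of "- (2 + \<delta>)" \<epsilon> 1] \<epsilon> \<delta> by simp
    have N1: "N d \<epsilon> \<ge> 1" using good[OF \<epsilon>(1), of d] by (simp add: good_def)
    show ?thesis
    proof (cases "N d \<epsilon> = 1")
      case True
      have "real d * cost 1 = 8 * real d powr 1 * 1" using dr by (simp add: cost_def)
      also have "\<dots> \<le> c * real d powr c * \<epsilon> powr (- (2 + \<delta>))"
        using c1 dr \<epsilon>1 by (intro mult_mono powr_mono) auto
      finally show ?thesis using True by simp
    next
      case False
      then obtain m where m: "N d \<epsilon> = Suc m" "m \<ge> 1" using N1 by (cases "N d \<epsilon>") auto
      have "\<not> good d \<epsilon> m"
        using not_less_Least[of m "good d \<epsilon>"] m(1) by (simp add: N_def)
      moreover have "\<forall>n\<ge>Suc m. K * real d powr p * b n \<le> \<epsilon>"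
        using good[OF \<epsilon>(1), of d] m(1) by (simp add: good_def)
      ultimately have "K * real d powr p * b m > \<epsilon>"
        using m(2) unfolding good_def by (metis le_antisym not_less not_less_eq_eq)
      then have "1 \<le> (K * real d powr p * b m / \<epsilon>) powr (2 + \<delta>)"
        using \<epsilon> \<delta> by (intro ge_one_powr_ge_zero) auto
      also have "\<dots> = K powr (2 + \<delta>) * real d powr (p * (2 + \<delta>)) * b m powr (2 + \<delta>) * \<epsilon> powr (- (2 + \<delta>))"
      proof -
        have "(K * real d powr p * b m / \<epsilon>) powr (2 + \<delta>)
            = (K * real d powr p * b m) powr (2 + \<delta>) * \<epsilon> powr (- (2 + \<delta>))"
          using K \<epsilon> b0[of m] unfolding powr_minus_divide by (subst powr_divide) auto
        then show ?thesis using K b0[of m] by (simp add: powr_mult powr_powr)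
      qed
      finally have 1: "1 \<le> K powr (2 + \<delta>) * real d powr (p * (2 + \<delta>)) * b m powr (2 + \<delta>) * \<epsilon> powr (- (2 + \<delta>))" .
      have "real d * cost (Suc m) * 1 \<le> real d * cost (Suc m) *
         (K powr (2 + \<delta>) * real d powr (p * (2 + \<delta>)) * b m powr (2 + \<delta>) * \<epsilon> powr (- (2 + \<delta>)))"
        using 1 cost0 by (intro mult_left_mono) auto
      also have "\<dots> = (cost (Suc m) * b m powr (2 + \<delta>)) * K powr (2 + \<delta>)
          * (real d powr 1 * real d powr (p * (2 + \<delta>))) * \<epsilon> powr (- (2 + \<delta>))"
        using dr by simp
      also have "\<dots> \<le> C * K powr (2 + \<delta>) * (real d powr 1 * real d powr (p * (2 + \<delta>))) * \<epsilon> powr (- (2 + \<delta>))"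
        using C(2)[of m] by (intro mult_right_mono) auto
      also have "real d powr 1 * real d powr (p * (2 + \<delta>)) = real d powr (1 + p * (2 + \<delta>))"
        by (rule powr_add[symmetric])
      also have "C * K powr (2 + \<delta>) * real d powr (1 + p * (2 + \<delta>)) * \<epsilon> powr (- (2 + \<delta>))
          \<le> c * real d powr c * \<epsilon> powr (- (2 + \<delta>))"
        using c1 dr by (intro mult_right_mono mult_mono powr_mono) auto
      finally show ?thesis using m(1) by simp
    qed
  qed
  show ?thesis
  proof (rule exI[of _ c], rule exI[of _ N], intro allI impI ballI conjI)
    fix d :: nat and \<epsilon> assume d: "1 \<le> d" and \<epsilon>: "\<epsilon> \<in> {0<..1::real}"
    have g: "good d \<epsilon> (N d \<epsilon>)" using \<epsilon> by (intro good) simp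
    then show "N d \<epsilon> \<ge> 1" by (simp add: good_def)
    show "K * real d powr p * (A ^ n * real n powr (- real n / 8)) \<le> \<epsilon>" if "n \<ge> N d \<epsilon>" for n
      using g that unfolding good_def b_def by blast
    show "real d * (real (N d \<epsilon>) * 8 ^ N d \<epsilon> * real (N d \<epsilon>) powr (real (N d \<epsilon>) / 4)) \<le> c * real d powr c * \<epsilon> powr (- (2 + \<delta>))"
      using cost_le[OF d, of \<epsilon>] \<epsilon> unfolding cost_def by simp
  qed
qed

section \<open>The integer part of the fourth root of n\<close>

lemma root4_ge_1: "n \<ge> 1 \<Longrightarrow> root4 n \<ge> 1"
proof -
  assume "n \<ge> 1"
  then have "real n powr (1/4) \<ge> 1" by (intro ge_one_powr_ge_zero) auto
  then have "\<lfloor>real n powr (1/4)\<rfloor> \<ge> 1" by (simp add: le_floor_iff)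
  then show ?thesis unfolding root4_def by linarith
qed

lemma root4_le: "real (root4 n) \<le> real n powr (1/4)"
  unfolding root4_def by (simp add: of_nat_nat)

lemma root4_ge: "n \<ge> 1 \<Longrightarrow> real n powr (1/4) \<le> 2 * real (root4 n)"
proof -
  assume n: "n \<ge> 1"
  have "real n powr (1/4) < real_of_int \<lfloor>real n powr (1/4)\<rfloor> + 1" by linarith
  also have "real_of_int \<lfloor>real n powr (1/4)\<rfloor> = real (root4 n)" unfolding root4_def by (simp add: of_nat_nat)
  finally show ?thesis using root4_ge_1[OF n] by simp
qed

text \<open>With \<beta> of order M^2 this keeps exp (2 \<beta> T) at most geometric in n.\<close>

lemma root4_square_le:
  assumes n: "n \<ge> 1"
  shows "(real (root4 n))\<^sup>2 \<le> real n"
proof -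
  have "(real (root4 n))\<^sup>2 \<le> (real n powr (1/4))\<^sup>2" by (intro power_mono root4_le) simp
  also have "\<dots> = real n powr (1/2)" using n by (simp add: powr_power)
  also have "\<dots> \<le> real n powr 1" using n by (intro powr_mono) auto
  finally show ?thesis using n by simp
qed

lemma root4_power_le:
  assumes n: "n \<ge> 1"
  shows "real (root4 n) ^ n \<le> real n powr (real n / 4)"
proof -
  have "real (root4 n) ^ n \<le> (real n powr (1/4)) ^ n" by (intro power_mono root4_le) simp
  also have "\<dots> = real n powr (real n / 4)" using n by (simp add: powr_power)
  finally show ?thesis .
qed

text \<open>Rounding down at most halves the fourth root, so 2 / M is at most 4 n^(-1/4).\<close>

lemma two_div_root4_power_le:
  assumes n: "n \<ge> 1"
  shows "(2 / real (root4 n)) ^ n \<le> 4 ^ n * real n powr (- real n / 4)"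
proof -
  have pos: "real n powr (1/4) > 0" using n by simp
  have "2 / real (root4 n) \<le> 4 / real n powr (1/4)"
    using root4_ge[OF n] root4_ge_1[OF n] pos
      frac_le[of 4 4 "real n powr (1/4)" "2 * real (root4 n)"] by simp
  then have "(2 / real (root4 n)) ^ n \<le> (4 / real n powr (1/4)) ^ n" by (intro power_mono) auto
  also have "\<dots> = 4 ^ n * real n powr (- real n / 4)"
    using n by (simp add: power_divide powr_power powr_minus_divide)
  finally show ?thesis .
qed

text \<open>Level l costs at most 4 * 8^l times d M^n: twice from d + 1 \<le> 2 d, and once from
  each of the two earlier costs. The induction closes because 1 + 4 (8^n - 1) / 7 \<le> 8^n.\<close>

lemma cost_bound:
  fixes R :: "int \<Rightarrow> int" and d M :: nat
  assumes d: "d \<ge> 1" and M: "M \<ge> 1" and R0: "R 0 = 0"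
    and rec: "\<And>n::nat. n \<ge> 1 \<Longrightarrow> R (int n) \<le> int d * int M ^ n
        + (\<Sum>l=0..<n. int M ^ (n - l) * (int d + 1 + R (int l) + of_bool (l \<ge> 1) * R (int l - 1)))"
  shows "R (int n) \<le> int d * (8 ^ n * int M ^ n)"
proof (induction n rule: less_induct)
  case (less n)
  have Mi: "int M \<ge> 1" using M by simp
  have di: "int d \<ge> 1" using d by simp
  show ?case
  proof (cases "n = 0")
    case True then show ?thesis using R0 d by simp
  next
    case False
    have level: "int M ^ (n - l) * (int d + 1 + R (int l) + of_bool (l \<ge> 1) * R (int l - 1)) \<le> int d * int M ^ n * (4 * 8 ^ l)"
      if l: "l \<in> {0..<n}" for l
    proof -
      have Ml: "int M ^ l \<ge> 1" using Mi by simp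
      have a: "R (int l) \<le> int d * (8 ^ l * int M ^ l)" using l by (intro less) simp
      have b: "of_bool (l \<ge> 1) * R (int l - 1) \<le> int d * (8 ^ l * int M ^ l)"
      proof (cases "l \<ge> 1")
        case True
        then have "R (int l - 1) \<le> int d * (8 ^ (l - 1) * int M ^ (l - 1))"
          using less[of "l - 1"] l by (simp add: of_nat_diff)
        also have "\<dots> \<le> int d * (8 ^ l * int M ^ l)"
          using Mi by (intro mult_mono power_increasing) auto
        finally show ?thesis using True by simp
      qed simp
      have "int d * 1 \<le> int d * (8 ^ l * int M ^ l)"
        using Ml one_le_power[of "8::int" l] mult_mono[of 1 "8 ^ l :: int" 1 "int M ^ l"] by (intro mult_left_mono) auto
      then have "int d + 1 + R (int l) + of_bool (l \<ge> 1) * R (int l - 1) \<le> int d * (4 * (8 ^ l * int M ^ l))"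
        using a b di by linarith
      then have "int M ^ (n - l) * (int d + 1 + R (int l) + of_bool (l \<ge> 1) * R (int l - 1))
          \<le> int M ^ (n - l) * (int d * (4 * (8 ^ l * int M ^ l)))"
        by (intro mult_left_mono) auto
      also have "\<dots> = int d * (int M ^ (n - l) * int M ^ l) * (4 * 8 ^ l)" by simp
      also have "int M ^ (n - l) * int M ^ l = int M ^ n" using l by (simp add: power_add[symmetric])
      finally show ?thesis .
    qed
    have geo: "(\<Sum>l=0..<m. 8 ^ l :: int) * 7 = 8 ^ m - 1" for m by (induction m) auto
    have "R (int n) \<le> int d * int M ^ n + (\<Sum>l=0..<n. int d * int M ^ n * (4 * 8 ^ l))"
      by (rule order_trans[OF rec add_left_mono[OF sum_mono[OF level]]]) (use False in auto)
    also have "\<dots> = int d * int M ^ n * (1 + 4 * (\<Sum>l=0..<n. 8 ^ l))"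
      by (simp add: sum_distrib_left distrib_left)
    also have "\<dots> \<le> int d * int M ^ n * 8 ^ n"
    proof (rule mult_left_mono)
      have "(8::int) ^ n \<ge> 1" by simp
      then show "1 + 4 * (\<Sum>l=0..<n. 8 ^ l :: int) \<le> 8 ^ n" using geo[of n] by linarith
    qed simp
    finally show ?thesis by (simp add: ac_simps)
  qed
qed

text \<open>The bound for a single n is increasing in n, so N times the last one dominates the
  sum.\<close>

lemma total_cost_bound:
  fixes R :: "int \<Rightarrow> int \<Rightarrow> int" and d :: nat
  assumes d: "d \<ge> 1"
    and le: "\<And>n M. n \<ge> 1 \<Longrightarrow> M \<ge> 1 \<Longrightarrow> R (int n) (int M) \<le> int d * (8 ^ n * int M ^ n)"
  shows "real_of_int (\<Sum>n=1..N. R (int n) (int (root4 n))) \<le> real d * (real N * 8 ^ N * real N powr (real N / 4))"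
proof -
  have "real_of_int (R (int n) (int (root4 n))) \<le> real d * (8 ^ N * real N powr (real N / 4))" if n: "n \<in> {1..N}" for n
  proof -
    have n1: "n \<ge> 1" "n \<le> N" using n by auto
    have "real_of_int (R (int n) (int (root4 n))) \<le> real_of_int (int d * (8 ^ n * int (root4 n) ^ n))"
      unfolding of_int_le_iff by (intro le root4_ge_1 n1)
    also have "\<dots> = real d * (8 ^ n * real (root4 n) ^ n)" by simp
    also have "\<dots> \<le> real d * (8 ^ n * real n powr (real n / 4))"
      by (intro mult_left_mono root4_power_le n1) auto
    also have "\<dots> \<le> real d * (8 ^ N * real N powr (real N / 4))"
    proof (intro mult_left_mono mult_mono power_increasing n1)
      have "real n powr (real n / 4) \<le> real N powr (real n / 4)" using n1 by (intro powr_mono2) auto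
      also have "\<dots> \<le> real N powr (real N / 4)" using n1 by (intro powr_mono) auto
      finally show "real n powr (real n / 4) \<le> real N powr (real N / 4)" .
    qed auto
    finally show ?thesis .
  qed
  then have "(\<Sum>n=1..N. real_of_int (R (int n) (int (root4 n)))) \<le> (\<Sum>n=1..N. real d * (8 ^ N * real N powr (real N / 4)))"
    by (rule sum_mono)
  then show ?thesis by (simp add: mult.assoc mult.left_commute)
qed

text \<open>Distribution functions are compared. The given formula covers b in (0, 1), where v^2
  \<le> b means v \<le> sqrt b for positive v; for all other b the range of R decides.\<close>

lemma distr_eq_rlaw:
  assumes P: "prob_space P" and m: "R \<in> borel_measurable P"
    and range: "\<And>\<omega>. \<omega> \<in> space P \<Longrightarrow> R \<omega> \<in> {0<..<1::real}"
    and dist: "\<And>b. b \<in> {0<..<1} \<Longrightarrow> measure P {\<omega> \<in> space P. R \<omega> \<le> b} = sqrt b"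
  shows "distr P borel R = rlaw"
proof (rule cdf_unique)
  interpret P: prob_space P by (rule P)
  interpret U: prob_space unif01 by (rule prob_space_unif01)
  show "real_distribution (distr P borel R)" using m by (rule P.real_distribution_distr)
  show "real_distribution rlaw"
    unfolding rlaw_def by (rule U.real_distribution_distr) measurable
  show "cdf (distr P borel R) = cdf rlaw"
  proof
    fix b :: real
    have l: "cdf (distr P borel R) b = measure P {\<omega> \<in> space P. R \<omega> \<le> b}"
      using m by (auto simp: cdf_def measure_distr intro!: arg_cong[where f="measure P"])
    have sp: "space unif01 = UNIV" by (simp add: unif01_def)
    have sm: "{v. v\<^sup>2 \<le> b} \<in> sets borel" by measurable
    have "cdf rlaw b = measure unif01 {v. v\<^sup>2 \<le> b}"
      unfolding cdf_def rlaw_def by (subst measure_distr) (auto simp: sp vimage_def)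
    also have "\<dots> = measure lborel ({0<..<1} \<inter> {v. v\<^sup>2 \<le> b})"
    proof -
      have "emeasure unif01 {v. v\<^sup>2 \<le> b} = (\<integral>\<^sup>+v. indicator ({0<..<1} \<inter> {v. v\<^sup>2 \<le> b}) v \<partial>lborel)"
      proof -
        have *: "(\<lambda>v::real. ennreal (indicator {0<..<1} v)) \<in> borel_measurable lborel" by measurable
        show ?thesis
          unfolding unif01_def emeasure_density[OF * sm[folded sets_lborel]]
          by (rule nn_integral_cong) (simp add: indicator_def)
      qed
      also have "\<dots> = emeasure lborel ({0<..<1} \<inter> {v. v\<^sup>2 \<le> b})"
        using sm by (intro nn_integral_indicator) auto
      finally show ?thesis by (simp add: measure_def)
    qed
    finally have r: "cdf rlaw b = measure lborel ({0<..<1} \<inter> {v. v\<^sup>2 \<le> b})" .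
    consider "b \<le> 0" | "0 < b" "b < 1" | "1 \<le> b" by linarith
    then show "cdf (distr P borel R) b = cdf rlaw b"
    proof cases
      case 1
      have "{\<omega> \<in> space P. R \<omega> \<le> b} = {}" using range 1 by force
      moreover have "{0<..<1} \<inter> {v. v\<^sup>2 \<le> b} = {}"
        using 1 by (auto simp: not_le dest: order_trans[OF _ 1])
      ultimately show ?thesis unfolding l r by (simp only: measure_empty)
    next
      case 2
      have "{0<..<1} \<inter> {v. v\<^sup>2 \<le> b} = {0<..sqrt b}"
      proof -
        have "v\<^sup>2 \<le> b \<longleftrightarrow> v \<le> sqrt b" if "v > 0" for v
          using that real_le_rsqrt[of v b] real_sqrt_le_iff[of "v\<^sup>2" b] by auto
        moreover have "v < 1" if "v \<le> sqrt b" for v using that 2 real_sqrt_lt_1_iff[of b] by linarith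
        ultimately show ?thesis by auto
      qed
      then show ?thesis unfolding l r using 2 dist[of b] by simp
    next
      case 3
      have "{\<omega> \<in> space P. R \<omega> \<le> b} = space P" using range 3 by force
      moreover have "{0<..<1} \<inter> {v. v\<^sup>2 \<le> b} = {0<..<1}"
      proof -
        have "v\<^sup>2 \<le> b" if "0 < v" "v < 1" for v
          using power_le_one[of v 2] that 3 by simp
        then show ?thesis by auto
      qed
      ultimately show ?thesis unfolding l r by (simp only: P.prob_space) simp
    qed
  qed
qed

section \<open>Transfer to the given random variables\<close>

text \<open>Serves to pass from the family indexed by pairs (d, \<theta>) to the family for one
  fixed d.\<close>

lemma (in prob_space) indep_vars_reindex:
  assumes f: "inj_on f I" and X: "indep_vars N X (f ` I)"
  shows "indep_vars (\<lambda>i. N (f i)) (\<lambda>i. X (f i)) I"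
  unfolding indep_vars_def2
proof (intro conjI ballI indep_setsI)
  have Xs: "indep_sets (\<lambda>i. {X i -` A \<inter> space M |A. A \<in> sets (N i)}) (f ` I)"
    and Xm: "\<And>i. i \<in> I \<Longrightarrow> X (f i) \<in> M \<rightarrow>\<^sub>M N (f i)"
    using X by (auto simp: indep_vars_def2)
  show "X (f i) \<in> M \<rightarrow>\<^sub>M N (f i)" if "i \<in> I" for i by (rule Xm[OF that])
  show "{X (f i) -` A \<inter> space M |A. A \<in> sets (N (f i))} \<subseteq> events" if "i \<in> I" for i
    using measurable_sets[OF Xm[OF that]] by auto
  fix A J assume J: "J \<noteq> {}" "J \<subseteq> I" "finite J"
    and A: "\<forall>j\<in>J. A j \<in> {X (f j) -` B \<inter> space M |B. B \<in> sets (N (f j))}"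
  have inj: "inj_on f J" using f J(2) by (rule inj_on_subset)
  have eq: "A (inv_into J f (f j)) = A j" if "j \<in> J" for j using inv_into_f_f[OF inj that] by simp
  have "prob (\<Inter>i\<in>f ` J. A (inv_into J f i)) = (\<Prod>i\<in>f ` J. prob (A (inv_into J f i)))"
    using J A eq by (intro indep_setsD[OF Xs]) auto
  also have "(\<Prod>i\<in>f ` J. prob (A (inv_into J f i))) = (\<Prod>j\<in>J. prob (A j))"
    by (simp add: prod.reindex[OF inj] eq)
  also have "(\<Inter>i\<in>f ` J. A (inv_into J f i)) = (\<Inter>j\<in>J. A j)"
    using eq by auto
  finally show "prob (\<Inter>j\<in>J. A j) = (\<Prod>j\<in>J. prob (A j))" .
qed

text \<open>Preimages of rectangles form a generator that is stable under intersections. For them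
  the probability of a finite intersection splits into an X part and a Y part by \<open>XY\<close>,
  and each part splits by independence within its family.\<close>

lemma (in prob_space) indep_vars_Pair:
  assumes X: "indep_vars (\<lambda>_. N) X I" and Y: "indep_vars (\<lambda>_. N') Y I"
    and XY: "\<And>A B. A \<in> sigma_family M (\<lambda>_. N) X I \<Longrightarrow> B \<in> sigma_family M (\<lambda>_. N') Y I \<Longrightarrow>
      prob (A \<inter> B) = prob A * prob B"
  shows "indep_vars (\<lambda>_. N \<Otimes>\<^sub>M N') (\<lambda>i \<omega>. (X i \<omega>, Y i \<omega>)) I"
proof -
  have Xm: "X i \<in> M \<rightarrow>\<^sub>M N" and Ym: "Y i \<in> M \<rightarrow>\<^sub>M N'" if "i \<in> I" for i
    using X Y that by (auto simp: indep_vars_def)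
  have Xs: "indep_sets (\<lambda>i. {X i -` A \<inter> space M |A. A \<in> sets N}) I"
    and Ys: "indep_sets (\<lambda>i. {Y i -` A \<inter> space M |A. A \<in> sets N'}) I"
    using X Y by (simp_all add: indep_vars_def2)
  define E where "E i = {(X i -` A \<inter> space M) \<inter> (Y i -` B \<inter> space M) |A B. A \<in> sets N \<and> B \<in> sets N'}" for i
  have family_Int: "(\<Inter>j\<in>J. V j -` A j \<inter> space M) \<in> sigma_family M (\<lambda>_. Q) V I"
    if J: "finite J" "J \<noteq> {}" "J \<subseteq> I" and A: "\<And>j. j \<in> J \<Longrightarrow> A j \<in> sets Q"
      and V: "\<And>i. i \<in> I \<Longrightarrow> V i \<in> M \<rightarrow>\<^sub>M Q" for J V A and Q :: "'z measure"
  proof -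
    have "sigma_algebra (space M) (sigma_family M (\<lambda>_. Q) V I)"
      unfolding sigma_family_def by (rule sigma_algebra_sigma_sets) auto
    then interpret S: sigma_algebra "space M" "sigma_family M (\<lambda>_. Q) V I" .
    have "V j -` A j \<inter> space M \<in> sigma_family M (\<lambda>_. Q) V I" if "j \<in> J" for j
      unfolding sigma_family_def using J(3) A[OF that] that by (intro sigma_sets.Basic) auto
    then show ?thesis using J(1,2) by (intro S.finite_INT) auto
  qed
  have "indep_sets E I"
  proof (rule indep_setsI)
    fix i assume i: "i \<in> I"
    show "E i \<subseteq> events" unfolding E_def using measurable_sets[OF Xm[OF i]] measurable_sets[OF Ym[OF i]] by (auto simp del: Int_iff)
  next
    fix C J assume J: "J \<noteq> {}" "J \<subseteq> I" "finite J" and C: "\<forall>j\<in>J. C j \<in> E j"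
    have "\<forall>j\<in>J. \<exists>p. C j = (X j -` fst p \<inter> space M) \<inter> (Y j -` snd p \<inter> space M) \<and> fst p \<in> sets N \<and> snd p \<in> sets N'"
      using C unfolding E_def by fastforce
    then obtain p where p: "\<And>j. j \<in> J \<Longrightarrow> C j = (X j -` fst (p j) \<inter> space M) \<inter> (Y j -` snd (p j) \<inter> space M)"
        "\<And>j. j \<in> J \<Longrightarrow> fst (p j) \<in> sets N" "\<And>j. j \<in> J \<Longrightarrow> snd (p j) \<in> sets N'"
      by metis
    have split: "prob (\<Inter>j\<in>K. C j) = prob (\<Inter>j\<in>K. X j -` fst (p j) \<inter> space M) * prob (\<Inter>j\<in>K. Y j -` snd (p j) \<inter> space M)"
      if K: "K \<subseteq> J" "K \<noteq> {}" for K
    proof -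
      have K': "finite K" "K \<subseteq> I" using K J finite_subset by auto
      have "(\<Inter>j\<in>K. C j) = (\<Inter>j\<in>K. X j -` fst (p j) \<inter> space M) \<inter> (\<Inter>j\<in>K. Y j -` snd (p j) \<inter> space M)"
        using p(1) K by (subst INT_Int_distrib[symmetric], intro INF_cong) auto
      then show ?thesis
        using K K' p(2,3) Xm Ym by (simp only:) (intro XY family_Int; auto)
    qed
    have "prob (\<Inter>j\<in>J. C j) = (\<Prod>j\<in>J. prob (X j -` fst (p j) \<inter> space M)) * (\<Prod>j\<in>J. prob (Y j -` snd (p j) \<inter> space M))"
      unfolding split[OF order_refl J(1)]
      by (intro arg_cong2[where f="(*)"] indep_setsD[OF Xs J(2,1,3)] indep_setsD[OF Ys J(2,1,3)]) (use p(2,3) in auto)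
    also have "\<dots> = (\<Prod>j\<in>J. prob (C j))"
      unfolding prod.distrib[symmetric] using split[of "{_}"] by (intro prod.cong) auto
    finally show "prob (\<Inter>j\<in>J. C j) = (\<Prod>j\<in>J. prob (C j))" .
  qed
  then have sig: "indep_sets (\<lambda>i. sigma_sets (space M) (E i)) I"
  proof (rule indep_sets_sigma)
    fix i assume "i \<in> I"
    show "Int_stable (E i)"
      unfolding Int_stable_def
    proof (intro ballI)
      fix a b assume "a \<in> E i" "b \<in> E i"
      then obtain A B A' B' where *: "A \<in> sets N" "A' \<in> sets N" "B \<in> sets N'" "B' \<in> sets N'"
        "a = (X i -` A \<inter> space M) \<inter> (Y i -` B \<inter> space M)" "b = (X i -` A' \<inter> space M) \<inter> (Y i -` B' \<inter> space M)"
        unfolding E_def by blast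
      then have "a \<inter> b = (X i -` (A \<inter> A') \<inter> space M) \<inter> (Y i -` (B \<inter> B') \<inter> space M)" by auto
      then show "a \<inter> b \<in> E i" unfolding E_def using * by blast
    qed
  qed
  have eq: "{(\<lambda>\<omega>. (X i \<omega>, Y i \<omega>)) -` C \<inter> space M |C. C \<in> sets (N \<Otimes>\<^sub>M N')} = sigma_sets (space M) (E i)" if i: "i \<in> I" for i
  proof -
    have "(\<lambda>\<omega>. (X i \<omega>, Y i \<omega>)) \<in> space M \<rightarrow> space N \<times> space N'"
      using measurable_space[OF Xm[OF i]] measurable_space[OF Ym[OF i]] by auto
    from sigma_sets_vimage_commute[OF this, of "{A \<times> B |A B. A \<in> sets N \<and> B \<in> sets N'}"]
    have "{(\<lambda>\<omega>. (X i \<omega>, Y i \<omega>)) -` C \<inter> space M |C. C \<in> sets (N \<Otimes>\<^sub>M N')} =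
        sigma_sets (space M) {(\<lambda>\<omega>. (X i \<omega>, Y i \<omega>)) -` C \<inter> space M |C. C \<in> {A \<times> B |A B. A \<in> sets N \<and> B \<in> sets N'}}"
      by (simp add: sets_pair_measure)
    also have "{(\<lambda>\<omega>. (X i \<omega>, Y i \<omega>)) -` C \<inter> space M |C. C \<in> {A \<times> B |A B. A \<in> sets N \<and> B \<in> sets N'}} = E i"
    proof -
      have *: "(\<lambda>\<omega>. (X i \<omega>, Y i \<omega>)) -` (A \<times> B) \<inter> space M = (X i -` A \<inter> space M) \<inter> (Y i -` B \<inter> space M)" for A B
        by auto
      show ?thesis unfolding E_def *[symmetric] by blast
    qed
    finally show ?thesis .
  qed
  show ?thesis
    unfolding indep_vars_def2
  proof (intro conjI ballI)
    show "(\<lambda>\<omega>. (X i \<omega>, Y i \<omega>)) \<in> M \<rightarrow>\<^sub>M N \<Otimes>\<^sub>M N'" if "i \<in> I" for i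
      using Xm[OF that] Ym[OF that] by simp
    show "indep_sets (\<lambda>i. {(\<lambda>\<omega>. (X i \<omega>, Y i \<omega>)) -` C \<inter> space M |C. C \<in> sets (N \<Otimes>\<^sub>M N')}) I"
      using sig by (rule indep_sets_cong[THEN iffD1, rotated -1]) (use eq in auto)
  qed
qed

lemma (in prob_space) distr_Pair_family:
  assumes X: "X i \<in> M \<rightarrow>\<^sub>M N" and Y: "Y i \<in> M \<rightarrow>\<^sub>M N'" and i: "i \<in> I"
    and XY: "\<And>A B. A \<in> sigma_family M (\<lambda>_. N) X I \<Longrightarrow> B \<in> sigma_family M (\<lambda>_. N') Y I \<Longrightarrow>
      prob (A \<inter> B) = prob A * prob B"
  shows "distr M (N \<Otimes>\<^sub>M N') (\<lambda>\<omega>. (X i \<omega>, Y i \<omega>)) = distr M N (X i) \<Otimes>\<^sub>M distr M N' (Y i)"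
proof (rule pair_measure_eqI[symmetric])
  interpret X: prob_space "distr M N (X i)" by (rule prob_space_distr[OF X])
  interpret Y: prob_space "distr M N' (Y i)" by (rule prob_space_distr[OF Y])
  show "sigma_finite_measure (distr M N (X i))" ..
  show "sigma_finite_measure (distr M N' (Y i))" ..
  show "sets (distr M N (X i) \<Otimes>\<^sub>M distr M N' (Y i)) = sets (distr M (N \<Otimes>\<^sub>M N') (\<lambda>\<omega>. (X i \<omega>, Y i \<omega>)))"
    by (simp cong: sets_pair_measure_cong)
  fix A B assume "A \<in> sets (distr M N (X i))" "B \<in> sets (distr M N' (Y i))"
  then have A: "A \<in> sets N" and B: "B \<in> sets N'" by auto
  have "prob ((X i -` A \<inter> space M) \<inter> (Y i -` B \<inter> space M)) = prob (X i -` A \<inter> space M) * prob (Y i -` B \<inter> space M)"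
    by (rule XY; unfold sigma_family_def; rule sigma_sets.Basic) (use i A B in auto)
  moreover have "(\<lambda>\<omega>. (X i \<omega>, Y i \<omega>)) -` (A \<times> B) \<inter> space M = (X i -` A \<inter> space M) \<inter> (Y i -` B \<inter> space M)"
    by auto
  moreover have "(\<lambda>\<omega>. (X i \<omega>, Y i \<omega>)) \<in> M \<rightarrow>\<^sub>M N \<Otimes>\<^sub>M N'" using X Y by simp
  ultimately show "emeasure (distr M N (X i)) A * emeasure (distr M N' (Y i)) B
      = emeasure (distr M (N \<Otimes>\<^sub>M N') (\<lambda>\<omega>. (X i \<omega>, Y i \<omega>))) (A \<times> B)"
    using X Y A B by (simp add: emeasure_distr emeasure_eq_measure ennreal_mult)
qed

text \<open>Appending to a fixed \<theta> is injective on indices, so the input below \<theta> is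
  again i.i.d. with the same law. The shift is there because the scheme in question is evaluated at
  the index [0] and not at the root.\<close>

lemma (in prob_space) distr_tree:
  assumes indep: "indep_vars (\<lambda>_. borel_Rd d \<Otimes>\<^sub>M borel) X Theta"
    and law: "\<And>\<eta>. \<eta> \<in> Theta \<Longrightarrow> distr M (borel_Rd d \<Otimes>\<^sub>M borel) (X \<eta>) = step_law d"
  shows "(\<lambda>\<omega>. \<lambda>\<eta>\<in>Theta. X (\<theta> @ \<eta>) \<omega>) \<in> M \<rightarrow>\<^sub>M tree_law d"
    and "distr M (tree_law d) (\<lambda>\<omega>. \<lambda>\<eta>\<in>Theta. X (\<theta> @ \<eta>) \<omega>) = tree_law d"
proof -
  have m: "X \<eta> \<in> M \<rightarrow>\<^sub>M borel_Rd d \<Otimes>\<^sub>M borel" if "\<eta> \<in> Theta" for \<eta>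
    using indep that by (auto simp: indep_vars_def)
  have m': "X \<eta> \<in> M \<rightarrow>\<^sub>M step_law d" if "\<eta> \<in> Theta" for \<eta>
    using m[OF that] by (simp cong: measurable_cong_sets add: sets_step_law)
  let ?W = "\<lambda>\<omega>. \<lambda>\<eta>\<in>Theta. X \<eta> \<omega>"
  have W: "?W \<in> M \<rightarrow>\<^sub>M tree_law d"
    unfolding tree_law_def by (rule measurable_restrict[OF m'])
  have sub: "(\<lambda>\<omega>. \<lambda>\<eta>\<in>Theta. X (\<theta> @ \<eta>) \<omega>) = (\<lambda>\<omega>. subtree \<theta> (?W \<omega>))"
    by (auto simp: subtree_def Theta_def fun_eq_iff)
  show "(\<lambda>\<omega>. \<lambda>\<eta>\<in>Theta. X (\<theta> @ \<eta>) \<omega>) \<in> M \<rightarrow>\<^sub>M tree_law d"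
    unfolding sub by (rule measurable_compose[OF W measurable_subtree])
  have i: "indep_vars (\<lambda>_. step_law d) X Theta"
    using indep by (simp add: indep_vars_def sets_step_law cong: measurable_cong_sets)
  have ne: "Theta \<noteq> {}" by (auto simp: Theta_def)
  have "distr M (PiM Theta (\<lambda>_. step_law d)) ?W = (\<Pi>\<^sub>M \<eta>\<in>Theta. distr M (step_law d) (X \<eta>))"
    using i by (subst (asm) indep_vars_iff_distr_eq_PiM'[OF ne m']) auto
  also have "\<dots> = tree_law d"
    unfolding tree_law_def
  proof (intro PiM_cong refl)
    fix \<eta> assume \<eta>: "\<eta> \<in> Theta"
    have "distr M (step_law d) (X \<eta>) = distr M (borel_Rd d \<Otimes>\<^sub>M borel) (X \<eta>)"
      by (intro distr_cong) (auto simp: sets_step_law)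
    then show "distr M (step_law d) (X \<eta>) = step_law d" using law[OF \<eta>] by simp
  qed
  finally have dW: "distr M (tree_law d) ?W = tree_law d"
    by (simp add: tree_law_def)
  have "distr M (tree_law d) (\<lambda>\<omega>. subtree \<theta> (?W \<omega>)) = distr (distr M (tree_law d) ?W) (tree_law d) (subtree \<theta>)"
    by (simp add: distr_distr[OF measurable_subtree W] o_def)
  also have "\<dots> = tree_law d"
    unfolding dW unfolding tree_law_def subtree_def
    by (rule distr_PiM_reindex) (auto simp: prob_space_step_law append_Theta inj_on_def)
  finally show "distr M (tree_law d) (\<lambda>\<omega>. \<lambda>\<eta>\<in>Theta. X (\<theta> @ \<eta>) \<omega>) = tree_law d"
    unfolding sub .
qed

text \<open>For one \<omega> both sides satisfy the same recursion, with the input below \<theta> in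
  place of the root input. The range of \<rho> keeps all times in (0, T], where the recursion for U
  is given, and makes the indicator in \<open>source_term\<close> equal to 1.\<close>

lemma mlp_eq:
  fixes U :: "int list \<Rightarrow> int \<Rightarrow> real \<Rightarrow> (nat \<Rightarrow> real) \<Rightarrow> 'a \<Rightarrow> nat \<Rightarrow> real"
    and z :: "int list \<Rightarrow> nat \<Rightarrow> real" and \<rho> :: "int list \<Rightarrow> real"
  assumes \<rho>: "\<And>\<theta>. \<theta> \<in> Theta \<Longrightarrow> \<rho> \<theta> \<in> {0<..<1}"
    and init: "\<And>\<theta> t x k. \<lbrakk>\<theta> \<in> Theta; 0 < t; t \<le> T; x \<in> Rd d; k \<le> d\<rbrakk> \<Longrightarrow> U \<theta> 0 t x \<omega> k = 0"
    and rec: "\<And>(n::nat) \<theta> t x k.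
      \<lbrakk>n \<ge> 1; \<theta> \<in> Theta; 0 < t; t \<le> T; x \<in> Rd d; k \<le> d\<rbrakk> \<Longrightarrow>
        U \<theta> (int n) t x \<omega> k =
          (if k = 0 then g x else 0)
          + (\<Sum>i=1..M^n. 1 / real (M^n)
               * (g (add_scaled d x (sqrt (2 * t)) (z (\<theta> @ [0, - int i]))) - g x)
               * one_scaled (sqrt (2 * t)) (z (\<theta> @ [0, - int i])) k)
          + (\<Sum>l=0..<n. \<Sum>i=1..M^(n - l).
               let \<rho>' = \<rho> (\<theta> @ [int l, int i]);
                   \<zeta> = z (\<theta> @ [int l, int i]);
                   s = t * (1 - \<rho>');
                   y = add_scaled d x (sqrt (2 * t * \<rho>')) \<zeta>
               in 2 * t * sqrt \<rho>' / real (M^(n - l))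
                  * (app_R1d d f (U (\<theta> @ [int l, int i]) (int l) s y \<omega>)
                     - of_bool (l \<ge> 1)
                       * app_R1d d f (U (\<theta> @ [- int l, int i]) (int l - 1) s y \<omega>))
                  * one_scaled (sqrt (2 * t * \<rho>')) \<zeta> k)"
    and "\<theta> \<in> Theta" "0 < t" "t \<le> T" "x \<in> Rd d" "k \<le> d"
  shows "U \<theta> (int n) t x \<omega> k = mlp d f g M n t x (\<lambda>\<eta>\<in>Theta. (z (\<theta> @ \<eta>), \<rho> (\<theta> @ \<eta>))) k"
  using assms(4-)
proof (induction n arbitrary: \<theta> t x k rule: less_induct)
  case (less n)
  define w where "w \<theta> = (\<lambda>\<eta>\<in>Theta. (z (\<theta> @ \<eta>), \<rho> (\<theta> @ \<eta>)))" for \<theta>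
  have w_app: "w \<theta> [a, b] = (z (\<theta> @ [a, b]), \<rho> (\<theta> @ [a, b]))" for a b by (simp add: w_def Theta_def)
  have sub: "subtree \<eta> (w \<theta>) = w (\<theta> @ \<eta>)" for \<eta>
    by (auto simp: subtree_def w_def fun_eq_iff Theta_def)
  note IH = less.IH[folded w_def]
  show ?case
  proof (cases "n = 0")
    case True
    then show ?thesis using init[OF less.prems] by (simp add: mlp_0)
  next
    case False
    have app: "app_R1d d f (U \<theta>' (int l) s y \<omega>) = app_R1d d f (mlp d f g M l s y (w \<theta>'))"
      if "l < n" "\<theta>' \<in> Theta" "0 < s" "s \<le> T" "y \<in> Rd d" for l \<theta>' s y
    proof -
      have "U \<theta>' (int l) s y \<omega> j = mlp d f g M l s y (w \<theta>') j" if "j \<le> d" for j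
        by (rule IH) fact+
      then show ?thesis by (auto simp: app_R1d_def intro!: arg_cong2[where f=f] restrict_ext)
    qed
    have level: "(let \<rho>' = \<rho> (\<theta> @ [int l, int i]);
                   \<zeta> = z (\<theta> @ [int l, int i]);
                   s = t * (1 - \<rho>');
                   y = add_scaled d x (sqrt (2 * t * \<rho>')) \<zeta>
               in 2 * t * sqrt \<rho>' / real (M^(n - l))
                  * (app_R1d d f (U (\<theta> @ [int l, int i]) (int l) s y \<omega>)
                     - of_bool (l \<ge> 1)
                       * app_R1d d f (U (\<theta> @ [- int l, int i]) (int l - 1) s y \<omega>))
                  * one_scaled (sqrt (2 * t * \<rho>')) \<zeta> k)
       = 1 / real (M^(n - l)) * source_term d t x (w \<theta> [int l, int i]) k (\<lambda>s y.
            app_R1d d f (mlp d f g M l s y (subtree [int l, int i] (w \<theta>)))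
            - of_bool (l \<ge> 1) * app_R1d d f (mlp d f g M (l - 1) s y (subtree [- int l, int i] (w \<theta>))))"
      if l: "l < n" for l i
    proof -
      let ?\<theta> = "\<theta> @ [int l, int i]" and ?\<theta>' = "\<theta> @ [- int l, int i]"
      have \<theta>: "?\<theta> \<in> Theta" "?\<theta>' \<in> Theta" by (auto simp: Theta_def)
      define s where "s = t * (1 - \<rho> ?\<theta>)"
      define y where "y = add_scaled d x (sqrt (2 * t * \<rho> ?\<theta>)) (z ?\<theta>)"
      have r: "\<rho> ?\<theta> \<in> {0<..<1}" by (rule \<rho>[OF \<theta>(1)])
      have "s \<le> t" unfolding s_def using r less.prems(2) by (intro mult_left_le) auto
      then have "s \<le> T" using less.prems(3) by linarith
      moreover have "0 < s" unfolding s_def using r less.prems(2) by simp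
      ultimately have s: "0 < s" "s \<le> T" by auto
      have y: "y \<in> Rd d" by (simp add: y_def add_scaled_def)
      have "app_R1d d f (U ?\<theta>' (int l - 1) s y \<omega>) = app_R1d d f (mlp d f g M (l - 1) s y (w ?\<theta>'))" if "l \<ge> 1"
        using app[of "l - 1" ?\<theta>' s y] that l \<theta> s y by (simp add: of_nat_diff)
      then have "of_bool (l \<ge> 1) * app_R1d d f (U ?\<theta>' (int l - 1) s y \<omega>)
          = of_bool (l \<ge> 1) * app_R1d d f (mlp d f g M (l - 1) s y (w ?\<theta>'))" by simp
      then show ?thesis
        using app[of l ?\<theta> s y, OF l \<theta>(1) s y] r
        unfolding sub w_app source_term_def Let_def fst_conv snd_conv s_def[symmetric] y_def[symmetric]
        by simp
    qed
    have n: "1 \<le> n" using False by simp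
    show ?thesis
      unfolding w_def[symmetric]
      by (subst mlp.simps, subst rec[OF n less.prems], simp only: False if_False)
        (intro arg_cong2[where f="(+)"] sum.cong refl level; simp add: w_app init_term_def)
  qed
qed

text \<open>Six times the bracket bounds \<open>error_const\<close> up to D^2: 4 lam^2 comes from g
  at the origin and from its Lipschitz part, 1 / 24 from f at the origin. The last factor bounds the
  weight of the starting point up to d D^2.\<close>

definition root4_const :: "real \<Rightarrow> real \<Rightarrow> real" where
  "root4_const T lam = 6 * (4 * lam\<^sup>2 + (3 + 2 * T) * lam\<^sup>2 + 1 / 24) * (1 + lam\<^sup>2)"

text \<open>The 4 stems from the powers of 2 / M, the exponential from exp (2 \<beta> T) with
  \<beta> at most n times the inner square.\<close>

definition root4_rate :: "real \<Rightarrow> real \<Rightarrow> real" where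
  "root4_rate T lam = 4 * exp (2 * T * (48 * lam\<^sup>2 * source_const T)\<^sup>2)"

text \<open>\<beta> is chosen to make 48 lam^2 \<open>kap \<beta>\<close> M equal to 1. The exponent
  1 + 4 lam of d arises from d D^4: D^2 from the error constant, and d D^2 from the weight at a
  point with coordinates of size lam D.\<close>

lemma (in semilinear_heat) mlp_error_root4:
  assumes D: "D = real d powr lam" and g0: "\<bar>g (zero_Rd d)\<bar> \<le> lam * D" and f0: "\<bar>f 0 (zero_Rd d)\<bar> \<le> lam * D"
    and x: "x \<in> Rd d" "\<And>i. i \<in> {1..d} \<Longrightarrow> \<bar>x i\<bar> \<le> lam * D" and n: "n \<ge> 1" and k: "k \<le> d"
  shows "second_moment_le (tree_law d) (\<lambda>\<omega>. mlp d f g (root4 n) n T x \<omega> k - ucomp k T x)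
    (root4_const T lam * real d powr (1 + 4 * lam) * (root4_rate T lam ^ n * real n powr (- real n / 4)))"
proof -
  define M where "M = root4 n"
  have M: "M \<ge> 1" unfolding M_def by (rule root4_ge_1[OF n])
  define S where "S = 48 * lam\<^sup>2 * source_const T"
  have S: "S > 0" unfolding S_def source_const_def using T_pos lam_pos by simp
  define \<beta> where "\<beta> = (S * real M)\<^sup>2"
  have \<beta>: "\<beta> > 0" using S M by (simp add: \<beta>_def)
  have "48 * lam\<^sup>2 * kap \<beta> * real M = S * real M / sqrt \<beta>"
    unfolding kap_def S_def by simp
  also have "\<dots> = 1" using S M by (simp add: \<beta>_def)
  finally have small: "48 * lam\<^sup>2 * kap \<beta> * real M \<le> 1" by simp
  have D1: "D \<ge> 1" unfolding D using d_pos lam_pos by (intro ge_one_powr_ge_zero) auto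
  then have D21: "D\<^sup>2 \<ge> 1" by simp
  have sq: "a\<^sup>2 \<le> lam\<^sup>2 * D\<^sup>2" if "\<bar>a\<bar> \<le> lam * D" for a
    using power_mono[OF that, of 2] by (simp add: power_mult_distrib)
  have C1: "error_const \<le> 6 * (4 * lam\<^sup>2 + (3 + 2 * T) * lam\<^sup>2 + 1 / 24) * D\<^sup>2"
  proof -
    have "(local.f0)\<^sup>2 / (24 * lam\<^sup>2) \<le> lam\<^sup>2 * D\<^sup>2 / (24 * lam\<^sup>2)"
      unfolding f0_def using sq[OF f0] by (intro divide_right_mono) auto
    then have "(local.f0)\<^sup>2 / (24 * lam\<^sup>2) \<le> D\<^sup>2 / 24" using lam_pos by simp
    then show ?thesis
      unfolding error_const_def init_const_def using sq[OF g0] by (simp add: algebra_simps)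
  qed
  have C2: "weight d x \<le> real d * (1 + lam\<^sup>2) * D\<^sup>2"
  proof -
    have "norm2 d x \<le> (\<Sum>i\<in>{1..d}. lam\<^sup>2 * D\<^sup>2)"
      unfolding norm2_def by (intro sum_mono sq x(2))
    moreover have "real d * 1 \<le> real d * D\<^sup>2" using D21 by (intro mult_left_mono) auto
    ultimately show ?thesis by (simp add: weight_def algebra_simps)
  qed
  have C3: "exp (2 * \<beta> * T) \<le> exp (2 * T * S\<^sup>2) ^ n"
  proof -
    have "\<beta> \<le> S\<^sup>2 * real n"
      unfolding \<beta>_def power_mult_distrib M_def by (intro mult_left_mono root4_square_le n) auto
    then have "2 * T * \<beta> \<le> 2 * T * (S\<^sup>2 * real n)" using T_pos by (intro mult_left_mono) auto
    then show ?thesis unfolding exp_of_nat_mult[symmetric] by (simp add: ac_simps)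
  qed
  have C4: "(2 / real M) ^ n \<le> 4 ^ n * real n powr (- real n / 4)"
    unfolding M_def by (rule two_div_root4_power_le[OF n])
  have "error_const * (2 / real M) ^ n * (exp (2 * \<beta> * T) * weight d x)
     \<le> (6 * (4 * lam\<^sup>2 + (3 + 2 * T) * lam\<^sup>2 + 1 / 24) * D\<^sup>2) * (4 ^ n * real n powr (- real n / 4))
        * (exp (2 * T * S\<^sup>2) ^ n * (real d * (1 + lam\<^sup>2) * D\<^sup>2))"
    using error_const_nonneg weight_ge_1[OF d_pos, of x] T_pos
    by (intro mult_mono C1 C2 C3 C4 mult_nonneg_nonneg) auto
  also have "\<dots> = root4_const T lam * (real d * D ^ 4) * (root4_rate T lam ^ n * real n powr (- real n / 4))"
    unfolding root4_const_def root4_rate_def S_def power_mult_distrib by (simp add: power4_eq_xxxx power2_eq_square)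
  also have "real d * D ^ 4 = real d powr (1 + 4 * lam)"
    unfolding D using d_pos by (simp add: powr_add powr_realpow[symmetric] powr_powr mult.commute)
  finally have le: "error_const * (2 / real M) ^ n * (exp (2 * \<beta> * T) * weight d x)
     \<le> root4_const T lam * real d powr (1 + 4 * lam) * (root4_rate T lam ^ n * real n powr (- real n / 4))" .
  have "second_moment_le (tree_law d) (\<lambda>\<omega>. mlp d f g M n T x \<omega> k - ucomp k T x)
    (error_const * (2 / real M) ^ n * (exp (2 * \<beta> * T) * weight d x))"
    by (rule mlp_error_bound[OF \<beta> M small T_pos order_refl x(1) k])
  then show ?thesis
    unfolding second_moment_le_def M_def[symmetric] using ennreal_leI[OF le] by (auto intro: order_trans)
qed

lemma second_moment_le_cong:
  assumes "second_moment_le Q X c" and eq: "\<And>\<omega>. \<omega> \<in> space Q \<Longrightarrow> X \<omega> = Y \<omega>"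
  shows "second_moment_le Q Y c"
proof -
  have "X \<in> borel_measurable Q \<longleftrightarrow> Y \<in> borel_measurable Q" by (intro measurable_cong eq)
  moreover have "(\<integral>\<^sup>+\<omega>. ennreal ((X \<omega>)\<^sup>2) \<partial>Q) = (\<integral>\<^sup>+\<omega>. ennreal ((Y \<omega>)\<^sup>2) \<partial>Q)"
    by (intro nn_integral_cong) (simp add: eq)
  ultimately show ?thesis using assms(1) by (simp add: second_moment_le_def)
qed

theorem corollary5p4:
  fixes T \<delta> lam :: real
    and f :: "nat \<Rightarrow> real \<Rightarrow> (nat \<Rightarrow> real) \<Rightarrow> real"
    and g :: "nat \<Rightarrow> (nat \<Rightarrow> real) \<Rightarrow> real"
    and \<xi> :: "nat \<Rightarrow> nat \<Rightarrow> real"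
    and L :: "nat \<Rightarrow> nat \<Rightarrow> real"
    and u :: "nat \<Rightarrow> real \<Rightarrow> (nat \<Rightarrow> real) \<Rightarrow> real"
    and P :: "'a measure"
    and Z :: "nat \<Rightarrow> int list \<Rightarrow> 'a \<Rightarrow> nat \<Rightarrow> real"
    and r :: "int list \<Rightarrow> 'a \<Rightarrow> real"
    and U :: "nat \<Rightarrow> int list \<Rightarrow> int \<Rightarrow> nat \<Rightarrow> real \<Rightarrow> (nat \<Rightarrow> real) \<Rightarrow> 'a \<Rightarrow> nat \<Rightarrow> real"
    and RV :: "int \<Rightarrow> int \<Rightarrow> int \<Rightarrow> int"
  assumes pos: "T > 0" "\<delta> > 0" "lam > 0"
    and f_cont: "\<And>d. d \<ge> 1 \<Longrightarrow>
      continuous_map (prod_topology euclideanreal (powertop_real {1..d})) euclideanreal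
        (\<lambda>(y, z). f d y z)"
    and g_cont: "\<And>d. d \<ge> 1 \<Longrightarrow> continuous_map (powertop_real {1..d}) euclideanreal (g d)"
    and \<xi>_space: "\<And>d. d \<ge> 1 \<Longrightarrow> \<xi> d \<in> Rd d"
    and u_C12: "\<And>d. d \<ge> 1 \<Longrightarrow> C12 T d (u d)"
    and u_growth: "\<And>d. d \<ge> 1 \<Longrightarrow> poly_growing T d (u d)"
    and lipschitz: "\<And>d x x' z z' y y'. \<lbrakk>d \<ge> 1; x \<in> Rd d; x' \<in> Rd d; z \<in> Rd d; z' \<in> Rd d\<rbrakk> \<Longrightarrow>
      max \<bar>f d y z - f d y' z'\<bar> \<bar>g d x - g d x'\<bar>
        \<le> (\<Sum>j\<in>{1..d}. L d j * (real d powr lam * \<bar>x j - x' j\<bar> + \<bar>y - y'\<bar> + \<bar>z j - z' j\<bar>))"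
    and pde: "\<And>d t x. \<lbrakk>d \<ge> 1; 0 \<le> t; t < T; x \<in> Rd d\<rbrakk> \<Longrightarrow>
      time_deriv T (u d) t x
        = laplacian d (u d t) x + f d (u d t x) (gradient d (u d t) x)"
    and initial: "\<And>d x. \<lbrakk>d \<ge> 1; x \<in> Rd d\<rbrakk> \<Longrightarrow> u d 0 x = g d x"
    and bounds: "\<And>d. d \<ge> 1 \<Longrightarrow>
      real d powr (- lam) *
          (\<bar>g d (zero_Rd d)\<bar> + \<bar>f d 0 (zero_Rd d)\<bar> + Max ((\<lambda>i. \<bar>\<xi> d i\<bar>) ` {1..d}))
        + (\<Sum>i\<in>{1..d}. L d i) \<le> lam"
    and prob: "prob_space P"
    and Z_indep: "prob_space.indep_vars P (\<lambda>(d, \<theta>). borel_Rd d) (\<lambda>(d, \<theta>). Z d \<theta>) ({1..} \<times> Theta)"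
    and Z_normal: "\<And>d \<theta>. \<lbrakk>d \<ge> 1; \<theta> \<in> Theta\<rbrakk> \<Longrightarrow> distr P (borel_Rd d) (Z d \<theta>) = std_normal_Rd d"
    and r_range: "\<And>\<theta> \<omega>. \<lbrakk>\<theta> \<in> Theta; \<omega> \<in> space P\<rbrakk> \<Longrightarrow> r \<theta> \<omega> \<in> {0<..<1}"
    and r_indep: "prob_space.indep_vars P (\<lambda>_. borel) r Theta"
    and r_ident: "\<And>\<theta>. \<theta> \<in> Theta \<Longrightarrow> distr P borel (r \<theta>) = distr P borel (r [0])"
    and r_dist: "\<And>b. b \<in> {0<..<1} \<Longrightarrow> measure P {\<omega> \<in> space P. r [0] \<omega> \<le> b} = sqrt b"
    and Z_r_indep: "indep_families P (\<lambda>(d, \<theta>). borel_Rd d) (\<lambda>(d, \<theta>). Z d \<theta>) ({1..} \<times> Theta)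
                      (\<lambda>_. borel) r Theta"
    and U_init: "\<And>M d \<theta> t x \<omega> k.
      \<lbrakk>M \<ge> 1; d \<ge> 1; \<theta> \<in> Theta; 0 < t; t \<le> T; x \<in> Rd d; \<omega> \<in> space P; k \<le> d\<rbrakk> \<Longrightarrow>
        U d \<theta> (-1) M t x \<omega> k = 0 \<and> U d \<theta> 0 M t x \<omega> k = 0"
    and U_rec: "\<And>(n::nat) M d \<theta> t x \<omega> k.
      \<lbrakk>n \<ge> 1; M \<ge> 1; d \<ge> 1; \<theta> \<in> Theta; 0 < t; t \<le> T; x \<in> Rd d; \<omega> \<in> space P; k \<le> d\<rbrakk> \<Longrightarrow>
        U d \<theta> (int n) M t x \<omega> k =
          (if k = 0 then g d x else 0)
          + (\<Sum>i=1..M^n. 1 / real (M^n)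
               * (g d (add_scaled d x (sqrt (2 * t)) (Z d (\<theta> @ [0, - int i]) \<omega>)) - g d x)
               * one_scaled (sqrt (2 * t)) (Z d (\<theta> @ [0, - int i]) \<omega>) k)
          + (\<Sum>l=0..<n. \<Sum>i=1..M^(n - l).
               let \<rho> = r (\<theta> @ [int l, int i]) \<omega>;
                   \<zeta> = Z d (\<theta> @ [int l, int i]) \<omega>;
                   s = t * (1 - \<rho>);
                   y = add_scaled d x (sqrt (2 * t * \<rho>)) \<zeta>
               in 2 * t * sqrt \<rho> / real (M^(n - l))
                  * (app_R1d d (f d) (U d (\<theta> @ [int l, int i]) (int l) M s y \<omega>)
                     - of_bool (l \<ge> 1)
                       * app_R1d d (f d) (U d (\<theta> @ [- int l, int i]) (int l - 1) M s y \<omega>))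
                  * one_scaled (sqrt (2 * t * \<rho>)) \<zeta> k)"
    and RV_init: "\<And>d M. \<lbrakk>d \<ge> 1; M \<ge> 1\<rbrakk> \<Longrightarrow> RV d 0 M = 0"
    and RV_rec: "\<And>d n M :: nat. \<lbrakk>d \<ge> 1; n \<ge> 1; M \<ge> 1\<rbrakk> \<Longrightarrow>
      RV (int d) (int n) (int M) \<le> int d * int M ^ n
        + (\<Sum>l=0..<n. int M ^ (n - l)
             * (int d + 1 + RV (int d) (int l) (int M)
                + of_bool (l \<ge> 1) * RV (int d) (int l - 1) (int M)))"
  shows "\<exists>(c::real) (N :: nat \<Rightarrow> real \<Rightarrow> nat).
    \<forall>d\<ge>1. \<forall>\<epsilon>\<in>{0<..1}.
      N d \<epsilon> \<ge> 1 \<and>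
      real_of_int (\<Sum>n=1..N d \<epsilon>. RV (int d) (int n) (int (root4 n)))
        \<le> c * real d powr c * \<epsilon> powr (- (2 + \<delta>)) \<and>
      (\<forall>n\<ge>N d \<epsilon>.
         integrable P (\<lambda>\<omega>. \<bar>U d [0] (int n) (root4 n) T (\<xi> d) \<omega> 0 - u d T (\<xi> d)\<bar>\<^sup>2) \<and>
         (\<forall>i\<in>{1..d}. integrable P
           (\<lambda>\<omega>. \<bar>U d [0] (int n) (root4 n) T (\<xi> d) \<omega> i - partial i (u d T) (\<xi> d)\<bar>\<^sup>2))) \<and>
      (SUP n\<in>{N d \<epsilon>..}. ereal (sqrt (
         (\<integral>\<omega>. \<bar>U d [0] (int n) (root4 n) T (\<xi> d) \<omega> 0 - u d T (\<xi> d)\<bar>\<^sup>2 \<partial>P)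
         + Max ((\<lambda>i. \<integral>\<omega>. \<bar>U d [0] (int n) (root4 n) T (\<xi> d) \<omega> i
                              - partial i (u d T) (\<xi> d)\<bar>\<^sup>2 \<partial>P) ` {1..d}))))
        \<le> ereal \<epsilon>"
proof -
  interpret prob_space P by (rule prob)
  define C where "C = root4_const T lam"
  define A where "A = sqrt (root4_rate T lam)"
  \<comment> \<open>Half the exponent of d in the mean squared error, because the final estimate is
    for the square root; likewise A is the square root of the rate.\<close>
  define p where "p = (1 + 4 * lam) / 2"
  have C: "C > 0"
    unfolding C_def root4_const_def using pos by (intro mult_pos_pos add_pos_pos add_nonneg_pos) auto
  have A1: "A \<ge> 1"
  proof -
    have "exp (2 * T * (48 * lam\<^sup>2 * source_const T)\<^sup>2) \<ge> 1" using pos by simp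
    then show ?thesis by (simp add: A_def root4_rate_def del: one_le_exp_iff)
  qed
  have A2: "A\<^sup>2 = root4_rate T lam" by (simp add: A_def root4_rate_def)
  define B where "B d n = C * real d powr (1 + 4 * lam) * (root4_rate T lam ^ n * real n powr (- real n / 4))" for d n :: nat
  have B0: "B d n \<ge> 0" for d n unfolding B_def using C A2[symmetric] by simp
  \<comment> \<open>One B for the solution and one for the maximum over the gradient
    components.\<close>
  have B_sqrt: "sqrt (B d n + B d n) = sqrt (2 * C) * real d powr p * (A ^ n * real n powr (- real n / 8))" for d n
  proof (rule real_sqrt_unique)
    have "(real d powr p)\<^sup>2 = real d powr (1 + 4 * lam)" "(real n powr (- real n / 8))\<^sup>2 = real n powr (- real n / 4)"
      by (simp_all add: power2_eq_square powr_add[symmetric] p_def)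
    moreover have "(A ^ n)\<^sup>2 = root4_rate T lam ^ n"
      unfolding A2[symmetric] by (simp add: power_mult[symmetric] mult.commute)
    ultimately show "(sqrt (2 * C) * real d powr p * (A ^ n * real n powr (- real n / 8)))\<^sup>2 = B d n + B d n"
      using C by (simp add: B_def power_mult_distrib)
    show "0 \<le> sqrt (2 * C) * real d powr p * (A ^ n * real n powr (- real n / 8))" using C A1 by simp
  qed
  obtain c and N :: "nat \<Rightarrow> real \<Rightarrow> nat" where cN: "\<And>d \<epsilon>. d \<ge> 1 \<Longrightarrow> \<epsilon> \<in> {0<..1} \<Longrightarrow> N d \<epsilon> \<ge> 1
     \<and> real d * (real (N d \<epsilon>) * 8 ^ N d \<epsilon> * real (N d \<epsilon>) powr (real (N d \<epsilon>) / 4)) \<le> c * real d powr c * \<epsilon> powr (- (2 + \<delta>))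
     \<and> (\<forall>n\<ge>N d \<epsilon>. sqrt (2 * C) * real d powr p * (A ^ n * real n powr (- real n / 8)) \<le> \<epsilon>)"
  proof -
    have "sqrt (2 * C) > 0" "p \<ge> 0" using C pos by (simp_all add: p_def)
    from complexity_choice[OF A1 this pos(2)] show ?thesis using that by blast
  qed
  have cost: "real_of_int (\<Sum>n=1..m. RV (int d) (int n) (int (root4 n)))
      \<le> real d * (real m * 8 ^ m * real m powr (real m / 4))" if d: "d \<ge> 1" for d m
    by (rule total_cost_bound[OF d cost_bound[OF d]]) (use d RV_init RV_rec in auto)
  have error: "second_moment_le P (\<lambda>\<omega>. U d [0] (int n) (root4 n) T (\<xi> d) \<omega> k
        - (if k = 0 then u d T (\<xi> d) else partial k (u d T) (\<xi> d))) (B d n)"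
    if d: "d \<ge> 1" and n: "n \<ge> 1" and k: "k \<le> d" for d n k
  proof -
    define D where "D = real d powr lam"
    have D1: "D \<ge> 1" unfolding D_def using d pos by (intro ge_one_powr_ge_zero) auto
    have zero: "zero_Rd d \<in> Rd d" by (simp add: zero_Rd_def)
    \<comment> \<open>Nonnegativity of the coefficients follows from the Lipschitz inequality
      itself, applied to two points that differ only by the j-th unit vector in the gradient
      variable.\<close>
    have L0: "L d j \<ge> 0" if j: "j \<in> {1..d}" for j
    proof -
      define z where "z = (\<lambda>i\<in>{1..d}. if i = j then 1 else 0 :: real)"
      have "0 \<le> (\<Sum>i\<in>{1..d}. L d i * (real d powr lam * \<bar>zero_Rd d i - zero_Rd d i\<bar> + \<bar>0 - 0 :: real\<bar> + \<bar>z i - zero_Rd d i\<bar>))"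
        by (rule order_trans[OF _ lipschitz[OF d zero zero _ zero]]) (auto simp: z_def)
      also have "\<dots> = (\<Sum>i\<in>{1..d}. if i = j then L d j else 0)"
        by (intro sum.cong) (auto simp: z_def zero_Rd_def)
      also have "\<dots> = L d j" using j by simp
      finally show ?thesis .
    qed
    have \<xi>max: "\<bar>\<xi> d i\<bar> \<le> Max ((\<lambda>i. \<bar>\<xi> d i\<bar>) ` {1..d})" if "i \<in> {1..d}" for i
      using that by (intro Max_ge) auto
    have max0: "0 \<le> Max ((\<lambda>i. \<bar>\<xi> d i\<bar>) ` {1..d})"
      by (rule order_trans[OF abs_ge_zero \<xi>max[of 1]]) (use d in simp)
    \<comment> \<open>As the sum of the L d i is nonnegative, the other part of the hypothesis
      \<open>bounds\<close> is at most lam on its own.\<close>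
    have sum_le: "\<bar>g d (zero_Rd d)\<bar> + \<bar>f d 0 (zero_Rd d)\<bar> + Max ((\<lambda>i. \<bar>\<xi> d i\<bar>) ` {1..d}) \<le> lam * D"
    proof -
      have "0 \<le> (\<Sum>i\<in>{1..d}. L d i)" by (intro sum_nonneg L0)
      then have "real d powr (- lam) * (\<bar>g d (zero_Rd d)\<bar> + \<bar>f d 0 (zero_Rd d)\<bar> + Max ((\<lambda>i. \<bar>\<xi> d i\<bar>) ` {1..d})) \<le> lam"
        using bounds[OF d] by linarith
      moreover have "real d powr (- lam) = inverse D" by (simp add: D_def powr_minus)
      ultimately have "(\<bar>g d (zero_Rd d)\<bar> + \<bar>f d 0 (zero_Rd d)\<bar> + Max ((\<lambda>i. \<bar>\<xi> d i\<bar>) ` {1..d})) / D \<le> lam"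
        by (simp only: divide_inverse mult.commute)
      then show ?thesis using D1 by (subst (asm) pos_divide_le_eq) auto
    qed
    have small: "\<bar>g d (zero_Rd d)\<bar> \<le> lam * D" "\<bar>f d 0 (zero_Rd d)\<bar> \<le> lam * D"
      using max0 sum_le by linarith+
    have \<xi>_le: "\<bar>\<xi> d i\<bar> \<le> lam * D" if "i \<in> {1..d}" for i
      using sum_le \<xi>max[OF that] by linarith
    have Lsum: "(\<Sum>i\<in>{1..d}. L d i) \<le> lam"
    proof -
      have "0 \<le> real d powr (- lam) * (\<bar>g d (zero_Rd d)\<bar> + \<bar>f d 0 (zero_Rd d)\<bar> + Max ((\<lambda>i. \<bar>\<xi> d i\<bar>) ` {1..d}))"
        using max0 by simp
      then show ?thesis using bounds[OF d] by linarith
    qed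
    interpret semilinear_heat T lam D d "f d" "g d" "L d" "u d"
    proof
      show "T > 0" "lam > 0" "d \<ge> 1" "D \<ge> 0" using pos d D1 by auto
      show "\<bar>f d y z - f d y' z'\<bar> \<le> (\<Sum>j\<in>{1..d}. L d j * (\<bar>y - y'\<bar> + \<bar>z j - z' j\<bar>))"
        if "z \<in> Rd d" "z' \<in> Rd d" for y y' z z'
        using lipschitz[OF d zero zero that, of y y'] by simp
      show "\<bar>g d x - g d x'\<bar> \<le> (\<Sum>j\<in>{1..d}. L d j * (D * \<bar>x j - x' j\<bar>))"
        if "x \<in> Rd d" "x' \<in> Rd d" for x x'
        using lipschitz[OF d that zero zero, of 0 0] by (simp add: D_def)
    qed (use f_cont g_cont u_C12 u_growth L0 Lsum pde initial d in auto)
    have Zd: "indep_vars (\<lambda>_. borel_Rd d) (Z d) Theta"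
    proof -
      have "indep_vars (\<lambda>(d, \<theta>). borel_Rd d) (\<lambda>(d, \<theta>). Z d \<theta>) (Pair d ` Theta)"
        by (rule indep_vars_subset[OF Z_indep]) (use d in auto)
      from indep_vars_reindex[OF _ this] show ?thesis by (simp add: inj_on_def)
    qed
    \<comment> \<open>Independence is assumed for all dimensions at once; the sigma-algebra of one
      dimension is contained in the one generated by all.\<close>
    have XY: "prob (E \<inter> F) = prob E * prob F"
      if "E \<in> sigma_family P (\<lambda>_. borel_Rd d) (Z d) Theta" "F \<in> sigma_family P (\<lambda>_. borel) r Theta" for E F
    proof (rule indep_setD[OF Z_r_indep[unfolded indep_families_def] _ that(2)])
      have sub: "(\<Union>\<theta>\<in>Theta. {Z d \<theta> -` A \<inter> space P | A. A \<in> sets (borel_Rd d)})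
          \<subseteq> (\<Union>i\<in>{1..} \<times> Theta. {(case i of (d, \<theta>) \<Rightarrow> Z d \<theta>) -` A \<inter> space P | A. A \<in> sets (case i of (d, \<theta>) \<Rightarrow> borel_Rd d)})"
        using d by fastforce
      show "E \<in> sigma_family P (\<lambda>(d, \<theta>). borel_Rd d) (\<lambda>(d, \<theta>). Z d \<theta>) ({1..} \<times> Theta)"
        using that(1) unfolding sigma_family_def by (rule subsetD[OF sigma_sets_mono'[OF sub]])
    qed
    have Zm: "Z d \<eta> \<in> P \<rightarrow>\<^sub>M borel_Rd d" and rm: "r \<eta> \<in> borel_measurable P" if "\<eta> \<in> Theta" for \<eta>
      using Zd r_indep that by (auto simp: indep_vars_def)
    have law: "distr P (borel_Rd d \<Otimes>\<^sub>M borel) (\<lambda>\<omega>. (Z d \<eta> \<omega>, r \<eta> \<omega>)) = step_law d" if \<eta>: "\<eta> \<in> Theta" for \<eta>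
    proof -
      have 0: "[0] \<in> Theta" by (simp add: Theta_def)
      have "distr P borel (r \<eta>) = rlaw"
        unfolding r_ident[OF \<eta>] by (rule distr_eq_rlaw[OF prob rm[OF 0] r_range[OF 0] r_dist])
      then show ?thesis
        using distr_Pair_family[where X="Z d" and Y=r and i=\<eta> and I=Theta, OF Zm[OF \<eta>] rm[OF \<eta>] \<eta> XY]
        by (simp only: step_law_def Z_normal[OF d \<eta>])
    qed
    \<comment> \<open>The input below the index [0], at which the scheme is evaluated in the
      claim.\<close>
    define W where "W \<omega> = (\<lambda>\<eta>\<in>Theta. (Z d ([0] @ \<eta>) \<omega>, r ([0] @ \<eta>) \<omega>))" for \<omega>
    have W: "W \<in> P \<rightarrow>\<^sub>M tree_law d" "distr P (tree_law d) W = tree_law d"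
      using distr_tree[OF indep_vars_Pair[OF Zd r_indep XY] law, of "[0]"] by (simp_all add: W_def[abs_def])
    have "second_moment_le P (\<lambda>\<omega>. mlp d (f d) (g d) (root4 n) n T (\<xi> d) (W \<omega>) k - ucomp k T (\<xi> d)) (B d n)"
      unfolding B_def C_def
      by (rule second_moment_le_distr[OF mlp_error_root4[OF D_def small \<xi>_space[OF d] \<xi>_le n k] W])
    then show ?thesis
    proof (rule second_moment_le_cong)
      fix \<omega> assume \<omega>: "\<omega> \<in> space P"
      have "U d [0] (int n) (root4 n) T (\<xi> d) \<omega> k = mlp d (f d) (g d) (root4 n) n T (\<xi> d) (W \<omega>) k"
        unfolding W_def
      proof (rule mlp_eq[where U="\<lambda>\<theta> m. U d \<theta> m (root4 n)" and z="\<lambda>\<theta>. Z d \<theta> \<omega>" and \<rho>="\<lambda>\<theta>. r \<theta> \<omega>" and T=T])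
        note M = root4_ge_1[OF n]
        show "r \<theta> \<omega> \<in> {0<..<1}" if "\<theta> \<in> Theta" for \<theta> by (rule r_range[OF that \<omega>])
        show "U d \<theta> 0 (root4 n) t x \<omega> k = 0"
          if "\<theta> \<in> Theta" "0 < t" "t \<le> T" "x \<in> Rd d" "k \<le> d" for \<theta> t x k
          using U_init[OF M d that(1-4) \<omega> that(5)] by simp
      qed (rule U_rec[OF _ root4_ge_1[OF n] d _ _ _ _ \<omega>], assumption+,
          use \<xi>_space[OF d] pos k in \<open>simp_all add: Theta_def\<close>)
      then show "mlp d (f d) (g d) (root4 n) n T (\<xi> d) (W \<omega>) k - ucomp k T (\<xi> d)
          = U d [0] (int n) (root4 n) T (\<xi> d) \<omega> k - (if k = 0 then u d T (\<xi> d) else partial k (u d T) (\<xi> d))"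
        by (simp add: ucomp_def)
    qed
  qed
  show ?thesis
  proof (rule exI[of _ c], rule exI[of _ N], intro allI impI ballI)
    fix d :: nat and \<epsilon> :: real assume d: "1 \<le> d" and \<epsilon>: "\<epsilon> \<in> {0<..1}"
    note N = cN[OF d \<epsilon>]
    let ?eu = "\<lambda>n \<omega>. \<bar>U d [0] (int n) (root4 n) T (\<xi> d) \<omega> 0 - u d T (\<xi> d)\<bar>\<^sup>2"
    let ?ep = "\<lambda>n i \<omega>. \<bar>U d [0] (int n) (root4 n) T (\<xi> d) \<omega> i - partial i (u d T) (\<xi> d)\<bar>\<^sup>2"
    have e0: "integrable P (?eu n)" "(\<integral>\<omega>. ?eu n \<omega> \<partial>P) \<le> B d n"
      and e: "\<And>i. i \<in> {1..d} \<Longrightarrow> integrable P (?ep n i)" "\<And>i. i \<in> {1..d} \<Longrightarrow> (\<integral>\<omega>. ?ep n i \<omega> \<partial>P) \<le> B d n"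
      if n: "n \<ge> N d \<epsilon>" for n
    proof -
      have n1: "n \<ge> 1" using N n by linarith
      show "integrable P (?eu n)" "(\<integral>\<omega>. ?eu n \<omega> \<partial>P) \<le> B d n"
        using second_moment_leD[OF error[OF d n1, of 0] B0] by simp_all
      show "integrable P (?ep n i)" "(\<integral>\<omega>. ?ep n i \<omega> \<partial>P) \<le> B d n" if "i \<in> {1..d}" for i
        using second_moment_leD[OF error[OF d n1, of i] B0] that by simp_all
    qed
    have le: "ereal (sqrt ((\<integral>\<omega>. ?eu n \<omega> \<partial>P) + Max ((\<lambda>i. \<integral>\<omega>. ?ep n i \<omega> \<partial>P) ` {1..d}))) \<le> ereal \<epsilon>"
      if n: "n \<in> {N d \<epsilon>..}" for n
    proof -
      have n': "n \<ge> N d \<epsilon>" using n by simp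
      have "Max ((\<lambda>i. \<integral>\<omega>. ?ep n i \<omega> \<partial>P) ` {1..d}) \<le> B d n"
        using e(2)[OF n'] d by (intro Max.boundedI) auto
      then have "sqrt ((\<integral>\<omega>. ?eu n \<omega> \<partial>P) + Max ((\<lambda>i. \<integral>\<omega>. ?ep n i \<omega> \<partial>P) ` {1..d})) \<le> sqrt (B d n + B d n)"
        using e0(2)[OF n'] by (intro real_sqrt_le_mono add_mono)
      also have "\<dots> \<le> \<epsilon>" unfolding B_sqrt using N n' by blast
      finally show ?thesis by simp
    qed
    show "N d \<epsilon> \<ge> 1 \<and>
      real_of_int (\<Sum>n=1..N d \<epsilon>. RV (int d) (int n) (int (root4 n))) \<le> c * real d powr c * \<epsilon> powr (- (2 + \<delta>)) \<and>
      (\<forall>n\<ge>N d \<epsilon>. integrable P (?eu n) \<and> (\<forall>i\<in>{1..d}. integrable P (?ep n i))) \<and>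
      (SUP n\<in>{N d \<epsilon>..}. ereal (sqrt ((\<integral>\<omega>. ?eu n \<omega> \<partial>P) + Max ((\<lambda>i. \<integral>\<omega>. ?ep n i \<omega> \<partial>P) ` {1..d})))) \<le> ereal \<epsilon>"
      using N order_trans[OF cost[OF d]] e0(1) e(1) by (intro conjI SUP_least le) blast+
  qed
qed

end
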